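(* Let $T>0$, $0<\varepsilon\le1$. Let $f,g\in H^2(0,T;L^2(\mathcal E))$, $h\in H^3(0,T;\mathbb R^{n_D})$, $r\in H^3(0,T;\mathbb R^{n_N})$ with $\dot r(0)=0$. Let $p(0)\in H^1(\bar{\mathcal E})$ with $\mathcal Bp(0)=h(0)$ and $m(0)\in L^2(\mathcal E)$. Assume there exists $m_*\in L^2(\mathcal E)$ with $$(m_*,q)=\langle\mathcal K^*m(0),q\rangle-\langle\mathcal C^*r(0),q\rangle\quad\text{for all }q\in H^1_0(\bar{\mathcal E}),$$ and $p_*\in H^1_0(\bar{\mathcal E})$ with $$(p_*,q)=\big\langle g(0)-\mathcal C^*r(0)-(\mathcal L+a)p(0)-\mathcal B^-\dot h(0)+\mathcal K^*d^{-1}f(0),\,q\big\rangle\quad\text{for all }q\in H^1_0(\bar{\mathcal E}).$$ Assume further $\mathcal Kp(0)-f(0)+d\,m(0)=0$. Let $(p,m,\lambda)$ be the solution of $(H_\varepsilon)$ with initial values $p(0),m(0)$, let $(p_0,m_0,\lambda_0)$ solve $(P_0)$ with $p_0(0)=p(0)$, let $(p_1,m_1,\lambda_1)$ solve $(P_1)$ with $p_1(0)=0$ (systems given in the context), and set $\hat p=p_0+\varepsilon p_1$, $\hat m=m_0+\varepsilon m_1$. Then for all $t\le T$ $$\|(p-\hat p)(t)\|^2+c_{\mathcal L}\int_0^t\|(p-\hat p)(s)\|^2_{H^1(\bar{\mathcal E})}ds+\underline d\int_0^t\|(m-\hat m)(s)\|^2ds\le\varepsilon^3\hat C\,\|\dot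 f(0)-\mathcal K\dot p(0)\|^2+\varepsilon^4\hat C_{\rm data}$$ with constants $\hat C=\hat C(c_{\mathcal L},\underline d)$ and $\hat C_{\rm data}=\hat C_{\rm data}\big(\|p_*\|^2_{H^1(\bar{\mathcal E})},\|f\|^2_{H^2(0,T;L^2(\mathcal E))},\|g\|^2_{H^2(0,T;L^2(\mathcal E))},\|h\|^2_{H^3(0,T;\mathbb R^{n_D})},\|r\|^2_{H^3(0,T;\mathbb R^{n_N})}\big)$.
   Context: Network: $\mathcal G=(\mathcal V,\mathcal E)$ is a finite connected directed graph whose edges are identified with bounded intervals of positive length. $\mathcal V$ is the disjoint union of $\mathcal V_D$ (boundary vertices where the potential is prescribed) and $\mathcal V_N$ (all other vertices); $n_D=|\mathcal V_D|\ge1$, $n_N=|\mathcal V_N|$, and vectors in $\mathbb R^{n_D},\mathbb R^{n_N}$ are indexed by these vertices. Spaces: $L^2(\mathcal E)$ = functions edgewise in $L^2(e)$, with inner product $(\cdot,\cdot)=\sum_e(\cdot,\cdot)_{L^2(e)}$ and norm $\|\cdot\|$. $H^1(\bar{\mathcal E})$ = functions edgewise in $H^1(e)$ that are globally continuous on the network (usual $H^1$ norm); $H^1_0(\bar{\mathcal E})$ = those vanishing at $\mathcal V_D$; $H^{-1}(\bar{\mathcal E})=[H^1_0(\bar{\mathcal E})]^*$. $L^2(\mathcal E)$ is identified with its dual. Coefficients: measurable, time-independent $a,d$ on $\mathcal E$ with $0\le a\le\overline a$ and $0<\underline d\le d\le\overline d<\infty$ a.e. Operators: $\mathcal K:H^1(\bar{\mathcal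 E})\to[L^2(\mathcal E)]^*$, $\langle\mathcal Kq,m\rangle=(\partial_xq,m)$ (edgewise derivative); $\mathcal B:H^1(\bar{\mathcal E})\to\mathbb R^{n_D}$ and $\mathcal C:H^1(\bar{\mathcal E})\to\mathbb R^{n_N}$ are point evaluation at $\mathcal V_D$ and $\mathcal V_N$; $\mathcal B^-:\mathbb R^{n_D}\to H^1(\bar{\mathcal E})$ is a fixed linear right inverse of $\mathcal B$. $\mathcal L=\mathcal K^*d^{-1}\mathcal K$ satisfies $\langle\mathcal Lq,q\rangle\ge c_{\mathcal L}\|q\|^2_{H^1(\bar{\mathcal E})}$ for $q\in H^1_0(\bar{\mathcal E})$, with $c_{\mathcal L}>0$. System $(H_\varepsilon)$: $\dot p+ap-\mathcal K^*m+\mathcal B^*\lambda=g-\mathcal C^*r$ in $[H^1(\bar{\mathcal E})]^*$; $\varepsilon\dot m+\mathcal Kp+dm=f$ in $[L^2(\mathcal E)]^*$; $\mathcal Bp=h$ in $\mathbb R^{n_D}$. System $(P_0)$: $\dot p_0+ap_0-\mathcal K^*m_0+\mathcal B^*\lambda_0=g-\mathcal C^*r$ in $[H^1(\bar{\mathcal E})]^*$; $\mathcal Kp_0+dm_0=f$ in $[L^2(\mathcal E)]^*$; $\mathcal Bp_0=h$ in $\mathbb R^{n_D}$. System $(P_1)$: $\dot p_1+ap_1-\mathcal K^*m_1+\mathcal B^*\lambda_1=0$ in $[H^1(\bar{\mathcal E})]^*$; $\mathcal Kp_1+dm_1=-\dot m_0$ in $[L^2(\mathcal E)]^*$; $\mathcal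 Bp_1=0$ in $\mathbb R^{n_D}$. The constant $\hat C_{\rm data}$ may also depend on the fixed quantities $T$, the network, $a$, $d$, but not on $\varepsilon$ or $t$. *)

theory Defs
  imports "HOL-Analysis.Analysis" "Graph_Theory.Digraph_Component"
begin

section \<open>Test functions and weak derivatives on an interval\<close>

definition test_fun :: "real \<Rightarrow> (real \<Rightarrow> real) \<Rightarrow> bool" where
  \<comment> \<open>the smooth functions with compact support in the open interval from 0 to L\<close>
  "test_fun L \<phi> \<longleftrightarrow>
     (\<forall>k x. (deriv ^^ k) \<phi> differentiable at x) \<and>
     (\<exists>\<alpha> \<beta>. 0 < \<alpha> \<and> \<beta> < L \<and> (\<forall>x. x \<notin> {\<alpha>..\<beta>} \<longrightarrow> \<phi> x = 0))"

definition weak_deriv :: "real \<Rightarrow> (real \<Rightarrow> real) \<Rightarrow> (real \<Rightarrow> real) \<Rightarrow> bool" where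
  "weak_deriv L u v \<longleftrightarrow>
     (\<forall>\<phi>. test_fun L \<phi> \<longrightarrow>
        integral\<^sup>L (lebesgue_on {0..L}) (\<lambda>x. u x * deriv \<phi> x) =
        - integral\<^sup>L (lebesgue_on {0..L}) (\<lambda>x. v x * \<phi> x))"

definition distribution :: "real \<Rightarrow> ((real \<Rightarrow> real) \<Rightarrow> real) \<Rightarrow> bool" where
  "distribution T \<Lambda> \<longleftrightarrow>
     (\<forall>\<phi> \<psi> c. test_fun T \<phi> \<longrightarrow> test_fun T \<psi> \<longrightarrow>
        \<Lambda> (\<lambda>t. \<phi> t + c * \<psi> t) = \<Lambda> \<phi> + c * \<Lambda> \<psi>) \<and>
     (\<forall>\<alpha> \<beta>. 0 < \<alpha> \<longrightarrow> \<beta> < T \<longrightarrow>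
        (\<exists>C n. \<forall>\<phi> M. test_fun T \<phi> \<longrightarrow> (\<forall>t. t \<notin> {\<alpha>..\<beta>} \<longrightarrow> \<phi> t = 0) \<longrightarrow>
           (\<forall>k\<le>n. \<forall>t. \<bar>(deriv ^^ k) \<phi> t\<bar> \<le> M) \<longrightarrow> \<bar>\<Lambda> \<phi>\<bar> \<le> C * M))"


section \<open>Bochner--Sobolev spaces in time\<close>

text \<open>A Hilbert space is given by a set of representatives together with its inner product;
  representatives at distance zero stand for the same element. In the instances below the
  representatives are families of functions on the edges, or families of reals indexed by
  vertices, and the subtraction used is the pointwise one.\<close>

record 'x hspace =
  carr :: "'x set"
  inn :: "'x \<Rightarrow> 'x \<Rightarrow> real"

definition nrm :: "'x hspace \<Rightarrow> 'x \<Rightarrow> real" where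
  "nrm X u = sqrt (inn X u u)"

definition strongly_meas :: "'x::minus hspace \<Rightarrow> real \<Rightarrow> (real \<Rightarrow> 'x) \<Rightarrow> bool" where
  "strongly_meas X T u \<longleftrightarrow>
     (\<exists>s :: nat \<Rightarrow> real \<Rightarrow> 'x.
        (\<forall>n. simple_function (lebesgue_on {0..T}) (s n) \<and> s n ` {0..T} \<subseteq> carr X) \<and>
        (AE t in lebesgue_on {0..T}. u t \<in> carr X \<and> (\<lambda>n. nrm X (s n t - u t)) \<longlonglongrightarrow> 0))"

definition L2T :: "'x::minus hspace \<Rightarrow> real \<Rightarrow> (real \<Rightarrow> 'x) \<Rightarrow> bool" where
  "L2T X T u \<longleftrightarrow> strongly_meas X T u \<and> integrable (lebesgue_on {0..T}) (\<lambda>t. (nrm X (u t))\<^sup>2)"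

definition contT :: "'x::minus hspace \<Rightarrow> real \<Rightarrow> (real \<Rightarrow> 'x) \<Rightarrow> bool" where
  "contT X T u \<longleftrightarrow>
     (\<forall>t\<in>{0..T}. u t \<in> carr X \<and> ((\<lambda>s. nrm X (u s - u t)) \<longlongrightarrow> 0) (at t within {0..T}))"

text \<open>The identity of Bochner integrals that defines the weak time derivative is tested with
  the elements of the space, which separate points.\<close>

definition weak_tderiv :: "'x hspace \<Rightarrow> real \<Rightarrow> (real \<Rightarrow> 'x) \<Rightarrow> (real \<Rightarrow> 'x) \<Rightarrow> bool" where
  "weak_tderiv X T u v \<longleftrightarrow>
     (\<forall>\<phi>. test_fun T \<phi> \<longrightarrow> (\<forall>w\<in>carr X.
        integral\<^sup>L (lebesgue_on {0..T}) (\<lambda>t. inn X (u t) w * deriv \<phi> t) =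
        - integral\<^sup>L (lebesgue_on {0..T}) (\<lambda>t. inn X (v t) w * \<phi> t)))"

definition tderiv :: "'x::minus hspace \<Rightarrow> real \<Rightarrow> (real \<Rightarrow> 'x) \<Rightarrow> (real \<Rightarrow> 'x)" where
  "tderiv X T u = (SOME v. L2T X T v \<and> weak_tderiv X T u v)"

definition weakly_diffT :: "'x::minus hspace \<Rightarrow> real \<Rightarrow> (real \<Rightarrow> 'x) \<Rightarrow> bool" where
  "weakly_diffT X T u \<longleftrightarrow> (\<exists>v. L2T X T v \<and> weak_tderiv X T u v)"

text \<open>For \<open>k \<ge> 1\<close>, elements of \<open>H\<^sup>k(0,T;X)\<close> are always taken as their continuous
  representative, so that their values at single times make sense.\<close>

definition HkT :: "'x::minus hspace \<Rightarrow> real \<Rightarrow> nat \<Rightarrow> (real \<Rightarrow> 'x) \<Rightarrow> bool" where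
  "HkT X T k u \<longleftrightarrow>
     L2T X T u \<and> (\<forall>j<k. weakly_diffT X T ((tderiv X T ^^ j) u)) \<and> (k \<ge> 1 \<longrightarrow> contT X T u)"

definition HkT_norm2 :: "'x::minus hspace \<Rightarrow> real \<Rightarrow> nat \<Rightarrow> (real \<Rightarrow> 'x) \<Rightarrow> real" where
  "HkT_norm2 X T k u =
     (\<Sum>j\<le>k. integral\<^sup>L (lebesgue_on {0..T}) (\<lambda>t. (nrm X ((tderiv X T ^^ j) u t))\<^sup>2))"


section \<open>Networks and their function spaces\<close>

text \<open>The edge \<open>e\<close> is identified with the interval \<open>{0..len N e}\<close>, running from its tail to
  its head. Loops and parallel edges are permitted.\<close>

record ('v, 'e) network =
  graph :: "('v, 'e) pre_digraph"
  len :: "'e \<Rightarrow> real"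
  VD :: "'v set"

definition VN :: "('v, 'e) network \<Rightarrow> 'v set" where
  "VN N = verts (graph N) - VD N"

definition is_network :: "('v, 'e) network \<Rightarrow> bool" where
  "is_network N \<longleftrightarrow>
     fin_digraph (graph N) \<and> Digraph_Component.connected (graph N) \<and>
     (\<forall>e\<in>arcs (graph N). len N e > 0) \<and> VD N \<subseteq> verts (graph N) \<and> VD N \<noteq> {}"

type_synonym 'e nfun = "'e \<Rightarrow> real \<Rightarrow> real"

definition ae_eq :: "('v, 'e) network \<Rightarrow> 'e nfun \<Rightarrow> 'e nfun \<Rightarrow> bool" where
  "ae_eq N u w \<longleftrightarrow>
     (\<forall>e\<in>arcs (graph N). AE x in lebesgue_on {0..len N e}. u e x = w e x)"

definition L2 :: "('v, 'e) network \<Rightarrow> 'e nfun set" where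
  "L2 N = {u. \<forall>e\<in>arcs (graph N).
     u e \<in> borel_measurable (lebesgue_on {0..len N e}) \<and>
     integrable (lebesgue_on {0..len N e}) (\<lambda>x. (u e x)\<^sup>2)}"

definition ip :: "('v, 'e) network \<Rightarrow> 'e nfun \<Rightarrow> 'e nfun \<Rightarrow> real" where
  "ip N u w = (\<Sum>e\<in>arcs (graph N). integral\<^sup>L (lebesgue_on {0..len N e}) (\<lambda>x. u e x * w e x))"

definition has_dx :: "('v, 'e) network \<Rightarrow> 'e nfun \<Rightarrow> 'e nfun \<Rightarrow> bool" where
  "has_dx N u w \<longleftrightarrow> w \<in> L2 N \<and> (\<forall>e\<in>arcs (graph N). weak_deriv (len N e) (u e) (w e))"

definition dx :: "('v, 'e) network \<Rightarrow> 'e nfun \<Rightarrow> 'e nfun" where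
  "dx N u = (SOME w. has_dx N u w)"

text \<open>Elements of \<open>H\<^sup>1\<close> are given by their continuous representative on the closed edges; global
  continuity means that the end values at each vertex agree.\<close>

definition H1 :: "('v, 'e) network \<Rightarrow> 'e nfun set" where
  "H1 N = {q \<in> L2 N. (\<exists>w. has_dx N q w) \<and>
     (\<forall>e\<in>arcs (graph N). continuous_on {0..len N e} (q e)) \<and>
     (\<exists>V. \<forall>e\<in>arcs (graph N). q e 0 = V (tail (graph N) e) \<and> q e (len N e) = V (head (graph N) e))}"

definition vval :: "('v, 'e) network \<Rightarrow> 'e nfun \<Rightarrow> 'v \<Rightarrow> real" where
  "vval N q v = (THE c. \<exists>e\<in>arcs (graph N).
     (tail (graph N) e = v \<and> c = q e 0) \<or> (head (graph N) e = v \<and> c = q e (len N e)))"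

definition H10 :: "('v, 'e) network \<Rightarrow> 'e nfun set" where
  "H10 N = {q \<in> H1 N. \<forall>v\<in>VD N. vval N q v = 0}"

definition L2_sp :: "('v, 'e) network \<Rightarrow> 'e nfun hspace" where
  "L2_sp N = \<lparr>carr = L2 N, inn = ip N\<rparr>"

definition H1_sp :: "('v, 'e) network \<Rightarrow> 'e nfun hspace" where
  "H1_sp N = \<lparr>carr = H1 N, inn = (\<lambda>u w. ip N u w + ip N (dx N u) (dx N w))\<rparr>"

text \<open>A vector indexed by a finite set \<open>S\<close> of vertices is represented by any function that has
  the right values on \<open>S\<close>.\<close>

definition vec_sp :: "'v set \<Rightarrow> ('v \<Rightarrow> real) hspace" where
  "vec_sp S = \<lparr>carr = UNIV, inn = (\<lambda>x y. \<Sum>v\<in>S. x v * y v)\<rparr>"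


section \<open>Operators\<close>

text \<open>Functionals on \<open>H\<^sup>1\<close> are functions of the test element \<open>q\<close>. \<open>K\<close> is \<open>dx\<close>, and \<open>B\<close>, \<open>C\<close> are
  \<open>vval\<close> restricted to \<open>VD\<close>, \<open>VN\<close>.\<close>

definition K_adj :: "('v, 'e) network \<Rightarrow> 'e nfun \<Rightarrow> 'e nfun \<Rightarrow> real" where
  "K_adj N m q = ip N m (dx N q)"

definition B_adj :: "('v, 'e) network \<Rightarrow> ('v \<Rightarrow> real) \<Rightarrow> 'e nfun \<Rightarrow> real" where
  "B_adj N \<mu> q = (\<Sum>v\<in>VD N. \<mu> v * vval N q v)"

definition C_adj :: "('v, 'e) network \<Rightarrow> ('v \<Rightarrow> real) \<Rightarrow> 'e nfun \<Rightarrow> real" where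
  "C_adj N \<rho> q = (\<Sum>v\<in>VN N. \<rho> v * vval N q v)"

definition L_op :: "('v, 'e) network \<Rightarrow> 'e nfun \<Rightarrow> 'e nfun \<Rightarrow> 'e nfun \<Rightarrow> real" where
  "L_op N d p = K_adj N (\<lambda>e x. dx N p e x / d e x)"

definition B_right_inverse :: "('v, 'e) network \<Rightarrow> (('v \<Rightarrow> real) \<Rightarrow> 'e nfun) \<Rightarrow> bool" where
  \<comment> \<open>the last clause: the value depends only on the vector indexed by \<open>VD\<close>\<close>
  "B_right_inverse N Bm \<longleftrightarrow>
     (\<forall>\<mu>. Bm \<mu> \<in> H1 N \<and> (\<forall>v\<in>VD N. vval N (Bm \<mu>) v = \<mu> v)) \<and>
     (\<forall>\<mu> \<nu> c. ae_eq N (Bm (\<lambda>v. \<mu> v + c * \<nu> v)) (\<lambda>e x. Bm \<mu> e x + c * Bm \<nu> e x)) \<and>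
     (\<forall>\<mu> \<nu>. (\<forall>v\<in>VD N. \<mu> v = \<nu> v) \<longrightarrow> ae_eq N (Bm \<mu>) (Bm \<nu>))"

definition coefficients ::
  "('v, 'e) network \<Rightarrow> 'e nfun \<Rightarrow> 'e nfun \<Rightarrow> real \<Rightarrow> real \<Rightarrow> real \<Rightarrow> bool" where
  "coefficients N a d a_hi d_lo d_hi \<longleftrightarrow> 0 < d_lo \<and>
     (\<forall>e\<in>arcs (graph N).
        a e \<in> borel_measurable (lebesgue_on {0..len N e}) \<and>
        d e \<in> borel_measurable (lebesgue_on {0..len N e}) \<and>
        (AE x in lebesgue_on {0..len N e}.
           0 \<le> a e x \<and> a e x \<le> a_hi \<and> d_lo \<le> d e x \<and> d e x \<le> d_hi))"


section \<open>Strong time derivatives\<close>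

definition has_L2_deriv ::
  "('v, 'e) network \<Rightarrow> real \<Rightarrow> (real \<Rightarrow> 'e nfun) \<Rightarrow> 'e nfun \<Rightarrow> real \<Rightarrow> bool" where
  "has_L2_deriv N T u w t \<longleftrightarrow> w \<in> L2 N \<and>
     ((\<lambda>s. nrm (L2_sp N) (\<lambda>e x. (u s e x - u t e x) / (s - t) - w e x)) \<longlongrightarrow> 0) (at t within {0..T})"

definition L2_deriv :: "('v, 'e) network \<Rightarrow> real \<Rightarrow> (real \<Rightarrow> 'e nfun) \<Rightarrow> real \<Rightarrow> 'e nfun" where
  "L2_deriv N T u t = (SOME w. has_L2_deriv N T u w t)"

definition C1T :: "('v, 'e) network \<Rightarrow> real \<Rightarrow> (real \<Rightarrow> 'e nfun) \<Rightarrow> bool" where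
  "C1T N T u \<longleftrightarrow> contT (L2_sp N) T u \<and> (\<forall>t\<in>{0..T}. \<exists>w. has_L2_deriv N T u w t) \<and>
     contT (L2_sp N) T (L2_deriv N T u)"

definition vec_deriv :: "real \<Rightarrow> (real \<Rightarrow> 'v \<Rightarrow> real) \<Rightarrow> real \<Rightarrow> 'v \<Rightarrow> real" where
  "vec_deriv T h t v = vector_derivative (\<lambda>s. h s v) (at t within {0..T})"


section \<open>The systems\<close>

text \<open>Classical solutions of the hyperbolic system: \<open>p\<close> in \<open>C([0,T];H\<^sup>1)\<close> and
  \<open>C\<^sup>1([0,T];L\<^sup>2)\<close>, \<open>m\<close> in \<open>C\<^sup>1([0,T];L\<^sup>2)\<close>, \<open>lam\<close> continuous.\<close>

definition solves_H ::
  "('v, 'e) network \<Rightarrow> real \<Rightarrow> 'e nfun \<Rightarrow> 'e nfun \<Rightarrow> real \<Rightarrow>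
   (real \<Rightarrow> 'e nfun) \<Rightarrow> (real \<Rightarrow> 'e nfun) \<Rightarrow> (real \<Rightarrow> 'v \<Rightarrow> real) \<Rightarrow> (real \<Rightarrow> 'v \<Rightarrow> real) \<Rightarrow>
   (real \<Rightarrow> 'e nfun) \<Rightarrow> (real \<Rightarrow> 'e nfun) \<Rightarrow> (real \<Rightarrow> 'v \<Rightarrow> real) \<Rightarrow> bool" where
  "solves_H N T a d \<epsilon> f g h r p m lam \<longleftrightarrow>
     contT (H1_sp N) T p \<and> C1T N T p \<and> C1T N T m \<and> contT (vec_sp (VD N)) T lam \<and>
     (\<forall>t\<in>{0..T}.
        (\<forall>q\<in>H1 N. ip N (L2_deriv N T p t) q + ip N (\<lambda>e x. a e x * p t e x) q
             - K_adj N (m t) q + B_adj N (lam t) q = ip N (g t) q - C_adj N (r t) q) \<and>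
        ae_eq N (\<lambda>e x. \<epsilon> * L2_deriv N T m t e x + dx N (p t) e x + d e x * m t e x) (f t) \<and>
        (\<forall>v\<in>VD N. vval N (p t) v = h t v))"

text \<open>Weak solutions of the parabolic systems: \<open>p\<close> in \<open>C([0,T];L\<^sup>2)\<close> and \<open>L\<^sup>2(0,T;H\<^sup>1)\<close>, \<open>m\<close> in
  \<open>L\<^sup>2(0,T;L\<^sup>2)\<close>. The first equation, with values in the dual of \<open>H\<^sup>1\<close>, holds in the sense of
  distributions in time and the multiplier \<open>lam\<close> is a vector of distributions; no more
  can be expected of \<open>lam\<close> when the derivative of \<open>p\<close> is only in
  \<open>L\<^sup>2(0,T;H\<^sup>-\<^sup>1)\<close>.\<close>

definition solves_P ::
  "('v, 'e) network \<Rightarrow> real \<Rightarrow> 'e nfun \<Rightarrow> 'e nfun \<Rightarrow>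
   (real \<Rightarrow> 'e nfun) \<Rightarrow> (real \<Rightarrow> 'e nfun) \<Rightarrow> (real \<Rightarrow> 'v \<Rightarrow> real) \<Rightarrow> (real \<Rightarrow> 'v \<Rightarrow> real) \<Rightarrow>
   (real \<Rightarrow> 'e nfun) \<Rightarrow> (real \<Rightarrow> 'e nfun) \<Rightarrow> ((real \<Rightarrow> real) \<Rightarrow> 'v \<Rightarrow> real) \<Rightarrow> bool" where
  "solves_P N T a d f g h r p m lam \<longleftrightarrow>
     contT (L2_sp N) T p \<and> L2T (H1_sp N) T p \<and> L2T (L2_sp N) T m \<and>
     (\<forall>v\<in>VD N. distribution T (\<lambda>\<phi>. lam \<phi> v)) \<and>
     (\<forall>\<phi>. test_fun T \<phi> \<longrightarrow> (\<forall>q\<in>H1 N.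
        - integral\<^sup>L (lebesgue_on {0..T}) (\<lambda>t. ip N (p t) q * deriv \<phi> t)
        + integral\<^sup>L (lebesgue_on {0..T})
            (\<lambda>t. (ip N (\<lambda>e x. a e x * p t e x) q - K_adj N (m t) q) * \<phi> t)
        + B_adj N (lam \<phi>) q
        = integral\<^sup>L (lebesgue_on {0..T}) (\<lambda>t. (ip N (g t) q - C_adj N (r t) q) * \<phi> t))) \<and>
     (AE t in lebesgue_on {0..T}.
        ae_eq N (\<lambda>e x. dx N (p t) e x + d e x * m t e x) (f t) \<and>
        (\<forall>v\<in>VD N. vval N (p t) v = h t v))"

definition solves_P1 ::
  "('v, 'e) network \<Rightarrow> real \<Rightarrow> 'e nfun \<Rightarrow> 'e nfun \<Rightarrow> (real \<Rightarrow> 'e nfun) \<Rightarrow>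
   (real \<Rightarrow> 'e nfun) \<Rightarrow> (real \<Rightarrow> 'e nfun) \<Rightarrow> ((real \<Rightarrow> real) \<Rightarrow> 'v \<Rightarrow> real) \<Rightarrow> bool" where
  "solves_P1 N T a d m0 p1 m1 lam1 \<longleftrightarrow>
     weakly_diffT (L2_sp N) T m0 \<and>
     solves_P N T a d (\<lambda>t e x. - tderiv (L2_sp N) T m0 t e x) (\<lambda>t e x. 0) (\<lambda>t v. 0) (\<lambda>t v. 0)
       p1 m1 lam1"

end

theory Submission
 imports Defs "HOL-Library.Function_Algebras"
begin

text \<open>Put \<open>E = p - p0\<close> and \<open>W = m' - m0'\<close>. The pair \<open>(E, m - m0)\<close> solves the parabolic system with
 \<open>- \<epsilon> m'\<close> on the right of the second equation, and the error \<open>e = p - p0 - \<epsilon> p1\<close> solves it with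
 \<open>- \<epsilon> W\<close> there. The energy inequality thus bounds the left-hand side by a multiple of \<open>\<epsilon>\<^sup>2 \<integral>|W|\<^sup>2\<close>. Applied to
 difference quotients of \<open>E\<close> it also gives \<open>\<integral>|W|\<^sup>2 \<le> C \<epsilon>\<^sup>2 \<integral>|m''|\<^sup>2\<close>, with no contribution of the initial time:
 the compatibility conditions and \<open>r'(0) = 0\<close> force \<open>m'(0) = 0\<close>, whence \<open>E'(0) = 0\<close>.

 It remains to bound \<open>m''\<close>. Lifting \<open>h\<close> to a function on the network and writing vertex values as
 \<open>L\<^sup>2\<close> products with \<open>K q\<close> and \<open>q\<close> leaves a damped wave system with homogeneous boundary conditions whose
 data are of class \<open>H\<^sup>2\<close> in time, and with \<open>p'(0) = p\<^sub>*\<close>. Its energy \<open>|p''|\<^sup>2 + \<epsilon> |m''|\<^sup>2\<close> starts at a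
 multiple of \<open>|f'(0) - K p'(0)|\<^sup>2 / \<epsilon>\<close> plus terms controlled by the data, which are the two
 contributions to the estimate. As second derivatives need not exist, they are replaced by difference
 quotients throughout.\<close>

text \<open>The powers multiply up as \<open>eps^2 * eps^2 * (defect / eps + data)\<close>.
  \<open>Chat\<close> involves only the lower bound of \<open>d\<close>: the \<open>H^1\<close> norm
  of the error carries the factor \<open>c_L\<close>, and this product is bounded through
  \<open>L_op\<close> without dividing by \<open>c_L\<close>.

  Two obstacles shape the proof. The limit problem holds only in the sense of distributions in time,
  with a distributional multiplier; it is tested with functions vanishing at \<open>VD\<close>,
  which removes the multiplier, and its energy inequality cannot come from differentiating the
  squared norm. And the constant \<open>C\<close> in |m'(s)| \<le> C s, which shows that
  \<open>dq tau E\<close> starts at zero in the limit, may depend on \<open>eps\<close> in any way;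
  this is harmless because it enters only multiplied by \<open>tau\<close>, and \<open>tau\<close>
  tends to zero.

  Elements of the spaces are representatives, and \<open>dx\<close>, \<open>tderiv\<close> and
  \<open>L2_deriv\<close> are choices among functions at distance zero. So linearity, equations and
  initial values are carried as \<open>nrm X (x - y) = 0\<close>, and the Hilbert space theory is
  done for a semi-inner product.\<close>

notation scaleR (infixr "*R" 75) and tendsto (infixr "--->" 55)

abbreviation (input) divideR' (infixl "'/R" 70) where "x /R c \<equiv> inverse c *R x"

abbreviation (input) lim_seq (infixr "---->" 60) where "u ----> l \<equiv> u \<longlonglongrightarrow> l"

abbreviation ivl :: "real \<Rightarrow> real \<Rightarrow> real measure" where "ivl a b \<equiv> lebesgue_on {a..b}"

abbreviation meas :: "real \<Rightarrow> real \<Rightarrow> (real \<Rightarrow> real) set" where "meas a b \<equiv> borel_measurable (ivl a b)"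

abbreviation ig :: "real \<Rightarrow> real \<Rightarrow> (real \<Rightarrow> real) \<Rightarrow> real" where "ig a b f \<equiv> integral {a..b} f"

abbreviation lint :: "real \<Rightarrow> real \<Rightarrow> (real \<Rightarrow> real) \<Rightarrow> real" where "lint a b f \<equiv> integral\<^sup>L (ivl a b) f"

text \<open>The elements of the spaces are families of functions on the edges. With functions
  forming a real vector space, \<open>subspace\<close>, \<open>span\<close> and vector algebra apply
  to them, through both arguments of \<open>'e nfun\<close>.\<close>

instantiation "fun" :: (type, real_vector) real_vector
begin

definition scaleR_fun_def: "scaleR c f = (%x. c *R f x)"

instance
 by standard (auto simp: scaleR_fun_def fun_eq_iff algebra_simps)

end

lemma scaleR_fun_apply [simp]: "(c *R f) x = c *R f x"
 by (simp add: scaleR_fun_def)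

section \<open>Smooth bump functions\<close>

definition smooth :: "(real => real) => bool" where
 "smooth phi \<longleftrightarrow> (\<forall>k x. (deriv ^^ k) phi differentiable at x)"

text \<open>A class in which every function has a derivative from the same class contains all
  iterated derivatives of its members. This spares a formula for
  \<open>(deriv ^^ k) phi\<close>.\<close>

lemma smooth_coinduct:
 assumes P: "P phi"
  and step: "\<And>phi. P phi ==> \<exists>phi'. P phi' \<and> (\<forall>x. (phi has_real_derivative phi' x) (at x))"
 shows "smooth phi"
proof -
 have "P ((deriv ^^ k) phi)" for k
 proof (induction k)
  case (Suc k)
  then obtain phi' where phi': "P phi'" "\<And>x. ((deriv ^^ k) phi has_real_derivative phi' x) (at x)"
   using step by blast
  then have "deriv ((deriv ^^ k) phi) = phi'"
   by (auto simp: fun_eq_iff intro: DERIV_imp_deriv)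
  then show ?case
   using phi' by simp
 qed (use P in simp)
 then show ?thesis
  unfolding smooth_def by (meson step real_differentiable_def)
qed

lemma smooth_deriv:
 assumes "smooth phi"
 shows "smooth (deriv phi)" and "(phi has_real_derivative deriv phi x) (at x)"
proof -
 have "(deriv ^^ k) (deriv phi) = (deriv ^^ Suc k) phi" for k
  by (simp only: funpow_Suc_right o_apply)
 then show "smooth (deriv phi)"
  using assms unfolding smooth_def by metis
 have "phi differentiable at x"
  using assms unfolding smooth_def by (metis funpow_0)
 then show "(phi has_real_derivative deriv phi x) (at x)"
  by (metis DERIV_imp_deriv real_differentiable_def)
qed

lemma smooth_add:
 assumes "smooth f" "smooth g"
 shows "smooth (%x. f x + g x)"
proof (rule smooth_coinduct[where P = "%h. \<exists>f g. smooth f \<and> smooth g \<and> h = (%x. f x + g x)"])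
 show "\<exists>phi'. (\<exists>f g. smooth f \<and> smooth g \<and> phi' = (%x. f x + g x)) \<and>
   (\<forall>x. (phi has_real_derivative phi' x) (at x))"
  if phi: "\<exists>f g. smooth f \<and> smooth g \<and> phi = (%x. f x + g x)" for phi
 proof -
  obtain f g where fg: "smooth f" "smooth g" "phi = (%x. f x + g x)"
   using phi by blast
  then show ?thesis
   by (intro exI[of _ "%x. deriv f x + deriv g x"])
     (auto intro!: DERIV_add smooth_deriv)
 qed
qed (use assms in blast)

lemma smooth_affine_mult:
 assumes "smooth f"
 shows "smooth (%x. (c + d * x) * f x)"
\<comment> \<open>The derivative of \<open>(c + d * x) * f x\<close> is
  \<open>(c + d * x) * deriv f x + d * f x\<close>; the extra summand \<open>g\<close> makes the
  class closed under this.\<close>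
proof (rule smooth_coinduct[where
  P = "%h. \<exists>f g. smooth f \<and> smooth g \<and> h = (%x. (c + d * x) * f x + g x)"])
 have "smooth (%x. 0)"
  by (rule smooth_coinduct[where P = "%f. f = (%x. 0)"]) auto
 then show "\<exists>f' g. smooth f' \<and> smooth g \<and> (%x. (c + d * x) * f x) = (%x. (c + d * x) * f' x + g x)"
  using assms by fastforce
 show "\<exists>phi'. (\<exists>f g. smooth f \<and> smooth g \<and> phi' = (%x. (c + d * x) * f x + g x)) \<and>
   (\<forall>x. (phi has_real_derivative phi' x) (at x))"
  if phi: "\<exists>f g. smooth f \<and> smooth g \<and> phi = (%x. (c + d * x) * f x + g x)" for phi
 proof -
  obtain f g where fg: "smooth f" "smooth g" "phi = (%x. (c + d * x) * f x + g x)"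
   using phi by blast
  have s: "smooth (%x. d * f x)"
  proof (rule smooth_coinduct[where P = "%h. \<exists>f. smooth f \<and> h = (%x. d * f x)"])
   show "\<exists>fa. smooth fa \<and> (%x. d * f x) = (%x. d * fa x)"
    using fg by blast
   show "\<exists>phi'. (\<exists>f. smooth f \<and> phi' = (%x. d * f x)) \<and> (\<forall>x. (phi has_real_derivative phi' x) (at x))"
    if phi: "\<exists>f. smooth f \<and> phi = (%x. d * f x)" for phi
   proof -
    obtain f where "smooth f" "phi = (%x. d * f x)"
     using phi by blast
    then show ?thesis
     by (intro exI[of _ "%x. d * deriv f x"]) (auto intro!: DERIV_cmult smooth_deriv)
   qed
  qed
  show ?thesis
  proof (intro exI conjI allI)
   show "smooth (deriv f)" "smooth (%x. d * f x + deriv g x)"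
    using fg s by (auto intro!: smooth_add smooth_deriv)
   show "(%x. (c + d * x) * deriv f x + (d * f x + deriv g x)) =
     (%x. (c + d * x) * deriv f x + (d * f x + deriv g x))" ..
   show "(phi has_real_derivative (c + d * x) * deriv f x + (d * f x + deriv g x)) (at x)" for x
    unfolding fg(3)
    by (auto intro!: derivative_eq_intros smooth_deriv fg simp: algebra_simps)
  qed
 qed
qed

text \<open>One-sided functions exp (-c / y) / y^j with \<open>y = s * (x - \<alpha>)\<close>, where
  the sign \<open>s\<close> is the side. The power \<open>j\<close> is a parameter since
  differentiation raises it: the derivative combines the members with \<open>j + 1\<close> and
  \<open>j + 2\<close>.\<close>

definition flat :: "nat => real => real => real => real => real" where
 "flat j c s \<alpha> x = (if s * (x - \<alpha>) > 0 then exp (- c / (s * (x - \<alpha>))) / (s * (x - \<alpha>)) ^ j else 0)"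

text \<open>The algebra generated by these functions is closed under differentiation, so
  \<open>smooth_coinduct\<close> applies to it as a whole and covers products such as bumps.\<close>

inductive flat_alg :: "(real => real) => bool" where
 base: "c > 0 ==> s = 1 \<or> s = -1 ==> flat_alg (flat j c s \<alpha>)"
| scale: "flat_alg f ==> flat_alg (%x. k * f x)"
| add: "flat_alg f ==> flat_alg g ==> flat_alg (%x. f x + g x)"
| mult: "flat_alg f ==> flat_alg g ==> flat_alg (%x. f x * g x)"

lemma exp_ge_power_div_fact:
 fixes x :: real
 assumes "x \<ge> 0"
 shows "x ^ n / fact n \<le> exp x"
proof -
 have "(\<Sum>k\<in>{n}. x ^ k /R fact k) \<le> (\<Sum>k. x ^ k /R fact k)"
  using assms by (intro sum_le_suminf) (auto simp: summable_exp)
 then show ?thesis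
  by (simp add: exp_def divide_inverse mult.commute)
qed

text \<open>The exponential series gives exp z \<ge> z^n / n! with \<open>n = j + 2\<close> and z =
  c / y. This beats the denominator y^j and leaves a square, which is what makes the function
  differentiable at the seam.\<close>

lemma flat_le_square:
 assumes "c > 0" "s = 1 \<or> s = -1"
 shows "\<bar>flat j c s \<alpha> x\<bar> \<le> fact (j + 2) / c ^ (j + 2) * (x - \<alpha>)^2"
proof (cases "s * (x - \<alpha>) > 0")
 case True
 define y where "y = s * (x - \<alpha>)"
 have y: "y > 0" "(x - \<alpha>)^2 = y^2"
  using True assms by (auto simp: y_def power_mult_distrib)
 have "(c / y) ^ (j + 2) / fact (j + 2) \<le> exp (c / y)"
  using y assms by (intro exp_ge_power_div_fact) auto
 then have "inverse (exp (c / y)) \<le> inverse ((c / y) ^ (j + 2) / fact (j + 2))"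
  using y assms by (intro le_imp_inverse_le) auto
 then have "exp (- c / y) \<le> 1 / ((c / y) ^ (j + 2) / fact (j + 2))"
  by (simp add: exp_minus inverse_eq_divide del: power_Suc fact_Suc)
 also have "\<dots> = fact (j + 2) / c ^ (j + 2) * y^2 * y ^ j"
  using y assms by (simp add: power_divide power_add power2_eq_square del: fact_Suc)
 finally have "exp (- c / y) / y ^ j \<le> fact (j + 2) / c ^ (j + 2) * y^2"
  using y by (simp add: divide_le_eq)
 then show ?thesis
  using y True unfolding flat_def y_def[symmetric] by simp
next
 case False
 then show ?thesis
  using assms by (auto simp: flat_def)
qed

lemma flat_has_derivative:
 assumes c: "c > 0" and s: "s = 1 \<or> s = -1"
 shows "(flat j c s \<alpha> has_real_derivative
   s * (c * flat (j + 2) c s \<alpha> x - j * flat (j + 1) c s \<alpha> x)) (at x)"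
proof -
 define y where "y = s * (x - \<alpha>)"
 consider "y > 0" | "y < 0" | "y = 0" by linarith
 then show ?thesis
 proof cases
  case 1
  have "((%x. exp (- c / (s * (x - \<alpha>))) / (s * (x - \<alpha>)) ^ j) has_real_derivative
    ((exp (- c / y) * (c * s / y^2)) * y ^ j - exp (- c / y) * (real j * y ^ (j - 1) * s)) / (y ^ j * y ^ j)) (at x)"
   using 1 unfolding y_def
   by (auto intro!: derivative_eq_intros simp: power2_eq_square field_simps)
  moreover have "((exp (- c / y) * (c * s / y^2)) * y ^ j - exp (- c / y) * (real j * y ^ (j - 1) * s)) / (y ^ j * y ^ j)
    = s * (c * flat (j + 2) c s \<alpha> x - j * flat (j + 1) c s \<alpha> x)"
   using 1 unfolding flat_def y_def[symmetric]
   by (cases j) (simp_all add: field_simps power2_eq_square)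
  ultimately have "((%x. exp (- c / (s * (x - \<alpha>))) / (s * (x - \<alpha>)) ^ j) has_real_derivative
    s * (c * flat (j + 2) c s \<alpha> x - j * flat (j + 1) c s \<alpha> x)) (at x)" by simp
  moreover have "open {x. s * (x - \<alpha>) > 0}"
   by (intro open_Collect_less continuous_intros)
  ultimately show ?thesis
   using 1 by (elim has_field_derivative_transform_within_open) (auto simp: flat_def y_def)
 next
  case 2
  have "((%x. 0) has_real_derivative 0) (at x)" by simp
  moreover have "open {x. s * (x - \<alpha>) < 0}"
   by (intro open_Collect_less continuous_intros)
  ultimately have "(flat j c s \<alpha> has_real_derivative 0) (at x)"
   using 2 by (elim has_field_derivative_transform_within_open) (auto simp: flat_def y_def)
  then show ?thesis
   using 2 by (simp add: flat_def y_def)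
 next
  case 3
  then have x: "x = \<alpha>"
   using s by (auto simp: y_def)
  define M where "M = fact (j + 2) / c ^ (j + 2)"
  \<comment> \<open>By the quadratic bound the difference quotient at the seam is at most
    \<open>M * \<bar>h\<bar>\<close>.\<close>
  have "((%h. flat j c s \<alpha> (\<alpha> + h) / h) ---> 0) (at 0)"
  proof (rule tendsto_rabs_zero_cancel, rule tendsto_sandwich[of "%_. 0" _ _ "%h. M * \<bar>h\<bar>"])
   show "\<forall>\<^sub>F h in at 0. \<bar>flat j c s \<alpha> (\<alpha> + h) / h\<bar> \<le> M * \<bar>h\<bar>"
   proof (rule eventually_at_filter[THEN iffD2], rule always_eventually, intro allI impI)
    fix h :: real assume "h \<noteq> 0"
    then show "\<bar>flat j c s \<alpha> (\<alpha> + h) / h\<bar> \<le> M * \<bar>h\<bar>"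
     using flat_le_square[OF c s, of j \<alpha> "\<alpha> + h"]
     by (simp add: abs_divide divide_le_eq M_def power2_eq_square mult.assoc abs_mult_self_eq)
   qed
   show "((%h. M * \<bar>h\<bar>) ---> 0) (at 0)"
    by (auto intro!: tendsto_eq_intros)
  qed auto
  then have "(flat j c s \<alpha> has_real_derivative 0) (at x)"
   unfolding x DERIV_def by (simp add: flat_def)
  then show ?thesis
   by (simp add: x flat_def)
 qed
qed

lemma flat_alg_smooth:
 assumes "flat_alg f"
 shows "smooth f"
proof (rule smooth_coinduct[where P = flat_alg])
 show "\<exists>phi'. flat_alg phi' \<and> (\<forall>x. (phi has_real_derivative phi' x) (at x))" if "flat_alg phi" for phi
  using that
 proof (induction rule: flat_alg.induct)
  case (base c s j \<alpha>)
  have "flat_alg (%x. (s * c) * flat (j + 2) c s \<alpha> x + (- s * j) * flat (j + 1) c s \<alpha> x)"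
   using base by (intro flat_alg.add flat_alg.scale flat_alg.base)
  moreover have eq: "(s * c) * flat (j + 2) c s \<alpha> x + (- s * j) * flat (j + 1) c s \<alpha> x =
    s * (c * flat (j + 2) c s \<alpha> x - j * flat (j + 1) c s \<alpha> x)" for x
   by (simp add: algebra_simps)
  ultimately show ?case
   using flat_has_derivative[OF base] by (intro exI conjI allI) (assumption, simp only: eq)
 next
  case (scale f k)
  then obtain f' where "flat_alg f'" "\<And>x. (f has_real_derivative f' x) (at x)" by blast
  then show ?case
   by (intro exI[of _ "%x. k * f' x"]) (auto intro: flat_alg.scale DERIV_cmult)
 next
  case (add f g)
  then obtain f' g' where "flat_alg f'" "\<And>x. (f has_real_derivative f' x) (at x)"
   "flat_alg g'" "\<And>x. (g has_real_derivative g' x) (at x)" by blast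
  then show ?case
   by (intro exI[of _ "%x. f' x + g' x"]) (auto intro: flat_alg.add DERIV_add)
 next
  case (mult f g)
  then obtain f' g' where d: "flat_alg f'" "\<And>x. (f has_real_derivative f' x) (at x)"
   "flat_alg g'" "\<And>x. (g has_real_derivative g' x) (at x)" by blast
  then show ?case
   using mult.hyps
   by (intro exI[of _ "%x. f' x * g x + g' x * f x"])
     (auto intro!: flat_alg.add flat_alg.mult DERIV_mult)
 qed
qed (fact assms)

text \<open>The exponents \<open>1 / Suc k\<close> tend to zero, so the bumps converge pointwise to
  the indicator of the open interval while staying between 0 and 1. Dominated convergence with bumps
  then takes the place of mollification.\<close>

definition bump :: "nat => real => real => real => real" where
 "bump k \<alpha> \<beta> x = flat 0 (1 / Suc k) 1 \<alpha> x * flat 0 (1 / Suc k) (-1) \<beta> x"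

lemma smooth_bump: "smooth (bump k \<alpha> \<beta>)"
 unfolding bump_def by (intro flat_alg_smooth flat_alg.mult flat_alg.base) auto

lemma smooth_bump_diff: "smooth (%x. c * bump k \<alpha> \<beta> x + d * bump k \<gamma> dl x)"
 unfolding bump_def
 by (intro flat_alg_smooth flat_alg.add flat_alg.scale flat_alg.mult flat_alg.base) auto

lemma smooth_continuous_on: "smooth f ==> continuous_on S f"
 by (meson DERIV_isCont continuous_at_imp_continuous_on smooth_deriv(2))

lemma flat_bounds: "0 < c ==> 0 \<le> flat 0 c s \<alpha> x" "0 < c ==> flat 0 c s \<alpha> x \<le> 1"
 by (auto simp: flat_def)

lemma bump_bounds: "0 \<le> bump k \<alpha> \<beta> x" "bump k \<alpha> \<beta> x \<le> 1"
 unfolding bump_def by (auto intro!: mult_nonneg_nonneg mult_le_one flat_bounds)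

lemma bump_zero: "x \<notin> {\<alpha><..<\<beta>} ==> bump k \<alpha> \<beta> x = 0"
 by (auto simp: bump_def flat_def)

lemma bump_tendsto: "(%k. bump k \<alpha> \<beta> x) ----> indicator {\<alpha><..<\<beta>} x"
proof (cases "x \<in> {\<alpha><..<\<beta>}")
 case True
 have "(%k. exp (- (1 / real (Suc k)) / (x - \<alpha>)) * exp (- (1 / real (Suc k)) / (\<beta> - x))) ---->
   exp (- 0 / (x - \<alpha>)) * exp (- 0 / (\<beta> - x))"
  using True by (intro tendsto_intros LIMSEQ_Suc lim_1_over_n) auto
 then show ?thesis
  using True by (simp add: bump_def flat_def)
next
 case False
 then show ?thesis
  by (simp add: bump_zero)
qed

section \<open>Integrals over compact intervals\<close>

abbreviation intable :: "real => real => (real => real) => bool" where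
 "intable a b f \<equiv> integrable (ivl a b) f"

lemma ivl_integrable_on: "intable a b f ==> f integrable_on {a..b}"
 by (rule integrable_on_lebesgue_on) auto

lemma ivl_eq: "intable a b f ==> lint a b f = ig a b f"
 by (rule lebesgue_integral_eq_integral) auto

lemma ivl_sub: "intable a b f ==> a \<le> c ==> d \<le> b ==> intable c d f"
 by (rule integrable_subinterval) auto

text \<open>An explicit null set can be translated, united with others and avoided at the two times
  \<open>s\<close> and \<open>s + tau\<close> at once, as all arguments with windows and difference
  quotients require.\<close>

lemma AE_ivl_iff:
 "(AE x in lebesgue_on {a..b::real}. P x) \<longleftrightarrow> (\<exists>Z. negligible Z \<and> (\<forall>x\<in>{a..b} - Z. P x))"
proof -
 have "{x. \<not> (x \<in> {a..b} --> P x)} \<subseteq> Z \<longleftrightarrow> (\<forall>x\<in>{a..b} - Z. P x)" for Z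
  by blast
 moreover have "(AE x in ivl a b. P x) \<longleftrightarrow> (AE x in lebesgue. x \<in> {a..b} --> P x)"
  by (rule AE_restrict_space_iff) simp
 ultimately show ?thesis
  unfolding eventually_ae_filter_negligible by simp
qed

lemma AE_ivlI: "negligible Z ==> (\<And>x. x \<in> {a..b} ==> x \<notin> Z ==> P x) ==> AE x in lebesgue_on {a..b::real}. P x"
 unfolding AE_ivl_iff by blast

lemma AE_ivl_all: "(\<And>x. x \<in> {a..b} ==> P x) ==> AE x in lebesgue_on {a..b::real}. P x"
 by (rule AE_ivlI[of "{}"]) auto

lemma AE_ivl_sub:
 "(AE x in lebesgue_on {a..b::real}. P x) ==> a \<le> c ==> d \<le> b ==> AE x in ivl c d. P x"
 unfolding AE_ivl_iff by auto

lemma AE_ivl_shift: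
 assumes "AE x in lebesgue_on {a..b::real}. P x"
 shows "AE x in ivl (a - c) (b - c). P (x + c)"
proof -
 obtain Z where Z: "negligible Z" "\<And>x. x \<in> {a..b} - Z ==> P x"
  using assms unfolding AE_ivl_iff by blast
 then have "negligible ((+) (- c) ` Z)"
  by (intro negligible_translation)
 then show ?thesis
 proof (rule AE_ivlI)
  fix x assume "x \<in> {a - c..b - c}" "x \<notin> (+) (- c) ` Z"
  then have "x + c \<in> {a..b}" "x + c \<notin> Z"
   by (auto simp: image_iff)
  then show "P (x + c)"
   using Z by blast
 qed
qed

lemma ivl_cong_AE:
 assumes "intable a b f" "AE x in ivl a b. f x = g x"
 shows "ig a b g = ig a b f"
 using assms(2) unfolding AE_ivl_iff by (auto intro!: integral_spike)

lemma ivl_mono_AE: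
 assumes "intable a b f" "intable a b g" "AE x in ivl a b. f x \<le> g x"
 shows "ig a b f \<le> ig a b g"
 using integral_mono_AE[OF assms] assms by (simp add: ivl_eq)

lemma ivl_shift:
 assumes "intable a b f"
 shows "intable (a - c) (b - c) (%x. f (x + c))"
  and "ig (a - c) (b - c) (%x. f (x + c)) = ig a b f"
proof -
 have *: "intable a b f \<longleftrightarrow> f absolutely_integrable_on {a..b}" for a b and f :: "real => real"
  by (simp add: set_integrable_def integrable_restrict_space)
 have h: "((%x. f (1 *R x + c)) has_integral ig a b f) ((%x. (1 / 1) *R x + - ((1 / 1) *R c)) ` {a..b})"
  if "f integrable_on {a..b}" for f :: "real => real"
  using has_integral_affinity[of f "ig a b f" a b 1 c] that
  by (simp add: has_integral_integral)
 have im: "(%x::real. (1 / 1) *R x + - ((1 / 1) *R c)) ` {a..b} = {a - c..b - c}"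
  by (auto simp: image_iff intro!: bexI[of _ "_ + c"])
 have hs: "((%x. f (x + c)) has_integral ig a b f) {a - c..b - c}"
  if "f integrable_on {a..b}" for f :: "real => real"
  using h[OF that] unfolding im by simp
 show "ig (a - c) (b - c) (%x. f (x + c)) = ig a b f"
  using hs[OF ivl_integrable_on[OF assms]] by blast
 have "f absolutely_integrable_on {a..b}"
  using assms * by blast
 then have "(%x. norm (f x)) integrable_on {a..b}"
  by (simp add: absolutely_integrable_on_def)
 then have "(%x. f (x + c)) absolutely_integrable_on {a - c..b - c}"
  using hs[OF ivl_integrable_on[OF assms]] hs[of "%x. norm (f x)"]
  by (auto simp: absolutely_integrable_on_def intro: has_integral_integrable)
 then show "intable (a - c) (b - c) (%x. f (x + c))"
  using * by blast
qed

lemma ivl_meas_shift: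
 assumes "f \<in> meas a b"
 shows "(%x. f (x + c)) \<in> borel_measurable (lebesgue_on {a - c..b - c::real})"
proof (rule measurable_compose[OF _ assms])
 have "(%x. c + (\<Sum>j\<in>Basis. (1 * (x \<bullet> j)) *R j)) \<in> lebesgue \<rightarrow>\<^sub>M lebesgue"
  by (rule lebesgue_affine_measurable) auto
 then have "(%x::real. x + c) \<in> lebesgue \<rightarrow>\<^sub>M lebesgue"
  by (simp add: add.commute)
 then show "(%x. x + c) \<in> ivl (a - c) (b - c) \<rightarrow>\<^sub>M ivl a b"
  by (rule measurable_restrict_space3) auto
qed

lemma ivl_cont: "continuous_on {a..b} f ==> intable a b f"
 by (rule continuous_imp_integrable_real)

lemma ivl_combine:
 "intable a b f ==> a \<le> c ==> c \<le> b ==> ig a c f + ig c b f = ig a b f"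
 by (intro Henstock_Kurzweil_Integration.integral_combine ivl_integrable_on)

lemma ivl_restrict:
 fixes f :: "real => real"
 assumes "{c..d} \<subseteq> {a..b}"
 shows "ig a b (%x. if x \<in> {c..d} then f x else 0) = ig c d f"
 unfolding integral_def integrable_on_def has_integral_restrict[OF assms] ..

lemma ivl_nonneg: 
 "intable a b f ==> (AE x in ivl a b. 0 \<le> f x) ==> 0 \<le> ig a b f"
 using integral_nonneg_AE[of f] by (metis ivl_eq)

lemma ivl_abs_le:
 assumes "intable a b f" "intable a b g" "AE x in ivl a b. \<bar>f x\<bar> \<le> g x"
 shows "\<bar>ig a b f\<bar> \<le> ig a b g"
proof -
 have "ig a b f \<le> ig a b g"
  using assms by (intro ivl_mono_AE) auto
 moreover have "ig a b (%x. - f x) \<le> ig a b g"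
  using assms by (intro ivl_mono_AE) auto
 ultimately show ?thesis
  by (simp add: abs_le_iff)
qed

lemma ivl_mono_sub:
 assumes "intable a b f" "AE x in ivl a b. 0 \<le> f x" "a \<le> c" "d \<le> b"
 shows "ig c d f \<le> ig a b f"
proof (cases "c \<le> d")
 case True
 have "ig a c f + ig c b f = ig a b f"
  "ig c d f + ig d b f = ig c b f"
  using assms True by (auto intro!: ivl_combine ivl_sub[OF assms(1)])
 moreover have "0 \<le> ig a c f" "0 \<le> ig d b f"
  using assms True by (auto intro!: ivl_nonneg ivl_sub[OF assms(1)] AE_ivl_sub[OF assms(2)])
 ultimately show ?thesis by linarith
next
 case False
 then show ?thesis
  using ivl_nonneg[OF assms(1,2)] by simp
qed

text \<open>This is how Young's inequality with all weights yields Cauchy-Schwarz. The best weight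
  is \<open>c = sqrt (b / a)\<close>; both numbers are first enlarged by a small \<open>d\<close>,
  so that the choice makes sense also when one of them vanishes.\<close>

lemma nonneg_quadratic_bound:
 fixes x a b :: real
 assumes "0 \<le> a" "0 \<le> b" "\<And>c. 0 < c ==> 2 * x \<le> c * a + b / c"
 shows "x \<le> sqrt a * sqrt b"
proof (rule field_le_epsilon)
 fix e :: real assume "e > 0"
 have "sqrt a * sqrt b * 2 + e * 2 \<ge> 2 * x"
 proof -
  have "((%d. sqrt (a + d) * sqrt (b + d)) ---> sqrt (a + 0) * sqrt (b + 0)) (at_right 0)"
   by (intro tendsto_intros)
  then have "\<forall>\<^sub>F d in at_right 0. sqrt (a + d) * sqrt (b + d) < sqrt a * sqrt b + e"
   by (rule order_tendstoD) (use \<open>e > 0\<close> in auto)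
  moreover have "\<forall>\<^sub>F d in at_right (0::real). d > 0"
   by (simp add: eventually_at_right_less)
  ultimately have "\<forall>\<^sub>F d in at_right 0. d > 0 \<and> sqrt (a + d) * sqrt (b + d) < sqrt a * sqrt b + e"
   by eventually_elim auto
  then obtain d where d: "d > 0" "sqrt (a + d) * sqrt (b + d) < sqrt a * sqrt b + e"
   using eventually_happens[of _ "at_right (0::real)"] by (auto simp: trivial_limit_at_right_real)
  define A where "A = sqrt (a + d)"
  define B where "B = sqrt (b + d)"
  have AB: "A > 0" "B > 0" "A^2 = a + d" "B^2 = b + d"
   using assms d by (auto simp: A_def B_def)
  have "2 * x \<le> (B / A) * a + b / (B / A)"
   using AB by (intro assms) auto
  also have "\<dots> \<le> (B / A) * A^2 + B^2 / (B / A)"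
   using AB d by (intro add_mono mult_left_mono divide_right_mono) auto
  also have "\<dots> = 2 * (A * B)"
   using AB(1,2) by (simp add: power2_eq_square)
  finally show ?thesis
   using d by (simp add: A_def B_def)
 qed
 then show "x \<le> sqrt a * sqrt b + e" by linarith
qed

lemma abs_le_imp_square_le: "\<bar>x\<bar> \<le> y ==> x^2 \<le> (y::real)^2"
 by (metis abs_ge_zero power2_abs power_mono)

section \<open>Square integrable functions on an interval\<close>

definition sq_int :: "real => real => (real => real) => bool" where
 "sq_int a b f \<longleftrightarrow> f \<in> meas a b \<and> intable a b (%x. (f x)^2)"

lemma sq_int_mult:
 assumes "sq_int a b f" "sq_int a b g"
 shows "intable a b (%x. f x * g x)"
proof (rule Bochner_Integration.integrable_bound)
 show "intable a b (%x. (f x)^2 + (g x)^2)"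
  using assms by (auto simp: sq_int_def)
 have "\<bar>f x * g x\<bar> \<le> (f x)^2 + (g x)^2" for x
 proof -
  have "2 * \<bar>f x * g x\<bar> \<le> (f x)^2 + (g x)^2"
   using sum_squares_bound[of "\<bar>f x\<bar>" "\<bar>g x\<bar>"] by (simp add: abs_mult mult.assoc)
  then show ?thesis by linarith
 qed
 then show "AE x in ivl a b. norm (f x * g x) \<le> norm ((f x)^2 + (g x)^2)"
  by auto
qed (use assms in \<open>auto simp: sq_int_def\<close>)

lemma sq_int_const: "sq_int a b (%x. c)"
 by (auto simp: sq_int_def intro!: ivl_cont)

lemma sq_int_cont: "continuous_on {a..b} f ==> sq_int a b f"
 unfolding sq_int_def
 by (auto intro!: ivl_cont continuous_intros continuous_imp_measurable_on_sets_lebesgue)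

lemma sq_int_integrable: "sq_int a b f ==> intable a b f"
 using sq_int_mult[of a b f "%_. 1"] sq_int_const by simp

lemma sq_int_abs: "sq_int a b f ==> sq_int a b (%x. \<bar>f x\<bar>)"
 by (auto simp: sq_int_def)

lemma sq_int_cmult: "sq_int a b f ==> sq_int a b (%x. c * f x)"
 by (auto simp: sq_int_def power_mult_distrib)

lemma sq_int_add:
 assumes "sq_int a b f" "sq_int a b g"
 shows "sq_int a b (%x. f x + g x)"
proof -
 have "(%x. (f x + g x)^2) = (%x. (f x)^2 + (g x)^2 + 2 * (f x * g x))"
  by (simp add: power2_sum fun_eq_iff)
 then show ?thesis
  using assms sq_int_mult[OF assms] by (auto simp: sq_int_def)
qed

lemma sq_int_sum: "finite A ==> (\<And>i. i \<in> A ==> sq_int a b (f i)) ==> sq_int a b (%x. \<Sum>i\<in>A. f i x)"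
 by (induction A rule: finite_induct) (auto intro!: sq_int_add sq_int_const)

lemma sq_int_sub: "sq_int a b f ==> a \<le> c ==> d \<le> b ==> sq_int c d f"
 unfolding sq_int_def
 by (auto intro: ivl_sub measurable_restrict_mono[of _ "lebesgue" "{a..b}"])

lemma sq_int_bound:
 assumes "sq_int a b g" "f \<in> meas a b"
  and "AE x in ivl a b. \<bar>f x\<bar> \<le> g x"
 shows "sq_int a b f"
 unfolding sq_int_def
proof (intro conjI Bochner_Integration.integrable_bound[of _ "%x. (g x)^2" "%x. (f x)^2"])
 show "AE x in ivl a b. norm ((f x)^2) \<le> norm ((g x)^2)"
  using assms(3) by eventually_elim (auto intro: abs_le_imp_square_le)
qed (use assms in \<open>auto simp: sq_int_def\<close>)

lemma sq_int_Cauchy_Schwarz: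
 assumes "sq_int a b f" "sq_int a b g"
 shows "ig a b (%x. f x * g x) \<le>
  sqrt (ig a b (%x. (f x)^2)) * sqrt (ig a b (%x. (g x)^2))"
proof (rule nonneg_quadratic_bound)
 have i: "intable a b (%x. (f x)^2)" "intable a b (%x. (g x)^2)"
  "intable a b (%x. f x * g x)"
  using assms sq_int_mult[OF assms] by (auto simp: sq_int_def)
 show "0 \<le> ig a b (%x. (f x)^2)" "0 \<le> ig a b (%x. (g x)^2)"
  using i by (auto intro!: ivl_nonneg)
 fix c :: real assume c: "0 < c"
 have *: "2 * (f x * g x) \<le> c * (f x)^2 + (1 / c) * (g x)^2" for x
  using sum_squares_bound[of "sqrt c * f x" "g x / sqrt c"] c
  by (simp add: power_mult_distrib power_divide)
 have "ig a b (%x. 2 * (f x * g x)) \<le> ig a b (%x. c * (f x)^2 + (1 / c) * (g x)^2)"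
  using i * by (intro ivl_mono_AE) auto
 also have "\<dots> = ig a b (%x. c * (f x)^2) + ig a b (%x. (1 / c) * (g x)^2)"
  using i by (intro Henstock_Kurzweil_Integration.integral_add ivl_integrable_on) auto
 finally show "2 * ig a b (%x. f x * g x) \<le>
   c * ig a b (%x. (f x)^2) + ig a b (%x. (g x)^2) / c"
  by simp
qed

lemma sq_int_integral_le:
 assumes "sq_int a b f" "a \<le> b"
 shows "ig a b f \<le> sqrt (b - a) * sqrt (ig a b (%x. (f x)^2))"
 using sq_int_Cauchy_Schwarz[OF sq_int_const[of a b 1] assms(1)] assms(2) by simp

text \<open>The integral of the square of an average over a window of length \<open>tau\<close> is compared with
 \<open>\<integral>(P (s + tau) - P s) / tau\<close>, where \<open>P\<close> is the primitive of \<open>g^2\<close>.\<close>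

lemma window_average_sq_le:
 assumes g: "sq_int 0 T g" and tau: "0 < tau" "tau \<le> T"
 shows "continuous_on {0..T - tau} (%s. ig s (s + tau) g / tau)"
  and "ig 0 (T - tau) (%s. (ig s (s + tau) g / tau)^2) \<le> ig 0 T (%x. (g x)^2)"
proof -
 have win: "ig s (s + tau) f = ig 0 (s + tau) f - ig 0 s f"
  if "intable 0 T f" "s \<in> {0..T - tau}" for f s
 proof -
  have "ig 0 s f + ig s (s + tau) f = ig 0 (s + tau) f"
   using that tau by (intro ivl_combine ivl_sub[OF that(1)]) auto
  then show ?thesis by linarith
 qed
 have cont: "continuous_on {0..T - tau} (%s. ig 0 (s + tau) f - ig 0 s f)"
  if "intable 0 T f" for f
 proof -
  have c: "continuous_on {0..T} (%x. ig 0 x f)"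
   using that by (intro indefinite_integral_continuous_1 ivl_integrable_on)
  show ?thesis
   using tau by (intro continuous_intros continuous_on_compose2[OF c]) auto
 qed
 have gi: "intable 0 T g" "intable 0 T (%x. (g x)^2)"
  using g sq_int_integrable[OF g] by (auto simp: sq_int_def)
 have c1: "continuous_on {0..T - tau} (%s. ig s (s + tau) g)"
  using cont[OF gi(1)] by (rule continuous_on_eq) (use win[OF gi(1)] in simp)
 then show c2: "continuous_on {0..T - tau} (%s. ig s (s + tau) g / tau)"
  using tau by (intro continuous_intros) auto
 define P where "P x = ig 0 x (%x. (g x)^2)" for x
 have cP: "continuous_on {0..T} P"
  unfolding P_def using gi by (intro indefinite_integral_continuous_1 ivl_integrable_on)
 have P0: "0 \<le> P x" if "x \<in> {0..T}" for x
  unfolding P_def using that gi by (intro ivl_nonneg ivl_sub[OF gi(2)]) auto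
 have PT: "P x \<le> P T" if "x \<in> {0..T}" for x
  unfolding P_def using that gi by (intro ivl_mono_sub) auto
 have cs: "continuous_on {0..T - tau} (%s. P (s + tau))" "continuous_on {0..T - tau} P"
  using tau by (auto intro!: continuous_on_compose2[OF cP] continuous_intros)
 have "(ig s (s + tau) g / tau)^2 \<le> (P (s + tau) - P s) / tau" if s: "s \<in> {0..T - tau}" for s
 proof -
  have g': "sq_int s (s + tau) g" using s by (intro sq_int_sub[OF g]) auto
  have n: "0 \<le> ig s (s + tau) (%x. (g x)^2)"
   using g' by (intro ivl_nonneg) (auto simp: sq_int_def)
  have "\<bar>ig s (s + tau) g\<bar> \<le> ig s (s + tau) (%x. \<bar>g x\<bar>)"
   using sq_int_integrable[OF g'] by (intro ivl_abs_le) auto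
  also have "\<dots> \<le> sqrt tau * sqrt (ig s (s + tau) (%x. (g x)^2))"
   using sq_int_integral_le[OF sq_int_abs[OF g']] tau by simp
  finally have "\<bar>ig s (s + tau) g\<bar>^2 \<le> (sqrt tau * sqrt (ig s (s + tau) (%x. (g x)^2)))^2"
   by (intro power_mono) auto
  also have "\<dots> = tau * (P (s + tau) - P s)"
   using tau n win[OF gi(2) s] by (simp add: power_mult_distrib P_def)
  finally show ?thesis
   using tau by (simp add: power_divide divide_le_eq power2_eq_square mult.commute)
 qed
 then have "ig 0 (T - tau) (%s. (ig s (s + tau) g / tau)^2)
   \<le> ig 0 (T - tau) (%s. (P (s + tau) - P s) / tau)"
  by (intro integral_le integrable_continuous_interval continuous_intros c2 cs) (use tau in auto)
 also have "\<dots> = (ig 0 (T - tau) (%s. P (s + tau)) - ig 0 (T - tau) P) / tau"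
  by (simp add: Henstock_Kurzweil_Integration.integral_diff integrable_continuous_interval cs)
 also have "ig 0 (T - tau) (%s. P (s + tau)) = ig tau T P"
  using ivl_shift(2)[OF ivl_cont, of tau T P tau] continuous_on_subset[OF cP] tau by simp
 \<comment> \<open>Both integrals are the integral over \<open>{0..T}\<close> less a window at one
   end. The first window counts with a negative sign, and on the last one \<open>P\<close> is at
   most \<open>P T\<close>.\<close>
 also have "ig tau T P - ig 0 (T - tau) P \<le> tau * P T"
 proof -
  have "ig 0 tau P + ig tau T P = ig 0 T P"
   "ig 0 (T - tau) P + ig (T - tau) T P = ig 0 T P"
   using tau by (auto intro!: ivl_combine ivl_cont cP)
  moreover have "0 \<le> ig 0 tau P"
   using tau P0 by (intro ivl_nonneg ivl_cont continuous_on_subset[OF cP] AE_ivl_all) auto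
  moreover have "ig (T - tau) T P \<le> ig (T - tau) T (%x. P T)"
   using tau PT by (intro ivl_mono_AE ivl_cont continuous_on_subset[OF cP] AE_ivl_all) auto
  ultimately show ?thesis using tau by simp
 qed
 finally show "ig 0 (T - tau) (%s. (ig s (s + tau) g / tau)^2) \<le> ig 0 T (%x. (g x)^2)"
  using tau by (simp add: P_def divide_le_eq divide_right_mono mult.commute) 
qed

text \<open>A measurable indicator is almost everywhere a limit of continuous functions; cutting
  these off at 0 and 1 keeps them continuous and makes dominated convergence applicable.\<close>

lemma indicator_approx_continuous:
 assumes A: "A \<in> sets lebesgue" and dl: "dl > 0"
 obtains phi :: "real => real" where "continuous_on UNIV phi"
  "ig a b (%x. (indicator A x - phi x)^2) \<le> dl"
proof -
 obtain N and g :: "nat => real => real" where N: "negligible N" and cg: "\<And>n. continuous_on UNIV (g n)"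
  and g: "\<And>x. x \<notin> N ==> (%n. g n x) ----> indicat_real A x"
  using indicator_measurable_on[OF A] unfolding measurable_on_def by auto
 define phi where "phi n x = max 0 (min 1 (g n x))" for n x
 have cphi: "continuous_on S (phi n)" for n S
  unfolding phi_def by (intro continuous_intros continuous_on_subset[OF cg]) auto
 have phi: "(%n. phi n x) ----> indicator A x" if "x \<notin> N" for x
 proof -
  have "(%n. max 0 (min 1 (g n x))) ----> max 0 (min 1 (indicator A x))"
   by (intro tendsto_intros g that)
  then show ?thesis by (simp add: phi_def split: split_indicator)
 qed
 have m: "indicat_real A \<in> meas a b" "phi n \<in> meas a b" for n
  using A by (auto intro!: measurable_restrict_space1[of "indicat_real A"]
    continuous_imp_measurable_on_sets_lebesgue cphi)
 have bnd: "\<bar>indicator A x - phi n x\<bar> \<le> 1" for n x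
  by (auto simp: phi_def split: split_indicator)
 have b2: "(indicator A x - phi n x)^2 \<le> 1" for n x
  using bnd[of x n] by (simp add: abs_square_le_1)
 have "(%n. lint a b (%x. (indicator A x - phi n x)^2)) ---->
   lint a b (%x. 0)"
 proof (rule integral_dominated_convergence[where w = "%_. 1"])
  show "AE x in ivl a b. (%n. (indicator A x - phi n x)^2) ----> 0"
  proof (rule AE_ivlI[OF N])
   fix x assume "x \<notin> N"
   then show "(%n. (indicator A x - phi n x)^2) ----> 0"
    using tendsto_power[OF tendsto_diff[OF tendsto_const[of "indicator A x"] phi], of x 2] by simp
  qed
 qed (use m b2 in \<open>auto intro!: ivl_cont\<close>)
 then have "\<forall>\<^sub>F n in sequentially. lint a b (%x. (indicator A x - phi n x)^2) < dl"
  using dl by (intro order_tendstoD) auto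
 then obtain n where n: "lint a b (%x. (indicator A x - phi n x)^2) < dl"
  by (auto simp: eventually_sequentially)
 have "intable a b (%x. (indicator A x - phi n x)^2)"
  using m b2 by (intro Bochner_Integration.integrable_bound[OF ivl_cont[of a b "%_. 1"]]) auto
 then show ?thesis
  using n by (intro that[of "phi n"] cphi) (simp add: ivl_eq)
qed

section \<open>Weak derivatives on an interval\<close>

text \<open>A primitive of a compactly supported function has compact support exactly when the mean
  is zero. This provides test functions with prescribed derivative.\<close>

lemma primitive_test_fun:
 assumes \<omega>: "smooth \<omega>" "\<And>x. x \<notin> {\<alpha><..<\<beta>} ==> \<omega> x = 0"
  and ab: "0 < \<alpha>" "\<alpha> < \<beta>" "\<beta> < L" and int0: "ig 0 L \<omega> = 0"
 shows "test_fun L (%x. ig 0 x \<omega>)" and "deriv (%x. ig 0 x \<omega>) = \<omega>"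
proof -
 define phi where "phi x = ig 0 x \<omega>" for x
 have zero_l: "phi x = 0" if "x \<le> \<alpha>" for x
 proof -
  have "ig 0 x \<omega> = ig 0 x (%x. 0)"
   using that by (intro integral_cong \<omega>) auto
  then show ?thesis by (simp add: phi_def)
 qed
 have zero_r: "phi x = 0" if "\<beta> \<le> x" for x
 proof -
  have "ig \<beta> y \<omega> = ig \<beta> y (%x. 0)" for y
   by (intro integral_cong \<omega>) auto
  then have "ig \<beta> y \<omega> = 0" for y by simp
  moreover have "ig 0 \<beta> \<omega> + ig \<beta> y \<omega> = ig 0 y \<omega>" if "\<beta> \<le> y" for y
   using that ab by (intro ivl_combine ivl_cont smooth_continuous_on \<omega>) auto
  ultimately have "ig 0 y \<omega> = ig 0 \<beta> \<omega>" if "\<beta> \<le> y" for y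
   using that by force
  from this[of x] this[of L] show ?thesis
   using that ab int0 by (simp add: phi_def)
 qed
 have der: "(phi has_real_derivative \<omega> x) (at x)" for x
 proof (cases "x < \<alpha>")
  case True
  have "((%x. 0) has_real_derivative 0) (at x)" by simp
  then have "(phi has_real_derivative 0) (at x)"
   by (rule has_field_derivative_transform_within_open[of _ _ _ "{..<\<alpha>}"])
     (use True zero_l in auto)
  then show ?thesis using True \<omega> by simp
 next
  case False
  then have x: "0 < x" using ab by simp
  have "(phi has_real_derivative \<omega> x) (at x within {0..x + 1})"
   unfolding phi_def using x
   by (intro integral_has_real_derivative smooth_continuous_on \<omega>) auto
  moreover have "at x within {0..x + 1} = at x"
   using x by (intro at_within_interior) auto
  ultimately show ?thesis by simp
 qed
 then show d: "deriv (%x. ig 0 x \<omega>) = \<omega>"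
  unfolding phi_def[symmetric] by (auto simp: fun_eq_iff intro: DERIV_imp_deriv)
 have "smooth phi"
 proof (rule smooth_coinduct[where P = "%f. smooth f \<or> f = phi"])
  show "\<exists>phi'. (smooth phi' \<or> phi' = phi) \<and> (\<forall>x. (f has_real_derivative phi' x) (at x))"
   if "smooth f \<or> f = phi" for f
   using that der \<omega>(1) smooth_deriv by blast
 qed simp
 then show "test_fun L (%x. ig 0 x \<omega>)"
  unfolding test_fun_def smooth_def phi_def[symmetric]
  using ab zero_l zero_r by (intro conjI exI[of _ \<alpha>] exI[of _ \<beta>]) auto
qed

lemma test_fun_bump:
 assumes "0 < \<alpha>" "\<beta> < L"
 shows "test_fun L (bump k \<alpha> \<beta>)"
 unfolding test_fun_def using smooth_bump[of k \<alpha> \<beta>] assms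
 by (intro conjI exI[of _ \<alpha>] exI[of _ \<beta>]) (auto simp: smooth_def intro: bump_zero)

text \<open>Lebesgue's differentiation theorem with one-sided windows, applied to the extension of
  \<open>u\<close> by zero.\<close>

lemma right_averages_tendsto_AE:
 assumes u: "intable 0 L u"
 obtains Z where "negligible Z"
  "\<And>x. x \<in> {0<..<L} - Z ==> ((%h. ig x (x + h) u / h) ---> u x) (at_right 0)"
proof -
 define f where "f x = (if x \<in> {0..L} then u x else 0)" for x
 have "f integrable_on UNIV"
  unfolding f_def using ivl_integrable_on[OF u] by (subst integrable_restrict_UNIV)
 then have "f integrable_on cbox a b" for a b
  by (rule integrable_on_subcbox) auto
 then have "\<exists>Z. negligible Z \<and> (\<forall>x. x \<notin> Z --> (\<forall>e>0. \<exists>d>0. \<forall>h. 0 < h \<and> h < d -->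
   \<bar>ig x (x + h) f / h - f x\<bar> < e))"
 proof (rule integrable_ccontinuous_explicit)
  fix Z
  assume "negligible Z" and
   "\<And>x e. \<lbrakk>x \<notin> Z; 0 < e\<rbrakk> \<Longrightarrow> \<exists>d>0. \<forall>h. 0 < h \<and> h < d -->
    norm (integral (cbox x (x + h *R One)) f /R h ^ DIM(real) - f x) < e"
  then show ?thesis
   by (intro exI[of _ Z]) (simp add: divide_inverse mult.commute)
 qed
 then obtain Z where Z: "negligible Z" and
  *: "\<And>x e. x \<notin> Z ==> 0 < e ==> \<exists>d>0. \<forall>h. 0 < h \<and> h < d -->
    \<bar>ig x (x + h) f / h - f x\<bar> < e"
  by auto
 show ?thesis
 proof (rule that[OF Z])
  fix x assume x: "x \<in> {0<..<L} - Z"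
  have "((%h. ig x (x + h) f / h) ---> f x) (at_right 0)"
  proof (rule tendstoI)
   fix e :: real assume "e > 0"
   then show "\<forall>\<^sub>F h in at_right 0. dist (ig x (x + h) f / h) (f x) < e"
    unfolding eventually_at_right_field using *[of x e] x by (auto simp: dist_real_def)
  qed
  moreover have "\<forall>\<^sub>F h in at_right 0. ig x (x + h) f / h = ig x (x + h) u / h"
   unfolding eventually_at_right_field
  proof (intro exI[of _ "L - x"] conjI allI impI)
   fix h assume h: "0 < h" "h < L - x"
   have "ig x (x + h) f = ig x (x + h) u"
    using h x by (intro integral_cong) (auto simp: f_def)
   then show "ig x (x + h) f / h = ig x (x + h) u / h" by simp
  qed (use x in auto)
  ultimately have "((%h. ig x (x + h) u / h) ---> f x) (at_right 0)"
   by (rule Lim_transform_eventually)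
  then show "((%h. ig x (x + h) u / h) ---> u x) (at_right 0)"
   using x by (simp add: f_def)
 qed
qed

text \<open>Bumps converge to indicators, so the integral of \<open>w\<close> over every inner
  window vanishes; then so do its right averages, which converge to \<open>w\<close> almost
  everywhere.\<close>

lemma AE_zero_of_test_integrals:
 assumes w: "intable 0 L w"
  and zero: "\<And>phi. test_fun L phi ==> lint 0 L (%x. w x * phi x) = 0"
 shows "AE x in ivl 0 L. w x = 0"
proof -
 have 0: "ig s (s + h) w = 0" if sh: "0 < s" "0 < h" "s + h < L" for s h
 proof -
  have "indicat_real {s<..<s + h} \<in> meas 0 L"
   by (intro measurable_restrict_space1 borel_measurable_indicator) auto
  then have im: "(%x. w x * indicator {s<..<s + h} x) \<in> meas 0 L"
   using borel_measurable_integrable[OF w] by (intro borel_measurable_times)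
  have "(%k. lint 0 L (%x. w x * bump k s (s + h) x)) ---->
    lint 0 L (%x. w x * indicator {s<..<s + h} x)"
  proof (rule integral_dominated_convergence[where w = "%x. \<bar>w x\<bar>"])
   show "AE x in ivl 0 L. (%k. w x * bump k s (s + h) x) ----> w x * indicator {s<..<s + h} x"
    by (intro AE_I2 tendsto_intros bump_tendsto)
   show "AE x in ivl 0 L. norm (w x * bump k s (s + h) x) \<le> \<bar>w x\<bar>" for k
    using bump_bounds by (intro AE_I2) (auto simp: abs_mult intro: mult_left_le)
   show "(%x. w x * bump k s (s + h) x) \<in> meas 0 L" for k
    by (rule borel_measurable_times[OF borel_measurable_integrable[OF w]
       continuous_imp_measurable_on_sets_lebesgue[OF smooth_continuous_on[OF smooth_bump]]]) simp
   show "(%x. w x * indicator {s<..<s + h} x) \<in> meas 0 L"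
    by (rule im)
  qed (use w in auto)
  then have "lint 0 L (%x. w x * indicator {s<..<s + h} x) = 0"
   using zero test_fun_bump sh by (simp add: LIMSEQ_const_iff)
  also have "lint 0 L (%x. w x * indicator {s<..<s + h} x) =
    ig 0 L (%x. w x * indicator {s<..<s + h} x)"
  proof (intro ivl_eq Bochner_Integration.integrable_bound[OF integrable_abs[OF w]])
   show "(%x. w x * indicator {s<..<s + h} x) \<in> meas 0 L"
    by (rule im)
  qed (auto split: split_indicator)
  also have "\<dots> = ig 0 L (%x. if x \<in> {s..s + h} then w x else 0)"
   by (rule integral_spike[of "{s, s + h}"]) (auto split: split_indicator)
  also have "\<dots> = ig s (s + h) w"
   by (rule ivl_restrict) (use sh in auto)
  finally show ?thesis .
 qed
 obtain Z where Z: "negligible Z"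
  "\<And>x. x \<in> {0<..<L} - Z ==> ((%h. ig x (x + h) w / h) ---> w x) (at_right 0)"
  using right_averages_tendsto_AE[OF w] by blast
 show ?thesis
 proof (rule AE_ivlI[of "insert 0 (insert L Z)"])
  fix x assume "x \<in> {0..L}" "x \<notin> insert 0 (insert L Z)"
  then have x: "x \<in> {0<..<L} - Z" by auto
  have "\<forall>\<^sub>F h in at_right 0. ig x (x + h) w / h = 0"
   unfolding eventually_at_right_field using x 0 by (intro exI[of _ "L - x"]) auto
  then have "((%h. ig x (x + h) w / h) ---> 0) (at_right 0)"
   by (simp add: tendsto_eventually)
  then show "w x = 0"
   using Z(2)[OF x] tendsto_unique trivial_limit_at_right_real by blast
 qed (use Z in auto)
qed

lemma weak_deriv_AE_unique:
 assumes "weak_deriv L u v" "weak_deriv L u w" "intable 0 L v" "intable 0 L w"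
 shows "AE x in ivl 0 L. v x = w x"
proof -
 have "AE x in ivl 0 L. v x - w x = 0"
 proof (rule AE_zero_of_test_integrals)
  fix phi assume phi: "test_fun L phi"
  have "smooth phi" using phi by (simp add: test_fun_def smooth_def)
  then have "continuous_on {0..L} phi" by (rule smooth_continuous_on)
  then have "intable 0 L (%x. f x * phi x)" if "intable 0 L f" for f
  proof -
   have "bounded (phi ` {0..L})"
    by (intro compact_imp_bounded compact_continuous_image \<open>continuous_on {0..L} phi\<close>) auto
   then obtain B where B: "\<And>x. x \<in> {0..L} ==> \<bar>phi x\<bar> \<le> B"
    unfolding bounded_iff by (metis imageI real_norm_def)
   show ?thesis
   proof (rule Bochner_Integration.integrable_bound[of _ "%x. B * \<bar>f x\<bar>"])
    show "AE x in ivl 0 L. norm (f x * phi x) \<le> norm (B * \<bar>f x\<bar>)"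
   proof (rule AE_ivl_all)
    fix x assume "x \<in> {0..L}"
    then have "\<bar>f x\<bar> * \<bar>phi x\<bar> \<le> \<bar>f x\<bar> * \<bar>B\<bar>" by (intro mult_left_mono order_trans[OF B abs_ge_self]) auto
    then show "norm (f x * phi x) \<le> norm (B * \<bar>f x\<bar>)" by (simp add: abs_mult mult.commute)
   qed
    show "(%x. f x * phi x) \<in> meas 0 L"
     by (rule borel_measurable_times[OF borel_measurable_integrable[OF that]
        continuous_imp_measurable_on_sets_lebesgue[OF \<open>continuous_on {0..L} phi\<close>]]) simp
   qed (use that in auto)
  qed
  then have "lint 0 L (%x. (v x - w x) * phi x) =
    lint 0 L (%x. v x * phi x) - lint 0 L (%x. w x * phi x)"
   using assms by (simp add: left_diff_distrib)
  then show "lint 0 L (%x. (v x - w x) * phi x) = 0"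
   using assms(1,2) phi unfolding weak_deriv_def by auto
 qed (use assms in auto)
 then show ?thesis by eventually_elim simp
qed

lemma tendsto_ivl_dominated:
 fixes f :: "nat => real => real"
 assumes f: "\<And>n. intable a b (f n)" and w: "intable a b w"
  and lim: "AE x in ivl a b. (%n. f n x) ----> g x"
  and bound: "\<And>n. AE x in ivl a b. \<bar>f n x\<bar> \<le> w x"
  and g: "g \<in> meas a b"
 shows "intable a b g" "(%n. ig a b (f n)) ----> ig a b g"
proof -
 have "intable a b g" "(%n. lint a b (f n)) ----> lint a b g"
  using integrable_dominated_convergence[where f = g and s = f and w = w and M = "ivl a b"]
   integral_dominated_convergence[where f = g and s = f and w = w and M = "ivl a b"] assms
  by auto
 then show "intable a b g" "(%n. ig a b (f n)) ----> ig a b g"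
  using f by (simp_all add: ivl_eq)
qed

lemma integrable_ivl_mult_bounded:
 assumes f: "intable a b f" and g: "g \<in> meas a b"
  and B: "AE x in ivl a b. \<bar>g x\<bar> \<le> B"
 shows "intable a b (%x. f x * g x)"
proof (rule Bochner_Integration.integrable_bound[of _ "%x. B * \<bar>f x\<bar>"])
 show "AE x in ivl a b. norm (f x * g x) \<le> norm (B * \<bar>f x\<bar>)"
  using B
 proof eventually_elim
  case (elim x)
  then have "\<bar>f x\<bar> * \<bar>g x\<bar> \<le> \<bar>f x\<bar> * B" "0 \<le> B"
   by (auto intro: mult_left_mono)
  then show ?case by (simp add: abs_mult mult.commute)
 qed
qed (use f g in auto)

lemma integrable_ivl_mult_cont:
 assumes f: "intable a b f" and g: "continuous_on {a..b} g"
 shows "intable a b (%x. f x * g x)"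
proof -
 have "bounded (g ` {a..b})"
  by (intro compact_imp_bounded compact_continuous_image g) auto
 then obtain B where B: "\<And>x. x \<in> {a..b} ==> \<bar>g x\<bar> \<le> B"
  unfolding bounded_iff by (metis imageI real_norm_def)
 show ?thesis
  by (rule integrable_ivl_mult_bounded[OF f _ AE_ivl_all[OF B]])
    (auto intro: continuous_imp_measurable_on_sets_lebesgue g)
qed

text \<open>Completeness of Lebesgue measure, used on the whole line through the extension by
  zero.\<close>

lemma ivl_meas_cong_AE:
 fixes f :: "real => real"
 assumes "f \<in> meas a b" "AE x in ivl a b. f x = g x"
 shows "g \<in> meas a b"
proof -
 have S: "{a..b} \<in> sets lebesgue" by simp
 have "(%x. if x \<in> {a..b} then f x else 0) \<in> borel_measurable lebesgue"
  using assms(1) borel_measurable_if[OF S] by blast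
 moreover have "AE x in lebesgue. x \<in> {a..b} --> f x = g x"
  using assms(2) AE_restrict_space_iff[of "{a..b}" lebesgue] by simp
 then have "AE x in lebesgue. (if x \<in> {a..b} then f x else 0) = (if x \<in> {a..b} then g x else 0)"
  by eventually_elim auto
 ultimately have "(%x. if x \<in> {a..b} then g x else 0) \<in> borel_measurable lebesgue"
  by (rule borel_measurable_AE)
 then show ?thesis
  using borel_measurable_if[OF S] by blast
qed

lemma ivl_meas_lim_AE:
 fixes f :: "nat => real => real"
 assumes f: "\<And>n. f n \<in> meas a b"
  and lim: "AE x in ivl a b. (%n. f n x) ----> g x"
 shows "g \<in> meas a b"
proof -
 obtain Z where Z: "negligible Z" "\<And>x. x \<in> {a..b} - Z ==> (%n. f n x) ----> g x"
  using lim unfolding AE_ivl_iff by blast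
 have m: "(%x. if x \<in> Z then 0 else f n x) \<in> meas a b" for n
  by (rule ivl_meas_cong_AE[OF f[of n]], rule AE_ivlI[OF Z(1)]) auto
 have "(%x. if x \<in> Z then 0 else g x) \<in> meas a b"
  by (rule borel_measurable_LIMSEQ_real[where u = "%n x. if x \<in> Z then 0 else f n x"])
    (use Z m in auto)
 then show ?thesis
  by (rule ivl_meas_cong_AE, intro AE_ivlI[OF Z(1)]) auto
qed

lemma weak_derivD:
 assumes "weak_deriv L u v" "test_fun L phi" "intable 0 L u" "intable 0 L v"
 shows "ig 0 L (%x. u x * deriv phi x) = - ig 0 L (%x. v x * phi x)"
proof -
 have "smooth phi" using assms by (simp add: test_fun_def smooth_def)
 then have "intable 0 L (%x. u x * deriv phi x)" "intable 0 L (%x. v x * phi x)"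
  using assms by (auto intro!: integrable_ivl_mult_cont smooth_continuous_on smooth_deriv)
 moreover have "lint 0 L (%x. u x * deriv phi x) =
   - lint 0 L (%x. v x * phi x)"
  using assms(1,2) unfolding weak_deriv_def by blast
 ultimately show ?thesis
  by (simp only: ivl_eq)
qed

lemma integrable_ivl_cong_AE:
 assumes "intable a b f" "AE x in ivl a b. f x = g x"
 shows "intable a b g"
proof -
 have "g absolutely_integrable_on {a..b}" if "f absolutely_integrable_on {a..b}"
  using assms(2) that unfolding AE_ivl_iff by (metis absolutely_integrable_spike)
 moreover have "intable a b f \<longleftrightarrow> f absolutely_integrable_on {a..b}" for f :: "real => real"
  by (simp add: set_integrable_def integrable_restrict_space)
 ultimately show ?thesis using assms by blast
qed

text \<open>The primitive of the indicator of a window of length \<open>h\<close> starting at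
  \<open>s\<close>.\<close>

definition ramp :: "real => real => real => real" where
 "ramp s h x = max 0 (min h (x - s))"

text \<open>The test function is the primitive of a weighted difference of two bumps, one on each
  window. In the limit the bumps become indicators, the test function becomes
  \<open>h * (ramp s h x - ramp t h x)\<close>, and the common factor \<open>h\<close>
  cancels.\<close>

lemma weak_deriv_averages:
 assumes wd: "weak_deriv L u v" and u: "intable 0 L u" and v: "intable 0 L v"
  and st: "0 < s" "s < t" "t + h < L" "0 < h"
 shows "ig s (s + h) u - ig t (t + h) u =
  - ig 0 L (%x. v x * (ramp s h x - ramp t h x))"
proof -
 define b where "b k r = bump k r (r + h)" for k r
 define c where "c k r = ig 0 L (b k r)" for k r
 \<comment> \<open>Each bump is weighted with the mass of the other one. The mean is then exactly
   zero for every \<open>k\<close>, not only in the limit, as compact support of the primitive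
   requires.\<close>
 define psi where "psi k x = c k t * b k s x + - c k s * b k t x" for k x
 define phi where "phi k x = ig 0 x (psi k)" for k x
 have rL: "0 < r" "r + h < L" if "r = s \<or> r = t" for r
  using that st by auto
 have cb: "continuous_on S (b k r)" for S k r
  unfolding b_def by (intro smooth_continuous_on smooth_bump)
 have bb: "\<bar>b k r x\<bar> \<le> 1" for k r x
  using bump_bounds[of k r "r + h" x] by (simp add: b_def)
 have I1: "ig 0 x (%x. 1::real) = max 0 x" for x
  by (cases "0 \<le> x") auto
 have ind: "ig 0 x (indicat_real {r<..<r + h}) = ramp r h x" if "0 < r" for r x
 proof -
  have "{r<..<r + h} \<inter> {0..x} \<in> lmeasurable"
   by (rule bounded_set_imp_lmeasurable) (auto intro: bounded_Int)
  then have "ig 0 x (indicat_real {r<..<r + h}) = measure lebesgue ({r<..<r + h} \<inter> {0..x})"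
   by (rule Equivalence_Lebesgue_Henstock_Integration.integral_indicator)
  also have "{r<..<r + h} \<inter> {0..x} = (if x < r + h then {r<..x} else {r<..<r + h})"
   using that by auto
  also have "measure lebesgue \<dots> = ramp r h x"
   using st by (cases "r \<le> x") (auto simp: ramp_def)
  finally show ?thesis .
 qed
 have clim: "(%k. ig 0 x (b k r)) ----> ramp r h x" if "0 < r" for r x
 proof -
  have "(%k. ig 0 x (b k r)) ----> ig 0 x (indicat_real {r<..<r + h})"
  proof (rule tendsto_ivl_dominated(2)[where w = "%_. 1"])
   show "AE x in ivl 0 x. (%k. b k r x) ----> indicat_real {r<..<r + h} x"
    unfolding b_def by (intro AE_I2 bump_tendsto)
   show "indicat_real {r<..<r + h} \<in> meas 0 x"
    by (intro measurable_restrict_space1 borel_measurable_indicator) auto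
  qed (use cb bb in \<open>auto intro!: ivl_cont\<close>)
  then show ?thesis using ind[OF that] by simp
 qed
 have cl: "(%k. c k r) ----> h" if "r = s \<or> r = t" for r
  using clim[OF rL(1)[OF that], of L] rL[OF that] st by (simp add: c_def ramp_def)
 have cbnd: "\<bar>ig 0 x (b k r)\<bar> \<le> L" if "x \<in> {0..L}" for k r x
 proof -
  have "\<bar>ig 0 x (b k r)\<bar> \<le> ig 0 x (%x. 1)"
   using bb by (intro ivl_abs_le ivl_cont cb AE_I2) auto
  then show ?thesis using that I1 by simp
 qed
 have cbnd': "\<bar>c k r\<bar> \<le> L" for k r
  unfolding c_def using cbnd[of L] st by simp
 have phieq: "phi k x = c k t * ig 0 x (b k s) - c k s * ig 0 x (b k t)" for k x
  unfolding phi_def psi_def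
  by (subst Henstock_Kurzweil_Integration.integral_add)
    (auto intro!: ivl_integrable_on ivl_cont continuous_intros cb)
 have tf: "test_fun L (phi k)" "deriv (phi k) = psi k" for k
 proof -
  have "smooth (psi k)" unfolding psi_def b_def by (rule smooth_bump_diff)
  moreover have "psi k x = 0" if "x \<notin> {s<..<t + h}" for x
   using that st by (auto simp: psi_def b_def bump_zero)
  moreover have "ig 0 L (psi k) = 0"
   using phieq[of k L] by (simp add: phi_def c_def)
  ultimately show "test_fun L (phi k)" "deriv (phi k) = psi k"
   unfolding phi_def using primitive_test_fun[of "psi k" s "t + h" L] st by auto
 qed
 have meas: "(%x. f x * indicat_real {r<..<r'} x) \<in> meas 0 L"
  if "intable 0 L f" for f r r'
 proof -
  have "indicat_real {r<..<r'} \<in> meas 0 L"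
   by (intro measurable_restrict_space1 borel_measurable_indicator) auto
  then show ?thesis
   using borel_measurable_integrable[OF that] by (intro borel_measurable_times)
 qed
 have u1: "(%k. ig 0 L (%x. u x * b k r x)) ----> ig 0 L (%x. u x * indicat_real {r<..<r + h} x)" for r
 proof (rule tendsto_ivl_dominated(2)[where w = "%x. \<bar>u x\<bar>"])
  show "AE x in ivl 0 L. (%k. u x * b k r x) ----> u x * indicator {r<..<r + h} x"
   unfolding b_def by (intro AE_I2 tendsto_intros bump_tendsto)
  show "AE x in ivl 0 L. \<bar>u x * b k r x\<bar> \<le> \<bar>u x\<bar>" for k
   using bb by (intro AE_I2) (auto simp: abs_mult intro: mult_left_le)
 qed (use u meas in \<open>auto intro!: integrable_ivl_mult_cont cb\<close>)
 have u2: "ig 0 L (%x. u x * indicat_real {r<..<r + h} x) = ig r (r + h) u"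
  if "r = s \<or> r = t" for r
 proof -
  have "ig 0 L (%x. u x * indicat_real {r<..<r + h} x) =
    ig 0 L (%x. if x \<in> {r..r + h} then u x else 0)"
   by (rule integral_spike[of "{r, r + h}"]) (auto split: split_indicator)
  also have "\<dots> = ig r (r + h) u"
   by (rule ivl_restrict) (use rL[OF that] in auto)
  finally show ?thesis .
 qed
 have ulim: "(%k. ig 0 L (%x. u x * b k r x)) ----> ig r (r + h) u"
  if "r = s \<or> r = t" for r using u1[of r] u2[OF that] by simp
 have "(%k. c k t * ig 0 L (%x. u x * b k s x) - c k s * ig 0 L (%x. u x * b k t x))
   ----> h * ig s (s + h) u - h * ig t (t + h) u"
  by (intro tendsto_intros cl ulim) auto
 moreover have "c k t * ig 0 L (%x. u x * b k s x) - c k s * ig 0 L (%x. u x * b k t x)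
   = ig 0 L (%x. u x * deriv (phi k) x)" for k
 proof -
  have "(%x. u x * deriv (phi k) x) = (%x. c k t * (u x * b k s x) - c k s * (u x * b k t x))"
   by (simp add: tf psi_def algebra_simps)
  moreover have "intable 0 L (%x. c k t * (u x * b k s x))" "intable 0 L (%x. c k s * (u x * b k t x))"
   by (intro integrable_mult_right integrable_ivl_mult_cont u cb)+
  ultimately show ?thesis
   by (simp only: Henstock_Kurzweil_Integration.integral_diff ivl_integrable_on
     Henstock_Kurzweil_Integration.integral_mult_right)
 qed
 ultimately have "(%k. ig 0 L (%x. u x * deriv (phi k) x))
   ----> h * ig s (s + h) u - h * ig t (t + h) u" by simp
 moreover have "ig 0 L (%x. u x * deriv (phi k) x) = - ig 0 L (%x. v x * phi k x)" for k
  by (rule weak_derivD[OF wd tf(1) u v])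
 moreover have "(%k. - ig 0 L (%x. v x * phi k x)) ---->
   - ig 0 L (%x. v x * (h * (ramp s h x - ramp t h x)))"
 proof (intro tendsto_minus tendsto_ivl_dominated(2)[where w = "%x. 2 * L * L * \<bar>v x\<bar>"])
  show "intable 0 L (%x. v x * phi k x)" for k
   using tf(1)[of k] by (intro integrable_ivl_mult_cont v smooth_continuous_on)
    (auto simp: test_fun_def smooth_def)
  show "AE x in ivl 0 L. (%k. v x * phi k x) ----> v x * (h * (ramp s h x - ramp t h x))"
  proof (rule AE_I2)
   fix x
   have "(%k. v x * (c k t * ig 0 x (b k s) - c k s * ig 0 x (b k t)))
     ----> v x * (h * ramp s h x - h * ramp t h x)"
    using st by (intro tendsto_intros cl clim) auto
   then show "(%k. v x * phi k x) ----> v x * (h * (ramp s h x - ramp t h x))"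
    by (simp add: phieq right_diff_distrib)
  qed
  show "AE x in ivl 0 L. \<bar>v x * phi k x\<bar> \<le> 2 * L * L * \<bar>v x\<bar>" for k
  proof (rule AE_ivl_all)
   fix x assume x: "x \<in> {0..L}"
   have "\<bar>c k t * ig 0 x (b k s)\<bar> \<le> L * L" "\<bar>c k s * ig 0 x (b k t)\<bar> \<le> L * L"
    unfolding abs_mult using cbnd[OF x] cbnd' by (auto intro!: mult_mono' order_trans[OF abs_ge_zero])
   then have "\<bar>phi k x\<bar> \<le> 2 * L * L"
    unfolding phieq by linarith
   then have "\<bar>v x\<bar> * \<bar>phi k x\<bar> \<le> \<bar>v x\<bar> * (2 * L * L)"
    by (intro mult_left_mono) auto
   then show "\<bar>v x * phi k x\<bar> \<le> 2 * L * L * \<bar>v x\<bar>"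
    by (simp add: abs_mult mult.commute)
  qed
  show "(%x. v x * (h * (ramp s h x - ramp t h x))) \<in> meas 0 L"
   by (intro borel_measurable_integrable integrable_ivl_mult_cont v)
     (auto simp: ramp_def intro!: continuous_intros)
 qed (use v in auto)
 ultimately have "h * ig s (s + h) u - h * ig t (t + h) u =
   - ig 0 L (%x. v x * (h * (ramp s h x - ramp t h x)))"
  using LIMSEQ_unique by auto
 also have "(%x. v x * (h * (ramp s h x - ramp t h x))) = (%x. h * (v x * (ramp s h x - ramp t h x)))"
  by (simp add: algebra_simps)
 finally have main: "h * ig s (s + h) u - h * ig t (t + h) u =
   - (h * ig 0 L (%x. v x * (ramp s h x - ramp t h x)))"
  by (simp only: Henstock_Kurzweil_Integration.integral_mult_right)
 have *: "h * A - h * B = - (h * C) ==> A - B = - C" for A B C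
 proof -
  assume "h * A - h * B = - (h * C)"
  then have "h * (A - B) = h * (- C)" by (simp add: algebra_simps)
  then show "A - B = - C" using st by (metis mult_left_cancel less_irrefl)
 qed
 show ?thesis by (rule *[OF main])
qed

text \<open>As the windows shrink, the averages of \<open>u\<close> tend to its values at Lebesgue
  points, and the ramps divided by their height tend to indicators of half-lines, whose difference
  is the indicator of the interval between \<open>s\<close> and \<open>t\<close>.\<close>

lemma weak_deriv_AE_primitive:
 assumes wd: "weak_deriv L u v" and u: "intable 0 L u" and v: "intable 0 L v"
 obtains Z where "negligible Z"
  "\<And>s t. s \<in> {0..L} - Z ==> t \<in> {0..L} - Z ==> s \<le> t ==> u t - u s = ig s t v"
proof -
 obtain Z where Z: "negligible Z"
  "\<And>x. x \<in> {0<..<L} - Z ==> ((%h. ig x (x + h) u / h) ---> u x) (at_right 0)"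
  using right_averages_tendsto_AE[OF u] by blast
 show ?thesis
 proof (rule that[of "insert 0 (insert L Z)"])
  fix s t assume "s \<in> {0..L} - insert 0 (insert L Z)" "t \<in> {0..L} - insert 0 (insert L Z)" "s \<le> t"
  then have st: "s \<in> {0<..<L} - Z" "t \<in> {0<..<L} - Z" "s \<le> t" by auto
  show "u t - u s = ig s t v"
  proof (cases "s = t")
   case False
   \<comment> \<open>The denominator is greater than 1 already for \<open>n = 0\<close>, so every
     window lies strictly inside the interval.\<close>
   define d where "d n = (L - t) / (real n + 2)" for n
   have d: "0 < d n" "t + d n < L" for n
   proof -
    have "(L - t) / (real n + 2) < (L - t) / 1"
     using st by (intro divide_strict_left_mono) auto
    then show "0 < d n" "t + d n < L"
     using st by (auto simp: d_def)
   qed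
   have d0: "d ----> 0"
    unfolding d_def by real_asymp
   have dr: "filterlim d (at_right 0) sequentially"
    using d0 d by (intro tendsto_imp_filterlim_at_right) auto
   have av: "(%n. ig x (x + d n) u / d n) ----> u x" if "x \<in> {0<..<L} - Z" for x
    using filterlim_compose[OF Z(2)[OF that] dr] .
   have "(%n. ig s (s + d n) u / d n - ig t (t + d n) u / d n) ----> u s - u t"
    using st by (intro tendsto_diff av) auto
   moreover have "ig s (s + d n) u / d n - ig t (t + d n) u / d n =
     - ig 0 L (%x. v x * ((ramp s (d n) x - ramp t (d n) x) / d n))" for n
   proof -
    have "ig s (s + d n) u - ig t (t + d n) u =
      - ig 0 L (%x. v x * (ramp s (d n) x - ramp t (d n) x))"
     using st False d by (intro weak_deriv_averages[OF wd u v]) auto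
    then show ?thesis
     by (simp flip: diff_divide_distrib)
   qed
   moreover have "(%n. - ig 0 L (%x. v x * ((ramp s (d n) x - ramp t (d n) x) / d n))) ---->
     - ig 0 L (%x. v x * indicat_real {s<..t} x)"
   proof (intro tendsto_minus tendsto_ivl_dominated(2)[where w = "%x. \<bar>v x\<bar>"])
    show "intable 0 L (%x. v x * ((ramp s (d n) x - ramp t (d n) x) / d n))" for n
     using d(1)[of n] by (intro integrable_ivl_mult_cont v) (auto simp: ramp_def intro!: continuous_intros)
    have rl: "(%n. ramp r (d n) x / d n) ----> indicat_real {r<..} x" for r x
    proof (cases "r < x")
     case True
     have "\<forall>\<^sub>F n in sequentially. d n < x - r"
      using d0 True by (intro order_tendstoD) auto
     then have "\<forall>\<^sub>F n in sequentially. ramp r (d n) x / d n = 1"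
     proof eventually_elim
      case (elim n)
      then show ?case using d(1)[of n] by (simp add: ramp_def)
     qed
     then show ?thesis using True by (simp add: tendsto_eventually)
    next
     case False
     then have "ramp r (d n) x = 0" for n
      using d(1)[of n] by (simp add: ramp_def)
     then show ?thesis using False by simp
    qed
    show "AE x in ivl 0 L. (%n. v x * ((ramp s (d n) x - ramp t (d n) x) / d n)) ----> v x * indicat_real {s<..t} x"
    proof (rule AE_I2)
     fix x
     have "(%n. v x * (ramp s (d n) x / d n - ramp t (d n) x / d n)) ----> v x * (indicat_real {s<..} x - indicat_real {t<..} x)"
      by (intro tendsto_intros rl)
     then show "(%n. v x * ((ramp s (d n) x - ramp t (d n) x) / d n)) ----> v x * indicat_real {s<..t} x"
      using st by (simp add: diff_divide_distrib split: split_indicator split_indicator_asm)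
    qed
    show "AE x in ivl 0 L. \<bar>v x * ((ramp s (d n) x - ramp t (d n) x) / d n)\<bar> \<le> \<bar>v x\<bar>" for n
    proof (rule AE_I2)
     fix x
     have "\<bar>(ramp s (d n) x - ramp t (d n) x) / d n\<bar> \<le> 1"
      using d(1)[of n] by (auto simp: ramp_def field_simps abs_le_iff)
     then show "\<bar>v x * ((ramp s (d n) x - ramp t (d n) x) / d n)\<bar> \<le> \<bar>v x\<bar>"
      unfolding abs_mult by (intro mult_left_le) auto
    qed
    have "indicat_real {s<..t} \<in> meas 0 L"
     by (intro measurable_restrict_space1 borel_measurable_indicator) auto
    then show "(%x. v x * indicat_real {s<..t} x) \<in> meas 0 L"
     using borel_measurable_integrable[OF v] by (intro borel_measurable_times)
   qed (use v in auto)
   ultimately have "u s - u t = - ig 0 L (%x. v x * indicat_real {s<..t} x)"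
    using LIMSEQ_unique by auto
   also have "ig 0 L (%x. v x * indicat_real {s<..t} x) =
     ig 0 L (%x. if x \<in> {s..t} then v x else 0)"
    by (rule integral_spike[of "{s}"]) (auto split: split_indicator)
   also have "\<dots> = ig s t v"
    by (rule ivl_restrict) (use st in auto)
   finally show ?thesis by simp
  qed simp
 qed (use Z in auto)
qed

text \<open>A null set contains no open interval, so its complement is dense; identities valid
  almost everywhere thus extend by continuity.\<close>

lemma closure_ivl_minus_negligible:
 assumes "negligible Z" "a < b"
 shows "closure ({a..b::real} - Z) = {a..b}"
proof
 show "closure ({a..b} - Z) \<subseteq> {a..b}"
  by (rule closure_minimal) auto
 show "{a..b} \<subseteq> closure ({a..b} - Z)"
 proof
  fix x assume x: "x \<in> {a..b}"
  show "x \<in> closure ({a..b} - Z)"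
   unfolding closure_approachable
  proof (intro allI impI)
   fix e :: real assume e: "e > 0"
   define l where "l = max a (x - e / 2)"
   define r where "r = min b (x + e / 2)"
   have "l < r" using x e assms by (auto simp: l_def r_def)
   then have "\<not> negligible {l<..<r}"
    using negligible_interval(2)[of l r] by (simp add: box_real)
   then have "\<not> {l<..<r} \<subseteq> Z"
    using assms negligible_subset by blast
   then obtain y where y: "y \<in> {l<..<r}" "y \<notin> Z" by blast
   then show "\<exists>y\<in>{a..b} - Z. dist y x < e"
    using e by (intro bexI[of _ y]) (auto simp: l_def r_def dist_real_def)
  qed
 qed
qed

text \<open>The difference \<open>F\<close> of \<open>u\<close> and the primitive of
  \<open>v\<close> is continuous, and constant on a dense set by the version with a null
  set.\<close>

lemma weak_deriv_primitive:
 assumes wd: "weak_deriv L u v" and u: "continuous_on {0..L} u" and v: "intable 0 L v"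
  and st: "0 \<le> s" "s \<le> t" "t \<le> L"
 shows "u t - u s = ig s t v"
proof (cases "L > 0")
 case True
 obtain Z where Z: "negligible Z"
  "\<And>s t. s \<in> {0..L} - Z ==> t \<in> {0..L} - Z ==> s \<le> t ==> u t - u s = ig s t v"
  using weak_deriv_AE_primitive[OF wd ivl_cont[OF u] v] by blast
 define F where "F x = u x - ig 0 x v" for x
 have cl: "closure ({0..L} - Z) = {0..L}"
  using closure_ivl_minus_negligible[OF Z(1) True] .
 then obtain c where c: "c \<in> {0..L} - Z"
  using True by (metis atLeastAtMost_iff closure_empty equals0I less_eq_real_def)
 have comb: "ig 0 a v + ig a b v = ig 0 b v" if "0 \<le> a" "a \<le> b" "b \<le> L" for a b
  using that by (intro ivl_combine ivl_sub[OF v]) auto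
 have F: "F x = F c" if x: "x \<in> {0..L}" for x
 proof (rule continuous_constant_on_closure[of "{0..L} - Z" F "F c" x])
  show "continuous_on (closure ({0..L} - Z)) F"
   unfolding cl F_def by (intro continuous_intros u indefinite_integral_continuous_1 ivl_integrable_on v)
  fix y assume y: "y \<in> {0..L} - Z"
  show "F y = F c"
  proof (cases "y \<le> c")
   case True
   then show ?thesis using Z(2)[OF y c] comb[of y c] y c by (auto simp: F_def)
  next
   case False
   then show ?thesis using Z(2)[OF c y] comb[of c y] y c by (auto simp: F_def)
  qed
 qed (use x cl in auto)
 have "F t = F s" using F[of t] F[of s] st by auto
 then show ?thesis using comb[of s t] st by (auto simp: F_def)
next
 case False
 then have "s = t" using st by linarith
 then show ?thesis by simp
qed

section \<open>Functions of time with values in a space with semi-inner product\<close>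

lemma ivl_add:
 "intable a b f ==> intable a b g ==>
  ig a b (%x. f x + g x) = ig a b f + ig a b g"
 by (intro Henstock_Kurzweil_Integration.integral_add ivl_integrable_on)

lemma ivl_diff:
 "intable a b f ==> intable a b g ==>
  ig a b (%x. f x - g x) = ig a b f - ig a b g"
 by (intro Henstock_Kurzweil_Integration.integral_diff ivl_integrable_on)

text \<open>The form is only semi-definite: representatives at distance zero are not identified. The
  symmetry and linearity laws are demanded on the carrier only, since the integrals behind them may
  be meaningless elsewhere.\<close>

locale semi_inner =
 fixes X :: "'x::real_vector hspace"
 assumes subspace_carr: "subspace (carr X)"
  and inn_commute: "x \<in> carr X ==> y \<in> carr X ==> inn X x y = inn X y x"
  and inn_add_left: "x \<in> carr X ==> y \<in> carr X ==> z \<in> carr X ==> inn X (x + y) z = inn X x z + inn X y z"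
  and inn_scale_left: "x \<in> carr X ==> y \<in> carr X ==> inn X (c *R x) y = c * inn X x y"
  and inn_nonneg: "x \<in> carr X ==> 0 \<le> inn X x x"
begin

abbreviation nI :: "real => real => (real => 'x) => real" where "nI a b u \<equiv> ig a b (%t. (nrm X (u t))^2)"

lemma carr_zero [simp]: "0 \<in> carr X"
 and carr_add [simp]: "x \<in> carr X ==> y \<in> carr X ==> x + y \<in> carr X"
 and carr_diff [simp]: "x \<in> carr X ==> y \<in> carr X ==> x - y \<in> carr X"
 and carr_scale [simp]: "x \<in> carr X ==> c *R x \<in> carr X"
 and carr_minus [simp]: "x \<in> carr X ==> - x \<in> carr X"
 and carr_sum [simp]: "(\<And>i. i \<in> A ==> f i \<in> carr X) ==> sum f A \<in> carr X"
 using subspace_carr by (auto intro: subspace_0 subspace_add subspace_diff subspace_scale subspace_neg subspace_sum)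

lemma inn_add_right: "x \<in> carr X ==> y \<in> carr X ==> z \<in> carr X ==> inn X z (x + y) = inn X z x + inn X z y"
 by (simp add: inn_commute[of z] inn_add_left)

lemma inn_scale_right: "x \<in> carr X ==> y \<in> carr X ==> inn X y (c *R x) = c * inn X y x"
 by (simp add: inn_commute[of y] inn_scale_left)

lemma inn_minus_left: "x \<in> carr X ==> y \<in> carr X ==> inn X (- x) y = - inn X x y"
 using inn_scale_left[of x y "-1"] by simp

lemma inn_minus_right: "x \<in> carr X ==> y \<in> carr X ==> inn X y (- x) = - inn X y x"
 using inn_scale_right[of x y "-1"] by simp

lemma inn_diff_left: "x \<in> carr X ==> y \<in> carr X ==> z \<in> carr X ==> inn X (x - y) z = inn X x z - inn X y z"
 using inn_add_left[of x "- y" z] by (simp add: inn_minus_left)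

lemma inn_diff_right: "x \<in> carr X ==> y \<in> carr X ==> z \<in> carr X ==> inn X z (x - y) = inn X z x - inn X z y"
 using inn_add_right[of x "- y" z] by (simp add: inn_minus_right)

lemma inn_zero_left [simp]: "x \<in> carr X ==> inn X 0 x = 0"
 using inn_scale_left[of x x 0] by simp

lemma inn_zero_right [simp]: "x \<in> carr X ==> inn X x 0 = 0"
 using inn_scale_right[of x x 0] by simp

lemmas inn_simps = inn_add_left inn_add_right inn_diff_left inn_diff_right inn_scale_left inn_scale_right
 inn_minus_left inn_minus_right

lemma inn_sum_left:
 assumes "\<And>i. i \<in> A ==> f i \<in> carr X" "x \<in> carr X"
 shows "inn X (sum f A) x = (\<Sum>i\<in>A. inn X (f i) x)"
 using assms(1)
 by (induction A rule: infinite_finite_induct) (simp_all add: assms(2) inn_add_left)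

lemma nrm_sq: "x \<in> carr X ==> (nrm X x)^2 = inn X x x"
 by (simp add: nrm_def inn_nonneg)

lemma nrm_nonneg [simp]: "x \<in> carr X ==> 0 \<le> nrm X x"
 by (simp add: nrm_def inn_nonneg)

lemma nrm_zero [simp]: "nrm X 0 = 0"
 by (simp add: nrm_def)

lemma inn_le_nrm:
 assumes "x \<in> carr X" "y \<in> carr X"
 shows "inn X x y \<le> nrm X x * nrm X y"
 unfolding nrm_def
proof (rule nonneg_quadratic_bound)
 fix c :: real assume c: "0 < c"
 have "0 \<le> inn X (c *R x - y) (c *R x - y)"
  using assms by (intro inn_nonneg) simp
 also have "\<dots> = c * (c * inn X x x + inn X y y / c - 2 * inn X x y)"
  using assms c by (simp add: inn_simps inn_commute[of y x] algebra_simps)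
 finally show "2 * inn X x y \<le> c * inn X x x + inn X y y / c"
  using c by (simp add: zero_le_mult_iff)
qed (use assms inn_nonneg in auto)

lemma abs_inn_le:
 assumes "x \<in> carr X" "y \<in> carr X"
 shows "\<bar>inn X x y\<bar> \<le> nrm X x * nrm X y"
proof -
 have "nrm X (- x) = nrm X x"
  using assms by (simp add: nrm_def inn_simps)
 then show ?thesis
  using inn_le_nrm[OF assms] inn_le_nrm[of "- x" y] assms by (simp add: abs_le_iff inn_simps)
qed

lemma nrm_scale: "x \<in> carr X ==> nrm X (c *R x) = \<bar>c\<bar> * nrm X x"
 by (simp add: nrm_def inn_simps real_sqrt_mult mult.assoc[symmetric])

lemma nrm_triangle:
 assumes "x \<in> carr X" "y \<in> carr X"
 shows "nrm X (x + y) \<le> nrm X x + nrm X y"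
proof (rule power2_le_imp_le)
 have "(nrm X (x + y))^2 = (nrm X x)^2 + (nrm X y)^2 + 2 * inn X x y"
  using assms by (simp add: nrm_sq inn_simps inn_commute[of y x])
 also have "\<dots> \<le> (nrm X x + nrm X y)^2"
  using inn_le_nrm[OF assms] by (simp add: power2_sum)
 finally show "(nrm X (x + y))^2 \<le> (nrm X x + nrm X y)^2" .
qed (use assms in simp)

lemma nrm_minus: "x \<in> carr X ==> nrm X (- x) = nrm X x"
 by (simp add: nrm_def inn_simps)

lemma nrm_diff_commute: "x \<in> carr X ==> y \<in> carr X ==> nrm X (x - y) = nrm X (y - x)"
 using nrm_minus[of "x - y"] by simp

lemma nrm_diff_triangle:
 "x \<in> carr X ==> y \<in> carr X ==> z \<in> carr X ==> nrm X (x - z) \<le> nrm X (x - y) + nrm X (y - z)"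
 using nrm_triangle[of "x - y" "y - z"] by simp

lemma nrm_diff_le: "x \<in> carr X ==> y \<in> carr X ==> nrm X (x - y) \<le> nrm X x + nrm X y"
 using nrm_triangle[of x "- y"] by (simp add: nrm_minus)

lemma nrm_abs_diff_le:
 assumes "x \<in> carr X" "y \<in> carr X"
 shows "\<bar>nrm X x - nrm X y\<bar> \<le> nrm X (x - y)"
 using nrm_triangle[of "x - y" y] nrm_triangle[of "y - x" x] nrm_diff_commute[OF assms] assms
 by simp

lemma nrm_sum_le:
 assumes "\<And>i. i \<in> A ==> f i \<in> carr X"
 shows "nrm X (sum f A) \<le> (\<Sum>i\<in>A. nrm X (f i))"
 using assms
proof (induction A rule: infinite_finite_induct)
 case (insert i A)
 then have "nrm X (f i + sum f A) \<le> nrm X (f i) + nrm X (sum f A)"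
  by (intro nrm_triangle carr_sum) auto
 moreover have "nrm X (sum f A) \<le> (\<Sum>i\<in>A. nrm X (f i))"
  using insert by auto
 ultimately show ?case using insert.hyps by simp
qed simp_all

lemma nrm_eqI: "x \<in> carr X ==> y \<in> carr X ==> nrm X (x - y) = 0 ==> nrm X x = nrm X y"
 using nrm_abs_diff_le[of x y] by simp

lemma inn_eqI: "x \<in> carr X ==> y \<in> carr X ==> z \<in> carr X ==> nrm X (x - y) = 0 ==> inn X x z = inn X y z"
 using abs_inn_le[of "x - y" z] by (simp add: inn_simps)

section \<open>Continuous functions of time\<close>

lemma contT_carr: "contT X T u ==> t \<in> {0..T} ==> u t \<in> carr X"
 by (simp add: contT_def)

lemma contT_tendsto: "contT X T u ==> t \<in> {0..T} ==> ((%s. nrm X (u s - u t)) ---> 0) (at t within {0..T})"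
 by (simp add: contT_def)

lemma contTI_bound:
 assumes "\<And>t. t \<in> {0..T} ==> u t \<in> carr X"
  and "\<And>t. t \<in> {0..T} ==> (F t ---> 0) (at t within {0..T})"
  and "\<And>s t. s \<in> {0..T} ==> t \<in> {0..T} ==> nrm X (u s - u t) \<le> F t s"
 shows "contT X T u"
 unfolding contT_def
proof (intro ballI conjI)
 fix t assume t: "t \<in> {0..T}"
 show "u t \<in> carr X" using assms t by simp
 show "((%s. nrm X (u s - u t)) ---> 0) (at t within {0..T})"
  by (rule tendsto_sandwich[OF _ _ tendsto_const assms(2)[OF t]])
    (use assms t in \<open>auto simp: eventually_at_filter\<close>)
qed

lemma contT_add: 
 assumes u: "contT X T u" and v: "contT X T v"
 shows "contT X T (%t. u t + v t)"
proof (rule contTI_bound)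
 show "((%s. nrm X (u s - u t) + nrm X (v s - v t)) ---> 0) (at t within {0..T})" if "t \<in> {0..T}" for t
  using tendsto_add[OF contT_tendsto[OF u that] contT_tendsto[OF v that]] by simp
 show "nrm X (u s + v s - (u t + v t)) \<le> nrm X (u s - u t) + nrm X (v s - v t)"
  if "s \<in> {0..T}" "t \<in> {0..T}" for s t
  using nrm_triangle[of "u s - u t" "v s - v t"] contT_carr[OF u] contT_carr[OF v] that
  by (simp add: algebra_simps)
qed (use contT_carr u v in auto)

lemma contT_map:
 assumes u: "contT X T u" and P: "\<And>x. x \<in> carr X ==> P x \<in> carr X"
  "\<And>x y. x \<in> carr X ==> y \<in> carr X ==> nrm X (P x - P y) \<le> B * nrm X (x - y)"
 shows "contT X T (%t. P (u t))"
proof (rule contTI_bound)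
 show "((%s. B * nrm X (u s - u t)) ---> 0) (at t within {0..T})" if "t \<in> {0..T}" for t
  using tendsto_mult_left[OF contT_tendsto[OF u that], of B] by simp
qed (use contT_carr[OF u] P in auto)

lemma contT_scale: "contT X T u ==> contT X T (%t. c *R u t)"
 by (rule contT_map[where B = "\<bar>c\<bar>"]) (auto simp: scaleR_diff_right[symmetric] nrm_scale)

lemma contT_diff: "contT X T u ==> contT X T v ==> contT X T (%t. u t - v t)"
 using contT_add[of T u "%t. (-1) *R v t"] contT_scale[of T v "-1"] by simp

lemma contT_const: "w \<in> carr X ==> contT X T (%t. w)"
 by (simp add: contT_def)

lemma contT_scale_const:
 assumes "continuous_on {0..T} phi" "w \<in> carr X"
 shows "contT X T (%t. phi t *R w)"
proof (rule contTI_bound)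
 show "((%s. \<bar>phi s - phi t\<bar> * nrm X w) ---> 0) (at t within {0..T})" if "t \<in> {0..T}" for t
 proof -
  have "(phi ---> phi t) (at t within {0..T})"
   using assms that by (simp add: continuous_on_def)
  then have "((%s. \<bar>phi s - phi t\<bar> * nrm X w) ---> \<bar>phi t - phi t\<bar> * nrm X w) (at t within {0..T})"
   by (intro tendsto_intros)
  then show ?thesis by simp
 qed
qed (use assms in \<open>auto simp: scaleR_diff_left[symmetric] nrm_scale\<close>)

lemma contT_sum: "(\<And>i. i \<in> A ==> contT X T (u i)) ==> contT X T (%t. \<Sum>i\<in>A. u i t)"
 by (induction A rule: infinite_finite_induct) (auto intro: contT_add contT_const)

lemma contT_shift:
 assumes u: "contT X T u" and c: "0 \<le> c" "T' + c \<le> T"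
 shows "contT X T' (%t. u (t + c))"
 unfolding contT_def
proof (intro ballI conjI)
 fix t assume t: "t \<in> {0..T'}"
 then have tc: "t + c \<in> {0..T}" using c by auto
 show "u (t + c) \<in> carr X" using contT_carr[OF u tc] .
 have "((%s. s + c) ---> t + c) (at t within {0..T'})" by (intro tendsto_intros)
 moreover have "\<forall>\<^sub>F s in at t within {0..T'}. s + c \<in> {0..T} \<and> s + c \<noteq> t + c"
  using c by (auto simp: eventually_at_filter)
 ultimately have "filterlim (%s. s + c) (at (t + c) within {0..T}) (at t within {0..T'})"
  by (simp add: filterlim_at)
 then show "((%s. nrm X (u (s + c) - u (t + c))) ---> 0) (at t within {0..T'})"
  by (rule filterlim_compose[OF contT_tendsto[OF u tc]])
qed

lemma contT_sub: "contT X T u ==> T' \<le> T ==> contT X T' u"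
 using contT_shift[of T u 0 T'] by simp

text \<open>The intervals on which \<open>u\<close> stays within \<open>e / 2\<close> of its value
  at the centre cover \<open>{0..T}\<close>; a Lebesgue number of this cover serves as
  \<open>d\<close>.\<close>

lemma contT_uniform:
 assumes u: "contT X T u" and e: "e > 0"
 obtains d where "d > 0" "\<And>s t. s \<in> {0..T} ==> t \<in> {0..T} ==> \<bar>s - t\<bar> < d ==> nrm X (u s - u t) < e"
proof -
 have ex: "\<exists>d>0. \<forall>s\<in>{0..T}. \<bar>s - t\<bar> < d --> nrm X (u s - u t) < e / 2" if t: "t \<in> {0..T}" for t
 proof -
  have "\<forall>\<^sub>F s in at t within {0..T}. nrm X (u s - u t) < e / 2"
   using e by (intro order_tendstoD(2)[OF contT_tendsto[OF u t]]) simp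
  then obtain d where d: "d > 0" "\<And>s. s \<in> {0..T} ==> s \<noteq> t ==> dist s t < d ==> nrm X (u s - u t) < e / 2"
   unfolding eventually_at by blast
  have "nrm X (u s - u t) < e / 2" if "s \<in> {0..T}" "\<bar>s - t\<bar> < d" for s
   using d(2)[of s] that e by (cases "s = t") (auto simp: dist_real_def)
  then show ?thesis using d by blast
 qed
 then obtain D where D: "\<And>t. t \<in> {0..T} ==> D t > 0"
  "\<And>s t. t \<in> {0..T} ==> s \<in> {0..T} ==> \<bar>s - t\<bar> < D t ==> nrm X (u s - u t) < e / 2"
  by metis
 obtain d where d: "d > 0" "\<And>t. t \<in> {0..T} ==> \<exists>r\<in>{0..T}. ball t d \<subseteq> ball r (D r)"
 proof (rule Heine_Borel_lemma[of "{0..T}" "(%t. ball t (D t)) ` {0..T}"])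
  show "{0..T} \<subseteq> \<Union> ((%t. ball t (D t)) ` {0..T})"
   using D(1) by force
 qed (use that in auto)
 show ?thesis
 proof (rule that[OF d(1)])
  fix s t assume st: "s \<in> {0..T}" "t \<in> {0..T}" "\<bar>s - t\<bar> < d"
  obtain r where r: "r \<in> {0..T}" "ball t d \<subseteq> ball r (D r)" using d(2)[OF st(2)] by blast
  have "s \<in> ball t d" "t \<in> ball t d" using st d by (auto simp: dist_real_def)
  then have "s \<in> ball r (D r)" "t \<in> ball r (D r)" using r(2) by blast+
  then have "\<bar>s - r\<bar> < D r" "\<bar>t - r\<bar> < D r" by (auto simp: dist_real_def)
  then have "nrm X (u s - u r) < e / 2" "nrm X (u t - u r) < e / 2"
   using D(2) r st by auto
  then show "nrm X (u s - u t) < e"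
   using nrm_diff_triangle[of "u s" "u r" "u t"] nrm_diff_commute[of "u r" "u t"] contT_carr[OF u] st r
   by fastforce
 qed
qed

lemma contT_nrm: "contT X T u ==> continuous_on {0..T} (%t. nrm X (u t))"
 unfolding continuous_on_def
proof (intro ballI)
 fix t assume u: "contT X T u" and t: "t \<in> {0..T}"
 have "((%s. nrm X (u s) - nrm X (u t)) ---> 0) (at t within {0..T})"
  by (rule tendsto_rabs_zero_cancel, rule tendsto_sandwich[OF _ _ tendsto_const contT_tendsto[OF u t]])
    (use t contT_carr[OF u] nrm_abs_diff_le in \<open>auto simp: eventually_at_filter\<close>)
 then show "((%s. nrm X (u s)) ---> nrm X (u t)) (at t within {0..T})"
  by (simp add: LIM_zero_iff)
qed

lemma polarization:
 "x \<in> carr X ==> y \<in> carr X ==> inn X x y = ((nrm X (x + y))^2 - (nrm X (x - y))^2) / 4"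
 by (simp add: nrm_sq inn_simps inn_commute[of y x])

lemma contT_inn:
 assumes "contT X T u" "contT X T v"
 shows "continuous_on {0..T} (%t. inn X (u t) (v t))"
proof -
 have "continuous_on {0..T} (%t. ((nrm X (u t + v t))^2 - (nrm X (u t - v t))^2) / 4)"
  using assms by (intro continuous_intros contT_nrm contT_add contT_diff) auto
 then show ?thesis
  by (rule continuous_on_eq) (use assms polarization contT_carr in auto)
qed

text \<open>Square integrable functions of time, described by approximation with continuous ones.
  The distance is dominated by a scalar \<open>g\<close> instead of being integrated itself, so
  sums, Lipschitz maps and translations preserve the property before anything is known about the
  measurability of \<open>nrm X (u t - psi t)\<close>.\<close>

definition L2c :: "real => (real => 'x) => bool" where
 "L2c T u \<longleftrightarrow> (AE t in ivl 0 T. u t \<in> carr X) \<and>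
  (\<forall>dl>0. \<exists>psi g. contT X T psi \<and> sq_int 0 T g \<and> ig 0 T (%t. (g t)^2) \<le> dl \<and>
    (AE t in ivl 0 T. nrm X (u t - psi t) \<le> g t))"

lemma L2cD:
 assumes "L2c T u" "dl > 0"
 obtains psi g where "contT X T psi" "sq_int 0 T g" "ig 0 T (%t. (g t)^2) \<le> dl"
  "AE t in ivl 0 T. nrm X (u t - psi t) \<le> g t"
 using assms unfolding L2c_def by blast

lemma L2c_carr: "L2c T u ==> AE t in ivl 0 T. u t \<in> carr X"
 by (simp add: L2c_def)

lemma contT_AE_carr: "contT X T u ==> AE t in ivl 0 T. u t \<in> carr X"
 by (rule AE_ivl_all) (rule contT_carr)

lemma contT_L2c: "contT X T u ==> L2c T u"
 unfolding L2c_def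
proof (intro conjI allI impI contT_AE_carr)
 show "\<exists>psi g. contT X T psi \<and> sq_int 0 T g \<and> ig 0 T (%t. (g t)^2) \<le> dl \<and>
   (AE t in ivl 0 T. nrm X (u t - psi t) \<le> g t)" if "contT X T u" "dl > 0" for dl
  using that by (intro exI[of _ u] exI[of _ "%_. 0"]) (simp add: sq_int_const)
qed

lemma L2c_const: "w \<in> carr X ==> L2c T (%t. w)"
 by (intro contT_L2c contT_const)

lemma L2c_add:
 assumes u: "L2c T u" and v: "L2c T v"
 shows "L2c T (%t. u t + v t)"
 unfolding L2c_def
proof (intro conjI allI impI)
 show "AE t in ivl 0 T. u t + v t \<in> carr X"
  using L2c_carr[OF u] L2c_carr[OF v] by eventually_elim simp
 fix dl :: real assume "dl > 0"
 then have d4: "dl / 4 > 0" by simp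
 obtain psi g where g: "contT X T psi" "sq_int 0 T g" "ig 0 T (%t. (g t)^2) \<le> dl / 4"
  "AE t in ivl 0 T. nrm X (u t - psi t) \<le> g t" using L2cD[OF u d4] by blast
 obtain \<xi> k where k: "contT X T \<xi>" "sq_int 0 T k" "ig 0 T (%t. (k t)^2) \<le> dl / 4"
  "AE t in ivl 0 T. nrm X (v t - \<xi> t) \<le> k t" using L2cD[OF v d4] by blast
 show "\<exists>psi g. contT X T psi \<and> sq_int 0 T g \<and> ig 0 T (%t. (g t)^2) \<le> dl \<and>
    (AE t in ivl 0 T. nrm X (u t + v t - psi t) \<le> g t)"
 proof (intro exI conjI)
  show "contT X T (%t. psi t + \<xi> t)" using g k by (intro contT_add)
  show gk: "sq_int 0 T (%t. g t + k t)" using g k by (intro sq_int_add)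
  have i: "intable 0 T (%t. (g t)^2)" "intable 0 T (%t. (k t)^2)"
   "intable 0 T (%t. (g t + k t)^2)"
   using g k gk by (auto simp: sq_int_def)
  have "ig 0 T (%t. (g t + k t)^2) \<le> ig 0 T (%t. 2 * (g t)^2 + 2 * (k t)^2)"
  proof (intro ivl_mono_AE AE_I2)
   fix t show "(g t + k t)^2 \<le> 2 * (g t)^2 + 2 * (k t)^2"
    using sum_squares_bound[of "g t" "k t"] by (simp add: power2_sum)
  qed (use i in auto)
  also have "\<dots> = 2 * ig 0 T (%t. (g t)^2) + 2 * ig 0 T (%t. (k t)^2)"
   using i by (subst Henstock_Kurzweil_Integration.integral_add) (auto intro!: ivl_integrable_on)
  also have "\<dots> \<le> dl" using g k by simp
  finally show "ig 0 T (%t. (g t + k t)^2) \<le> dl" .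
  show "AE t in ivl 0 T. nrm X (u t + v t - (psi t + \<xi> t)) \<le> g t + k t"
   using g(4) k(4) L2c_carr[OF u] L2c_carr[OF v]
    contT_AE_carr[OF g(1)] contT_AE_carr[OF k(1)]
  proof eventually_elim
   case (elim t)
   then show ?case
    using nrm_triangle[of "u t - psi t" "v t - \<xi> t"] by (simp add: algebra_simps)
  qed
 qed
qed

lemma L2c_map:
 assumes u: "L2c T u" and P: "\<And>x. x \<in> carr X ==> P x \<in> carr X"
  "\<And>x y. x \<in> carr X ==> y \<in> carr X ==> nrm X (P x - P y) \<le> B * nrm X (x - y)"
 shows "L2c T (%t. P (u t))"
 unfolding L2c_def
proof (intro conjI allI impI)
 show "AE t in ivl 0 T. P (u t) \<in> carr X"
  using L2c_carr[OF u] by eventually_elim (simp add: P)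
 fix dl :: real assume dl: "dl > 0"
 then have "dl / (B^2 + 1) > 0" by (simp add: add_nonneg_pos)
 then obtain psi g where g: "contT X T psi" "sq_int 0 T g" "ig 0 T (%t. (g t)^2) \<le> dl / (B^2 + 1)"
  "AE t in ivl 0 T. nrm X (u t - psi t) \<le> g t" using L2cD[OF u] by blast
 show "\<exists>psi g. contT X T psi \<and> sq_int 0 T g \<and> ig 0 T (%t. (g t)^2) \<le> dl \<and>
    (AE t in ivl 0 T. nrm X (P (u t) - psi t) \<le> g t)"
 proof (intro exI conjI)
  show "contT X T (%t. P (psi t))" using contT_map[OF g(1) P] .
  show "sq_int 0 T (%t. \<bar>B\<bar> * g t)" using g by (intro sq_int_cmult)
  have "ig 0 T (%t. (\<bar>B\<bar> * g t)^2) = B^2 * ig 0 T (%t. (g t)^2)"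
   by (simp add: power_mult_distrib)
  also have "\<dots> \<le> B^2 * (dl / (B^2 + 1))" using g by (intro mult_left_mono) auto
  also have "\<dots> \<le> (B^2 + 1) * (dl / (B^2 + 1))"
   using dl by (intro mult_right_mono) auto
  also have "\<dots> = dl" using add_nonneg_pos[of "B^2" 1] by simp
  finally show "ig 0 T (%t. (\<bar>B\<bar> * g t)^2) \<le> dl" .
  show "AE t in ivl 0 T. nrm X (P (u t) - P (psi t)) \<le> \<bar>B\<bar> * g t"
   using g(4) L2c_carr[OF u] contT_AE_carr[OF g(1)]
  proof eventually_elim
   case (elim t)
   have "nrm X (P (u t) - P (psi t)) \<le> B * nrm X (u t - psi t)" using elim P by simp
   also have "\<dots> \<le> \<bar>B\<bar> * nrm X (u t - psi t)" using elim by (intro mult_right_mono) auto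
   also have "\<dots> \<le> \<bar>B\<bar> * g t" using elim by (intro mult_left_mono) auto
   finally show ?case .
  qed
 qed
qed

lemma L2c_scale: "L2c T u ==> L2c T (%t. c *R u t)"
 by (rule L2c_map[where B = "\<bar>c\<bar>"]) (auto simp: scaleR_diff_right[symmetric] nrm_scale)

lemma L2c_diff: "L2c T u ==> L2c T v ==> L2c T (%t. u t - v t)"
 using L2c_add[of T u "%t. (-1) *R v t"] L2c_scale[of T v "-1"] by simp

lemma L2c_shift:
 assumes u: "L2c T u" and c: "0 \<le> c" "T' + c \<le> T"
 shows "L2c T' (%t. u (t + c))"
 unfolding L2c_def
proof (intro conjI allI impI)
 have ae: "AE t in ivl 0 T'. P (t + c)" if "AE t in ivl 0 T. P t" for P
  using AE_ivl_shift[OF AE_ivl_sub[OF that c], of c] by (simp only: diff_self add_diff_cancel_right')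
 show "AE t in ivl 0 T'. u (t + c) \<in> carr X"
  by (rule ae[OF L2c_carr[OF u]])
 fix dl :: real assume "dl > 0"
 then obtain psi g where g: "contT X T psi" "sq_int 0 T g" "ig 0 T (%t. (g t)^2) \<le> dl"
  "AE t in ivl 0 T. nrm X (u t - psi t) \<le> g t" using L2cD[OF u] by blast
 have g2: "intable 0 T (%t. (g t)^2)" using g by (simp add: sq_int_def)
 show "\<exists>psi g. contT X T' psi \<and> sq_int 0 T' g \<and> ig 0 T' (%t. (g t)^2) \<le> dl \<and>
    (AE t in ivl 0 T'. nrm X (u (t + c) - psi t) \<le> g t)"
 proof (intro exI conjI)
  show "contT X T' (%t. psi (t + c))" by (rule contT_shift[OF g(1) c])
  have "sq_int c (T' + c) g" using g c by (intro sq_int_sub[OF g(2)]) auto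
  then show "sq_int 0 T' (%t. g (t + c))"
   using ivl_shift(1)[of c "T' + c" "%t. (g t)^2" c] ivl_meas_shift[of g c "T' + c" c]
   by (simp add: sq_int_def)
  have "ig 0 T' (%t. (g (t + c))^2) = ig c (T' + c) (%t. (g t)^2)"
   using ivl_shift(2)[of c "T' + c" "%t. (g t)^2" c] ivl_sub[OF g2, of c "T' + c"] c by simp
  also have "\<dots> \<le> ig 0 T (%t. (g t)^2)"
   using g2 c by (intro ivl_mono_sub) auto
  finally show "ig 0 T' (%t. (g (t + c))^2) \<le> dl" using g by simp
  show "AE t in ivl 0 T'. nrm X (u (t + c) - psi (t + c)) \<le> g (t + c)"
   by (rule ae[OF g(4)])
 qed
qed

lemma L2c_sub: "L2c T u ==> T' \<le> T ==> L2c T' u"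
 using L2c_shift[of T u 0 T'] by simp

text \<open>Here measurability is recovered: along a subsequence the errors tend to zero almost
  everywhere, so the norm of \<open>u\<close> is the limit of the continuous functions
  \<open>nrm X (psi (r n) t)\<close>.\<close>

lemma L2c_nrm:
 assumes u: "L2c T u"
 shows "sq_int 0 T (%t. nrm X (u t))"
proof -
 have ex: "\<forall>n. \<exists>psi g. contT X T psi \<and> sq_int 0 T g \<and> ig 0 T (%t. (g t)^2) \<le> 1 / real (Suc n) \<and>
   (AE t in ivl 0 T. nrm X (u t - psi t) \<le> g t)"
 proof
  fix n
  have "1 / real (Suc n) > 0" by simp
  then show "\<exists>psi g. contT X T psi \<and> sq_int 0 T g \<and> ig 0 T (%t. (g t)^2) \<le> 1 / real (Suc n) \<and>
   (AE t in ivl 0 T. nrm X (u t - psi t) \<le> g t)"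
   using u unfolding L2c_def by blast
 qed
 from choice[OF ex] obtain psi where
  ex2: "\<forall>n. \<exists>g. contT X T (psi n) \<and> sq_int 0 T g \<and> ig 0 T (%t. (g t)^2) \<le> 1 / real (Suc n) \<and>
   (AE t in ivl 0 T. nrm X (u t - psi n t) \<le> g t)" ..
 from choice[OF ex2] obtain g where psi: "\<And>n. contT X T (psi n)" and g: "\<And>n. sq_int 0 T (g n)"
  and gi: "\<And>n. ig 0 T (%t. (g n t)^2) \<le> 1 / real (Suc n)"
  and ae: "\<And>n. AE t in ivl 0 T. nrm X (u t - psi n t) \<le> g n t"
  by auto
 have g2: "intable 0 T (%t. (g n t)^2)" for n using g by (simp add: sq_int_def)
 have "(%n. ig 0 T (%t. (g n t)^2)) ----> 0"
 proof (rule tendsto_sandwich[OF _ _ tendsto_const])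
  show "(%n. 1 / real (Suc n)) ----> 0" using LIMSEQ_Suc lim_1_over_n by blast
 qed (use gi g2 in \<open>auto intro!: always_eventually ivl_nonneg\<close>)
 then have "(%n. lint 0 T (%t. norm ((g n t)^2))) ----> 0"
  using g2 by (simp add: ivl_eq)
 then obtain r where r: "strict_mono r"
  "AE t in ivl 0 T. (%n. (g (r n) t)^2) ----> 0"
  using tendsto_L1_AE_subseq[of "ivl 0 T" "%n t. (g n t)^2"] g2 by blast
 have ae': "AE t in ivl 0 T. \<forall>n. nrm X (u t - psi n t) \<le> g n t"
  using ae by (simp add: AE_all_countable)
 have cpsi: "AE t in ivl 0 T. \<forall>n. psi n t \<in> carr X"
  using contT_AE_carr[OF psi] by (simp add: AE_all_countable)
 have m: "(%t. nrm X (u t)) \<in> meas 0 T"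
 proof (rule ivl_meas_lim_AE)
  show "(%t. nrm X (psi (r n) t)) \<in> meas 0 T" for n
   by (intro continuous_imp_measurable_on_sets_lebesgue contT_nrm psi) simp
  show "AE t in ivl 0 T. (%n. nrm X (psi (r n) t)) ----> nrm X (u t)"
   using r(2) ae' L2c_carr[OF u] cpsi
  proof (eventually_elim, goal_cases)
   case (1 t)
   have "(%n. sqrt ((g (r n) t)^2)) ----> sqrt 0" using 1 by (intro tendsto_real_sqrt)
   then have lim: "(%n. \<bar>g (r n) t\<bar>) ----> 0" by simp
   have "(%n. nrm X (psi (r n) t) - nrm X (u t)) ----> 0"
   proof (rule tendsto_rabs_zero_cancel, rule tendsto_sandwich[OF _ _ tendsto_const lim])
    show "\<forall>\<^sub>F n in sequentially. \<bar>nrm X (psi (r n) t) - nrm X (u t)\<bar> \<le> \<bar>g (r n) t\<bar>"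
    proof (rule always_eventually, rule allI)
     fix n
     have "\<bar>nrm X (psi (r n) t) - nrm X (u t)\<bar> \<le> nrm X (u t - psi (r n) t)"
      using nrm_abs_diff_le[of "u t" "psi (r n) t"] 1 by (simp add: abs_minus_commute)
     also have "\<dots> \<le> \<bar>g (r n) t\<bar>" using 1 abs_ge_self order_trans by blast
     finally show "\<bar>nrm X (psi (r n) t) - nrm X (u t)\<bar> \<le> \<bar>g (r n) t\<bar>" .
    qed
   qed simp
   then show ?case by (simp add: LIM_zero_iff)
  qed
 qed
 have sq: "sq_int 0 T (%t. nrm X (psi 0 t) + g 0 t)"
  by (intro sq_int_add sq_int_cont contT_nrm psi g)
 have b: "AE t in ivl 0 T. \<bar>nrm X (u t)\<bar> \<le> nrm X (psi 0 t) + g 0 t"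
  using ae[of 0] L2c_carr[OF u] contT_AE_carr[OF psi[of 0]]
 proof eventually_elim
  case (elim t)
  then show ?case using nrm_triangle[of "u t - psi 0 t" "psi 0 t"] by simp
 qed
 show ?thesis by (rule sq_int_bound[OF sq m b])
qed

lemma L2c_inn:
 assumes u: "L2c T u" and v: "L2c T v"
 shows "intable 0 T (%t. inn X (u t) (v t))"
proof (rule integrable_ivl_cong_AE)
 have "intable 0 T (%t. (nrm X (u t + v t))^2)" "intable 0 T (%t. (nrm X (u t - v t))^2)"
  using L2c_nrm[OF L2c_add[OF u v]] L2c_nrm[OF L2c_diff[OF u v]] by (auto simp: sq_int_def)
 then show "intable 0 T (%t. ((nrm X (u t + v t))^2 - (nrm X (u t - v t))^2) / 4)"
  by auto
 show "AE t in ivl 0 T. ((nrm X (u t + v t))^2 - (nrm X (u t - v t))^2) / 4 = inn X (u t) (v t)"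
  using L2c_carr[OF u] L2c_carr[OF v] by eventually_elim (simp add: polarization)
qed

text \<open>A function in \<open>L^2\<close> is uniformly continuous in time up to an error that is small in
 \<open>L^2\<close>; this replaces the continuity of translations.\<close>

lemma L2c_modulus:
 assumes u: "L2c T u" and dl: "dl > 0"
 obtains g tau Z where "sq_int 0 T g" "\<And>t. 0 \<le> g t" "ig 0 T (%t. (g t)^2) \<le> dl" "tau > 0" "negligible Z"
  "\<And>s t. s \<in> {0..T} - Z ==> t \<in> {0..T} - Z ==> \<bar>s - t\<bar> < tau ==> nrm X (u s - u t) \<le> g s + g t + dl"
proof -
 obtain psi g where g: "contT X T psi" "sq_int 0 T g" "ig 0 T (%t. (g t)^2) \<le> dl"
  "AE t in ivl 0 T. nrm X (u t - psi t) \<le> g t" using L2cD[OF u dl] by blast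
 obtain tau where tau: "tau > 0" "\<And>s t. s \<in> {0..T} ==> t \<in> {0..T} ==> \<bar>s - t\<bar> < tau ==> nrm X (psi s - psi t) < dl"
  using contT_uniform[OF g(1) dl] by blast
 have "AE t in ivl 0 T. u t \<in> carr X \<and> nrm X (u t - psi t) \<le> g t"
  using g(4) L2c_carr[OF u] by eventually_elim simp
 then obtain Z where Z: "negligible Z" "\<And>t. t \<in> {0..T} - Z ==> u t \<in> carr X \<and> nrm X (u t - psi t) \<le> g t"
  unfolding AE_ivl_iff by blast
 show ?thesis
 proof (rule that[of "%t. \<bar>g t\<bar>" tau Z])
  fix s t assume st: "s \<in> {0..T} - Z" "t \<in> {0..T} - Z" "\<bar>s - t\<bar> < tau"
  have c: "u s \<in> carr X" "u t \<in> carr X" "psi s \<in> carr X" "psi t \<in> carr X"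
   using Z st contT_carr[OF g(1)] by auto
  have "nrm X (u s - u t) \<le> nrm X (u s - psi s) + (nrm X (psi s - psi t) + nrm X (psi t - u t))"
   using nrm_diff_triangle[of "u s" "psi s" "u t"] nrm_diff_triangle[of "psi s" "psi t" "u t"] c by simp
  also have "nrm X (psi t - u t) = nrm X (u t - psi t)" using c by (intro nrm_diff_commute)
  finally show "nrm X (u s - u t) \<le> \<bar>g s\<bar> + \<bar>g t\<bar> + dl"
   using Z(2)[OF st(1)] Z(2)[OF st(2)] tau(2)[of s t] st by auto
 qed (use g tau Z in \<open>auto intro: sq_int_abs\<close>)
qed

end

section \<open>Strongly measurable functions and weak time derivatives\<close>

context semi_inner
begin

lemma strongly_meas_nrm:
 fixes T :: real
 assumes fin: "simple_function (ivl 0 T) w" "w ` {0..T} \<subseteq> carr X"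
  and s: "\<And>n. simple_function (ivl 0 T) (s n)" "\<And>n. s n ` {0..T} \<subseteq> carr X"
  and lim: "AE t in ivl 0 T. u t \<in> carr X \<and> (%n. nrm X (s n t - u t)) ----> 0"
 shows "(%t. nrm X (w t - u t)) \<in> meas 0 T"
proof (rule ivl_meas_lim_AE)
 show "(%t. nrm X (w t - s n t)) \<in> meas 0 T" for n
  by (intro borel_measurable_simple_function simple_function_compose2[OF fin(1) s(1)])
 have "AE t in ivl 0 T. t \<in> {0..T}"
  by (rule AE_ivl_all)
 then show "AE t in ivl 0 T. (%n. nrm X (w t - s n t)) ----> nrm X (w t - u t)"
  using lim
 proof eventually_elim
  case (elim t)
  have c: "w t \<in> carr X" "s n t \<in> carr X" "u t \<in> carr X" for n
   using fin s(2)[of n] elim by auto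
  have "(%n. nrm X (w t - s n t) - nrm X (w t - u t)) ----> 0"
  proof (rule tendsto_rabs_zero_cancel, rule tendsto_sandwich[OF _ _ tendsto_const])
   show "(%n. nrm X (s n t - u t)) ----> 0" using elim by blast
   have "\<bar>nrm X (w t - s n t) - nrm X (w t - u t)\<bar> \<le> nrm X (s n t - u t)" for n
    using nrm_abs_diff_le[of "w t - s n t" "w t - u t"] c nrm_diff_commute[of "u t" "s n t"] by simp
   then show "\<forall>\<^sub>F n in sequentially. \<bar>nrm X (w t - s n t) - nrm X (w t - u t)\<bar> \<le> nrm X (s n t - u t)"
    by simp
  qed simp
  then show ?case by (simp add: LIM_zero_iff)
 qed
qed

text \<open>A simple function is a finite sum of values times indicators of its level sets, and each
  indicator is replaced by a continuous function close to it in \<open>L^2\<close>.\<close>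

lemma simple_approx_contT:
 assumes w: "simple_function (ivl 0 T) w" "w ` {0..T} \<subseteq> carr X" and dl: "dl > 0"
 obtains psi g where "contT X T psi" "sq_int 0 T g" "ig 0 T (%t. (g t)^2) \<le> dl"
  "\<And>t. t \<in> {0..T} ==> nrm X (w t - psi t) \<le> g t"
proof -
 define R where "R = w ` {0..T}"
 define A where "A y = w -` {y} \<inter> {0..T}" for y
 have R: "finite R" "R \<subseteq> carr X"
  using w by (auto simp: R_def simple_function_def)
 have A: "A y \<in> sets lebesgue" for y
 proof (cases "y \<in> R")
  case True
  then have "A y \<in> sets (ivl 0 T)"
   using w(1) by (auto simp: A_def R_def simple_function_def)
  then show ?thesis
   by (simp add: sets_restrict_space_iff)
 next
  case False
  then have "A y = {}" by (auto simp: A_def R_def)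
  then show ?thesis by simp
 qed
 define N where "N = real (card R) + 1"
 \<comment> \<open>The factor \<open>(nrm X y)^2 + 1\<close> absorbs the size of the value
   \<open>y\<close>. One factor \<open>N\<close> pays for the square of a sum of
   \<open>card R\<close> terms, the other for adding up their integrals.\<close>
 define \<eta> where "\<eta> y = dl / (N * N * ((nrm X y)^2 + 1))" for y
 have N: "N > 0" "real (card R) \<le> N" by (auto simp: N_def)
 have \<eta>: "\<eta> y > 0" for y
  using dl N by (auto simp: \<eta>_def intro!: divide_pos_pos mult_pos_pos add_nonneg_pos)
 have "\<exists>phi. continuous_on UNIV phi \<and> ig 0 T (%x. (indicator (A y) x - phi x)^2) \<le> \<eta> y" for y
  by (rule indicator_approx_continuous[OF A[of y] \<eta>[of y], of 0 T]) blast
 then have "\<forall>y. \<exists>phi. continuous_on UNIV phi \<and> ig 0 T (%x. (indicator (A y) x - phi x)^2) \<le> \<eta> y" by blast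
 from choice[OF this] obtain phi :: "'x => real => real" where
  phi: "\<And>y. continuous_on UNIV (phi y)" "\<And>y. ig 0 T (%x. (indicator (A y) x - phi y x)^2) \<le> \<eta> y"
  by blast
 define psi where "psi t = (\<Sum>y\<in>R. phi y t *R y)" for t
 define h where "h y t = \<bar>indicator (A y) t - phi y t\<bar> * nrm X y" for y t
 define g where "g t = (\<Sum>y\<in>R. h y t)" for t
 have dif: "sq_int 0 T (%t. indicator (A y) t - phi y t)" for y
 proof -
  have "sq_int 0 T (indicat_real (A y))"
   by (rule sq_int_bound[OF sq_int_const[of 0 T 1]])
     (use A in \<open>auto intro!: measurable_restrict_space1 AE_I2 split: split_indicator\<close>)
  moreover have "sq_int 0 T (%t. (-1) * phi y t)"
   by (intro sq_int_cmult sq_int_cont continuous_on_subset[OF phi(1)]) auto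
  ultimately show ?thesis
   using sq_int_add[of 0 T "indicat_real (A y)" "%t. (-1) * phi y t"] by simp
 qed
 have hs: "sq_int 0 T (h y)" for y
  using sq_int_cmult[OF sq_int_abs[OF dif[of y]], of "nrm X y"] by (simp add: h_def[abs_def] mult.commute)
 have hsi: "intable 0 T (%t. (h y t)^2)" for y
  using hs by (simp add: sq_int_def)
 have gs: "sq_int 0 T g"
  unfolding g_def using R hs by (intro sq_int_sum)
 show ?thesis
 proof (rule that[OF _ gs])
  show "contT X T psi"
   unfolding psi_def using R by (intro contT_sum contT_scale_const continuous_on_subset[OF phi(1)]) auto
  show "nrm X (w t - psi t) \<le> g t" if t: "t \<in> {0..T}" for t
  proof -
   have "w t = (\<Sum>y\<in>R. indicator (A y) t *R y)"
   proof -
    have "(\<Sum>y\<in>R. indicator (A y) t *R y) = (\<Sum>y\<in>R. if y = w t then y else 0)"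
     using t by (intro sum.cong) (auto simp: A_def split: split_indicator)
    also have "\<dots> = w t" using t R by (simp add: R_def)
    finally show ?thesis by simp
   qed
   then have "w t - psi t = (\<Sum>y\<in>R. (indicator (A y) t - phi y t) *R y)"
    by (simp add: psi_def sum_subtractf scaleR_diff_left)
   also have "nrm X \<dots> \<le> (\<Sum>y\<in>R. nrm X ((indicator (A y) t - phi y t) *R y))"
    using R by (intro nrm_sum_le) auto
   also have "\<dots> = g t"
    unfolding g_def h_def using R by (intro sum.cong refl) (auto simp: nrm_scale)
   finally show ?thesis .
  qed
  have "(g t)^2 \<le> N * (\<Sum>y\<in>R. (h y t)^2)" for t
  proof -
   have "(\<Sum>y\<in>R. h y t * 1)^2 \<le> (\<Sum>y\<in>R. (h y t)^2) * (\<Sum>y\<in>R. 1^2)"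
    by (rule Cauchy_Schwarz_ineq_sum)
   also have "\<dots> \<le> (\<Sum>y\<in>R. (h y t)^2) * N"
    using N by (intro mult_left_mono sum_nonneg) auto
   finally show ?thesis by (simp add: g_def mult.commute)
  qed
  then have "ig 0 T (%t. (g t)^2) \<le> ig 0 T (%t. N * (\<Sum>y\<in>R. (h y t)^2))"
   using gs hsi by (intro ivl_mono_AE AE_I2) (auto simp: sq_int_def)
  also have "\<dots> = N * (\<Sum>y\<in>R. ig 0 T (%t. (h y t)^2))"
   using R hsi by (simp add: Henstock_Kurzweil_Integration.integral_sum ivl_integrable_on)
  also have "\<dots> \<le> N * (\<Sum>y\<in>R. dl / (N * N))"
  proof (intro mult_left_mono sum_mono)
   fix y assume "y \<in> R"
   have "ig 0 T (%t. (h y t)^2) = (nrm X y)^2 * ig 0 T (%t. (indicator (A y) t - phi y t)^2)"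
    by (simp add: h_def power_mult_distrib mult.commute)
   also have "\<dots> \<le> ((nrm X y)^2 + 1) * \<eta> y"
    using phi(2)[of y] \<eta>[of y] dif[of y] by (intro mult_mono') (auto simp: sq_int_def intro!: ivl_nonneg)
   also have "\<dots> = dl / (N * N)"
    unfolding \<eta>_def using add_nonneg_pos[of "(nrm X y)^2" 1] by simp
   finally show "ig 0 T (%t. (h y t)^2) \<le> dl / (N * N)" .
  qed (use N in auto)
  also have "\<dots> = real (card R) / N * dl" using N by simp
  also have "\<dots> \<le> 1 * dl" using N dl by (intro mult_right_mono) auto
  finally show "ig 0 T (%t. (g t)^2) \<le> dl" by simp
 qed
qed

text \<open>The simple functions converge only pointwise and without a common bound. They are set to
  zero where their norm exceeds twice that of \<open>u\<close>; the error is then at most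
  \<open>3 * nrm X (u t)\<close>, and dominated convergence gives convergence in
  \<open>L^2\<close>.\<close>

lemma L2T_L2c:
 assumes u: "L2T X T u"
 shows "L2c T u"
proof -
 obtain s where s: "\<And>n. simple_function (ivl 0 T) (s n)" "\<And>n. s n ` {0..T} \<subseteq> carr X"
  and lim: "AE t in ivl 0 T. u t \<in> carr X \<and> (%n. nrm X (s n t - u t)) ----> 0"
  using u unfolding L2T_def strongly_meas_def by blast
 have cu: "AE t in ivl 0 T. u t \<in> carr X" using lim by eventually_elim simp
 have "(%t. nrm X (0 - u t)) \<in> meas 0 T"
  by (rule strongly_meas_nrm[OF _ _ s lim]) auto
 then have mu: "(%t. nrm X (u t)) \<in> meas 0 T"
 proof (rule ivl_meas_cong_AE)
  show "AE t in ivl 0 T. nrm X (0 - u t) = nrm X (u t)"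
   using cu by eventually_elim (simp add: nrm_minus)
 qed
 have u2: "intable 0 T (%t. (nrm X (u t))^2)" using u by (simp add: L2T_def)
 have ms: "(%t. nrm X (s n t)) \<in> meas 0 T" for n
  by (intro borel_measurable_simple_function simple_function_compose1[OF s(1)])
 define A where "A n = {t\<in>{0..T}. nrm X (s n t) \<le> 2 * nrm X (u t)}" for n
 have A: "A n \<in> sets (ivl 0 T)" for n
 proof -
  have "{t \<in> space (ivl 0 T). nrm X (s n t) \<le> 2 * nrm X (u t)} \<in> sets (ivl 0 T)"
   using ms mu by (intro borel_measurable_le) auto
  then show ?thesis by (simp add: A_def)
 qed
 define w where "w n t = (if t \<in> A n then s n t else 0)" for n t
 have wsf: "simple_function (ivl 0 T) (w n)" for n
  unfolding w_def using A s(1) by (intro simple_function_If_set) auto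
 have wc: "w n ` {0..T} \<subseteq> carr X" for n
  using s(2)[of n] by (auto simp: w_def)
 define k where "k n t = nrm X (w n t - u t)" for n t
 have mk: "k n \<in> meas 0 T" for n
  unfolding k_def by (rule strongly_meas_nrm[OF wsf wc s lim])
 have in0: "AE t in ivl 0 T. t \<in> {0..T}" by (rule AE_ivl_all)
 have kb: "AE t in ivl 0 T. \<bar>k n t\<bar> \<le> 3 * nrm X (u t)" for n
  using cu in0
 proof eventually_elim
  case (elim t)
  have c: "w n t \<in> carr X" using wc[of n] elim by auto
  have "nrm X (w n t) \<le> 2 * nrm X (u t)" using elim by (auto simp: w_def A_def)
  then show ?case
   using nrm_diff_le[OF c elim(1)] nrm_nonneg[OF carr_diff[OF c elim(1)]] by (simp add: k_def)
 qed
 have klim: "AE t in ivl 0 T. (%n. k n t) ----> 0"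
  using lim in0
 proof eventually_elim
  case (elim t)
  have c: "u t \<in> carr X" "s n t \<in> carr X" for n using elim s(2)[of n] by auto
  have sl: "(%n. nrm X (s n t - u t)) ----> 0" using elim by simp
  \<comment> \<open>If \<open>u t\<close> has norm zero, the truncation makes the error vanish for
    every \<open>n\<close>; otherwise \<open>t\<close> belongs to \<open>A n\<close> from some index
    on, and nothing is cut off.\<close>
  show ?case
  proof (cases "nrm X (u t) = 0")
   case True
   have "k n t = 0" for n
   proof -
    have "k n t \<le> 0"
    proof (cases "t \<in> A n")
     case tA: True
     then have "nrm X (s n t) \<le> 0" using True by (simp add: A_def)
     then show ?thesis using nrm_diff_le[OF c(2) c(1), of n] True tA by (simp add: k_def w_def)
    next
     case False
     then show ?thesis using True c by (simp add: k_def w_def nrm_minus)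
    qed
    moreover have "w n t \<in> carr X" using wc[of n] elim by blast
    then have "0 \<le> k n t" using c by (simp add: k_def)
    ultimately show ?thesis by simp
   qed
   then show ?thesis by simp
  next
   case False
   then have "nrm X (u t) > 0" using nrm_nonneg[OF c(1)] by linarith
   then have "\<forall>\<^sub>F n in sequentially. nrm X (s n t - u t) < nrm X (u t)"
    using sl by (intro order_tendstoD) auto
   then have "\<forall>\<^sub>F n in sequentially. nrm X (s n t - u t) = k n t"
   proof eventually_elim
    case (elim n)
    then have "t \<in> A n"
     using nrm_abs_diff_le[OF c(2) c(1), of n] in0 \<open>t \<in> {0..T}\<close> by (auto simp: A_def)
    then show ?case by (simp add: k_def w_def)
   qed
   then show ?thesis using sl by (rule Lim_transform_eventually[rotated])
  qed
 qed
 have ks: "sq_int 0 T (k n)" for n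
  by (rule sq_int_bound[OF sq_int_cmult[of 0 T "%t. nrm X (u t)" 3] mk kb]) (use u2 mu in \<open>simp add: sq_int_def\<close>)
 have kint: "(%n. ig 0 T (%t. (k n t)^2)) ----> ig 0 T (%t. 0)"
 proof (rule tendsto_ivl_dominated(2)[where w = "%t. 9 * (nrm X (u t))^2"])
  show "AE t in ivl 0 T. (%n. (k n t)^2) ----> 0"
   using klim
  proof eventually_elim
   case (elim t)
   then show ?case using tendsto_power[OF elim, of 2] by simp
  qed
  show "AE t in ivl 0 T. \<bar>(k n t)^2\<bar> \<le> 9 * (nrm X (u t))^2" for n
   using kb[of n]
  proof eventually_elim
   case (elim t)
   then show ?case using abs_le_imp_square_le[OF elim] by (simp add: power_mult_distrib)
  qed
 qed (use ks u2 in \<open>auto simp: sq_int_def\<close>)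
 show ?thesis
  unfolding L2c_def
 proof (intro conjI allI impI cu)
  fix dl :: real assume dl: "dl > 0"
  have "\<forall>\<^sub>F n in sequentially. ig 0 T (%t. (k n t)^2) < dl / 4"
   using dl kint by (intro order_tendstoD) auto
  then obtain n where n: "ig 0 T (%t. (k n t)^2) < dl / 4"
   by (auto simp: eventually_sequentially)
  have "dl / 4 > 0" using dl by simp
  then obtain psi g where g: "contT X T psi" "sq_int 0 T g" "ig 0 T (%t. (g t)^2) \<le> dl / 4"
   "\<And>t. t \<in> {0..T} ==> nrm X (w n t - psi t) \<le> g t"
   using simple_approx_contT[OF wsf wc] by blast
  have sum: "sq_int 0 T (%t. k n t + g t)" by (intro sq_int_add ks g)
  have "ig 0 T (%t. (k n t + g t)^2) \<le> ig 0 T (%t. 2 * (k n t)^2 + 2 * (g t)^2)"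
  proof (intro ivl_mono_AE AE_I2)
   fix t show "(k n t + g t)^2 \<le> 2 * (k n t)^2 + 2 * (g t)^2"
    using sum_squares_bound[of "k n t" "g t"] by (simp add: power2_sum)
  qed (use sum ks g in \<open>auto simp: sq_int_def\<close>)
  also have "\<dots> = 2 * ig 0 T (%t. (k n t)^2) + 2 * ig 0 T (%t. (g t)^2)"
   using ks g by (subst Henstock_Kurzweil_Integration.integral_add) (auto simp: sq_int_def intro!: ivl_integrable_on)
  also have "\<dots> \<le> dl" using n g by simp
  finally have int: "ig 0 T (%t. (k n t + g t)^2) \<le> dl" .
  have "AE t in ivl 0 T. nrm X (u t - psi t) \<le> k n t + g t"
   using cu in0
  proof eventually_elim
   case (elim t)
   have c: "w n t \<in> carr X" "psi t \<in> carr X" using wc[of n] contT_carr[OF g(1)] elim by auto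
   show ?case
    using nrm_diff_triangle[OF elim(1) c] nrm_diff_commute[OF elim(1) c(1)] g(4)[OF elim(2)]
    by (simp add: k_def)
  qed
  then show "\<exists>psi g. contT X T psi \<and> sq_int 0 T g \<and> ig 0 T (%t. (g t)^2) \<le> dl \<and>
    (AE t in ivl 0 T. nrm X (u t - psi t) \<le> g t)"
   using g(1) sum int by blast
 qed
qed

text \<open>The set \<open>Y\<close> below is the closed span of countably many approximating values; testing with
 countably many vectors is what makes a common null set possible.\<close>

lemma weak_tderiv_primitive:
 assumes u: "L2T X T u" and v: "L2T X T v" and wd: "weak_tderiv X T u v"
 obtains Z Y where "negligible Z" "subspace Y" "Y \<subseteq> carr X"
  "\<And>y. y \<in> carr X ==> (\<And>e. e > 0 ==> \<exists>z\<in>Y. nrm X (y - z) < e) ==> y \<in> Y"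
  "\<And>t. t \<in> {0..T} - Z ==> u t \<in> Y \<and> v t \<in> Y"
  "\<And>s t w. s \<in> {0..T} - Z ==> t \<in> {0..T} - Z ==> s \<le> t ==> w \<in> Y ==>
    inn X (u t - u s) w = ig s t (%r. inn X (v r) w)"
proof -
 have uc: "L2c T u" and vc: "L2c T v" using u v by (auto intro: L2T_L2c)
 obtain su where su: "\<And>n. simple_function (ivl 0 T) (su n)" "\<And>n. su n ` {0..T} \<subseteq> carr X"
  and ulim: "AE t in ivl 0 T. u t \<in> carr X \<and> (%n. nrm X (su n t - u t)) ----> 0"
  using u unfolding L2T_def strongly_meas_def by blast
 obtain sv where sv: "\<And>n. simple_function (ivl 0 T) (sv n)" "\<And>n. sv n ` {0..T} \<subseteq> carr X"
  and vlim: "AE t in ivl 0 T. v t \<in> carr X \<and> (%n. nrm X (sv n t - v t)) ----> 0"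
  using v unfolding L2T_def strongly_meas_def by blast
 define S where "S = (\<Union>n. su n ` {0..T} \<union> sv n ` {0..T})"
 have "finite (su n ` {0..T})" "finite (sv n ` {0..T})" for n
  using su(1)[of n] sv(1)[of n] by (auto simp: simple_function_def)
 then have "countable (su n ` {0..T} \<union> sv n ` {0..T})" for n
  by (intro countable_finite finite_UnI)
 then have S: "countable S"
  unfolding S_def by (intro countable_UN) auto
 have SX: "S \<subseteq> carr X"
  using su(2) sv(2) unfolding S_def by blast
 note S = S SX
 have spanS: "span S \<subseteq> carr X" using S subspace_carr by (intro span_minimal)
 \<comment> \<open>For a fixed test vector the weak time derivative is a scalar weak derivative. The
   null set depends on the vector, which is why \<open>S\<close> must be countable.\<close>
 have "\<forall>w\<in>S. \<exists>Z. negligible Z \<and> (\<forall>s\<in>{0..T} - Z. \<forall>t\<in>{0..T} - Z. s \<le> t -->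
   inn X (u t) w - inn X (u s) w = ig s t (%r. inn X (v r) w))"
 proof
  fix w assume "w \<in> S"
  then have w: "w \<in> carr X" using S by blast
  have "weak_deriv T (%t. inn X (u t) w) (%t. inn X (v t) w)"
   using wd w unfolding weak_tderiv_def weak_deriv_def by blast
  then obtain Z where "negligible Z" "\<And>s t. s \<in> {0..T} - Z ==> t \<in> {0..T} - Z ==> s \<le> t ==>
    inn X (u t) w - inn X (u s) w = ig s t (%r. inn X (v r) w)"
   using weak_deriv_AE_primitive[OF _ L2c_inn[OF uc L2c_const[OF w]] L2c_inn[OF vc L2c_const[OF w]]] by blast
  then show "\<exists>Z. negligible Z \<and> (\<forall>s\<in>{0..T} - Z. \<forall>t\<in>{0..T} - Z. s \<le> t -->
   inn X (u t) w - inn X (u s) w = ig s t (%r. inn X (v r) w))" by blast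
 qed
 from bchoice[OF this] obtain ZS where ZS: "\<And>w. w \<in> S ==> negligible (ZS w)"
  "\<And>w s t. w \<in> S ==> s \<in> {0..T} - ZS w ==> t \<in> {0..T} - ZS w ==> s \<le> t ==>
   inn X (u t) w - inn X (u s) w = ig s t (%r. inn X (v r) w)" by blast
 have "AE t in ivl 0 T. u t \<in> carr X \<and> (%n. nrm X (su n t - u t)) ----> 0 \<and>
   v t \<in> carr X \<and> (%n. nrm X (sv n t - v t)) ----> 0"
  using ulim vlim by eventually_elim blast
 then obtain Z0 where Z0: "negligible Z0" "\<And>t. t \<in> {0..T} - Z0 ==> u t \<in> carr X \<and> (%n. nrm X (su n t - u t)) ----> 0 \<and>
   v t \<in> carr X \<and> (%n. nrm X (sv n t - v t)) ----> 0"
  unfolding AE_ivl_iff by blast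
 define Z where "Z = Z0 \<union> (\<Union>w\<in>S. ZS w)"
 have nZ: "negligible Z"
  unfolding Z_def using Z0(1) ZS(1) S(1)
  by (intro negligible_Un negligible_countable_Union) auto
 define Y where "Y = {y\<in>carr X. \<forall>e>0. \<exists>z\<in>span S. nrm X (y - z) < e}"
 have SY: "y \<in> Y" if "y \<in> carr X" "\<And>n. z n \<in> S" "(%n. nrm X (z n - y)) ----> 0" for y z
  unfolding Y_def
 proof (intro CollectI conjI allI impI that(1))
  fix e :: real assume "e > 0"
  then have "\<forall>\<^sub>F n in sequentially. nrm X (z n - y) < e" using that(3) by (intro order_tendstoD) auto
  then obtain n where "nrm X (z n - y) < e" by (auto simp: eventually_sequentially)
  moreover have "z n \<in> carr X" using that(2) S by blast
  ultimately show "\<exists>z\<in>span S. nrm X (y - z) < e"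
   using that nrm_diff_commute[of "z n" y] by (intro bexI[of _ "z n"] span_base) auto
 qed
 have Yc: "Y \<subseteq> carr X" by (auto simp: Y_def)
 have Ysub: "subspace Y"
 proof (rule subspaceI)
  show "0 \<in> Y" unfolding Y_def by (auto intro!: bexI[of _ 0] span_zero)
  show "x + y \<in> Y" if xy: "x \<in> Y" "y \<in> Y" for x y
   unfolding Y_def
  proof (intro CollectI conjI allI impI)
   show "x + y \<in> carr X" using that Yc carr_add by blast
   fix e :: real assume "e > 0"
   then have "e / 2 > 0" by simp
   then obtain a b where ab: "a \<in> span S" "b \<in> span S" "nrm X (x - a) < e / 2" "nrm X (y - b) < e / 2"
    using xy unfolding Y_def by blast
   have "x - a \<in> carr X" "y - b \<in> carr X" using xy ab Yc spanS carr_diff by blast+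
   then have "nrm X ((x - a) + (y - b)) \<le> nrm X (x - a) + nrm X (y - b)"
    by (rule nrm_triangle)
   then have "nrm X (x + y - (a + b)) < e" using ab by (simp add: algebra_simps)
   then show "\<exists>z\<in>span S. nrm X (x + y - z) < e" using ab by (intro bexI[of _ "a + b"] span_add)
  qed
  show "c *R x \<in> Y" if xY: "x \<in> Y" for c x
   unfolding Y_def
  proof (intro CollectI conjI allI impI)
   show "c *R x \<in> carr X" using that Yc carr_scale by blast
   fix e :: real assume e: "e > 0"
   then have "e / (\<bar>c\<bar> + 1) > 0" by simp
   then obtain a where a: "a \<in> span S" "nrm X (x - a) < e / (\<bar>c\<bar> + 1)"
    using xY unfolding Y_def by blast
   have xa: "x - a \<in> carr X" using xY a Yc spanS carr_diff by blast
   have "nrm X (c *R x - c *R a) = \<bar>c\<bar> * nrm X (x - a)"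
    using xa by (simp add: scaleR_diff_right[symmetric] nrm_scale)
   also have "\<dots> \<le> (\<bar>c\<bar> + 1) * nrm X (x - a)" using xa by (intro mult_right_mono) auto
   also have "\<dots> < e" using a(2) by (simp add: pos_less_divide_eq mult.commute)
   finally show "\<exists>z\<in>span S. nrm X (c *R x - z) < e"
    using a by (intro bexI[of _ "c *R a"] span_scale)
  qed
 qed
 have Ycl: "y \<in> Y" if y: "y \<in> carr X" "\<And>e. e > 0 ==> \<exists>z\<in>Y. nrm X (y - z) < e" for y
  unfolding Y_def
 proof (intro CollectI conjI allI impI y(1))
  fix e :: real assume "e > 0"
  then have e: "e / 2 > 0" by simp
  obtain z where z: "z \<in> Y" "nrm X (y - z) < e / 2" using y(2)[OF e] by blast
  obtain a where a: "a \<in> span S" "nrm X (z - a) < e / 2" using z(1) e unfolding Y_def by blast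
  have "nrm X (y - a) \<le> nrm X (y - z) + nrm X (z - a)"
   using y z a Yc spanS by (intro nrm_diff_triangle) auto
  then show "\<exists>z\<in>span S. nrm X (y - z) < e" using z a by (intro bexI[of _ a]) auto
 qed
 have uvY: "u t \<in> Y \<and> v t \<in> Y" if t: "t \<in> {0..T} - Z" for t
 proof
  have t0: "t \<in> {0..T} - Z0" using t by (auto simp: Z_def)
  have inS: "su n t \<in> S" "sv n t \<in> S" for n
   using t unfolding S_def by blast+
  show "u t \<in> Y" by (rule SY[of _ "%n. su n t"]) (use Z0(2)[OF t0] inS in auto)
  show "v t \<in> Y" by (rule SY[of _ "%n. sv n t"]) (use Z0(2)[OF t0] inS in auto)
 qed
 have main: "inn X (u t - u s) w = ig s t (%r. inn X (v r) w)"
  if st: "s \<in> {0..T} - Z" "t \<in> {0..T} - Z" "s \<le> t" and wY: "w \<in> Y" for s t w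
 proof -
  have c: "u t \<in> carr X" "u s \<in> carr X" using uvY st Yc by auto
  define P where "P w \<longleftrightarrow> w \<in> carr X \<and> inn X (u t - u s) w = ig s t (%r. inn X (v r) w)" for w
  have vi: "intable s t (%r. inn X (v r) w)" if "w \<in> carr X" for w
   using st by (intro ivl_sub[OF L2c_inn[OF vc L2c_const[OF that]]]) auto
  have vAE: "AE r in ivl s t. v r \<in> carr X"
   using st by (intro AE_ivl_sub[OF L2c_carr[OF vc]]) auto
  have spanP: "P w" if "w \<in> span S" for w
   using that
  proof (induction rule: span_induct)
   case base
   show ?case
    unfolding subspace_def mem_Collect_eq
   proof (intro conjI ballI allI)
    have "ig s t (%r. inn X (v r) 0) = ig s t (%r. 0)"
     using vAE by (intro ivl_cong_AE) (auto elim!: eventually_mono)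
    then show "P 0" using c by (simp add: P_def)
    show "P (x + y)" if "x \<in> {x. P x}" "y \<in> {x. P x}" for x y
    proof -
     have xy: "x \<in> carr X" "y \<in> carr X" using that by (auto simp: P_def)
     have "ig s t (%r. inn X (v r) (x + y)) = ig s t (%r. inn X (v r) x + inn X (v r) y)"
      using vAE xy by (intro ivl_cong_AE Bochner_Integration.integrable_add vi)
       (auto elim!: eventually_mono simp: inn_add_right)
     also have "\<dots> = ig s t (%r. inn X (v r) x) + ig s t (%r. inn X (v r) y)"
      using xy by (intro Henstock_Kurzweil_Integration.integral_add ivl_integrable_on vi)
     finally show ?thesis using that c by (simp add: P_def inn_simps)
    qed
    show "P (a *R x)" if "x \<in> {x. P x}" for a x
    proof -
     have x: "x \<in> carr X" using that by (auto simp: P_def)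
     have "ig s t (%r. inn X (v r) (a *R x)) = ig s t (%r. a * inn X (v r) x)"
      using vAE x by (intro ivl_cong_AE integrable_mult_right vi)
       (auto elim!: eventually_mono simp: inn_scale_right)
     then show ?thesis using that c by (simp add: P_def inn_simps)
    qed
   qed
  next
   case (step w)
   have "s \<in> {0..T} - ZS w" "t \<in> {0..T} - ZS w" using st step by (auto simp: Z_def)
   then show ?case using ZS(2)[OF step] st step S c by (auto simp: P_def inn_diff_left)
  qed
  define M where "M = nrm X (u t - u s) + ig s t (%r. nrm X (v r))"
  have w: "w \<in> carr X" using wY Yc by auto
  have nv: "intable s t (%r. nrm X (v r))"
   using st by (intro ivl_sub[OF sq_int_integrable[OF L2c_nrm[OF vc]]]) auto
  \<comment> \<open>Both sides of the identity are continuous in the test vector with Lipschitz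
    constant \<open>M\<close>. This carries it from the span of \<open>S\<close> to the
    closure.\<close>
  have est: "\<bar>inn X (u t - u s) w - ig s t (%r. inn X (v r) w)\<bar> \<le> e * M" if e: "e > 0" for e
  proof -
   obtain z where z: "z \<in> span S" "nrm X (w - z) < e" using wY e unfolding Y_def by blast
   have zc: "z \<in> carr X" using z spanS by auto
   have Pz: "inn X (u t - u s) z = ig s t (%r. inn X (v r) z)" using spanP[OF z(1)] by (simp add: P_def)
   have "ig s t (%r. inn X (v r) (w - z)) = ig s t (%r. inn X (v r) w - inn X (v r) z)"
    using vAE w zc by (intro ivl_cong_AE Bochner_Integration.integrable_diff vi)
     (auto elim!: eventually_mono simp: inn_diff_right)
   also have "\<dots> = ig s t (%r. inn X (v r) w) - ig s t (%r. inn X (v r) z)"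
    using w zc by (intro Henstock_Kurzweil_Integration.integral_diff ivl_integrable_on vi)
   finally have "inn X (u t - u s) w - ig s t (%r. inn X (v r) w) =
     inn X (u t - u s) (w - z) - ig s t (%r. inn X (v r) (w - z))"
    using Pz c w zc by (simp add: inn_diff_right)
   moreover have "\<bar>inn X (u t - u s) (w - z)\<bar> \<le> nrm X (u t - u s) * e"
    using abs_inn_le[of "u t - u s" "w - z"] mult_left_mono[OF less_imp_le[OF z(2)], of "nrm X (u t - u s)"] c w zc
    by auto
   moreover have "\<bar>ig s t (%r. inn X (v r) (w - z))\<bar> \<le> ig s t (%r. e * nrm X (v r))"
   proof (intro ivl_abs_le vi integrable_mult_right nv)
    show "AE r in ivl s t. \<bar>inn X (v r) (w - z)\<bar> \<le> e * nrm X (v r)"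
     using vAE
    proof eventually_elim
     case (elim r)
     then show ?case
      using abs_inn_le[of "v r" "w - z"] mult_left_mono[OF less_imp_le[OF z(2)], of "nrm X (v r)"] w zc
      by (auto simp: mult.commute)
    qed
   qed (use w zc in auto)
   ultimately show ?thesis by (simp add: M_def algebra_simps)
  qed
  have "M \<ge> 0"
   unfolding M_def using c nv vAE by (intro add_nonneg_nonneg ivl_nonneg) (auto elim!: eventually_mono)
  have "\<bar>inn X (u t - u s) w - ig s t (%r. inn X (v r) w)\<bar> \<le> 0"
  proof (rule field_le_epsilon)
   fix e :: real assume "e > 0"
   then have "e / (M + 1) > 0" using \<open>M \<ge> 0\<close> by simp
   from est[OF this] have "\<bar>inn X (u t - u s) w - ig s t (%r. inn X (v r) w)\<bar> \<le> e / (M + 1) * M" .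
   also have "\<dots> \<le> e / (M + 1) * (M + 1)" using \<open>M \<ge> 0\<close> \<open>e > 0\<close> by (intro mult_left_mono) auto
   also have "\<dots> = e" using \<open>M \<ge> 0\<close> by simp
   finally show "\<bar>inn X (u t - u s) w - ig s t (%r. inn X (v r) w)\<bar> \<le> 0 + e" by simp
  qed
  then show ?thesis by simp
 qed
 show ?thesis by (rule that[OF nZ Ysub Yc Ycl uvY main])
qed

end

lemma square_sum4_le:
 fixes a b c d :: real
 shows "(a + b + c + d)^2 \<le> 4 * (a^2 + b^2 + c^2 + d^2)"
proof -
 have "4 * (a^2 + b^2 + c^2 + d^2) - (a + b + c + d)^2 =
   (a - b)^2 + (a - c)^2 + (a - d)^2 + (b - c)^2 + (b - d)^2 + (c - d)^2"
  by (simp add: power2_eq_square algebra_simps)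
 then show ?thesis by (smt (verit) zero_le_power2)
qed

section \<open>Window averages and difference quotients\<close>

context semi_inner
begin

text \<open>Both ends of the window serve as reference points: the left one for the convergence of
  difference quotients, the right one for the implicit Euler argument.\<close>

abbreviation window_bound :: "(real => 'x) => real => (real => real) => real => bool" where
 "window_bound v k R t \<equiv> v t \<in> carr X \<and> v (t + k) \<in> carr X \<and> (AE r in ivl t (t + k). v r \<in> carr X) \<and>
   intable t (t + k) (%r. nrm X (v r - v t)) \<and> intable t (t + k) (%r. nrm X (v r - v (t + k))) \<and>
   ig t (t + k) (%r. nrm X (v r - v t)) \<le> k * R t \<and> ig t (t + k) (%r. nrm X (v r - v (t + k))) \<le> k * R t"

text \<open>The mean deviation over a window is controlled by the modulus
  \<open>g r + g t + \<eta>\<close>. Averaged over the window, \<open>g r\<close> becomes a function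
  whose \<open>L^2\<close> norm does not exceed that of \<open>g\<close>, so the whole bound
  \<open>R\<close> is small in \<open>L^2\<close>.\<close>

lemma window_error:
 assumes v: "L2c T v" and dl: "dl > 0" and T: "T > 0"
 obtains tau0 Z where "tau0 > 0" "negligible Z"
  "\<And>tau. 0 < tau ==> tau < tau0 ==> tau \<le> T ==> \<exists>R. sq_int 0 (T - tau) R \<and> ig 0 (T - tau) (%t. (R t)^2) \<le> dl \<and>
    (\<forall>t. t \<in> {0..T - tau} --> t \<notin> Z --> t + tau \<notin> Z -->
     window_bound v tau R t)"
proof -
 \<comment> \<open>\<open>R\<close> has four summands: three with square integral at most
   \<open>\<eta>\<close>, and the constant \<open>\<eta>\<close>, whose square integral is at most
   \<open>T * \<eta>\<close> thanks to \<open>\<eta> \<le> 1\<close>. The factor 4 is that of the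
   square of a sum of four terms.\<close>
 define \<eta> where "\<eta> = min 1 (dl / (4 * (3 + T)))"
 have \<eta>: "\<eta> > 0" "\<eta> \<le> 1" using dl T by (auto simp: \<eta>_def)
 have "\<eta> \<le> dl / (4 * (3 + T))" by (simp add: \<eta>_def)
 then have \<eta>d: "4 * (3 + T) * \<eta> \<le> dl" using T by (simp add: pos_le_divide_eq mult.commute)
 obtain g tau0 Z1 where g: "sq_int 0 T g" "\<And>t. 0 \<le> g t" "ig 0 T (%t. (g t)^2) \<le> \<eta>" "tau0 > 0" "negligible Z1"
  and mod: "\<And>s t. s \<in> {0..T} - Z1 ==> t \<in> {0..T} - Z1 ==> \<bar>s - t\<bar> < tau0 ==> nrm X (v s - v t) \<le> g s + g t + \<eta>"
  using L2c_modulus[OF v \<eta>(1)] by blast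
 obtain Z2 where Z2: "negligible Z2" "\<And>t. t \<in> {0..T} - Z2 ==> v t \<in> carr X"
  using L2c_carr[OF v] unfolding AE_ivl_iff by blast
 show ?thesis
 proof (rule that[of tau0 "Z1 \<union> Z2"])
  show "tau0 > 0" "negligible (Z1 \<union> Z2)" using g Z2 by auto
  fix tau assume tau: "0 < tau" "tau < tau0" "tau \<le> T"
  define m where "m t = ig t (t + tau) g / tau" for t
  define R where "R t = m t + g t + g (t + tau) + \<eta>" for t
  have ms: "sq_int 0 (T - tau) m"
   unfolding m_def by (intro sq_int_cont window_average_sq_le g tau)
  have gs: "sq_int 0 (T - tau) g" using tau by (intro sq_int_sub[OF g(1)]) auto
  have g2: "intable 0 T (%t. (g t)^2)" using g by (simp add: sq_int_def)
  have gt: "sq_int tau T g" using tau by (intro sq_int_sub[OF g(1)]) auto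
  have gsh: "sq_int 0 (T - tau) (%t. g (t + tau))"
   using gt ivl_shift(1)[of tau T "%t. (g t)^2" tau] ivl_meas_shift[of g tau T tau] by (simp add: sq_int_def)
  have Rs: "sq_int 0 (T - tau) R"
   unfolding R_def by (intro sq_int_add ms gs gsh sq_int_const)
  have i1: "ig 0 (T - tau) (%t. (m t)^2) \<le> \<eta>"
   using window_average_sq_le(2)[OF g(1) tau(1,3)] g(3) by (simp add: m_def)
  have i2: "ig 0 (T - tau) (%t. (g t)^2) \<le> \<eta>"
   using ivl_mono_sub[OF g2, of 0 "T - tau"] g(3) tau by simp
  have i3: "ig 0 (T - tau) (%t. (g (t + tau))^2) \<le> \<eta>"
   using ivl_mono_sub[OF g2, of tau T] ivl_shift(2)[of tau T "%t. (g t)^2" tau] gt g(3) tau by (simp add: sq_int_def)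
  have ii: "intable 0 (T - tau) (%t. (m t)^2)" "intable 0 (T - tau) (%t. (g t)^2)"
   "intable 0 (T - tau) (%t. (g (t + tau))^2)"
   using ms gs gsh by (auto simp: sq_int_def)
  have "ig 0 (T - tau) (%t. (R t)^2) \<le>
    ig 0 (T - tau) (%t. 4 * ((m t)^2 + (g t)^2 + (g (t + tau))^2 + \<eta>^2))"
   using Rs ii by (intro ivl_mono_AE AE_I2) (auto simp: sq_int_def R_def intro!: ivl_cont order_trans[OF square_sum4_le])
  also have "\<dots> = 4 * ig 0 (T - tau) (%t. (m t)^2 + (g t)^2 + (g (t + tau))^2 + \<eta>^2)"
   by (rule Henstock_Kurzweil_Integration.integral_mult_right)
  also have "\<dots> = 4 * (ig 0 (T - tau) (%t. (m t)^2) + ig 0 (T - tau) (%t. (g t)^2) +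
    ig 0 (T - tau) (%t. (g (t + tau))^2) + (T - tau) * \<eta>^2)"
  proof -
   have "ig 0 (T - tau) (%t. (m t)^2 + (g t)^2 + (g (t + tau))^2 + \<eta>^2) =
     ig 0 (T - tau) (%t. (m t)^2) + ig 0 (T - tau) (%t. (g t)^2) +
     ig 0 (T - tau) (%t. (g (t + tau))^2) + ig 0 (T - tau) (%t. \<eta>^2)"
    using ii by (simp add: ivl_add ivl_cont)
   then show ?thesis using tau by simp
  qed
  also have "\<dots> \<le> 4 * (\<eta> + \<eta> + \<eta> + T * \<eta>)"
  proof -
   have "\<eta>^2 \<le> \<eta>" using \<eta> by (simp add: power2_eq_square mult_left_le)
   then have "(T - tau) * \<eta>^2 \<le> T * \<eta>" using tau \<eta> by (intro mult_mono) auto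
   then show ?thesis using i1 i2 i3 by simp
  qed
  also have "\<dots> \<le> dl" using \<eta>d by (simp add: algebra_simps)
  finally have Rint: "ig 0 (T - tau) (%t. (R t)^2) \<le> dl" .
  have "window_bound v tau R t"
   if t: "t \<in> {0..T - tau}" "t \<notin> Z1 \<union> Z2" "t + tau \<notin> Z1 \<union> Z2" for t
  proof -
   have tz: "t \<in> {0..T} - Z1" "t + tau \<in> {0..T} - Z1" "t \<in> {0..T} - Z2" "t + tau \<in> {0..T} - Z2"
    using t tau by auto
   have c: "v t \<in> carr X" "v (t + tau) \<in> carr X" using Z2(2) tz by auto
   have ni: "intable t (t + tau) (%r. nrm X (v r - w))" if "w \<in> carr X" for w
    using t by (intro ivl_sub[OF sq_int_integrable[OF L2c_nrm[OF L2c_diff[OF v L2c_const[OF that]]]]]) auto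
   have gi: "intable t (t + tau) g"
    using t by (intro ivl_sub[OF sq_int_integrable[OF g(1)]]) auto
   have le: "ig t (t + tau) (%r. nrm X (v r - v b)) \<le> tau * (m t + g b + \<eta>)"
    if b: "b = t \<or> b = t + tau" for b
   proof -
    have bz: "b \<in> {0..T} - Z1" "v b \<in> carr X" using b tz c by auto
    have "ig t (t + tau) (%r. nrm X (v r - v b)) \<le> ig t (t + tau) (%r. g r + (g b + \<eta>))"
    proof (intro ivl_mono_AE ni bz Bochner_Integration.integrable_add gi ivl_cont continuous_on_const)
     show "AE r in ivl t (t + tau). nrm X (v r - v b) \<le> g r + (g b + \<eta>)"
     proof (rule AE_ivlI[OF g(5)])
      fix r assume r: "r \<in> {t..t + tau}" "r \<notin> Z1"
      then show "nrm X (v r - v b) \<le> g r + (g b + \<eta>)"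
       using mod[of r b] bz b t tau by auto
     qed
    qed
    also have "\<dots> = ig t (t + tau) g + ig t (t + tau) (%r. g b + \<eta>)"
     by (intro Henstock_Kurzweil_Integration.integral_add ivl_integrable_on gi ivl_cont continuous_on_const)
    also have "\<dots> = tau * (m t + g b + \<eta>)" using tau by (simp add: m_def field_simps)
    finally show ?thesis .
   qed
   have "tau * (m t + g t + \<eta>) \<le> tau * R t" "tau * (m t + g (t + tau) + \<eta>) \<le> tau * R t"
    using tau g(2) by (auto simp: R_def intro!: mult_left_mono)
   then show ?thesis
    using le[of t] le[of "t + tau"] c ni t
    by (auto intro!: AE_ivl_sub[OF L2c_carr[OF v]] simp del: mult_le_cancel_left_pos)
  qed
  then show "\<exists>R. sq_int 0 (T - tau) R \<and> ig 0 (T - tau) (%t. (R t)^2) \<le> dl \<and>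
    (\<forall>t. t \<in> {0..T - tau} --> t \<notin> Z1 \<union> Z2 --> t + tau \<notin> Z1 \<union> Z2 -->
     window_bound v tau R t)"
   using Rs Rint by (intro exI[of _ R]) blast
 qed
qed

lemma le_nrm_of_inn_le:
 assumes "w \<in> carr X" "inn X w w \<le> nrm X w * B" "0 \<le> B"
 shows "nrm X w \<le> B"
proof (cases "nrm X w = 0")
 case False
 then have "nrm X w > 0" using nrm_nonneg[OF assms(1)] by linarith
 moreover have "nrm X w * nrm X w \<le> nrm X w * B"
  using assms nrm_sq[OF assms(1)] by (simp add: power2_eq_square)
 ultimately show ?thesis by simp
qed (use assms in simp)

text \<open>The integrated identity is tested with the error \<open>w\<close> of the quotient
  itself. This is legitimate for almost every \<open>t\<close>, because \<open>w\<close> lies in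
  \<open>Y\<close> and the exceptional null set is the same for all vectors of
  \<open>Y\<close>.\<close>

lemma weak_tderiv_quotient_error:
 assumes u: "L2T X T u" and v: "L2T X T v" and wd: "weak_tderiv X T u v" and dl: "dl > 0" and T: "T > 0"
 obtains tau0 where "tau0 > 0"
  "\<And>tau. 0 < tau ==> tau < tau0 ==> tau \<le> T ==> \<exists>R. sq_int 0 (T - tau) R \<and> ig 0 (T - tau) (%t. (R t)^2) \<le> dl \<and>
    (AE t in ivl 0 (T - tau). nrm X ((u (t + tau) - u t) /R tau - v t) \<le> R t)"
proof -
 obtain Z1 Y where Z1: "negligible Z1" and Y: "subspace Y" "Y \<subseteq> carr X"
  and uvY: "\<And>t. t \<in> {0..T} - Z1 ==> u t \<in> Y \<and> v t \<in> Y"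
  and id: "\<And>s t w. s \<in> {0..T} - Z1 ==> t \<in> {0..T} - Z1 ==> s \<le> t ==> w \<in> Y ==>
    inn X (u t - u s) w = ig s t (%r. inn X (v r) w)"
  using weak_tderiv_primitive[OF u v wd] by metis
 note vc = L2T_L2c[OF v]
 obtain tau0 Z2 where tau0: "tau0 > 0" and Z2: "negligible Z2" and
  err: "\<And>tau. 0 < tau ==> tau < tau0 ==> tau \<le> T ==> \<exists>R. sq_int 0 (T - tau) R \<and> ig 0 (T - tau) (%t. (R t)^2) \<le> dl \<and>
    (\<forall>t. t \<in> {0..T - tau} --> t \<notin> Z2 --> t + tau \<notin> Z2 -->
     window_bound v tau R t)"
  using window_error[OF vc dl T] by blast
 show ?thesis
 proof (rule that[OF tau0])
  fix tau assume tau: "0 < tau" "tau < tau0" "tau \<le> T"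
  from err[OF this] obtain R where R: "sq_int 0 (T - tau) R" "ig 0 (T - tau) (%t. (R t)^2) \<le> dl"
   "\<And>t. t \<in> {0..T - tau} ==> t \<notin> Z2 ==> t + tau \<notin> Z2 ==>
     v t \<in> carr X \<and> (AE r in ivl t (t + tau). v r \<in> carr X) \<and>
     intable t (t + tau) (%r. nrm X (v r - v t)) \<and>
     ig t (t + tau) (%r. nrm X (v r - v t)) \<le> tau * R t" by blast
  define Z where "Z = Z1 \<union> Z2"
  have nZ: "negligible Z" using Z1 Z2 by (auto simp: Z_def)
  have "AE t in ivl 0 (T - tau). nrm X ((u (t + tau) - u t) /R tau - v t) \<le> R t"
  proof (rule AE_ivlI[of "Z \<union> (+) (- tau) ` Z"])
   show "negligible (Z \<union> (+) (- tau) ` Z)" using nZ by (intro negligible_Un negligible_translation)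
   fix t assume t: "t \<in> {0..T - tau}" "t \<notin> Z \<union> (+) (- tau) ` Z"
   then have t2: "t + tau \<notin> Z" by (auto simp: image_iff)
   have z1: "t \<in> {0..T} - Z1" "t + tau \<in> {0..T} - Z1" using t t2 tau by (auto simp: Z_def)
   have r: "(AE r in ivl t (t + tau). v r \<in> carr X)" "intable t (t + tau) (%r. nrm X (v r - v t))"
     "ig t (t + tau) (%r. nrm X (v r - v t)) \<le> tau * R t"
    using R(3)[of t] t t2 by (auto simp: Z_def)
   define w where "w = (u (t + tau) - u t) /R tau - v t"
   have wY: "w \<in> Y"
    unfolding w_def using uvY[OF z1(1)] uvY[OF z1(2)] Y(1)
    by (intro subspace_diff subspace_scale) auto
   have c: "u t \<in> carr X" "u (t + tau) \<in> carr X" "v t \<in> carr X" "w \<in> carr X"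
    using uvY[OF z1(1)] uvY[OF z1(2)] wY Y(2) by auto
   have vi: "intable t (t + tau) (%r. inn X (v r) w)"
    using t by (intro ivl_sub[OF L2c_inn[OF vc L2c_const[OF c(4)]]]) auto
   have "tau * inn X w w = inn X (u (t + tau) - u t) w - tau * inn X (v t) w"
   proof -
    have "inn X w w = inn X (u (t + tau) - u t) w / tau - inn X (v t) w"
     using c by (subst (1) w_def) (simp add: inn_diff_left inn_scale_left divide_inverse mult.commute)
    then show ?thesis using tau by (simp add: field_simps)
   qed
   also have "\<dots> = ig t (t + tau) (%r. inn X (v r) w) - ig t (t + tau) (%r. inn X (v t) w)"
    using id[OF z1 _ wY] tau by simp
   also have "\<dots> = ig t (t + tau) (%r. inn X (v r) w - inn X (v t) w)"
    by (intro Henstock_Kurzweil_Integration.integral_diff[symmetric] ivl_integrable_on vi ivl_cont continuous_on_const)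
   also have "\<dots> \<le> ig t (t + tau) (%r. nrm X w * nrm X (v r - v t))"
   proof (rule ivl_mono_AE)
    show "intable t (t + tau) (%r. inn X (v r) w - inn X (v t) w)"
     by (intro Bochner_Integration.integrable_diff vi ivl_cont[OF continuous_on_const])
    show "intable t (t + tau) (%r. nrm X w * nrm X (v r - v t))"
     by (intro integrable_mult_right r)
    show "AE r in ivl t (t + tau). inn X (v r) w - inn X (v t) w \<le> nrm X w * nrm X (v r - v t)"
     using r(1)
    proof eventually_elim
     case (elim r)
     then show ?case
      using inn_le_nrm[of "v r - v t" w] c by (simp add: inn_diff_left mult.commute)
    qed
   qed
   also have "\<dots> = nrm X w * ig t (t + tau) (%r. nrm X (v r - v t))" by simp
   also have "\<dots> \<le> nrm X w * (tau * R t)" using r c by (intro mult_left_mono) auto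
   finally have 1: "inn X w w \<le> nrm X w * R t" using tau by (simp add: mult.left_commute)
   have "0 \<le> ig t (t + tau) (%r. nrm X (v r - v t))"
    using r c by (intro ivl_nonneg) (auto elim!: eventually_mono)
   then have "0 \<le> tau * R t" using r by linarith
   then have "0 \<le> R t" using tau by (simp add: zero_le_mult_iff)
   then show "nrm X ((u (t + tau) - u t) /R tau - v t) \<le> R t"
    using le_nrm_of_inn_le[OF c(4) 1] by (simp add: w_def)
  qed
  then show "\<exists>R. sq_int 0 (T - tau) R \<and> ig 0 (T - tau) (%t. (R t)^2) \<le> dl \<and>
    (AE t in ivl 0 (T - tau). nrm X ((u (t + tau) - u t) /R tau - v t) \<le> R t)"
   using R by blast
 qed
qed

end

section \<open>The energy inequality for weak solutions\<close>

context semi_inner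
begin

text \<open>Implicit Euler idea: \<open>|u(s+tau)|^2 - |u(s)|^2 \<le> 2 (u(s+tau) - u(s), u(s+tau))\<close>, where the right-hand
 side is accessible to the weak equation since \<open>u(s+tau)\<close> is an admissible test function for almost
 every \<open>s\<close>. Averaging over \<open>s\<close> and letting \<open>tau \<rightarrow> 0\<close> gives the energy inequality.\<close>

lemma weak_energy_at_end:
 assumes T: "T > 0" and u: "contT X T u" and n: "L2c T n" and k: "L2c T k"
  and K: "\<And>q. q \<in> V ==> q \<in> carr X \<and> K q \<in> carr X"
  and A: "\<And>x. x \<in> carr X ==> A x \<in> carr X" "\<And>x y. x \<in> carr X ==> y \<in> carr X ==> nrm X (A x - A y) \<le> B * nrm X (x - y)"
   "\<And>x. x \<in> carr X ==> 0 \<le> inn X (A x) x" "0 \<le> B"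
  and uV: "AE t in ivl 0 T. u t \<in> V \<and> nrm X (K (u t) - k t) = 0"
  and eq: "\<And>q s t. q \<in> V ==> 0 \<le> s ==> s \<le> t ==> t \<le> T ==>
   inn X (u t - u s) q = ig s t (%r. inn X (n r) (K q) - inn X (A (u r)) q)"
 shows "(nrm X (u T))^2 \<le> (nrm X (u 0))^2 + 2 * ig 0 T (%t. inn X (n t) (k t))"
proof -
 define F where "F t = nrm X (k t)" for t
 define H where "H t = nrm X (u t)" for t
 define E where "E t = inn X (n t) (k t)" for t
 define c where "c = sqrt (ig 0 T (%t. (F t)^2)) + B * sqrt (ig 0 T (%t. (H t)^2))"
 have Fs: "sq_int 0 T F" unfolding F_def by (rule L2c_nrm[OF k])
 have Hs: "sq_int 0 T H" unfolding H_def by (rule L2c_nrm[OF contT_L2c[OF u]])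
 have Ei: "intable 0 T E" unfolding E_def by (rule L2c_inn[OF n k])
 have Hc: "continuous_on {0..T} (%t. (H t)^2)" unfolding H_def by (intro continuous_intros contT_nrm u)
 have c0: "0 \<le> c" unfolding c_def using A by (intro add_nonneg_nonneg mult_nonneg_nonneg real_sqrt_ge_zero ivl_nonneg)
  (use Fs Hs in \<open>auto simp: sq_int_def\<close>)
 have main: "(H T)^2 - (H 0)^2 \<le> 2 * ig 0 T E + 4 * dl + 2 * sqrt dl * c" if dl: "dl > 0" for dl
 proof -
  obtain taun Zn where taun: "taun > 0" "negligible Zn" and
   errn: "\<And>tau. 0 < tau ==> tau < taun ==> tau \<le> T ==> \<exists>R. sq_int 0 (T - tau) R \<and> ig 0 (T - tau) (%t. (R t)^2) \<le> dl \<and>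
    (\<forall>t. t \<in> {0..T - tau} --> t \<notin> Zn --> t + tau \<notin> Zn -->
     window_bound n tau R t)"
   using window_error[OF n dl T] by blast
  obtain tauu Zu where tauu: "tauu > 0" "negligible Zu" and
   erru: "\<And>tau. 0 < tau ==> tau < tauu ==> tau \<le> T ==> \<exists>R. sq_int 0 (T - tau) R \<and> ig 0 (T - tau) (%t. (R t)^2) \<le> dl \<and>
    (\<forall>t. t \<in> {0..T - tau} --> t \<notin> Zu --> t + tau \<notin> Zu -->
     window_bound u tau R t)"
   using window_error[OF contT_L2c[OF u] dl T] by blast
  have "\<exists>d>0. \<forall>t\<in>{0..T}. \<bar>t - b\<bar> < d --> \<bar>f t - f b\<bar> < dl"
   if "continuous_on {0..T} f" "b \<in> {0..T}" for f :: "real => real" and b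
   using that dl unfolding continuous_on_iff dist_real_def by blast
  note cont = this
  have "continuous_on {0..T} (%x. ig 0 x E)"
   using Ei by (intro indefinite_integral_continuous_1 ivl_integrable_on)
  from cont[OF this, of 0] obtain d1 where d1: "d1 > 0" "\<And>t. t \<in> {0..T} ==> t < d1 ==> \<bar>ig 0 t E\<bar> < dl"
   using T by auto
  from cont[OF Hc, of 0] obtain d2 where d2: "d2 > 0" "\<And>t. t \<in> {0..T} ==> t < d2 ==> \<bar>(H t)^2 - (H 0)^2\<bar> < dl"
   using T by auto
  obtain d3 where d3: "d3 > 0" and d3': "\<forall>t\<in>{0..T}. \<bar>t - T\<bar> < d3 --> \<bar>(H t)^2 - (H T)^2\<bar> < dl"
   using cont[OF Hc, of T] T by auto
  define tau where "tau = min (min (taun / 2) (tauu / 2)) (min (min (d1 / 2) (d2 / 2)) (min (d3 / 2) T))"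
  have tau: "0 < tau" "tau < taun" "tau < tauu" "tau < d1" "tau < d2" "tau < d3" "tau \<le> T"
   unfolding tau_def using taun tauu d1 d2 d3 T by (auto simp: min_def)
  from errn[OF tau(1,2,7)] obtain R where R: "sq_int 0 (T - tau) R" "ig 0 (T - tau) (%t. (R t)^2) \<le> dl"
   "\<And>t. t \<in> {0..T - tau} ==> t \<notin> Zn ==> t + tau \<notin> Zn ==>
     n (t + tau) \<in> carr X \<and> (AE r in ivl t (t + tau). n r \<in> carr X) \<and>
     intable t (t + tau) (%r. nrm X (n r - n (t + tau))) \<and>
     ig t (t + tau) (%r. nrm X (n r - n (t + tau))) \<le> tau * R t" by blast
  from erru[OF tau(1,3,7)] obtain Q where Q: "sq_int 0 (T - tau) Q" "ig 0 (T - tau) (%t. (Q t)^2) \<le> dl"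
   "\<And>t. t \<in> {0..T - tau} ==> t \<notin> Zu ==> t + tau \<notin> Zu ==>
     intable t (t + tau) (%r. nrm X (u r - u (t + tau))) \<and>
     ig t (t + tau) (%r. nrm X (u r - u (t + tau))) \<le> tau * Q t" by blast
  obtain Zk where Zk: "negligible Zk" "\<And>t. t \<in> {0..T} - Zk ==> u t \<in> V \<and> nrm X (K (u t) - k t) = 0 \<and> k t \<in> carr X"
  proof -
   have "AE t in ivl 0 T. u t \<in> V \<and> nrm X (K (u t) - k t) = 0 \<and> k t \<in> carr X"
    using uV L2c_carr[OF k] by eventually_elim blast
   then show ?thesis using that unfolding AE_ivl_iff by blast
  qed
  define Z where "Z = Zn \<union> Zu \<union> Zk"
  have nZ: "negligible Z" using taun tauu Zk by (auto simp: Z_def)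
  \<comment> \<open>The estimate on one window. Inside it, \<open>n\<close> and \<open>u\<close> are
    compared with their values at the right end, where \<open>u\<close> is an admissible test
    function; \<open>R\<close> and \<open>Q\<close> measure what this costs.\<close>
  have point: "(H (s + tau))^2 - (H s)^2 \<le> 2 * tau * (E (s + tau) + R s * F (s + tau) + B * (Q s * H (s + tau)))"
   if s: "s \<in> {0..T - tau}" "s \<notin> Z" "s + tau \<notin> Z" for s
  proof -
   define b where "b = s + tau"
   have bT: "b \<in> {0..T}" "s \<in> {0..T}" "s \<le> b" using s tau by (auto simp: b_def)
   have nb: "n b \<in> carr X" "AE r in ivl s b. n r \<in> carr X"
    "intable s b (%r. nrm X (n r - n b))" "ig s b (%r. nrm X (n r - n b)) \<le> tau * R s"
    unfolding b_def using R(3)[of s] s by (auto simp: Z_def)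
   have ub: "intable s b (%r. nrm X (u r - u b))" "ig s b (%r. nrm X (u r - u b)) \<le> tau * Q s"
    unfolding b_def using Q(3)[of s] s by (auto simp: Z_def)
   have kb: "u b \<in> V" "nrm X (K (u b) - k b) = 0" "k b \<in> carr X"
    using Zk(2)[of b] s bT by (auto simp: b_def Z_def)
   have uc: "u r \<in> carr X" if "r \<in> {0..T}" for r using contT_carr[OF u that] .
   have Kc: "K (u b) \<in> carr X" using K kb by blast
   have Kk: "inn X x (K (u b)) = inn X x (k b)" if "x \<in> carr X" for x
    using inn_eqI[OF Kc kb(3) that kb(2)] inn_commute that Kc kb by metis
   have "(H b)^2 - (H s)^2 \<le> 2 * inn X (u b - u s) (u b)"
   proof -
    have "0 \<le> inn X (u b - u s) (u b - u s)" using uc bT by (intro inn_nonneg) auto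
    then show ?thesis
     using uc bT by (simp add: H_def nrm_sq inn_simps inn_commute[of "u s" "u b"])
   qed
   also have "inn X (u b - u s) (u b) = ig s b (%r. inn X (n r) (K (u b)) - inn X (A (u r)) (u b))"
    using eq[OF kb(1), of s b] bT by auto
   also have "\<dots> \<le> ig s b (%r. E b + F b * nrm X (n r - n b) + B * H b * nrm X (u r - u b))"
   proof (rule ivl_mono_AE)
    have "L2c T (%r. A (u r))" by (rule L2c_map[OF contT_L2c[OF u] A(1,2)])
    then show "intable s b (%r. inn X (n r) (K (u b)) - inn X (A (u r)) (u b))"
     using bT uc Kc n by (intro ivl_sub[of 0 T _ s b] Bochner_Integration.integrable_diff L2c_inn L2c_const) auto
    show "intable s b (%r. E b + F b * nrm X (n r - n b) + B * H b * nrm X (u r - u b))"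
     by (intro Bochner_Integration.integrable_add integrable_mult_right nb ub ivl_cont continuous_on_const)
    have "AE r in ivl s b. r \<in> {s..b}" by (rule AE_ivl_all)
    then show "AE r in ivl s b. inn X (n r) (K (u b)) - inn X (A (u r)) (u b) \<le>
      E b + F b * nrm X (n r - n b) + B * H b * nrm X (u r - u b)"
     using nb(2)
    proof eventually_elim
     case (elim r)
     have ur: "u r \<in> carr X" "u b \<in> carr X" using uc bT elim by auto
     have Ac: "A (u r) \<in> carr X" "A (u b) \<in> carr X" using A ur by auto
     have "inn X (n r) (K (u b)) = E b + inn X (n r - n b) (k b)"
      using Kk[OF elim(2)] elim nb kb by (simp add: E_def inn_diff_left)
     also have "inn X (n r - n b) (k b) \<le> F b * nrm X (n r - n b)"
      using inn_le_nrm[of "n r - n b" "k b"] elim nb kb by (simp add: F_def mult.commute)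
     finally have 1: "inn X (n r) (K (u b)) \<le> E b + F b * nrm X (n r - n b)" by simp
     \<comment> \<open>Freezing \<open>A (u r)\<close> at the right end gives a term of good sign,
       which is dropped, and a remainder bounded by the Lipschitz constant.\<close>
     have "- inn X (A (u r)) (u b) = inn X (A (u b) - A (u r)) (u b) - inn X (A (u b)) (u b)"
      using ur Ac by (simp add: inn_diff_left)
     also have "\<dots> \<le> inn X (A (u b) - A (u r)) (u b)" using A(3) ur by simp
     also have "\<dots> \<le> nrm X (A (u b) - A (u r)) * nrm X (u b)" using ur Ac by (intro inn_le_nrm) auto
     also have "\<dots> \<le> (B * nrm X (u b - u r)) * nrm X (u b)" using ur A by (intro mult_right_mono) auto
     also have "\<dots> = B * H b * nrm X (u r - u b)" using nrm_diff_commute[OF ur] by (simp add: H_def)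
     finally show ?case using 1 by simp
    qed
   qed
   also have "\<dots> = tau * E b + F b * ig s b (%r. nrm X (n r - n b)) + B * H b * ig s b (%r. nrm X (u r - u b))"
   proof -
    have "ig s b (%r. E b + F b * nrm X (n r - n b) + B * H b * nrm X (u r - u b)) =
      ig s b (%r. E b) + ig s b (%r. F b * nrm X (n r - n b)) + ig s b (%r. B * H b * nrm X (u r - u b))"
     using nb(3) ub(1) by (simp add: ivl_add ivl_cont del: Henstock_Kurzweil_Integration.integral_mult_right)
    then show ?thesis using bT by (simp add: b_def)
   qed
   also have "\<dots> \<le> tau * E b + F b * (tau * R s) + B * H b * (tau * Q s)"
    by (intro add_mono[OF add_mono[OF order_refl mult_left_mono[OF nb(4)]] mult_left_mono[OF ub(2)]])
     (use A(4) uc[OF bT(1)] kb in \<open>auto simp: F_def H_def\<close>)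
   finally show ?thesis by (simp add: b_def algebra_simps)
  qed
  define E' where "E' s = E (s + tau)" for s
  define F' where "F' s = F (s + tau)" for s
  define H' where "H' s = H (s + tau)" for s
  have Eitau: "intable tau T E" using tau by (intro ivl_sub[OF Ei]) auto
  have E'i: "intable 0 (T - tau) E'" "ig 0 (T - tau) E' = ig tau T E"
   using ivl_shift[OF Eitau, of tau] by (auto simp: E'_def[abs_def])
  have sh: "sq_int 0 (T - tau) (%s. G (s + tau))"
    "ig 0 (T - tau) (%s. (G (s + tau))^2) \<le> ig 0 T (%s. (G s)^2)" if "sq_int 0 T G" for G
  proof -
   have G: "sq_int tau T G" "intable 0 T (%s. (G s)^2)"
    using that tau sq_int_sub[OF that, of tau T] by (auto simp: sq_int_def)
   then show "sq_int 0 (T - tau) (%s. G (s + tau))"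
    using ivl_shift(1)[of tau T "%s. (G s)^2" tau] ivl_meas_shift[of G tau T tau] by (simp add: sq_int_def)
   show "ig 0 (T - tau) (%s. (G (s + tau))^2) \<le> ig 0 T (%s. (G s)^2)"
    using ivl_shift(2)[of tau T "%s. (G s)^2" tau] G ivl_mono_sub[OF G(2), of tau T] tau by (simp add: sq_int_def)
  qed
  have F's: "sq_int 0 (T - tau) F'" "ig 0 (T - tau) (%s. (F' s)^2) \<le> ig 0 T (%s. (F s)^2)"
   using sh[OF Fs] by (auto simp: F'_def[abs_def])
  have H's: "sq_int 0 (T - tau) H'" "ig 0 (T - tau) (%s. (H' s)^2) \<le> ig 0 T (%s. (H s)^2)"
   using sh[OF Hs] by (auto simp: H'_def[abs_def])
  have RF: "intable 0 (T - tau) (%s. R s * F' s)" "intable 0 (T - tau) (%s. Q s * H' s)"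
   by (intro sq_int_mult R F's Q H's)+
  have cs: "ig 0 (T - tau) (%s. P s * G' s) \<le> sqrt dl * sqrt (ig 0 T (%s. (G s)^2))"
   if "sq_int 0 (T - tau) P" "ig 0 (T - tau) (%t. (P t)^2) \<le> dl" "sq_int 0 (T - tau) G'"
    "ig 0 (T - tau) (%s. (G' s)^2) \<le> ig 0 T (%s. (G s)^2)" for P G G'
  proof -
   have "0 \<le> ig 0 (T - tau) (%s. (G' s)^2)" using that by (intro ivl_nonneg) (auto simp: sq_int_def)
   then show ?thesis
    using dl that by (intro order_trans[OF sq_int_Cauchy_Schwarz] mult_mono real_sqrt_le_mono) auto
  qed
  have c1: "continuous_on {0..T - tau} (%s. (H (s + tau))^2)" "continuous_on {0..T - tau} (%s. (H s)^2)"
   using tau by (auto intro!: continuous_on_compose2[OF Hc, of _ "%s. s + tau"] continuous_on_subset[OF Hc] continuous_on_add continuous_on_id continuous_on_const)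
  have "ig 0 (T - tau) (%s. (H (s + tau))^2 - (H s)^2) \<le>
    ig 0 (T - tau) (%s. 2 * tau * (E' s + R s * F' s + B * (Q s * H' s)))"
  proof (rule ivl_mono_AE)
   show "intable 0 (T - tau) (%s. (H (s + tau))^2 - (H s)^2)" by (intro ivl_cont continuous_intros c1)
   show "intable 0 (T - tau) (%s. 2 * tau * (E' s + R s * F' s + B * (Q s * H' s)))"
    by (intro Bochner_Integration.integrable_add integrable_mult_right E'i RF)
   show "AE s in ivl 0 (T - tau). (H (s + tau))^2 - (H s)^2 \<le> 2 * tau * (E' s + R s * F' s + B * (Q s * H' s))"
   proof (rule AE_ivlI[of "Z \<union> (+) (- tau) ` Z"])
    show "negligible (Z \<union> (+) (- tau) ` Z)" using nZ by (intro negligible_Un negligible_translation)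
    fix s assume s: "s \<in> {0..T - tau}" "s \<notin> Z \<union> (+) (- tau) ` Z"
    then have "s + tau \<notin> Z" by (auto simp: image_iff)
    then show "(H (s + tau))^2 - (H s)^2 \<le> 2 * tau * (E' s + R s * F' s + B * (Q s * H' s))"
     using point[of s] s by (simp add: E'_def F'_def H'_def)
   qed
  qed
  also have "\<dots> = 2 * tau * (ig 0 (T - tau) E' + ig 0 (T - tau) (%s. R s * F' s) + B * ig 0 (T - tau) (%s. Q s * H' s))"
  proof -
   have "ig 0 (T - tau) (%s. E' s + R s * F' s + B * (Q s * H' s)) =
     ig 0 (T - tau) E' + ig 0 (T - tau) (%s. R s * F' s) + ig 0 (T - tau) (%s. B * (Q s * H' s))"
    using E'i(1) RF by (simp add: ivl_add del: Henstock_Kurzweil_Integration.integral_mult_right)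
   then show ?thesis by simp
  qed
  also have "\<dots> \<le> 2 * tau * (ig 0 T E + dl + sqrt dl * c)"
  proof (intro mult_left_mono)
   have "ig 0 tau E + ig tau T E = ig 0 T E"
    using tau by (intro ivl_combine Ei) auto
   moreover have "\<bar>ig 0 tau E\<bar> < dl" using d1(2)[of tau] tau by auto
   moreover have "ig 0 (T - tau) (%s. R s * F' s) \<le> sqrt dl * sqrt (ig 0 T (%s. (F s)^2))"
    by (rule cs[OF R(1,2) F's])
   moreover have "B * ig 0 (T - tau) (%s. Q s * H' s) \<le> B * (sqrt dl * sqrt (ig 0 T (%s. (H s)^2)))"
    by (intro mult_left_mono cs[OF Q(1,2) H's] A(4))
   ultimately show "ig 0 (T - tau) E' + ig 0 (T - tau) (%s. R s * F' s) + B * ig 0 (T - tau) (%s. Q s * H' s)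
     \<le> ig 0 T E + dl + sqrt dl * c"
    by (simp add: E'i(2) c_def algebra_simps)
  qed (use tau in auto)
  finally have up: "ig 0 (T - tau) (%s. (H (s + tau))^2 - (H s)^2) \<le> 2 * tau * (ig 0 T E + dl + sqrt dl * c)" .
  \<comment> \<open>The integrated difference telescopes to the two end windows, on which the square
    of \<open>H\<close> is within \<open>dl\<close> of its values at \<open>T\<close> and at
    0.\<close>
  have "ig 0 (T - tau) (%s. (H (s + tau))^2 - (H s)^2) = ig 0 (T - tau) (%s. (H (s + tau))^2) - ig 0 (T - tau) (%s. (H s)^2)"
   by (intro Henstock_Kurzweil_Integration.integral_diff integrable_continuous_interval c1)
  also have "ig 0 (T - tau) (%s. (H (s + tau))^2) = ig tau T (%s. (H s)^2)"
   using ivl_shift(2)[OF ivl_cont, of tau T "%s. (H s)^2" tau] continuous_on_subset[OF Hc] tau by simp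
  also have "ig tau T (%s. (H s)^2) - ig 0 (T - tau) (%s. (H s)^2) =
    ig (T - tau) T (%s. (H s)^2) - ig 0 tau (%s. (H s)^2)"
   using ivl_combine[OF ivl_cont[OF Hc], of tau] ivl_combine[OF ivl_cont[OF Hc], of "T - tau"] tau by simp
  also have "\<dots> \<ge> tau * ((H T)^2 - dl) - tau * ((H 0)^2 + dl)"
  proof -
   have "ig (T - tau) T (%s. (H T)^2 - dl) \<le> ig (T - tau) T (%s. (H s)^2)"
   proof (intro ivl_mono_AE ivl_cont continuous_on_const continuous_on_subset[OF Hc] AE_ivl_all)
    fix t assume t: "t \<in> {T - tau..T}"
    then have "\<bar>(H t)^2 - (H T)^2\<bar> < dl" using d3'[rule_format, of t] tau by auto
    then show "(H T)^2 - dl \<le> (H t)^2" by linarith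
   qed (use tau in auto)
   moreover have "ig 0 tau (%s. (H s)^2) \<le> ig 0 tau (%s. (H 0)^2 + dl)"
   proof (intro ivl_mono_AE ivl_cont continuous_on_const continuous_on_subset[OF Hc] AE_ivl_all)
    fix t assume t: "t \<in> {0..tau}"
    then have "\<bar>(H t)^2 - (H 0)^2\<bar> < dl" using d2(2)[of t] tau by auto
    then show "(H t)^2 \<le> (H 0)^2 + dl" by linarith
   qed (use tau in auto)
   ultimately show ?thesis using tau by simp
  qed
  finally have "tau * ((H T)^2 - dl) - tau * ((H 0)^2 + dl) \<le> 2 * tau * (ig 0 T E + dl + sqrt dl * c)"
   using up by linarith
  then have "tau * ((H T)^2 - (H 0)^2) \<le> tau * (2 * ig 0 T E + 4 * dl + 2 * sqrt dl * c)"
   by (simp add: algebra_simps)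
  then show ?thesis using tau(1) by simp
 qed
 have "(H T)^2 - (H 0)^2 \<le> 2 * ig 0 T E"
 proof (rule tendsto_lowerbound)
  show "((%dl. 2 * ig 0 T E + 4 * dl + 2 * sqrt dl * c) ---> 2 * ig 0 T E) (at_right 0)"
   by (auto intro!: tendsto_eq_intros)
  show "\<forall>\<^sub>F dl in at_right 0. (H T)^2 - (H 0)^2 \<le> 2 * ig 0 T E + 4 * dl + 2 * sqrt dl * c"
   using main by (simp add: eventually_at_right_field) (meson zero_less_one)
 qed simp
 then show ?thesis by (simp add: H_def E_def[abs_def])
qed

text \<open>With \<open>S - D n\<close> in place of \<open>K u\<close>, Young's inequality with
  weight \<open>d\<close> bounds twice the product of \<open>n\<close> and \<open>S\<close> by d
  |n|^2 + |S|^2 / d. The first term is absorbed by one of the two copies of the dissipation; the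
  other copy is what appears on the left.\<close>

lemma weak_energy:
 assumes t: "0 \<le> t" "t \<le> T" and u: "contT X T u" and n: "L2c T n" and S: "L2c T S"
  and K: "\<And>q. q \<in> V ==> q \<in> carr X \<and> K q \<in> carr X"
  and A: "\<And>x. x \<in> carr X ==> A x \<in> carr X" "\<And>x y. x \<in> carr X ==> y \<in> carr X ==> nrm X (A x - A y) \<le> B * nrm X (x - y)"
   "\<And>x. x \<in> carr X ==> 0 \<le> inn X (A x) x" "0 \<le> B"
  and D: "\<And>x. x \<in> carr X ==> D x \<in> carr X" "\<And>x y. x \<in> carr X ==> y \<in> carr X ==> nrm X (D x - D y) \<le> BD * nrm X (x - y)"
   "\<And>x. x \<in> carr X ==> d * inn X x x \<le> inn X (D x) x" "0 < d"
  and uV: "AE t in ivl 0 T. u t \<in> V \<and> nrm X (K (u t) - (S t - D (n t))) = 0"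
  and eq: "\<And>q s t. q \<in> V ==> 0 \<le> s ==> s \<le> t ==> t \<le> T ==>
   inn X (u t - u s) q = ig s t (%r. inn X (n r) (K q) - inn X (A (u r)) q)"
 shows "(nrm X (u t))^2 + ig 0 t (%t. inn X (D (n t)) (n t)) \<le>
  (nrm X (u 0))^2 + nI 0 t S / d"
proof (cases "t = 0")
 case False
 have Dn: "L2c T (%t. D (n t))" by (rule L2c_map[OF n D(1,2)])
 have k: "L2c t (%t. S t - D (n t))" using t by (intro L2c_sub[OF L2c_diff[OF S Dn]]) auto
 have "(nrm X (u t))^2 \<le> (nrm X (u 0))^2 + 2 * ig 0 t (%t. inn X (n t) (S t - D (n t)))"
 proof (rule weak_energy_at_end[OF _ _ _ k K A])
  show "contT X t u" "L2c t n" using t by (auto intro: contT_sub[OF u] L2c_sub[OF n])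
  show "AE t in ivl 0 t. u t \<in> V \<and> nrm X (K (u t) - (S t - D (n t))) = 0"
   using t by (intro AE_ivl_sub[OF uV]) auto
 qed (use t False eq in auto)
 moreover have "2 * ig 0 t (%t. inn X (n t) (S t - D (n t))) \<le>
   ig 0 t (%t. (1 / d) * (nrm X (S t))^2 - inn X (D (n t)) (n t))"
 proof -
  have i: "intable 0 t (%t. inn X (n t) (S t - D (n t)))"
   "intable 0 t (%t. (1 / d) * (nrm X (S t))^2 - inn X (D (n t)) (n t))"
   using L2c_inn[OF L2c_sub[OF n t(2)] k] L2c_nrm[OF L2c_sub[OF S t(2)]]
    L2c_inn[OF L2c_sub[OF Dn t(2)] L2c_sub[OF n t(2)]]
   by (auto simp: sq_int_def)
  have "ig 0 t (%t. 2 * inn X (n t) (S t - D (n t))) \<le>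
   ig 0 t (%t. (1 / d) * (nrm X (S t))^2 - inn X (D (n t)) (n t))"
  proof (intro ivl_mono_AE i integrable_mult_right)
   show "AE t in ivl 0 t. 2 * inn X (n t) (S t - D (n t)) \<le> (1 / d) * (nrm X (S t))^2 - inn X (D (n t)) (n t)"
    using L2c_carr[OF L2c_sub[OF n t(2)]] L2c_carr[OF L2c_sub[OF S t(2)]]
   proof eventually_elim
    case (elim t)
    have "0 \<le> inn X (d *R n t - S t) (d *R n t - S t)" using elim by (intro inn_nonneg) auto
    also have "\<dots> = d * (d * inn X (n t) (n t) - 2 * inn X (n t) (S t) + (nrm X (S t))^2 / d)"
     using elim D(4) by (simp add: inn_simps nrm_sq inn_commute[of "S t" "n t"] algebra_simps)
    finally have "2 * inn X (n t) (S t) \<le> d * inn X (n t) (n t) + (nrm X (S t))^2 / d"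
     using D(4) by (simp add: zero_le_mult_iff)
    also have "d * inn X (n t) (n t) \<le> inn X (D (n t)) (n t)" using D(3) elim by simp
    finally show ?case
     using elim D(1) by (simp add: inn_diff_right inn_commute[of "D (n t)" "n t"])
   qed
  qed
  then show ?thesis by simp
 qed
 moreover have "ig 0 t (%t. (1 / d) * (nrm X (S t))^2 - inn X (D (n t)) (n t)) =
   nI 0 t S / d - ig 0 t (%t. inn X (D (n t)) (n t))"
  using L2c_nrm[OF L2c_sub[OF S t(2)]] L2c_inn[OF L2c_sub[OF Dn t(2)] L2c_sub[OF n t(2)]]
  by (subst Henstock_Kurzweil_Integration.integral_diff) (auto simp: sq_int_def intro!: ivl_integrable_on)
 ultimately show ?thesis by simp
qed simp

end

section \<open>Strong time derivatives and difference quotients\<close>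

definition dq :: "real => (real => 'x::real_vector) => real => 'x" where
 "dq k u t = (u (t + k) - u t) /R k"

context semi_inner
begin

text \<open>A relation and not an operator, because the derivative is determined only up to distance
  zero. At the end points the limit is one-sided.\<close>

definition sderiv :: "real => (real => 'x) => (real => 'x) => bool" where
 "sderiv T u u' \<longleftrightarrow> (\<forall>t\<in>{0..T}. u' t \<in> carr X \<and>
   ((%s. nrm X ((u s - u t) /R (s - t) - u' t)) ---> 0) (at t within {0..T}))"

lemma sderiv_carr: "sderiv T u u' ==> t \<in> {0..T} ==> u' t \<in> carr X"
 by (simp add: sderiv_def)

lemma sderiv_tendsto: "sderiv T u u' ==> t \<in> {0..T} ==>
  ((%s. nrm X ((u s - u t) /R (s - t) - u' t)) ---> 0) (at t within {0..T})"
 by (simp add: sderiv_def)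

lemma tendsto_zero_le:
 fixes f g :: "real => real"
 assumes "(g ---> 0) F" "\<forall>\<^sub>F x in F. 0 \<le> f x" "\<forall>\<^sub>F x in F. f x \<le> g x"
 shows "(f ---> 0) F"
 by (rule tendsto_sandwich[OF assms(2,3) tendsto_const assms(1)])

lemma ev_in: "(\<And>s. s \<in> S ==> P s) ==> \<forall>\<^sub>F s in at t within S. P s"
 by (auto simp: eventually_at_filter)

lemma sderiv_add:
 assumes u: "sderiv T u u'" "\<And>t. t \<in> {0..T} ==> u t \<in> carr X"
  and v: "sderiv T v v'" "\<And>t. t \<in> {0..T} ==> v t \<in> carr X"
 shows "sderiv T (%t. u t + v t) (%t. u' t + v' t)"
 unfolding sderiv_def
proof (intro ballI conjI)
 fix t assume t: "t \<in> {0..T}"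
 show "u' t + v' t \<in> carr X" using sderiv_carr u v t by simp
 show "((%s. nrm X ((u s + v s - (u t + v t)) /R (s - t) - (u' t + v' t))) ---> 0) (at t within {0..T})"
 proof (rule tendsto_zero_le)
  show "((%s. nrm X ((u s - u t) /R (s - t) - u' t) + nrm X ((v s - v t) /R (s - t) - v' t)) ---> 0) (at t within {0..T})"
   using tendsto_add[OF sderiv_tendsto[OF u(1) t] sderiv_tendsto[OF v(1) t]] by simp
  have c: "u t \<in> carr X" "v t \<in> carr X" "u' t \<in> carr X" "v' t \<in> carr X" using sderiv_carr u v t by auto
  show "\<forall>\<^sub>F s in at t within {0..T}. 0 \<le> nrm X ((u s + v s - (u t + v t)) /R (s - t) - (u' t + v' t))"
   using u v c by (intro ev_in) auto
  show "\<forall>\<^sub>F s in at t within {0..T}. nrm X ((u s + v s - (u t + v t)) /R (s - t) - (u' t + v' t))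
    \<le> nrm X ((u s - u t) /R (s - t) - u' t) + nrm X ((v s - v t) /R (s - t) - v' t)"
  proof (rule ev_in)
   fix s assume s: "s \<in> {0..T}"
   have eq: "(u s + v s - (u t + v t)) /R (s - t) - (u' t + v' t) =
     ((u s - u t) /R (s - t) - u' t) + ((v s - v t) /R (s - t) - v' t)"
    by (simp add: algebra_simps)
   show "nrm X ((u s + v s - (u t + v t)) /R (s - t) - (u' t + v' t))
    \<le> nrm X ((u s - u t) /R (s - t) - u' t) + nrm X ((v s - v t) /R (s - t) - v' t)"
    unfolding eq using u v c s by (intro nrm_triangle) auto
  qed
 qed
qed

lemma sderiv_scale:
 assumes u: "sderiv T u u'" "\<And>t. t \<in> {0..T} ==> u t \<in> carr X"
 shows "sderiv T (%t. c *R u t) (%t. c *R u' t)"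
 unfolding sderiv_def
proof (intro ballI conjI)
 fix t assume t: "t \<in> {0..T}"
 show "c *R u' t \<in> carr X" using sderiv_carr u t by simp
 have "\<forall>\<^sub>F s in at t within {0..T}. \<bar>c\<bar> * nrm X ((u s - u t) /R (s - t) - u' t) = nrm X ((c *R u s - c *R u t) /R (s - t) - c *R u' t)"
 proof (rule ev_in)
  fix s assume s: "s \<in> {0..T}"
  have "(c *R u s - c *R u t) /R (s - t) - c *R u' t = c *R ((u s - u t) /R (s - t) - u' t)"
   by (simp add: scaleR_diff_right mult.commute)
  then show "\<bar>c\<bar> * nrm X ((u s - u t) /R (s - t) - u' t) = nrm X ((c *R u s - c *R u t) /R (s - t) - c *R u' t)"
   using u s t sderiv_carr[OF u(1) t] by (simp add: nrm_scale)
 qed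
 then show "((%s. nrm X ((c *R u s - c *R u t) /R (s - t) - c *R u' t)) ---> 0) (at t within {0..T})"
  by (rule Lim_transform_eventually[rotated])
    (use tendsto_mult_left[OF sderiv_tendsto[OF u(1) t], of "\<bar>c\<bar>"] in simp)
qed

lemma sderiv_diff:
 assumes "sderiv T u u'" "\<And>t. t \<in> {0..T} ==> u t \<in> carr X"
  and "sderiv T v v'" "\<And>t. t \<in> {0..T} ==> v t \<in> carr X"
 shows "sderiv T (%t. u t - v t) (%t. u' t - v' t)"
 using sderiv_add[OF assms(1,2) sderiv_scale[OF assms(3,4), of "-1"]] assms(4) by simp

lemma sderiv_scale_const:
 assumes phi: "\<And>t. t \<in> {0..T} ==> (phi has_real_derivative phi' t) (at t within {0..T})" and w: "w \<in> carr X"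
 shows "sderiv T (%t. phi t *R w) (%t. phi' t *R w)"
 unfolding sderiv_def
proof (intro ballI conjI)
 fix t assume t: "t \<in> {0..T}"
 show "phi' t *R w \<in> carr X" using w by simp
 have "((%s. (phi s - phi t) / (s - t)) ---> phi' t) (at t within {0..T})"
  using phi[OF t] by (simp add: has_field_derivative_iff)
 then have "((%s. \<bar>(phi s - phi t) / (s - t) - phi' t\<bar> * nrm X w) ---> \<bar>phi' t - phi' t\<bar> * nrm X w) (at t within {0..T})"
  by (intro tendsto_intros)
 moreover have "nrm X ((phi s *R w - phi t *R w) /R (s - t) - phi' t *R w) = \<bar>(phi s - phi t) / (s - t) - phi' t\<bar> * nrm X w" for s
 proof -
  have "(phi s *R w - phi t *R w) /R (s - t) - phi' t *R w = ((phi s - phi t) / (s - t) - phi' t) *R w"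
   by (simp add: scaleR_diff_left[symmetric] divide_inverse mult.commute)
  then show ?thesis using w by (simp add: nrm_scale)
 qed
 ultimately show "((%s. nrm X ((phi s *R w - phi t *R w) /R (s - t) - phi' t *R w)) ---> 0) (at t within {0..T})"
  by simp
qed

lemma sderiv_const: "w \<in> carr X ==> sderiv T (%t. w) (%t. 0)"
 using sderiv_scale_const[of T "%_. 1" "%_. 0" w] by simp

lemma sderiv_sum:
 assumes "\<And>i. i \<in> I ==> sderiv T (u i) (u' i)" "\<And>i t. i \<in> I ==> t \<in> {0..T} ==> u i t \<in> carr X"
 shows "sderiv T (%t. \<Sum>i\<in>I. u i t) (%t. \<Sum>i\<in>I. u' i t)"
 using assms
proof (induction I rule: infinite_finite_induct)
 case (insert i I)
 then show ?case by (simp, intro sderiv_add) auto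
qed (simp_all add: sderiv_const)

lemma sderiv_shift:
 assumes u: "sderiv T u u'" and c: "0 \<le> c" "T' + c \<le> T"
 shows "sderiv T' (%t. u (t + c)) (%t. u' (t + c))"
 unfolding sderiv_def
proof (intro ballI conjI)
 fix t assume t: "t \<in> {0..T'}"
 then have tc: "t + c \<in> {0..T}" using c by auto
 show "u' (t + c) \<in> carr X" using sderiv_carr[OF u tc] .
 have "((%s. s + c) ---> t + c) (at t within {0..T'})" by (intro tendsto_intros)
 moreover have "\<forall>\<^sub>F s in at t within {0..T'}. s + c \<in> {0..T} \<and> s + c \<noteq> t + c"
  using c by (auto simp: eventually_at_filter)
 ultimately have "filterlim (%s. s + c) (at (t + c) within {0..T}) (at t within {0..T'})"
  by (simp add: filterlim_at)
 from filterlim_compose[OF sderiv_tendsto[OF u tc] this]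
 show "((%s. nrm X ((u (s + c) - u (t + c)) /R (s - t) - u' (t + c))) ---> 0) (at t within {0..T'})"
  by simp
qed

lemma sderiv_sub: "sderiv T u u' ==> T' \<le> T ==> sderiv T' u u'"
 using sderiv_shift[of T u u' 0 T'] by simp

lemma dq_carr: "(\<And>t. t \<in> {0..T} ==> u t \<in> carr X) ==> 0 \<le> k ==> t \<in> {0..T - k} ==> dq k u t \<in> carr X"
 by (simp add: dq_def)

lemma contT_dq: "contT X T u ==> 0 \<le> k ==> contT X (T - k) (dq k u)"
 unfolding dq_def[abs_def]
 by (intro contT_scale contT_diff) (auto intro: contT_shift contT_sub)

lemma L2c_dq: "L2c T u ==> 0 \<le> k ==> L2c (T - k) (dq k u)"
 unfolding dq_def[abs_def]
 by (intro L2c_scale L2c_diff) (auto intro: L2c_shift L2c_sub)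

lemma sderiv_dq:
 assumes "sderiv T u u'" "\<And>t. t \<in> {0..T} ==> u t \<in> carr X" "0 \<le> k"
 shows "sderiv (T - k) (dq k u) (dq k u')"
 unfolding dq_def[abs_def]
proof (intro sderiv_scale sderiv_diff)
 show "sderiv (T - k) (%t. u (t + k)) (%t. u' (t + k))" "sderiv (T - k) u u'"
  using assms by (auto intro: sderiv_shift sderiv_sub)
qed (use assms in auto)

lemma sderiv_inn_self:
 assumes u: "sderiv T u u'" and c: "contT X T u" and t: "t \<in> {0..T}"
 shows "((%s. inn X (u s) (u s)) has_real_derivative 2 * inn X (u' t) (u t)) (at t within {0..T})"
 unfolding has_field_derivative_iff
proof -
 have ut: "u t \<in> carr X" "u' t \<in> carr X" using contT_carr[OF c t] sderiv_carr[OF u t] by auto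
 define q where "q s = (u s - u t) /R (s - t)" for s
 have l1: "((%s. nrm X (q s - u' t)) ---> 0) (at t within {0..T})"
  unfolding q_def by (rule sderiv_tendsto[OF u t])
 have l2: "((%s. nrm X (u s - u t)) ---> 0) (at t within {0..T})"
  by (rule contT_tendsto[OF c t])
 have l3: "((%s. nrm X (u s)) ---> nrm X (u t)) (at t within {0..T})"
  using contT_nrm[OF c] t by (simp add: continuous_on_def)
 have "((%s. nrm X (q s - u' t) * (nrm X (u s) + nrm X (u t)) + nrm X (u' t) * nrm X (u s - u t)) --->
   0 * (nrm X (u t) + nrm X (u t)) + nrm X (u' t) * 0) (at t within {0..T})"
  by (intro tendsto_intros l1 l2 l3)
 then have lim: "((%s. nrm X (q s - u' t) * (nrm X (u s) + nrm X (u t)) + nrm X (u' t) * nrm X (u s - u t)) ---> 0) (at t within {0..T})"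
  by simp
 have "((%s. \<bar>(inn X (u s) (u s) - inn X (u t) (u t)) / (s - t) - 2 * inn X (u' t) (u t)\<bar>) ---> 0) (at t within {0..T})"
 proof (rule tendsto_zero_le[OF lim])
  show "\<forall>\<^sub>F s in at t within {0..T}. \<bar>(inn X (u s) (u s) - inn X (u t) (u t)) / (s - t) - 2 * inn X (u' t) (u t)\<bar>
    \<le> nrm X (q s - u' t) * (nrm X (u s) + nrm X (u t)) + nrm X (u' t) * nrm X (u s - u t)"
  proof (rule ev_in)
   fix s assume s: "s \<in> {0..T}"
   have us: "u s \<in> carr X" "q s \<in> carr X" using contT_carr[OF c s] ut by (auto simp: q_def)
   have "(inn X (u s) (u s) - inn X (u t) (u t)) / (s - t) = inn X (q s) (u s + u t)"
    using us ut by (simp add: q_def inn_simps inn_commute[of "u s" "u t"] divide_inverse mult.commute ring_distribs)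
   then have "(inn X (u s) (u s) - inn X (u t) (u t)) / (s - t) - 2 * inn X (u' t) (u t) =
     inn X (q s - u' t) (u s + u t) + inn X (u' t) (u s - u t)"
    using us ut by (simp add: inn_simps)
   moreover have "\<bar>inn X (q s - u' t) (u s + u t)\<bar> \<le> nrm X (q s - u' t) * (nrm X (u s) + nrm X (u t))"
    using us ut by (intro order_trans[OF abs_inn_le] mult_left_mono nrm_triangle) auto
   moreover have "\<bar>inn X (u' t) (u s - u t)\<bar> \<le> nrm X (u' t) * nrm X (u s - u t)"
    using us ut by (intro abs_inn_le) auto
   ultimately show "\<bar>(inn X (u s) (u s) - inn X (u t) (u t)) / (s - t) - 2 * inn X (u' t) (u t)\<bar>
    \<le> nrm X (q s - u' t) * (nrm X (u s) + nrm X (u t)) + nrm X (u' t) * nrm X (u s - u t)" by linarith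
  qed
 qed simp
 then have "((%s. (inn X (u s) (u s) - inn X (u t) (u t)) / (s - t) - 2 * inn X (u' t) (u t)) ---> 0) (at t within {0..T})"
  by (rule tendsto_rabs_zero_cancel)
 then show "((%s. (inn X (u s) (u s) - inn X (u t) (u t)) / (s - t)) ---> 2 * inn X (u' t) (u t)) (at t within {0..T})"
  by (simp add: LIM_zero_iff)
qed

lemma sderiv_inn:
 assumes u: "sderiv T u u'" and c: "\<And>t. t \<in> {0..T} ==> u t \<in> carr X" and w: "w \<in> carr X" and t: "t \<in> {0..T}"
 shows "((%s. inn X (u s) w) has_real_derivative inn X (u' t) w) (at t within {0..T})"
 unfolding has_field_derivative_iff
proof -
 have ut: "u t \<in> carr X" "u' t \<in> carr X" using c[OF t] sderiv_carr[OF u t] by auto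
 have lim: "((%s. nrm X ((u s - u t) /R (s - t) - u' t) * nrm X w) ---> 0) (at t within {0..T})"
  using tendsto_mult_right[OF sderiv_tendsto[OF u t], of "nrm X w"] by simp
 have "((%s. \<bar>(inn X (u s) w - inn X (u t) w) / (s - t) - inn X (u' t) w\<bar>) ---> 0) (at t within {0..T})"
 proof (rule tendsto_zero_le[OF lim])
  show "\<forall>\<^sub>F s in at t within {0..T}. \<bar>(inn X (u s) w - inn X (u t) w) / (s - t) - inn X (u' t) w\<bar>
    \<le> nrm X ((u s - u t) /R (s - t) - u' t) * nrm X w"
  proof (rule ev_in)
   fix s assume s: "s \<in> {0..T}"
   have "(inn X (u s) w - inn X (u t) w) / (s - t) - inn X (u' t) w = inn X ((u s - u t) /R (s - t) - u' t) w"
    using c[OF s] ut w by (simp add: inn_diff_left inn_scale_left divide_inverse mult.commute)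
   then show "\<bar>(inn X (u s) w - inn X (u t) w) / (s - t) - inn X (u' t) w\<bar>
    \<le> nrm X ((u s - u t) /R (s - t) - u' t) * nrm X w"
    using abs_inn_le[of "(u s - u t) /R (s - t) - u' t" w] c[OF s] ut w by simp
  qed
 qed simp
 then have "((%s. (inn X (u s) w - inn X (u t) w) / (s - t) - inn X (u' t) w) ---> 0) (at t within {0..T})"
  by (rule tendsto_rabs_zero_cancel)
 then show "((%s. (inn X (u s) w - inn X (u t) w) / (s - t)) ---> inn X (u' t) w) (at t within {0..T})"
  by (simp add: LIM_zero_iff)
qed

lemma sderiv_primitive:
 assumes u: "sderiv T u u'" and c: "\<And>t. t \<in> {0..T} ==> u t \<in> carr X" and w: "w \<in> carr X"
  and st: "0 \<le> s" "s \<le> t" "t \<le> T"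
 shows "inn X (u t - u s) w = ig s t (%r. inn X (u' r) w)"
proof -
 have "((%r. inn X (u' r) w) has_integral inn X (u t) w - inn X (u s) w) {s..t}"
 proof (rule fundamental_theorem_of_calculus[OF st(2)])
  fix r assume r: "r \<in> {s..t}"
  then have "((%s. inn X (u s) w) has_real_derivative inn X (u' r) w) (at r within {0..T})"
   using st by (intro sderiv_inn[OF u c w]) auto
  then have "((%s. inn X (u s) w) has_real_derivative inn X (u' r) w) (at r within {s..t})"
   by (rule DERIV_subset) (use st in auto)
  then show "((%s. inn X (u s) w) has_vector_derivative inn X (u' r) w) (at r within {s..t})"
   by (simp add: has_real_derivative_iff_has_vector_derivative)
 qed
 then show ?thesis
  using c w st by (simp add: inn_diff_left integral_unique)
qed

lemma sderiv_dq_tendsto: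
 assumes u: "sderiv T u u'" and t: "0 \<le> t" "t < T"
 shows "((%k. nrm X (dq k u t - u' t)) ---> 0) (at_right 0)"
proof -
 have "filterlim (%k. t + k) (at t within {0..T}) (at_right 0)"
  unfolding filterlim_at
 proof
  show "\<forall>\<^sub>F k in at_right 0. t + k \<in> {0..T} \<and> t + k \<noteq> t"
   unfolding eventually_at_right_field using t by (intro exI[of _ "T - t"]) auto
  show "((%k. t + k) ---> t) (at_right 0)" by (auto intro!: tendsto_eq_intros)
 qed
 from filterlim_compose[OF sderiv_tendsto[OF u] this] t
 show ?thesis by (simp add: dq_def)
qed

end

context semi_inner
begin

text \<open>The regularity of data in \<open>H^2\<close> in the form in which it is used: the first difference
 quotients start at \<open>G1\<close>, the second ones are bounded by \<open>M\<close> in \<open>L^2\<close>.\<close>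

definition H2_data :: "real => (real => 'x) => 'x => real => bool" where
 "H2_data T G G1 M \<longleftrightarrow> contT X T G \<and> G1 \<in> carr X \<and> 0 \<le> M \<and>
   (\<forall>t k. 0 < k --> 0 \<le> t --> t + k \<le> T --> nrm X (dq k G t - G1) \<le> sqrt (t + k) * M) \<and>
   (\<forall>tau k. 0 < tau --> 0 < k --> tau + k \<le> T --> nI 0 (T - tau - k) (%t. dq k (dq tau G) t) \<le> M^2)"

end

section \<open>The damped wave system in abstract form\<close>

text \<open>On the network \<open>X\<close> is \<open>L^2\<close>, \<open>V\<close> the functions of
  \<open>H^1\<close> vanishing at \<open>VD\<close>, \<open>K\<close> the edgewise derivative, and
  \<open>A\<close>, \<open>D\<close> are the multiplications by \<open>a\<close> and
  \<open>d\<close>. The multiplications are linear as maps on functions, whereas \<open>K\<close>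
  selects a representative and is linear only up to distance zero.\<close>

locale energy_ops = semi_inner X for X :: "'x::real_vector hspace" +
 fixes V :: "'x set" and K A D :: "'x => 'x" and BA BD d :: real
 assumes V_sub: "subspace V" and V_carr: "V \<subseteq> carr X"
  and K_carr: "q \<in> V ==> K q \<in> carr X"
  and K_lin: "q \<in> V ==> r \<in> V ==> nrm X (K (q + c *R r) - (K q + c *R K r)) = 0"
  and A_carr: "x \<in> carr X ==> A x \<in> carr X"
  and A_lin: "A (x + c *R y) = A x + c *R A y"
  and A_bnd: "x \<in> carr X ==> nrm X (A x) \<le> BA * nrm X x"
  and A_nonneg: "x \<in> carr X ==> 0 \<le> inn X (A x) x"
  and D_carr: "x \<in> carr X ==> D x \<in> carr X"
  and D_lin: "D (x + c *R y) = D x + c *R D y"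
  and D_bnd: "x \<in> carr X ==> nrm X (D x) \<le> BD * nrm X x"
  and D_ge: "x \<in> carr X ==> d * inn X x x \<le> inn X (D x) x"
  and d_pos: "0 < d" and BA_nonneg: "0 \<le> BA"
begin

lemma nrm_le_zeroI: "x \<in> carr X ==> nrm X x \<le> 0 ==> nrm X x = 0"
 using nrm_nonneg antisym by blast

lemma nrm_zero_add: "x \<in> carr X ==> y \<in> carr X ==> nrm X x = 0 ==> nrm X y = 0 ==> nrm X (x + y) = 0"
 using nrm_triangle[of x y] by (intro nrm_le_zeroI) auto

lemma A_zero [simp]: "A 0 = 0" and D_zero [simp]: "D 0 = 0"
 using A_lin[of 0 1 0] D_lin[of 0 1 0] by simp_all

lemma A_scale: "A (c *R x) = c *R A x" and D_scale: "D (c *R x) = c *R D x"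
 using A_lin[of 0 c x] D_lin[of 0 c x] by simp_all

lemma A_diff: "A (x - y) = A x - A y" and D_diff: "D (x - y) = D x - D y"
 using A_lin[of x "-1" y] D_lin[of x "-1" y] by simp_all

lemma A_Lipschitz: "x \<in> carr X ==> y \<in> carr X ==> nrm X (A x - A y) \<le> BA * nrm X (x - y)"
 using A_bnd[of "x - y"] by (simp add: A_diff)

lemma D_Lipschitz: "x \<in> carr X ==> y \<in> carr X ==> nrm X (D x - D y) \<le> BD * nrm X (x - y)"
 using D_bnd[of "x - y"] by (simp add: D_diff)

lemma K_diff_scale:
 assumes "q \<in> V" "r \<in> V"
 shows "nrm X (K (c *R (q - r)) - c *R (K q - K r)) = 0"
proof -
 have qr: "q - r \<in> V" "0 \<in> V" "c *R (q - r) \<in> V"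
  using assms V_sub by (auto intro: subspace_diff subspace_0 subspace_scale)
 have c: "K (c *R (q - r)) \<in> carr X" "K 0 \<in> carr X" "K (q - r) \<in> carr X" "K q \<in> carr X" "K r \<in> carr X"
  using qr assms by (auto intro: K_carr)
 have "nrm X (K (0 + 1 *R 0) - (K 0 + 1 *R K 0)) = 0" by (rule K_lin) (use qr in auto)
 then have 0: "nrm X (K 0) = 0" using nrm_minus[OF c(2)] by simp
 have 1: "nrm X (K (c *R (q - r)) - (K 0 + c *R K (q - r))) = 0"
  using K_lin[OF qr(2,1), of c] by simp
 have 2: "nrm X (K (q - r) - (K q - K r)) = 0"
  using K_lin[OF assms, of "-1"] by simp
 have "K (c *R (q - r)) - c *R (K q - K r) =
   (K (c *R (q - r)) - (K 0 + c *R K (q - r))) + (K 0 + c *R (K (q - r) - (K q - K r)))"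
  by (simp add: algebra_simps)
 also have "nrm X \<dots> \<le> nrm X (K (c *R (q - r)) - (K 0 + c *R K (q - r))) +
   (nrm X (K 0) + nrm X (c *R (K (q - r) - (K q - K r))))"
  using c by (intro order_trans[OF nrm_triangle] add_left_mono nrm_triangle) auto
 also have "\<dots> = 0" using 0 1 2 c by (simp add: nrm_scale)
 finally show ?thesis
  by (rule nrm_le_zeroI[rotated]) (use c in simp)
qed

text \<open>Strong solutions of \<open>u' + A u - K\<^sup>* n = G\<close> on \<open>V\<close> and \<open>eps n' + K u + D n = F\<close>.\<close>

definition wave :: "real => real => (real => 'x) => (real => 'x) => (real => 'x) => (real => 'x) =>
  (real => 'x) => (real => 'x) => bool" where
 "wave T eps u n u' n' G F \<longleftrightarrow> contT X T u \<and> contT X T n \<and> sderiv T u u' \<and> sderiv T n n' \<and>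
   contT X T G \<and> contT X T F \<and>
   (\<forall>t\<in>{0..T}. u t \<in> V \<and>
    (\<forall>q\<in>V. inn X (u' t) q + inn X (A (u t)) q - inn X (n t) (K q) = inn X (G t) q) \<and>
    nrm X (eps *R n' t + K (u t) + D (n t) - F t) = 0)"

lemma wave_carr:
 assumes "wave T eps u n u' n' G F" "t \<in> {0..T}"
 shows "u t \<in> carr X" "n t \<in> carr X" "u' t \<in> carr X" "n' t \<in> carr X" "G t \<in> carr X" "F t \<in> carr X"
  "u t \<in> V" "A (u t) \<in> carr X" "D (n t) \<in> carr X" "K (u t) \<in> carr X"
 using assms contT_carr[of T u t] contT_carr[of T n t] contT_carr[of T G t] contT_carr[of T F t]
  sderiv_carr[of T u u' t] sderiv_carr[of T n n' t] V_carr
 by (auto simp: wave_def intro!: A_carr D_carr K_carr)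

text \<open>The operators do not depend on time, so a quotient of a solution solves the system with
  the quotients of the data. Applied twice, this gives access to the energy of second
  derivatives.\<close>

lemma wave_dq:
 assumes w: "wave T eps u n u' n' G F" and k: "0 \<le> k"
 shows "wave (T - k) eps (dq k u) (dq k n) (dq k u') (dq k n') (dq k G) (dq k F)"
 unfolding wave_def
proof (intro conjI ballI)
 show "contT X (T - k) (dq k u)" "contT X (T - k) (dq k n)" "contT X (T - k) (dq k G)" "contT X (T - k) (dq k F)"
  using w k by (auto simp: wave_def intro: contT_dq)
 show "sderiv (T - k) (dq k u) (dq k u')" "sderiv (T - k) (dq k n) (dq k n')"
  using w k wave_carr[OF w] by (auto simp: wave_def intro!: sderiv_dq)
 fix t assume "t \<in> {0..T - k}"
 then have t: "t \<in> {0..T}" "t + k \<in> {0..T}" using k by auto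
 note c = wave_carr[OF w t(1)] wave_carr[OF w t(2)]
 show V: "dq k u t \<in> V"
  unfolding dq_def using c V_sub by (intro subspace_scale subspace_diff) auto
 show "inn X (dq k u' t) q + inn X (A (dq k u t)) q - inn X (dq k n t) (K q) = inn X (dq k G t) q" if q: "q \<in> V" for q
 proof -
  have e: "inn X (u' r) q + inn X (A (u r)) q - inn X (n r) (K q) = inn X (G r) q" if "r \<in> {0..T}" for r
   using w that q by (simp add: wave_def)
  have qc: "q \<in> carr X" "K q \<in> carr X" using q V_carr K_carr by auto
  have "inn X (dq k u' t) q + inn X (A (dq k u t)) q - inn X (dq k n t) (K q) =
    inverse k * ((inn X (u' (t + k)) q + inn X (A (u (t + k))) q - inn X (n (t + k)) (K q)) -
     (inn X (u' t) q + inn X (A (u t)) q - inn X (n t) (K q)))"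
   using c qc by (simp add: dq_def inn_scale_left inn_diff_left A_scale A_diff right_diff_distrib ring_distribs)
  also have "\<dots> = inn X (dq k G t) q"
   using c qc unfolding e[OF t(1)] e[OF t(2)] by (simp add: dq_def inn_scale_left inn_diff_left)
  finally show ?thesis .
 qed
 define z where "z r = eps *R n' r + K (u r) + D (n r) - F r" for r
 have z: "nrm X (z r) = 0" "z r \<in> carr X" if "r \<in> {0..T}" for r
  using w that wave_carr[OF w that] by (auto simp: wave_def z_def)
 have kd: "nrm X (K (dq k u t) - inverse k *R (K (u (t + k)) - K (u t))) = 0"
  unfolding dq_def using c by (intro K_diff_scale) auto
 have "eps *R dq k n' t + K (dq k u t) + D (dq k n t) - dq k F t =
   (K (dq k u t) - inverse k *R (K (u (t + k)) - K (u t))) + inverse k *R (z (t + k) - z t)"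
  by (simp add: z_def dq_def D_scale D_diff algebra_simps)
 also have "nrm X \<dots> = 0"
 proof (rule nrm_zero_add[OF _ _ kd])
  show "K (dq k u t) - inverse k *R (K (u (t + k)) - K (u t)) \<in> carr X" using c K_carr[OF V] by simp
  have "nrm X (z (t + k) - z t) = 0"
   using nrm_diff_le[OF z(2)[OF t(2)] z(2)[OF t(1)]] z t by (intro nrm_le_zeroI) auto
  then show "nrm X (inverse k *R (z (t + k) - z t)) = 0" using z t by (subst nrm_scale) auto
 qed (use z t in simp)
 finally show "nrm X (eps *R dq k n' t + K (dq k u t) + D (dq k n t) - dq k F t) = 0" .
qed

text \<open>Used for \<open>dq k u\<close>, whose limit at time 0 is \<open>p\<close>: after
  subtracting \<open>p\<close> the first-order energy starts near zero, at the price of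
  \<open>A p\<close> and \<open>K p\<close> in the data.\<close>

lemma wave_minus_const:
 assumes w: "wave T eps u n u' n' G F" and p: "p \<in> V"
 shows "wave T eps (%t. u t - p) n u' n' (%t. G t - A p) (%t. F t - K p)"
 unfolding wave_def
proof (intro conjI ballI)
 have pc: "p \<in> carr X" "A p \<in> carr X" "K p \<in> carr X" using p V_carr A_carr K_carr by auto
 show "contT X T (%t. u t - p)" "contT X T (%t. G t - A p)" "contT X T (%t. F t - K p)"
  using w pc by (auto simp: wave_def intro!: contT_diff contT_const)
 show "contT X T n" "sderiv T n n'" using w by (auto simp: wave_def)
 show "sderiv T (%t. u t - p) u'"
  using sderiv_diff[of T u u' "%_. p" "%_. 0"] sderiv_const[OF pc(1)] w wave_carr[OF w] pc by (simp add: wave_def)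
 fix t assume t: "t \<in> {0..T}"
 note c = wave_carr[OF w t]
 show "u t - p \<in> V" using c p V_sub by (intro subspace_diff)
 show "inn X (u' t) q + inn X (A (u t - p)) q - inn X (n t) (K q) = inn X (G t - A p) q" if q: "q \<in> V" for q
 proof -
  have "q \<in> carr X" using q V_carr by auto
  moreover have "inn X (u' t) q + inn X (A (u t)) q - inn X (n t) (K q) = inn X (G t) q"
   using w t q by (simp add: wave_def)
  ultimately show ?thesis using c pc by (simp add: A_diff inn_diff_left)
 qed
 have z: "eps *R n' t + K (u t) + D (n t) - F t \<in> carr X" "nrm X (eps *R n' t + K (u t) + D (n t) - F t) = 0"
  using w t c by (auto simp: wave_def)
 have upV: "u t - p \<in> V" using c p V_sub by (intro subspace_diff)
 have kd: "nrm X (K (u t - p) - (K (u t) - K p)) = 0" using K_diff_scale[OF c(7) p, of 1] by simp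
 have "eps *R n' t + K (u t - p) + D (n t) - (F t - K p) =
   (K (u t - p) - (K (u t) - K p)) + (eps *R n' t + K (u t) + D (n t) - F t)"
  by (simp add: algebra_simps)
 also have "nrm X \<dots> = 0" using kd z K_carr[OF upV] c pc by (intro nrm_zero_add) auto
 finally show "nrm X (eps *R n' t + K (u t - p) + D (n t) - (F t - K p)) = 0" .
qed

lemma wave_sub:
 assumes w: "wave T eps u n u' n' G F" and "T' \<le> T"
 shows "wave T' eps u n u' n' G F"
 using assms unfolding wave_def by (auto intro: contT_sub sderiv_sub)

definition wave_energy :: "real => (real => 'x) => (real => 'x) => real => real" where
 "wave_energy eps u n t = (nrm X (u t))^2 + eps * (nrm X (n t))^2"

text \<open>Testing the equations with \<open>u\<close> and \<open>n\<close> makes the two terms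
  with \<open>K\<close> cancel; the damping by \<open>A\<close> is dropped and that by
  \<open>D\<close> is kept.\<close>

lemma wave_energy_deriv:
 assumes w: "wave T eps u n u' n' G F" and t: "t \<in> {0..T}"
 obtains y' where "(wave_energy eps u n has_real_derivative y') (at t within {0..T})"
  "y' \<le> 2 * (inn X (G t) (u t) + inn X (F t) (n t) - d * (nrm X (n t))^2)"
proof -
 note c = wave_carr[OF w t]
 define y' where "y' = 2 * inn X (u' t) (u t) + eps * (2 * inn X (n' t) (n t))"
 have "((%s. inn X (u s) (u s) + eps * inn X (n s) (n s)) has_real_derivative y') (at t within {0..T})"
  unfolding y'_def using w t by (intro DERIV_add DERIV_cmult sderiv_inn_self) (auto simp: wave_def)
 then have der: "(wave_energy eps u n has_real_derivative y') (at t within {0..T})"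
 proof (rule has_field_derivative_transform_within[where d = 1])
  show "inn X (u s) (u s) + eps * inn X (n s) (n s) = wave_energy eps u n s" if "s \<in> {0..T}" for s
   using wave_carr[OF w that] by (simp add: wave_energy_def nrm_sq)
 qed (use t in auto)
 have e1: "inn X (u' t) (u t) = inn X (G t) (u t) - inn X (A (u t)) (u t) + inn X (n t) (K (u t))"
  using w t c unfolding wave_def by (smt (verit))
 have z: "eps *R n' t + K (u t) + D (n t) - F t \<in> carr X" "nrm X (eps *R n' t + K (u t) + D (n t) - F t) = 0"
  using w t c by (auto simp: wave_def)
 have "inn X (eps *R n' t + K (u t) + D (n t) - F t) (n t) = 0"
  using abs_inn_le[OF z(1) c(2)] z(2) by simp
 then have e2: "eps * inn X (n' t) (n t) = inn X (F t) (n t) - inn X (K (u t)) (n t) - inn X (D (n t)) (n t)"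
  using c by (simp add: inn_simps)
 have "y' = 2 * (inn X (G t) (u t) + inn X (F t) (n t) - inn X (D (n t)) (n t) - inn X (A (u t)) (u t))"
  unfolding y'_def using e1 e2 inn_commute[OF c(2) c(10)] by simp
 also have "\<dots> \<le> 2 * (inn X (G t) (u t) + inn X (F t) (n t) - d * (nrm X (n t))^2)"
  using D_ge[OF c(2)] A_nonneg[OF c(1)] c by (simp add: nrm_sq)
 finally show ?thesis using that[OF der] by blast
qed

text \<open>The derivative of the square root of the energy is bounded by the data alone. Thus the
  increment is linear in the length of the time interval, which is the rate that survives division
  by \<open>tau\<close> later on.\<close>

lemma wave_sup_estimate:
 assumes w: "wave T eps u n u' n' G F" and T: "0 < T" and eps: "0 < eps"
  and G: "\<And>t. t \<in> {0..T} ==> nrm X (G t) \<le> \<gamma>" and F: "\<And>t. t \<in> {0..T} ==> nrm X (F t) \<le> phi"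
 shows "sqrt (wave_energy eps u n T) \<le> sqrt (wave_energy eps u n 0) + T * (\<gamma> + phi / sqrt eps)"
proof (rule field_le_epsilon)
 fix dl :: real assume dl: "dl > 0"
 define y where "y = wave_energy eps u n"
 \<comment> \<open>The square root is not differentiable where the energy vanishes, and the energy
   does vanish initially in the application's limit; adding \<open>dl^2\<close> removes this
   point.\<close>
 define v where "v t = sqrt (y t + dl^2)" for t
 have y0: "0 \<le> y t" for t unfolding y_def wave_energy_def using eps by simp
 have v0: "0 < v t" "(v t)^2 = y t + dl^2" for t
  using y0[of t] dl by (auto simp: v_def add_nonneg_pos)
 have \<gamma>phi: "0 \<le> \<gamma>" "0 \<le> phi"
  using order_trans[OF nrm_nonneg[OF wave_carr(5)[OF w]] G, of 0]
   order_trans[OF nrm_nonneg[OF wave_carr(6)[OF w]] F, of 0] T by auto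
 have "\<exists>v'. (v has_real_derivative v') (at t within {0..T}) \<and> v' \<le> \<gamma> + phi / sqrt eps" if t: "t \<in> {0..T}" for t
 proof -
  note c = wave_carr[OF w t]
  obtain y' where y': "(y has_real_derivative y') (at t within {0..T})"
   "y' \<le> 2 * (inn X (G t) (u t) + inn X (F t) (n t) - d * (nrm X (n t))^2)"
   using wave_energy_deriv[OF w t] unfolding y_def by blast
  have "(v has_real_derivative y' / (2 * v t)) (at t within {0..T})"
  proof -
   have "((%s. y s + dl^2) has_real_derivative y') (at t within {0..T})"
    using DERIV_add[OF y'(1) DERIV_const[of "dl^2"]] by simp
   moreover have "0 < y t + dl^2" using y0[of t] dl by (simp add: add_nonneg_pos)
   ultimately have "((%s. sqrt (y s + dl^2)) has_real_derivative inverse (sqrt (y t + dl^2)) / 2 * y') (at t within {0..T})"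
    by (rule DERIV_chain'[OF _ DERIV_real_sqrt])
   moreover have "inverse r / 2 * y' = y' / (2 * r)" for r :: real by (simp add: field_simps)
   ultimately show ?thesis unfolding v_def by (simp only:)
  qed
  moreover have "y' / (2 * v t) \<le> \<gamma> + phi / sqrt eps"
  proof -
   have "(nrm X (u t))^2 \<le> (v t)^2" using eps v0(2)[of t] by (simp add: y_def wave_energy_def)
   then have u: "nrm X (u t) \<le> v t" by (rule power2_le_imp_le) (use v0[of t] in simp)
   have "(sqrt eps * nrm X (n t))^2 \<le> (v t)^2"
    using c eps v0[of t] by (simp add: y_def wave_energy_def power_mult_distrib)
   then have "sqrt eps * nrm X (n t) \<le> v t" by (rule power2_le_imp_le) (use v0[of t] in simp)
   then have n: "nrm X (n t) \<le> v t / sqrt eps" using eps by (simp add: pos_le_divide_eq mult.commute)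
   have "0 \<le> d * (nrm X (n t))^2" using d_pos by simp
   then have "y' \<le> 2 * (inn X (G t) (u t) + inn X (F t) (n t))"
    by (intro order_trans[OF y'(2)]) simp
   also have "inn X (G t) (u t) \<le> \<gamma> * v t"
    using c G[OF t] u \<gamma>phi by (intro order_trans[OF inn_le_nrm] mult_mono) auto
   also have "inn X (F t) (n t) \<le> phi * (v t / sqrt eps)"
    using c F[OF t] n \<gamma>phi by (intro order_trans[OF inn_le_nrm] mult_mono) auto
   finally have "y' \<le> (\<gamma> + phi / sqrt eps) * (2 * v t)" by (simp add: algebra_simps)
   then show ?thesis using v0[of t] by (simp add: pos_divide_le_eq)
  qed
  ultimately show ?thesis by blast
 qed
 then obtain v' where v': "\<And>t. t \<in> {0..T} ==> (v has_real_derivative v' t) (at t within {0..T})"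
  "\<And>t. t \<in> {0..T} ==> v' t \<le> \<gamma> + phi / sqrt eps" by metis
 have "\<exists>x\<in>{0<..<T}. v T - v 0 = (%h. v' x * h) (T - 0)"
 proof (rule mvt_simple[OF T])
  fix x assume "0 \<le> x" "x \<le> T"
  then show "(v has_derivative (%h. v' x * h)) (at x within {0..T})"
   using v'(1)[of x] by (simp add: has_field_derivative_def)
 qed
 then obtain x where "x \<in> {0<..<T}" "v T - v 0 = v' x * T" by auto
 then have x: "x \<in> {0..T}" "v T - v 0 = v' x * T" by auto
 have "v T \<le> v 0 + T * (\<gamma> + phi / sqrt eps)"
 proof -
  have "T * v' x \<le> T * (\<gamma> + phi / sqrt eps)" using T v'(2)[OF x(1)] by (intro mult_left_mono) auto
  moreover have "v T - v 0 = T * v' x" using x(2) by (simp only: mult.commute)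
  ultimately show ?thesis by linarith
 qed
 moreover have "sqrt (y T) \<le> v T" unfolding v_def by simp
 moreover have "v 0 \<le> sqrt (y 0) + dl"
  unfolding v_def using sqrt_add_le_add_sqrt[of "y 0" "dl^2"] y0[of 0] dl by simp
 ultimately show "sqrt (wave_energy eps u n T) \<le> sqrt (wave_energy eps u n 0) + T * (\<gamma> + phi / sqrt eps) + dl"
  unfolding y_def by linarith
qed

text \<open>The weight exp (-t / \<theta>) produces the term that absorbs \<open>u\<close>, so the
  bound contains no norm of \<open>u\<close> at later times. On \<open>{0..T}\<close> the weight is
  at least exp (-1), whence the factor \<open>exp 1\<close>. Having \<open>\<theta>\<close>
  independent of \<open>T\<close> makes the bound uniform over the shortened intervals on which
  quotients live.\<close>

lemma wave_L2_estimate: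
 assumes w: "wave T eps u n u' n' G F" and T: "0 < T" "T \<le> \<theta>" and eps: "0 < eps"
 shows "d * nI 0 T n \<le>
  exp 1 * (wave_energy eps u n 0 + \<theta> * nI 0 T G + nI 0 T F / d)"
proof -
 define y where "y = wave_energy eps u n"
 have y0: "0 \<le> y t" for t unfolding y_def wave_energy_def using eps by simp
 define z where "z t = exp (- t / \<theta>) * y t" for t
 define g where "g t = \<theta> * (nrm X (G t))^2 + (1 / d) * (nrm X (F t))^2 - exp (-1) * d * (nrm X (n t))^2" for t
 have \<theta>: "\<theta> > 0" using T by simp
 have ex: "\<exists>z'. (z has_real_derivative z') (at t within {0..T}) \<and> z' \<le> g t" if t: "t \<in> {0..T}" for t
 proof -
  note c = wave_carr[OF w t]
  obtain y' where y': "(y has_real_derivative y') (at t within {0..T})"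
   "y' \<le> 2 * (inn X (G t) (u t) + inn X (F t) (n t) - d * (nrm X (n t))^2)"
   using wave_energy_deriv[OF w t] unfolding y_def by blast
  have "(z has_real_derivative exp (- t / \<theta>) * (y' - y t / \<theta>)) (at t within {0..T})"
   unfolding z_def using \<theta> by (auto intro!: derivative_eq_intros y'(1) simp: algebra_simps)
  moreover have "exp (- t / \<theta>) * (y' - y t / \<theta>) \<le> g t"
  proof -
   define P where "P = \<theta> * (nrm X (G t))^2 + (1 / d) * (nrm X (F t))^2"
   define Q where "Q = d * (nrm X (n t))^2"
   have "2 * (nrm X (G t) * nrm X (u t)) \<le> \<theta> * (nrm X (G t))^2 + (nrm X (u t))^2 / \<theta>"
    using sum_squares_bound[of "sqrt \<theta> * nrm X (G t)" "nrm X (u t) / sqrt \<theta>"] \<theta>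
    by (simp add: power_mult_distrib power_divide)
   then have 1: "2 * inn X (G t) (u t) \<le> \<theta> * (nrm X (G t))^2 + (nrm X (u t))^2 / \<theta>"
    using inn_le_nrm[OF c(5) c(1)] by simp
   have "(nrm X (u t))^2 / \<theta> \<le> y t / \<theta>"
    using eps \<theta> by (intro divide_right_mono) (auto simp: y_def wave_energy_def)
   then have 2: "2 * inn X (G t) (u t) - y t / \<theta> \<le> \<theta> * (nrm X (G t))^2" using 1 by simp
   have "2 * (nrm X (F t) * nrm X (n t)) \<le> (1 / d) * (nrm X (F t))^2 + d * (nrm X (n t))^2"
    using sum_squares_bound[of "nrm X (F t) / sqrt d" "sqrt d * nrm X (n t)"] d_pos
    by (simp add: power_mult_distrib power_divide)
   then have 3: "2 * inn X (F t) (n t) \<le> (1 / d) * (nrm X (F t))^2 + d * (nrm X (n t))^2"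
    using inn_le_nrm[OF c(6) c(2)] by simp
   have "y' - y t / \<theta> \<le> P - Q" using y'(2) 2 3 by (simp add: P_def Q_def)
   then have "exp (- t / \<theta>) * (y' - y t / \<theta>) \<le> exp (- t / \<theta>) * P - exp (- t / \<theta>) * Q"
    by (simp flip: right_diff_distrib)
   moreover have "exp (- t / \<theta>) * P \<le> 1 * P"
    using t \<theta> d_pos by (intro mult_right_mono) (auto simp: P_def)
   moreover have "exp (-1) * Q \<le> exp (- t / \<theta>) * Q"
    using t T \<theta> d_pos by (intro mult_right_mono) (auto simp: Q_def)
   ultimately show ?thesis by (simp add: g_def P_def Q_def)
  qed
  ultimately show ?thesis by blast
 qed
 then obtain z' where z': "\<And>t. t \<in> {0..T} ==> (z has_real_derivative z' t) (at t within {0..T})"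
  "\<And>t. t \<in> {0..T} ==> z' t \<le> g t" by metis
 have hs: "(z' has_integral z T - z 0) {0..T}"
  using T z'(1) by (intro fundamental_theorem_of_calculus) (auto simp flip: has_real_derivative_iff_has_vector_derivative)
 have cG: "continuous_on {0..T} (%t. (nrm X (G t))^2)" "continuous_on {0..T} (%t. (nrm X (F t))^2)"
  "continuous_on {0..T} (%t. (nrm X (n t))^2)"
  using w by (auto simp: wave_def intro!: continuous_intros contT_nrm)
 have gc: "continuous_on {0..T} g"
  unfolding g_def by (intro continuous_intros cG)
 have le: "z T - z 0 \<le> ig 0 T g"
  by (rule has_integral_le[OF hs integrable_integral[OF integrable_continuous_interval[OF gc]] z'(2)])
 have "ig 0 T g = \<theta> * nI 0 T G + (1 / d) * nI 0 T F
   - exp (-1) * d * nI 0 T n"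
 proof -
  have i: "intable 0 T (%t. \<theta> * (nrm X (G t))^2)" "intable 0 T (%t. (1 / d) * (nrm X (F t))^2)"
   "intable 0 T (%t. exp (-1) * d * (nrm X (n t))^2)"
   by (intro ivl_cont continuous_intros cG)+
  show ?thesis unfolding g_def
   by (subst ivl_diff[OF Bochner_Integration.integrable_add[OF i(1,2)] i(3)], subst ivl_add[OF i(1,2)]) simp
 qed
 moreover have "0 \<le> z T" "z 0 = y 0" using y0 by (auto simp: z_def)
 ultimately have "exp (-1) * (d * nI 0 T n) \<le>
   y 0 + \<theta> * nI 0 T G + nI 0 T F / d"
  using le by simp
 then have "exp 1 * (exp (-1) * (d * nI 0 T n)) \<le>
   exp 1 * (y 0 + \<theta> * nI 0 T G + nI 0 T F / d)"
  by (intro mult_left_mono) auto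
 then show ?thesis by (simp add: y_def mult.assoc[symmetric] exp_minus)
qed

text \<open>The energy of the first derivatives, with \<open>p\<close> subtracted from
  \<open>u'\<close>, vanishes at time 0 and is therefore of order \<open>tau\<close> at time
  \<open>tau\<close>. It is obtained from the supremum estimate for \<open>dq k u\<close> on
  \<open>{0..tau}\<close> as \<open>k\<close> tends to zero.\<close>

lemma wave_first_order:
 assumes w: "wave T eps u n u' n' G F" and eps: "0 < eps"
  and G: "H2_data T G G1 MG" and F: "H2_data T F F1 MF"
  and p: "p \<in> V" "nrm X (u' 0 - p) = 0" "nrm X (n' 0) = 0" and tau: "0 < tau" "tau < T"
 shows "sqrt ((nrm X (u' tau - p))^2 + eps * (nrm X (n' tau))^2) \<le>
  tau * (nrm X (G1 - A p) + nrm X (F1 - K p) / sqrt eps + sqrt tau * (MG + MF / sqrt eps))"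
proof -
 have pc: "p \<in> carr X" "A p \<in> carr X" "K p \<in> carr X" using p V_carr A_carr K_carr by auto
 define Y where "Y k t = (nrm X (dq k u t - p))^2 + eps * (nrm X (dq k n t))^2" for k t
 define y where "y t = (nrm X (u' t - p))^2 + eps * (nrm X (n' t))^2" for t
 have lim: "((%k. Y k t) ---> y t) (at_right 0)" if t: "0 \<le> t" "t < T" for t
 proof -
  have tT: "t \<in> {0..T}" using t by auto
  note c = wave_carr[OF w tT]
  have ev: "\<forall>\<^sub>F k in at_right 0. 0 < k \<and> t + k \<in> {0..T}"
   unfolding eventually_at_right_field using t by (intro exI[of _ "T - t"]) auto
  have l: "((%k. nrm X (dq k v t - q)) ---> nrm X (v' t - q)) (at_right 0)"
   if v: "sderiv T v v'" "\<And>s. s \<in> {0..T} ==> v s \<in> carr X" and q: "q \<in> carr X" for v v' q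
  proof -
   have v't: "v' t \<in> carr X" "v t \<in> carr X" using sderiv_carr[OF v(1) tT] v(2)[OF tT] by auto
   have "((%k. nrm X (dq k v t - q) - nrm X (v' t - q)) ---> 0) (at_right 0)"
   proof (rule tendsto_rabs_zero_cancel, rule tendsto_zero_le[OF sderiv_dq_tendsto[OF v(1) t]])
    show "\<forall>\<^sub>F k in at_right 0. \<bar>nrm X (dq k v t - q) - nrm X (v' t - q)\<bar> \<le> nrm X (dq k v t - v' t)"
     using ev
    proof eventually_elim
     case (elim k)
     then have "dq k v t \<in> carr X" using v(2)[of "t + k"] v't by (simp add: dq_def)
     then show ?case
      using nrm_abs_diff_le[of "dq k v t - q" "v' t - q"] v't q by simp
    qed
   qed simp
   then show ?thesis by (simp add: LIM_zero_iff)
  qed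
  have "sderiv T u u'" "sderiv T n n'" using w by (auto simp: wave_def)
  then show ?thesis
   unfolding Y_def y_def
   using l[of u u' p] l[of n n' 0] wave_carr[OF w] pc by (auto intro!: tendsto_intros)
 qed
 define B where "B k = tau * ((nrm X (G1 - A p) + sqrt (tau + k) * MG) + (nrm X (F1 - K p) + sqrt (tau + k) * MF) / sqrt eps)" for k
 have "\<forall>\<^sub>F k in at_right 0. sqrt (Y k tau) \<le> sqrt (Y k 0) + B k"
  unfolding eventually_at_right_field
 proof (intro exI[of _ "T - tau"] conjI allI impI)
  fix k assume k: "0 < k" "k < T - tau"
  have wk: "wave tau eps (%t. dq k u t - p) (dq k n) (dq k u') (dq k n') (%t. dq k G t - A p) (%t. dq k F t - K p)"
   using wave_sub[OF wave_minus_const[OF wave_dq[OF w, of k] p(1)], of tau] k by simp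
  have bnd: "nrm X (dq k H t - q) \<le> nrm X (H1 - q) + sqrt (tau + k) * M"
   if H: "H2_data T H H1 M" and q: "q \<in> carr X" and t: "t \<in> {0..tau}" for H H1 M q t
  proof -
   have c: "dq k H t \<in> carr X" "H1 \<in> carr X" "0 \<le> M"
    using H k t dq_carr[of T H k t] contT_carr[of T H] by (auto simp: H2_data_def)
   have "nrm X (dq k H t - q) \<le> nrm X (dq k H t - H1) + nrm X (H1 - q)"
    using c q by (intro nrm_diff_triangle)
   also have "nrm X (dq k H t - H1) \<le> sqrt (t + k) * M" using H t k by (auto simp: H2_data_def)
   also have "\<dots> \<le> sqrt (tau + k) * M" using t c by (intro mult_right_mono) auto
   finally show ?thesis by simp
  qed
  have "sqrt (wave_energy eps (%t. dq k u t - p) (dq k n) tau) \<le> sqrt (wave_energy eps (%t. dq k u t - p) (dq k n) 0) + B k"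
   unfolding B_def
   by (rule wave_sup_estimate[OF wk tau(1) eps]) (use bnd[OF G pc(2)] bnd[OF F pc(3)] in auto)
  then show "sqrt (Y k tau) \<le> sqrt (Y k 0) + B k" by (simp add: Y_def wave_energy_def)
 qed (use tau in auto)
 moreover have "((%k. sqrt (Y k tau)) ---> sqrt (y tau)) (at_right 0)" using tau by (intro tendsto_real_sqrt lim) auto
 moreover have "((%k. sqrt (Y k 0) + B k) ---> sqrt (y 0) + B 0) (at_right 0)"
 proof (intro tendsto_add tendsto_real_sqrt lim)
  have "((%k. tau + k) ---> tau + 0) (at_right 0)" by (intro tendsto_intros)
  then show "(B ---> B 0) (at_right 0)"
   unfolding B_def using eps by (intro tendsto_intros) auto
 qed (use tau in auto)
 ultimately have "sqrt (y tau) \<le> sqrt (y 0) + B 0"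
  by (intro tendsto_le[OF _ _ _ ]) auto
 moreover have "y 0 = 0" using p by (simp add: y_def)
 ultimately show ?thesis by (simp add: y_def B_def add_divide_distrib algebra_simps)
qed

text \<open>For fixed \<open>tau\<close> the estimate is applied to the double quotients
  \<open>dq k (dq tau u)\<close>, and \<open>k\<close> tends to zero. The initial energy tends to
  that of the first derivatives' quotients at time 0, which the first-order estimate bounds
  independently of small \<open>tau\<close> by \<open>A0^2\<close>.\<close>

lemma wave_second_order:
 assumes w: "wave T eps u n u' n' G F" and eps: "0 < eps"
  and G: "H2_data T G G1 MG" and F: "H2_data T F F1 MF"
  and p: "p \<in> V" "nrm X (u' 0 - p) = 0" "nrm X (n' 0) = 0" and tau: "0 < tau" "tau < T"
  and cn': "contT X T n'"
 shows "d * nI 0 (T - tau) (dq tau n') \<le>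
  exp 1 * ((nrm X (G1 - A p) + nrm X (F1 - K p) / sqrt eps + sqrt tau * (MG + MF / sqrt eps))^2 + T * MG^2 + MF^2 / d)"
proof -
 define A0 where "A0 = nrm X (G1 - A p) + nrm X (F1 - K p) / sqrt eps + sqrt tau * (MG + MF / sqrt eps)"
 define R where "R = exp 1 * (A0^2 + T * MG^2 + MF^2 / d)"
 have pc: "p \<in> carr X" "A p \<in> carr X" "K p \<in> carr X" using p V_carr A_carr K_carr by auto
 have T0: "0 \<in> {0..T}" "tau \<in> {0..T}" using tau by auto
 have su: "sderiv T u u'" "sderiv T n n'" "contT X T u" "contT X T n" using w by (auto simp: wave_def)
 have cc: "u t \<in> carr X" "n t \<in> carr X" "u' t \<in> carr X" "n' t \<in> carr X" if "t \<in> {0..T}" for t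
  using wave_carr[OF w that] by auto
 have cdq: "dq tau u t \<in> carr X" "dq tau n t \<in> carr X" "dq tau u' t \<in> carr X" "dq tau n' t \<in> carr X" if t: "t \<in> {0..T - tau}" for t
  by (rule dq_carr[OF cc(1) less_imp_le[OF tau(1)] t] dq_carr[OF cc(2) less_imp_le[OF tau(1)] t]
    dq_carr[OF cc(3) less_imp_le[OF tau(1)] t] dq_carr[OF cc(4) less_imp_le[OF tau(1)] t]; assumption)+
 have sdq: "sderiv (T - tau) (dq tau u) (dq tau u')" "sderiv (T - tau) (dq tau n) (dq tau n')"
  using tau su cc by (auto intro!: sderiv_dq)
 define Y where "Y k = wave_energy eps (dq k (dq tau u)) (dq k (dq tau n)) 0" for k
 have lim: "((%k. nrm X (dq k v t)) ---> nrm X (v' t)) (at_right 0)"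
  if v: "sderiv (T - tau) v v'" "\<And>s. s \<in> {0..T - tau} ==> v s \<in> carr X" and t: "0 \<le> t" "t < T - tau" for v v' t
 proof -
  have v't: "v' t \<in> carr X" "v t \<in> carr X" using sderiv_carr[OF v(1)] v(2) t by auto
  have ev: "\<forall>\<^sub>F k in at_right 0. 0 < k \<and> t + k \<in> {0..T - tau}"
   unfolding eventually_at_right_field using t by (intro exI[of _ "T - tau - t"]) auto
  have "((%k. nrm X (dq k v t) - nrm X (v' t)) ---> 0) (at_right 0)"
  proof (rule tendsto_rabs_zero_cancel, rule tendsto_zero_le[OF sderiv_dq_tendsto[OF v(1) t]])
   show "\<forall>\<^sub>F k in at_right 0. \<bar>nrm X (dq k v t) - nrm X (v' t)\<bar> \<le> nrm X (dq k v t - v' t)"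
    using ev
   proof eventually_elim
    case (elim k)
    then have "dq k v t \<in> carr X" using v(2)[of "t + k"] v't by (simp add: dq_def)
    then show ?case using nrm_abs_diff_le[of "dq k v t" "v' t"] v't by simp
   qed
  qed simp
  then show ?thesis by (simp add: LIM_zero_iff)
 qed
 have Ylim: "(Y ---> (nrm X (dq tau u' 0))^2 + eps * (nrm X (dq tau n' 0))^2) (at_right 0)"
  unfolding Y_def wave_energy_def using tau by (intro tendsto_intros lim[OF sdq(1)] lim[OF sdq(2)] cdq) auto
 \<comment> \<open>As \<open>u' 0\<close> is at distance zero from \<open>p\<close> and
   \<open>n' 0\<close> from 0, these quotients are the first-order quantities at time
   \<open>tau\<close> divided by \<open>tau\<close>.\<close>
 have Yle: "(nrm X (dq tau u' 0))^2 + eps * (nrm X (dq tau n' 0))^2 \<le> A0^2"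
 proof -
  have e: "nrm X (x - y) = nrm X (x - z)" if "x \<in> carr X" "y \<in> carr X" "z \<in> carr X" "nrm X (y - z) = 0" for x y z
   using that nrm_diff_commute[of y z] by (intro nrm_eqI) auto
  have "nrm X (u' tau - u' 0) = nrm X (u' tau - p)" using p cc T0 pc by (intro e) auto
  then have 1: "nrm X (dq tau u' 0) = nrm X (u' tau - p) / tau"
   using tau cc T0 by (simp add: dq_def nrm_scale divide_inverse mult.commute)
  have "nrm X (n' tau - n' 0) = nrm X (n' tau - 0)" using p cc T0 by (intro e) auto
  then have 2: "nrm X (dq tau n' 0) = nrm X (n' tau) / tau"
   using tau cc T0 by (simp add: dq_def nrm_scale divide_inverse mult.commute)
  have "sqrt ((nrm X (u' tau - p))^2 + eps * (nrm X (n' tau))^2) \<le> tau * A0"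
   unfolding A0_def by (rule wave_first_order[OF w eps G F p tau])
  then have "(nrm X (u' tau - p))^2 + eps * (nrm X (n' tau))^2 \<le> (tau * A0)^2"
   by (rule sqrt_le_D)
  then have "((nrm X (u' tau - p))^2 + eps * (nrm X (n' tau))^2) / tau^2 \<le> A0^2"
   using tau by (simp add: divide_le_eq power_mult_distrib mult.commute)
  then show ?thesis unfolding 1 2 by (simp add: power_divide add_divide_distrib)
 qed
 have T0M: "0 \<le> MG" "0 \<le> MF" using G F by (auto simp: H2_data_def)
 have est: "d * nI 0 (T - tau - k) (%t. dq k (dq tau n) t) \<le> exp 1 * (Y k + T * MG^2 + MF^2 / d)"
  if k: "0 < k" "k < T - tau" for k
 proof -
  have wk: "wave (T - tau - k) eps (dq k (dq tau u)) (dq k (dq tau n)) (dq k (dq tau u')) (dq k (dq tau n')) (dq k (dq tau G)) (dq k (dq tau F))"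
   using k tau by (intro wave_dq w) auto
  have "d * nI 0 (T - tau - k) (%t. dq k (dq tau n) t) \<le>
    exp 1 * (Y k + T * nI 0 (T - tau - k) (%t. dq k (dq tau G) t) + nI 0 (T - tau - k) (%t. dq k (dq tau F) t) / d)"
   unfolding Y_def by (rule wave_L2_estimate[OF wk _ _ eps]) (use k tau in auto)
  also have "\<dots> \<le> exp 1 * (Y k + T * MG^2 + MF^2 / d)"
   using G F k tau d_pos by (intro mult_left_mono add_mono divide_right_mono order_refl) (auto simp: H2_data_def)
  finally show ?thesis .
 qed
 \<comment> \<open>The double quotient is defined only up to \<open>T - tau - k\<close>. For
   \<open>S\<close> strictly smaller than \<open>T - tau\<close> the limit is taken on a fixed
   interval; the last piece follows by continuity in \<open>S\<close>.\<close>
 have main: "d * nI 0 S (dq tau n') \<le> R" if S: "0 < S" "S < T - tau" for S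
 proof -
  define k where "k j = (T - tau - S) / (real j + 2)" for j
  have k: "0 < k j" "k j < T - tau - S" "k j < T - tau" for j
  proof -
   have "(T - tau - S) / (real j + 2) < (T - tau - S) / 1" using S by (intro divide_strict_left_mono) auto
   then show "0 < k j" "k j < T - tau - S" "k j < T - tau" using S by (auto simp: k_def)
  qed
  have k0: "k ----> 0" unfolding k_def by real_asymp
  have kr: "filterlim k (at_right 0) sequentially" using k0 k by (intro tendsto_imp_filterlim_at_right) auto
  have cdn: "contT X (T - tau) (dq tau n)" "contT X (T - tau) (dq tau n')" using tau su cn' by (auto intro: contT_dq)
  obtain M where M: "\<And>t. t \<in> {0..T - tau} ==> nrm X (dq tau n' t) \<le> M"
  proof -
   have "bounded ((%t. nrm X (dq tau n' t)) ` {0..T - tau})"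
    by (intro compact_imp_bounded compact_continuous_image contT_nrm cdn) auto
   then show ?thesis using that unfolding bounded_iff by (metis abs_le_D1 imageI real_norm_def)
  qed
  \<comment> \<open>A bound uniform in \<open>j\<close> for dominated convergence. A quotient is an
    average of the derivative, and the average is estimated by testing with the quotient
    itself.\<close>
  have b: "nrm X (dq (k j) (dq tau n) t) \<le> M" if t: "t \<in> {0..S}" for j t
  proof (rule le_nrm_of_inn_le)
   have tk: "t \<in> {0..T - tau}" "t + k j \<in> {0..T - tau}" using t k[of j] by auto
   define v where "v = dq (k j) (dq tau n) t"
   have vc: "v \<in> carr X" unfolding v_def using tk cdq by (simp add: dq_def[of "k j"])
   show "dq (k j) (dq tau n) t \<in> carr X" using vc by (simp add: v_def)
   have "inn X v v = inn X (dq tau n (t + k j) - dq tau n t) v / k j"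
    using tk cdq vc by (subst (1) v_def) (simp add: dq_def[of "k j"] inn_scale_left divide_inverse)
   also have "inn X (dq tau n (t + k j) - dq tau n t) v = ig t (t + k j) (%r. inn X (dq tau n' r) v)"
    using tk k[of j] by (intro sderiv_primitive[OF sdq(2) _ vc] cdq) auto
   also have "\<dots> \<le> ig t (t + k j) (%r. nrm X v * M)"
   proof (intro integral_le integrable_continuous_interval continuous_on_const)
    show "continuous_on {t..t + k j} (%r. inn X (dq tau n' r) v)"
     by (rule continuous_on_subset[OF contT_inn[OF cdn(2) contT_const[OF vc]]]) (use tk in auto)
    fix r assume "r \<in> {t..t + k j}"
    then have r: "r \<in> {0..T - tau}" using tk by auto
    have "inn X (dq tau n' r) v \<le> nrm X (dq tau n' r) * nrm X v" using r cdq vc by (intro inn_le_nrm) auto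
    also have "\<dots> \<le> M * nrm X v" using M[OF r] vc by (intro mult_right_mono) auto
    finally show "inn X (dq tau n' r) v \<le> nrm X v * M" by (simp add: mult.commute)
   qed
   also have "\<dots> = k j * (nrm X v * M)" using k[of j] by simp
   finally have "inn X v v \<le> nrm X v * M"
    using k[of j] by (simp add: divide_right_mono)
   then show "inn X (dq (k j) (dq tau n) t) (dq (k j) (dq tau n) t) \<le> nrm X (dq (k j) (dq tau n) t) * M" by (simp add: v_def)
   show "0 \<le> M" using M[OF tk(1)] nrm_nonneg[OF cdq(4)[OF tk(1)]] by linarith
  qed
  have cdk: "continuous_on {0..S} (%t. (nrm X (dq (k j) (dq tau n) t))^2)" for j
  proof -
   have "contT X (T - tau - k j) (dq (k j) (dq tau n))" using k[of j] by (intro contT_dq cdn) auto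
   then have "contT X S (dq (k j) (dq tau n))" by (rule contT_sub) (use k[of j] in auto)
   then show ?thesis by (intro continuous_intros contT_nrm)
  qed
  have cS: "continuous_on {0..S} (%t. (nrm X (dq tau n' t))^2)"
   using contT_sub[OF cdn(2), of S] S by (intro continuous_intros contT_nrm) auto
  have "(%j. nI 0 S (%t. dq (k j) (dq tau n) t)) ----> nI 0 S (dq tau n')"
  proof (rule tendsto_ivl_dominated(2)[where w = "%_. M^2"])
   show "AE t in ivl 0 S. (%j. (nrm X (dq (k j) (dq tau n) t))^2) ----> (nrm X (dq tau n' t))^2"
    using S by (intro AE_ivl_all tendsto_intros filterlim_compose[OF lim[OF sdq(2) cdq(2)] kr]) auto
   show "AE t in ivl 0 S. \<bar>(nrm X (dq (k j) (dq tau n) t))^2\<bar> \<le> M^2" for j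
   proof (rule AE_ivl_all)
    fix t assume t: "t \<in> {0..S}"
    have "t \<in> {0..T - tau}" "t + k j \<in> {0..T - tau}" using t k[of j] by auto
    then have "dq (k j) (dq tau n) t \<in> carr X" using cdq by (simp add: dq_def[of "k j"])
    then show "\<bar>(nrm X (dq (k j) (dq tau n) t))^2\<bar> \<le> M^2" using b[OF t, of j] by (auto intro!: power_mono)
   qed
  qed (use cdk cS in \<open>auto intro!: ivl_cont continuous_imp_measurable_on_sets_lebesgue\<close>)
  then have l1: "(%j. d * nI 0 S (%t. dq (k j) (dq tau n) t)) ----> d * nI 0 S (dq tau n')"
   by (intro tendsto_intros)
  have l2: "(%j. exp 1 * (Y (k j) + T * MG^2 + MF^2 / d)) ---->
    exp 1 * ((nrm X (dq tau u' 0))^2 + eps * (nrm X (dq tau n' 0))^2 + T * MG^2 + MF^2 / d)"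
   using d_pos by (intro tendsto_intros filterlim_compose[OF Ylim kr]) auto
  have "d * nI 0 S (%t. dq (k j) (dq tau n) t) \<le> exp 1 * (Y (k j) + T * MG^2 + MF^2 / d)" for j
  proof -
   have "contT X (T - tau - k j) (dq (k j) (dq tau n))" using k[of j] by (intro contT_dq cdn) auto
   then have "intable 0 (T - tau - k j) (%t. (nrm X (dq (k j) (dq tau n) t))^2)"
    by (intro ivl_cont continuous_intros contT_nrm)
   then have "nI 0 S (%t. dq (k j) (dq tau n) t) \<le> nI 0 (T - tau - k j) (%t. dq (k j) (dq tau n) t)"
    using k[of j] by (intro ivl_mono_sub) auto
   then show ?thesis
    using est[OF k(1,3)[of j]] d_pos mult_left_mono[of _ _ d] by (meson less_imp_le order_trans)
  qed
  then have "d * nI 0 S (dq tau n') \<le>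
    exp 1 * ((nrm X (dq tau u' 0))^2 + eps * (nrm X (dq tau n' 0))^2 + T * MG^2 + MF^2 / d)"
   by (intro LIMSEQ_le[OF l1 l2]) auto
  also have "\<dots> \<le> R" unfolding R_def using Yle by (intro mult_left_mono add_mono order_refl) auto
  finally show ?thesis .
 qed
 have cI: "continuous_on {0..T - tau} (%S. d * nI 0 S (dq tau n'))"
  using tau cn' by (intro continuous_intros indefinite_integral_continuous_1 integrable_continuous_interval contT_nrm contT_dq) auto
 have "((%S. d * nI 0 S (dq tau n')) ---> d * nI 0 (T - tau) (dq tau n')) (at_left (T - tau))"
 proof -
  have "((%S. d * nI 0 S (dq tau n')) ---> d * nI 0 (T - tau) (dq tau n')) (at (T - tau) within {0..T - tau})"
   using cI tau by (auto simp: continuous_on_def)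
  moreover have "at (T - tau) within {0..T - tau} = at_left (T - tau)" using tau by (intro at_within_Icc_at_left) auto
  ultimately show ?thesis by simp
 qed
 moreover have "\<forall>\<^sub>F S in at_left (T - tau). d * nI 0 S (dq tau n') \<le> R"
  unfolding eventually_at_left_field using tau main by (intro exI[of _ 0]) auto
 ultimately have "d * nI 0 (T - tau) (dq tau n') \<le> R"
  by (rule tendsto_upperbound) simp
 then show ?thesis by (simp add: R_def A0_def)
qed

end

section \<open>Data of class \<open>H^2\<close> in time\<close>

lemma L2_triangle:
 assumes f: "sq_int a b f" and g: "sq_int a b g" and "0 \<le> M" "0 \<le> N"
  and "ig a b (%x. (f x)^2) \<le> M^2" "ig a b (%x. (g x)^2) \<le> N^2"
 shows "ig a b (%x. (f x + g x)^2) \<le> (M + N)^2"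
proof -
 have i: "intable a b (%x. (f x)^2)" "intable a b (%x. (g x)^2)" "intable a b (%x. f x * g x)"
  using f g sq_int_mult[OF f g] by (auto simp: sq_int_def)
 have "sqrt (ig a b (%x. (f x)^2)) \<le> M" "sqrt (ig a b (%x. (g x)^2)) \<le> N"
  using assms by (auto intro: real_le_lsqrt)
 moreover have "0 \<le> ig a b (%x. (g x)^2)" using i by (intro ivl_nonneg) auto
 ultimately have "ig a b (%x. f x * g x) \<le> M * N"
  using assms by (intro order_trans[OF sq_int_Cauchy_Schwarz[OF f g]] mult_mono) auto
 moreover have "ig a b (%x. (f x + g x)^2) =
   ig a b (%x. (f x)^2) + ig a b (%x. (g x)^2) + 2 * ig a b (%x. f x * g x)"
  using i by (simp add: power2_sum ivl_add mult.assoc)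
 ultimately show ?thesis using assms by (simp add: power2_sum)
qed

context semi_inner
begin

text \<open>Minkowski's inequality for a vector integral that is never formed: \<open>x\<close> is
  known only through its product with itself, and the integrand is paired with \<open>x\<close>
  under the integral.\<close>

lemma nrm_le_integral:
 assumes x: "x \<in> carr X" and f: "AE r in ivl a b. f r \<in> carr X \<and> nrm X (f r) \<le> h r"
  and i: "intable a b (%r. inn X (f r) x)" "intable a b h"
  and le: "inn X x x \<le> c * ig a b (%r. inn X (f r) x)" "0 \<le> c"
 shows "nrm X x \<le> c * ig a b h"
proof (rule le_nrm_of_inn_le[OF x])
 have "ig a b (%r. inn X (f r) x) \<le> ig a b (%r. nrm X x * h r)"
 proof (intro ivl_mono_AE i integrable_mult_right)
  show "AE r in ivl a b. inn X (f r) x \<le> nrm X x * h r"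
   using f
  proof eventually_elim
   case (elim r)
   then have "nrm X (f r) * nrm X x \<le> h r * nrm X x" using x by (intro mult_right_mono) auto
   then show ?case using inn_le_nrm[of "f r" x] elim x by (simp add: mult.commute)
  qed
 qed
 then have "c * ig a b (%r. inn X (f r) x) \<le> c * ig a b (%r. nrm X x * h r)"
  using le by (intro mult_left_mono)
 then show "inn X x x \<le> nrm X x * (c * ig a b h)" using le by (simp add: mult.left_commute)
 have "AE r in ivl a b. 0 \<le> h r"
  using f by eventually_elim (auto intro: order_trans[OF nrm_nonneg])
 then show "0 \<le> c * ig a b h" using i le by (intro mult_nonneg_nonneg ivl_nonneg) auto
qed

text \<open>Here \<open>v\<close> is the first derivative of \<open>u\<close>, and
  \<open>zet\<close> dominates the norm of the second. A quotient of \<open>u\<close> is an average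
  of \<open>v\<close>, and a double quotient is bounded by two successive window averages of
  \<open>zet\<close>, neither of which increases the \<open>L^2\<close> norm.\<close>

lemma H2_dataI:
 assumes u: "contT X T u" and v: "L2c T v"
  and id: "\<And>s t w. 0 \<le> s ==> s \<le> t ==> t \<le> T ==> w \<in> carr X ==> inn X (u t - u s) w = ig s t (%r. inn X (v r) w)"
  and zet: "sq_int 0 T zet" "\<And>t. 0 \<le> zet t" "ig 0 T (%t. (zet t)^2) \<le> M^2" "0 \<le> M"
  and Z: "negligible Z"
  and vc: "\<And>s t. s \<in> {0..T} - Z ==> t \<in> {0..T} - Z ==> s \<le> t ==> v s \<in> carr X \<and> nrm X (v t - v s) \<le> ig s t zet"
  and u1: "u1 \<in> carr X" "\<And>t. t \<in> {0..T} - Z ==> nrm X (v t - u1) \<le> ig 0 t zet"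
 shows "H2_data T u u1 M"
 unfolding H2_data_def
proof (intro conjI allI impI u u1(1) zet(4))
 have zeti: "intable 0 T zet" by (rule sq_int_integrable[OF zet(1)])
 have zet2: "intable 0 T (%t. (zet t)^2)" using zet by (simp add: sq_int_def)
 have vint: "intable a b (%r. inn X (v r) w)" if "w \<in> carr X" "0 \<le> a" "b \<le> T" for a b w
  using that by (intro ivl_sub[OF L2c_inn[OF v L2c_const]]) auto
 show "nrm X (dq k u t - u1) \<le> sqrt (t + k) * M" if k: "0 < k" "0 \<le> t" "t + k \<le> T" for t k
 proof -
  define w where "w = dq k u t - u1"
  define B where "B = sqrt (t + k) * M"
  have ut: "u t \<in> carr X" "u (t + k) \<in> carr X" using contT_carr[OF u] k by auto
  then have w: "w \<in> carr X" "dq k u t \<in> carr X" using u1 by (auto simp: w_def dq_def)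
  have b: "ig 0 r zet \<le> B" if r: "r \<in> {t..t + k}" for r
  proof -
   have "ig 0 r zet \<le> sqrt (r - 0) * sqrt (ig 0 r (%t. (zet t)^2))"
    using r k by (intro sq_int_integral_le sq_int_sub[OF zet(1)]) auto
   also have "ig 0 r (%t. (zet t)^2) \<le> ig 0 T (%t. (zet t)^2)"
    using r k by (intro ivl_mono_sub zet2) auto
   finally have "ig 0 r zet \<le> sqrt r * sqrt (ig 0 T (%t. (zet t)^2))"
    using r k by (simp add: mult_left_mono)
   also have "\<dots> \<le> sqrt r * sqrt (M^2)"
    using zet(3) r k by (intro mult_left_mono real_sqrt_le_mono) auto
   finally have "ig 0 r zet \<le> sqrt r * sqrt (M^2)" .
   also have "\<dots> \<le> B" unfolding B_def using r k zet(4) by (simp add: mult_right_mono)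
   finally show ?thesis .
  qed
  have "nrm X w \<le> (1 / k) * ig t (t + k) (%r. B)"
  proof (rule nrm_le_integral[where f = "%r. v r - u1"])
   show AE: "AE r in ivl t (t + k). v r - u1 \<in> carr X \<and> nrm X (v r - u1) \<le> B"
   proof (rule AE_ivlI[OF Z])
    fix r assume r: "r \<in> {t..t + k}" "r \<notin> Z"
    then have "r \<in> {0..T} - Z" using k by auto
    then show "v r - u1 \<in> carr X \<and> nrm X (v r - u1) \<le> B"
     using vc[of r r] u1 b[OF r(1)] by (auto intro: order_trans)
   qed
   have vr: "AE r in ivl t (t + k). v r \<in> carr X"
    using k by (intro AE_ivl_sub[OF L2c_carr[OF v]]) auto
   have eq: "AE r in ivl t (t + k). inn X (v r) w - inn X u1 w = inn X (v r - u1) w"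
    using vr by eventually_elim (use u1 w in \<open>simp add: inn_diff_left\<close>)
   have i1: "intable t (t + k) (%r. inn X (v r) w - inn X u1 w)"
    using k w by (intro Bochner_Integration.integrable_diff vint ivl_cont[OF continuous_on_const]) auto
   show "intable t (t + k) (%r. inn X (v r - u1) w)" by (rule integrable_ivl_cong_AE[OF i1 eq])
   have "ig t (t + k) (%r. inn X (v r - u1) w) = inn X (u (t + k) - u t) w - k * inn X u1 w"
    using ivl_cong_AE[OF i1 eq] id[of t "t + k" w] k w vint[OF w(1), of t "t + k"]
    by (simp add: ivl_diff ivl_cont)
   then show "inn X w w \<le> (1 / k) * ig t (t + k) (%r. inn X (v r - u1) w)"
   proof -
    have "inn X w w = inn X (u (t + k) - u t) w / k - inn X u1 w"
     using w u1 ut by (subst (1) w_def) (simp add: dq_def inn_diff_left inn_scale_left divide_inverse mult.commute)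
    then show "ig t (t + k) (%r. inn X (v r - u1) w) = inn X (u (t + k) - u t) w - k * inn X u1 w ==> ?thesis"
     using k by (simp add: field_simps)
   qed
  qed (use w k in \<open>auto intro: ivl_cont\<close>)
  then show ?thesis using k by (simp add: w_def B_def)
 qed
 show "nI 0 (T - tau - k) (%t. dq k (dq tau u) t) \<le> M^2"
  if tauk: "0 < tau" "0 < k" "tau + k \<le> T" for tau k
 proof -
  define m where "m s = ig s (s + tau) zet / tau" for s
  define mm where "mm t = ig t (t + k) m / k" for t
  have m: "continuous_on {0..T - tau} m" "ig 0 (T - tau) (%s. (m s)^2) \<le> ig 0 T (%t. (zet t)^2)"
   unfolding m_def using window_average_sq_le[OF zet(1), of tau] tauk by auto
  have mm: "continuous_on {0..T - tau - k} mm" "ig 0 (T - tau - k) (%s. (mm s)^2) \<le> ig 0 (T - tau) (%t. (m t)^2)"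
   unfolding mm_def using window_average_sq_le[OF sq_int_cont[OF m(1)], of k] tauk by auto
  have "nrm X (dq k (dq tau u) t) \<le> mm t" if t: "t \<in> {0..T - tau - k}" for t
  proof -
   define w where "w = dq k (dq tau u) t"
   have ut: "u t \<in> carr X" "u (t + k) \<in> carr X" "u (t + tau) \<in> carr X" "u (t + k + tau) \<in> carr X"
    using contT_carr[OF u] tauk t by auto
   then have w: "w \<in> carr X" by (simp add: w_def dq_def)
   have "nrm X w \<le> (1 / (k * tau)) * ig t (t + k) (%r. tau * m r)"
   proof (rule nrm_le_integral[where f = "%r. v (r + tau) - v r"])
    show AE: "AE r in ivl t (t + k). v (r + tau) - v r \<in> carr X \<and> nrm X (v (r + tau) - v r) \<le> tau * m r"
    proof (rule AE_ivlI[of "Z \<union> (+) (- tau) ` Z"])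
     show "negligible (Z \<union> (+) (- tau) ` Z)" using Z by (intro negligible_Un negligible_translation)
     fix r assume r: "r \<in> {t..t + k}" "r \<notin> Z \<union> (+) (- tau) ` Z"
     then have "r + tau \<notin> Z" by (auto simp: image_iff)
     then have z: "r \<in> {0..T} - Z" "r + tau \<in> {0..T} - Z" using r t tauk by auto
     then show "v (r + tau) - v r \<in> carr X \<and> nrm X (v (r + tau) - v r) \<le> tau * m r"
      using vc[OF z] vc[OF z(2,2)] tauk by (simp add: m_def)
    qed
    have i1: "intable t (t + k) (%r. inn X (v r) w)" using t tauk w by (intro vint) auto
    have i2: "intable (t + tau) (t + k + tau) (%r. inn X (v r) w)" using t tauk w by (intro vint) auto
    have i3: "intable t (t + k) (%r. inn X (v (r + tau)) w)"
     "ig t (t + k) (%r. inn X (v (r + tau)) w) = ig (t + tau) (t + k + tau) (%r. inn X (v r) w)"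
     using ivl_shift[OF i2, of tau] by auto
    have vr: "AE r in ivl t (t + k). v r \<in> carr X"
     using t tauk by (intro AE_ivl_sub[OF L2c_carr[OF v]]) auto
    have eq: "AE r in ivl t (t + k). inn X (v (r + tau)) w - inn X (v r) w = inn X (v (r + tau) - v r) w"
     using vr AE
    proof eventually_elim
     case (elim r)
     then have "v (r + tau) \<in> carr X" using carr_add[of "v (r + tau) - v r" "v r"] by simp
     then show ?case using elim w by (simp add: inn_diff_left)
    qed
    note i4 = Bochner_Integration.integrable_diff[OF i3(1) i1]
    show "intable t (t + k) (%r. inn X (v (r + tau) - v r) w)" by (rule integrable_ivl_cong_AE[OF i4 eq])
    have "ig t (t + k) (%r. inn X (v (r + tau) - v r) w) = inn X (u (t + k + tau) - u (t + tau)) w - inn X (u (t + k) - u t) w"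
     using ivl_cong_AE[OF i4 eq] i3 i1 id[of "t + tau" "t + k + tau" w] id[of t "t + k" w] t tauk w
     by (simp add: ivl_diff)
    then show "inn X w w \<le> (1 / (k * tau)) * ig t (t + k) (%r. inn X (v (r + tau) - v r) w)"
    proof -
     have "inn X w w = (inn X (u (t + k + tau) - u (t + tau)) w - inn X (u (t + k) - u t) w) / (k * tau)"
      using w ut by (subst (1) w_def) (simp add: inn_diff_left inn_scale_left dq_def divide_inverse ring_distribs)
     then show "ig t (t + k) (%r. inn X (v (r + tau) - v r) w) = inn X (u (t + k + tau) - u (t + tau)) w - inn X (u (t + k) - u t) w ==> ?thesis"
      by simp
    qed
    show "intable t (t + k) (%r. tau * m r)"
     using t by (intro integrable_mult_right ivl_cont continuous_on_subset[OF m(1)]) auto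
   qed (use w tauk in auto)
   also have "\<dots> = mm t" using tauk by (simp add: mm_def)
   finally show ?thesis by (simp add: w_def)
  qed
  moreover have "dq k (dq tau u) t \<in> carr X" if "t \<in> {0..T - tau - k}" for t
   using contT_carr[OF u] that tauk by (simp add: dq_def)
  moreover have "contT X (T - tau - k) (dq k (dq tau u))" using tauk u by (intro contT_dq) auto
  ultimately have "nI 0 (T - tau - k) (%t. dq k (dq tau u) t) \<le> ig 0 (T - tau - k) (%s. (mm s)^2)"
   by (intro integral_le integrable_continuous_interval continuous_intros contT_nrm mm power_mono) auto
  then show ?thesis using mm m zet(3) by simp
 qed
qed

lemma H2_data_add:
 assumes a: "H2_data T u u1 M" and b: "H2_data T v v1 N"
 shows "H2_data T (%t. u t + v t) (u1 + v1) (M + N)"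
proof -
 have u: "contT X T u" "u1 \<in> carr X" "0 \<le> M" and v: "contT X T v" "v1 \<in> carr X" "0 \<le> N"
  using a b by (auto simp: H2_data_def)
 have dqa: "dq k (%t. u t + v t) = (%t. dq k u t + dq k v t)" for k and u v :: "real => 'x"
  by (simp add: dq_def fun_eq_iff algebra_simps)
 show ?thesis
  unfolding H2_data_def
 proof (intro conjI allI impI)
  show "contT X T (%t. u t + v t)" "u1 + v1 \<in> carr X" "0 \<le> M + N" using u v by (auto intro: contT_add)
  show "nrm X (dq k (%t. u t + v t) t - (u1 + v1)) \<le> sqrt (t + k) * (M + N)"
   if k: "0 < k" "0 \<le> t" "t + k \<le> T" for t k
  proof -
   have c: "dq k u t \<in> carr X" "dq k v t \<in> carr X"
    using contT_carr[OF u(1)] contT_carr[OF v(1)] k by (auto simp: dq_def)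
   have "nrm X ((dq k u t - u1) + (dq k v t - v1)) \<le> nrm X (dq k u t - u1) + nrm X (dq k v t - v1)"
    using c u v by (intro nrm_triangle) auto
   also have "\<dots> \<le> sqrt (t + k) * M + sqrt (t + k) * N" using a b k by (auto simp: H2_data_def intro!: add_mono)
   finally show ?thesis by (simp add: dqa algebra_simps)
  qed
  show "nI 0 (T - tau - k) (%t. dq k (dq tau (%t. u t + v t)) t) \<le> (M + N)^2"
   if tauk: "0 < tau" "0 < k" "tau + k \<le> T" for tau k
  proof -
   have c: "contT X (T - tau - k) (dq k (dq tau u))" "contT X (T - tau - k) (dq k (dq tau v))"
    using tauk u v by (auto intro!: contT_dq)
   have "nI 0 (T - tau - k) (%t. dq k (dq tau u) t + dq k (dq tau v) t) \<le>
     ig 0 (T - tau - k) (%t. (nrm X (dq k (dq tau u) t) + nrm X (dq k (dq tau v) t))^2)"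
    using contT_carr[OF c(1)] contT_carr[OF c(2)]
    by (intro integral_le integrable_continuous_interval continuous_intros contT_nrm contT_add c power_mono nrm_triangle) auto
   also have "\<dots> \<le> (M + N)^2"
    using a b tauk u v by (intro L2_triangle sq_int_cont contT_nrm c) (auto simp: H2_data_def)
   finally show ?thesis by (simp add: dqa)
  qed
 qed
qed

lemma H2_data_zero: "H2_data T (%t. 0) 0 0"
 by (simp add: H2_data_def dq_def contT_const)

lemma H2_data_sum:
 assumes "finite I" "\<And>i. i \<in> I ==> H2_data T (u i) (u1 i) (M i)"
 shows "H2_data T (%t. \<Sum>i\<in>I. u i t) (\<Sum>i\<in>I. u1 i) (\<Sum>i\<in>I. M i)"
 using assms by (induction I rule: finite_induct) (auto intro: H2_data_add simp: H2_data_zero)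

lemma H2_data_scale_const:
 assumes phi: "\<And>t. t \<in> {0..T} ==> (phi has_real_derivative psi t) (at t within {0..T})"
  and psi: "continuous_on {0..T} psi" and y: "sq_int 0 T y"
  and psiy: "\<And>s t. 0 \<le> s ==> s \<le> t ==> t \<le> T ==> psi t - psi s = ig s t y" and w: "w \<in> carr X" and T: "0 \<le> T"
 shows "H2_data T (%t. phi t *R w) (psi 0 *R w) (sqrt (ig 0 T (%t. (y t)^2)) * nrm X w)"
proof (rule H2_dataI[where v = "%t. psi t *R w" and zet = "%t. nrm X w * \<bar>y t\<bar>" and Z = "{}"])
 have cphi: "continuous_on {0..T} phi" using phi by (rule DERIV_continuous_on)
 show "contT X T (%t. phi t *R w)" by (rule contT_scale_const[OF cphi w])
 show "L2c T (%t. psi t *R w)" by (rule contT_L2c[OF contT_scale_const[OF psi w]])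
 have y2: "0 \<le> ig 0 T (%t. (y t)^2)" using y by (intro ivl_nonneg) (auto simp: sq_int_def)
 show "sq_int 0 T (%t. nrm X w * \<bar>y t\<bar>)" by (intro sq_int_cmult sq_int_abs y)
 show "0 \<le> nrm X w * \<bar>y t\<bar>" for t using w by simp
 show "0 \<le> sqrt (ig 0 T (%t. (y t)^2)) * nrm X w" using y2 w by simp
 show "ig 0 T (%t. (nrm X w * \<bar>y t\<bar>)^2) \<le> (sqrt (ig 0 T (%t. (y t)^2)) * nrm X w)^2"
  using y2 by (simp add: power_mult_distrib mult.commute)
 have b: "nrm X (psi t *R w - psi s *R w) \<le> ig s t (%t. nrm X w * \<bar>y t\<bar>)"
  if "0 \<le> s" "s \<le> t" "t \<le> T" for s t
 proof -
  have yi: "intable s t y" using that by (intro ivl_sub[OF sq_int_integrable[OF y]]) auto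
  have "psi t *R w - psi s *R w = (psi t - psi s) *R w" by (simp add: scaleR_diff_left)
  then have "nrm X (psi t *R w - psi s *R w) = \<bar>ig s t y\<bar> * nrm X w"
   using w psiy[OF that] by (simp add: nrm_scale)
  also have "\<dots> \<le> ig s t (%t. \<bar>y t\<bar>) * nrm X w"
   using w yi by (intro mult_right_mono ivl_abs_le) auto
  finally show ?thesis by (simp add: mult.commute)
 qed
 show "psi s *R w \<in> carr X \<and> nrm X (psi t *R w - psi s *R w) \<le> ig s t (%t. nrm X w * \<bar>y t\<bar>)"
  if "s \<in> {0..T} - {}" "t \<in> {0..T} - {}" "s \<le> t" for s t
  using that w b by auto
 show "nrm X (psi t *R w - psi 0 *R w) \<le> ig 0 t (%t. nrm X w * \<bar>y t\<bar>)" if "t \<in> {0..T} - {}" for t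
  using that b by auto
 show "inn X (phi t *R w - phi s *R w) z = ig s t (%r. inn X (psi r *R w) z)"
  if "0 \<le> s" "s \<le> t" "t \<le> T" "z \<in> carr X" for s t z
  using that w by (intro sderiv_primitive[OF sderiv_scale_const[OF phi w]]) auto
qed (use w in auto)

end

text \<open>Completeness serves to produce the initial value of a weak time derivative.\<close>

locale hilbert = semi_inner X for X :: "'x::real_vector hspace" +
 assumes complete: "\<And>x. (\<And>n. x n \<in> carr X) ==>
   (\<And>e. e > 0 ==> \<exists>N::nat. \<forall>m\<ge>N. \<forall>n\<ge>N. nrm X (x m - x n) < e) ==>
   \<exists>y\<in>carr X. (%n. nrm X (x n - y)) ----> 0"
begin

text \<open>Off a null set \<open>v\<close> is Hoelder continuous with exponent 1/2, because its
  derivative \<open>z\<close> is square integrable. Its values along times decreasing to 0 therefore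
  form a Cauchy sequence, and the limit is \<open>u1\<close>.\<close>

lemma H2_data_of_weak:
 assumes T: "T > 0" and u: "contT X T u" and uvz: "L2T X T u" "L2T X T v" "L2T X T z"
  and uv: "weak_tderiv X T u v" and vz: "weak_tderiv X T v z"
 obtains u1 where "H2_data T u u1 (sqrt (nI 0 T z))"
  "(nrm X u1)^2 \<le> 2 / T * nI 0 T v + 2 * T * nI 0 T z"
proof -
 define I where "I = nI 0 T z"
 note vc = L2T_L2c[OF uvz(2)] and zc = L2T_L2c[OF uvz(3)]
 have ns: "sq_int 0 T (%t. nrm X (z t))" by (rule L2c_nrm[OF zc])
 have ni: "intable 0 T (%t. nrm X (z t))" by (rule sq_int_integrable[OF ns])
 have n2: "intable 0 T (%t. (nrm X (z t))^2)" using ns by (simp add: sq_int_def)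
 have I0: "0 \<le> I" unfolding I_def using n2 by (intro ivl_nonneg) auto
 obtain Z Y where Z: "negligible Z" and Y: "subspace Y" "Y \<subseteq> carr X"
  and vY: "\<And>t. t \<in> {0..T} - Z ==> v t \<in> Y \<and> z t \<in> Y"
  and vid: "\<And>s t w. s \<in> {0..T} - Z ==> t \<in> {0..T} - Z ==> s \<le> t ==> w \<in> Y ==>
    inn X (v t - v s) w = ig s t (%r. inn X (z r) w)"
  using weak_tderiv_primitive[OF uvz(2,3) vz] by metis
 define zet where "zet t = \<bar>nrm X (z t)\<bar>" for t
 have zets: "sq_int 0 T zet" unfolding zet_def by (intro sq_int_abs ns)
 have zetI: "ig 0 T (%t. (zet t)^2) = I" by (simp add: zet_def I_def)
 have vzet: "nrm X (v t - v s) \<le> ig s t zet" if st: "s \<in> {0..T} - Z" "t \<in> {0..T} - Z" "s \<le> t" for s t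
 proof -
  have w: "v t - v s \<in> Y" using vY[OF st(1)] vY[OF st(2)] Y by (intro subspace_diff) auto
  then have wc: "v t - v s \<in> carr X" using Y by blast
  have "nrm X (v t - v s) \<le> 1 * ig s t zet"
  proof (rule nrm_le_integral[OF wc, where f = z])
   show "AE r in ivl s t. z r \<in> carr X \<and> nrm X (z r) \<le> zet r"
   proof (rule AE_ivlI[OF Z])
    fix r assume "r \<in> {s..t}" "r \<notin> Z"
    then have "z r \<in> Y" using vY[of r] st by auto
    then show "z r \<in> carr X \<and> nrm X (z r) \<le> zet r" using Y by (auto simp: zet_def)
   qed
   show "intable s t (%r. inn X (z r) (v t - v s))"
    using st wc by (intro ivl_sub[OF L2c_inn[OF zc L2c_const]]) auto
   show "intable s t zet" using st by (intro ivl_sub[OF sq_int_integrable[OF zets]]) auto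
  qed (use vid[OF st w] in auto)
  then show ?thesis by simp
 qed
 have zetb: "ig s t zet \<le> sqrt (t - s) * sqrt I" if "0 \<le> s" "s \<le> t" "t \<le> T" for s t
 proof -
  have "ig s t zet \<le> sqrt (t - s) * sqrt (ig s t (%t. (zet t)^2))"
   using that by (intro sq_int_integral_le sq_int_sub[OF zets]) auto
  also have "ig s t (%t. (zet t)^2) \<le> I"
   unfolding zetI[symmetric] using that zets by (intro ivl_mono_sub) (auto simp: sq_int_def)
  finally show ?thesis using that by (simp add: mult_left_mono)
 qed
 have "\<exists>t. t \<in> {0..T} - Z \<and> t < e" if e: "e > 0" for e
 proof -
  have "0 \<in> closure ({0..T} - Z)" using closure_ivl_minus_negligible[OF Z T] T by simp
  then obtain y where "y \<in> {0..T} - Z" "dist y 0 < e" using e unfolding closure_approachable by blast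
  then show ?thesis by (intro exI[of _ y]) (auto simp: dist_real_def)
 qed
 then have "\<forall>n. \<exists>t. t \<in> {0..T} - Z \<and> t < 1 / real (Suc n)" by simp
 from choice[OF this] obtain x where x: "\<And>n. x n \<in> {0..T} - Z" "\<And>n. x n < 1 / real (Suc n)" by blast
 have vx: "v (x n) \<in> carr X" for n using vY[OF x(1)] Y by blast
 have cau: "nrm X (v s - v t) \<le> sqrt e * sqrt I" if "s \<in> {0..T} - Z" "t \<in> {0..T} - Z" "s \<le> e" "t \<le> e" for s t e
 proof -
  have le: "nrm X (v t - v s) \<le> sqrt e * sqrt I" if st: "s \<in> {0..T} - Z" "t \<in> {0..T} - Z" "s \<le> t" "t \<le> e" for s t
  proof -
   have "nrm X (v t - v s) \<le> sqrt (t - s) * sqrt I" using vzet[OF st(1-3)] zetb[of s t] st by auto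
   also have "\<dots> \<le> sqrt e * sqrt I" using st I0 by (intro mult_right_mono) auto
   finally show ?thesis .
  qed
  have "v s \<in> carr X" "v t \<in> carr X" using vY that Y by blast+
  then show ?thesis using le[of s t] le[of t s] that nrm_diff_commute by (cases "s \<le> t") auto
 qed
 have e0: "(%n. sqrt (1 / real (Suc n)) * sqrt I) ----> 0"
 proof -
  have "(%n. sqrt (1 / real (Suc n)) * sqrt I) ----> sqrt 0 * sqrt I"
   using LIMSEQ_Suc[OF lim_1_over_n] by (intro tendsto_intros)
  then show ?thesis by simp
 qed
 have xle: "x m \<le> 1 / real (Suc N)" if "N \<le> m" for m N
 proof -
  have "1 / real (Suc m) \<le> 1 / real (Suc N)" using that by (intro divide_left_mono) auto
  then show ?thesis using x(2)[of m] by linarith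
 qed
 obtain u1 where u1: "u1 \<in> carr X" "(%n. nrm X (v (x n) - u1)) ----> 0"
 proof -
  have "\<exists>y\<in>carr X. (%n. nrm X (v (x n) - y)) ----> 0"
  proof (rule complete[OF vx])
   fix e :: real assume "e > 0"
   then have "\<forall>\<^sub>F n in sequentially. sqrt (1 / real (Suc n)) * sqrt I < e" by (intro order_tendstoD(2)[OF e0])
   then obtain N where N: "sqrt (1 / real (Suc N)) * sqrt I < e" by (auto simp: eventually_sequentially)
   show "\<exists>N. \<forall>m\<ge>N. \<forall>n\<ge>N. nrm X (v (x m) - v (x n)) < e"
    using cau[OF x(1) x(1) xle xle] N by (intro exI[of _ N]) (meson le_less_trans)
  qed
  then show ?thesis using that by blast
 qed
 have vu1: "nrm X (v t - u1) \<le> ig 0 t zet" if t: "t \<in> {0..T} - Z" for t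
 proof (rule field_le_epsilon)
  fix e :: real assume e: "e > 0"
  have vt: "v t \<in> carr X" using vY[OF t] Y by blast
  show "nrm X (v t - u1) \<le> ig 0 t zet + e"
  proof (cases "t = 0")
   case False
   have "(%n. nrm X (v (x n) - u1)) ----> 0" by (fact u1)
   then have "\<forall>\<^sub>F n in sequentially. nrm X (v (x n) - u1) < e" using e by (intro order_tendstoD) auto
   moreover have "\<forall>\<^sub>F n in sequentially. 1 / real (Suc n) < t"
    using LIMSEQ_Suc[OF lim_1_over_n] False t by (intro order_tendstoD) auto
   ultimately have "\<forall>\<^sub>F n in sequentially. nrm X (v (x n) - u1) < e \<and> 1 / real (Suc n) < t"
    by eventually_elim simp
   then obtain n where n: "nrm X (v (x n) - u1) < e" "1 / real (Suc n) < t" by (auto simp: eventually_sequentially)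
   have xt: "x n \<le> t" using x(2)[of n] n by linarith
   have "nrm X (v t - v (x n)) \<le> ig (x n) t zet" by (rule vzet[OF x(1) t xt])
   also have "\<dots> \<le> ig 0 t zet"
    using x(1)[of n] t zet_def by (intro ivl_mono_sub ivl_sub[OF sq_int_integrable[OF zets]]) auto
   finally show ?thesis using nrm_diff_triangle[OF vt vx[of n] u1(1)] n by linarith
  next
   case True
   have "(%n. sqrt (1 / real (Suc n)) * sqrt I + nrm X (v (x n) - u1)) ----> 0 + 0" by (intro tendsto_add e0 u1)
   then have "\<forall>\<^sub>F n in sequentially. sqrt (1 / real (Suc n)) * sqrt I + nrm X (v (x n) - u1) < e" using e by (intro order_tendstoD) auto
   then obtain n where n: "sqrt (1 / real (Suc n)) * sqrt I + nrm X (v (x n) - u1) < e" by (auto simp: eventually_sequentially)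
   have "nrm X (v t - v (x n)) \<le> sqrt (1 / real (Suc n)) * sqrt I"
    using cau[OF t x(1)[of n] _ xle[OF order_refl]] True by auto
   then show ?thesis using nrm_diff_triangle[OF vt vx[of n] u1(1)] n True by simp
  qed
 qed
 have "H2_data T u u1 (sqrt I)"
 proof (rule H2_dataI[OF u vc _ zets _ _ _ Z _ u1(1) vu1])
  show "inn X (u t - u s) w = ig s t (%r. inn X (v r) w)" if "0 \<le> s" "s \<le> t" "t \<le> T" "w \<in> carr X" for s t w
  proof -
   have "weak_deriv T (%t. inn X (u t) w) (%t. inn X (v t) w)"
    using uv that unfolding weak_tderiv_def weak_deriv_def by blast
   then have "inn X (u t) w - inn X (u s) w = ig s t (%r. inn X (v r) w)"
    by (rule weak_deriv_primitive[OF _ contT_inn[OF u contT_const[OF that(4)]] L2c_inn[OF vc L2c_const[OF that(4)]] that(1-3)])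
   then show ?thesis using contT_carr[OF u] that by (simp add: inn_diff_left)
  qed
  show "v s \<in> carr X \<and> nrm X (v t - v s) \<le> ig s t zet" if "s \<in> {0..T} - Z" "t \<in> {0..T} - Z" "s \<le> t" for s t
   using vzet[OF that] vY[OF that(1)] Y by blast
 qed (use I0 zetI in \<open>auto simp: zet_def\<close>)
 moreover have "(nrm X u1)^2 \<le> 2 / T * nI 0 T v + 2 * T * I"
 proof -
  have v2: "intable 0 T (%t. (nrm X (v t))^2)" using L2c_nrm[OF vc] by (simp add: sq_int_def)
  \<comment> \<open>The trace inequality: \<open>u1\<close> is compared with \<open>v t\<close> for
    every \<open>t\<close>, and the result is averaged over the interval. This is where
    \<open>2 / T\<close> and \<open>2 * T\<close> come from.\<close>
  have "ig 0 T (%t. (nrm X u1)^2) \<le> ig 0 T (%t. 2 * (nrm X (v t))^2 + 2 * (T * I))"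
  proof (intro ivl_mono_AE Bochner_Integration.integrable_add integrable_mult_right v2 AE_ivlI[OF Z] ivl_cont[OF continuous_on_const])
   fix t assume "t \<in> {0..T}" "t \<notin> Z"
   then have t: "t \<in> {0..T} - Z" by auto
   have vt: "v t \<in> carr X" using vY[OF t] Y by blast
   have "nrm X (v t - u1) \<le> sqrt t * sqrt I" using vu1[OF t] zetb[of 0 t] t by simp
   also have "\<dots> \<le> sqrt T * sqrt I" using t I0 by (intro mult_right_mono) auto
   finally have "(nrm X (v t - u1))^2 \<le> (sqrt T * sqrt I)^2" using vt u1 by (intro power_mono) auto
   then have 1: "(nrm X (v t - u1))^2 \<le> T * I" using T I0 by (simp add: power_mult_distrib)
   have "nrm X u1 \<le> nrm X (v t) + nrm X (v t - u1)"
    using nrm_abs_diff_le[OF vt u1(1)] by linarith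
   then have "(nrm X u1)^2 \<le> (nrm X (v t) + nrm X (v t - u1))^2" using u1 by (intro power_mono) auto
   also have "\<dots> \<le> 2 * (nrm X (v t))^2 + 2 * (nrm X (v t - u1))^2"
    using sum_squares_bound[of "nrm X (v t)" "nrm X (v t - u1)"] by (simp add: power2_sum)
   finally show "(nrm X u1)^2 \<le> 2 * (nrm X (v t))^2 + 2 * (T * I)" using 1 by linarith
  qed
  also have "\<dots> = 2 * nI 0 T v + T * (2 * (T * I))"
   using v2 T by (simp add: ivl_add ivl_cont)
  finally have "T * (nrm X u1)^2 \<le> 2 * nI 0 T v + T * (2 * (T * I))" using T by simp
  then show ?thesis using T by (simp add: field_simps)
 qed
 ultimately show ?thesis using that by (simp add: I_def)
qed

end

section \<open>The spaces on the network\<close>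

lemma smooth_test_fun: "test_fun L phi ==> smooth phi"
 by (simp add: test_fun_def smooth_def)

locale net =
 fixes N :: "('v, 'e) network"
 assumes net: "is_network N"
begin

abbreviation E :: "'e set" where "E \<equiv> arcs (graph N)"

lemma finE: "finite E" and finV: "finite (verts (graph N))"
 using net by (auto simp: is_network_def fin_digraph_def fin_digraph_axioms_def)

lemma len_pos: "e \<in> E ==> 0 < len N e"
 using net by (auto simp: is_network_def)

lemma L2_iff: "u \<in> L2 N \<longleftrightarrow> (\<forall>e\<in>E. sq_int 0 (len N e) (u e))"
 by (auto simp: L2_def sq_int_def)

lemma L2D: "u \<in> L2 N ==> e \<in> E ==> sq_int 0 (len N e) (u e)"
 by (simp add: L2_iff)

lemma ip_eq:
 assumes "u \<in> L2 N" "w \<in> L2 N"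
 shows "ip N u w = (\<Sum>e\<in>E. ig 0 (len N e) (%x. u e x * w e x))"
 unfolding ip_def using assms by (intro sum.cong refl ivl_eq sq_int_mult) (auto simp: L2_iff)

lemma L2_subspace: "subspace (L2 N)"
proof (rule subspaceI)
 show "0 \<in> L2 N" by (simp add: L2_iff zero_fun_def sq_int_const)
 show "u + w \<in> L2 N" if "u \<in> L2 N" "w \<in> L2 N" for u w
  using that by (auto simp: L2_iff plus_fun_def intro!: sq_int_add)
 show "c *R u \<in> L2 N" if "u \<in> L2 N" for c u
  using that by (auto simp: L2_iff scaleR_fun_def intro!: sq_int_cmult)
qed

lemma ae_eq_refl: "ae_eq N u u" by (simp add: ae_eq_def)

lemma ae_eq_sym: "ae_eq N u w ==> ae_eq N w u"
 unfolding ae_eq_def by (auto elim!: eventually_mono)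

lemma ae_eq_trans: "ae_eq N u w ==> ae_eq N w z ==> ae_eq N u z"
 unfolding ae_eq_def by (fastforce elim: eventually_elim2)

lemma ip_cong: "ae_eq N u w ==> u \<in> L2 N ==> w \<in> L2 N ==> z \<in> L2 N ==> ip N u z = ip N w z"
 by (simp add: ip_eq)
   (auto intro!: sum.cong ivl_cong_AE sq_int_mult[OF L2D L2D] simp: ae_eq_def elim!: eventually_mono)

sublocale L: semi_inner "L2_sp N"
proof
 show "subspace (carr (L2_sp N))" by (simp add: L2_sp_def L2_subspace)
 show "inn (L2_sp N) x y = inn (L2_sp N) y x" for x y by (simp add: L2_sp_def ip_def mult.commute)
 show "inn (L2_sp N) (x + y) z = inn (L2_sp N) x z + inn (L2_sp N) y z"
  if "x \<in> carr (L2_sp N)" "y \<in> carr (L2_sp N)" "z \<in> carr (L2_sp N)" for x y z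
  using that unfolding L2_sp_def ip_def
  by (auto simp: distrib_right sum.distrib[symmetric] intro!: sum.cong Bochner_Integration.integral_add sq_int_mult[OF L2D L2D])
 show "inn (L2_sp N) (c *R x) y = c * inn (L2_sp N) x y" if "x \<in> carr (L2_sp N)" "y \<in> carr (L2_sp N)" for c x y
  by (simp add: L2_sp_def ip_def sum_distrib_left mult.assoc)
 show "0 \<le> inn (L2_sp N) x x" for x
  by (auto simp: L2_sp_def ip_def intro!: sum_nonneg Bochner_Integration.integral_nonneg)
qed

lemma carr_L [simp]: "carr (L2_sp N) = L2 N" and inn_L [simp]: "inn (L2_sp N) = ip N"
 by (auto simp: L2_sp_def)

abbreviation nL :: "'e nfun => real" where "nL \<equiv> nrm (L2_sp N)"

lemma nL_sq: "u \<in> L2 N ==> (nL u)^2 = (\<Sum>e\<in>E. ig 0 (len N e) (%x. (u e x)^2))"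
 using L.nrm_sq[of u] by (simp add: ip_eq power2_eq_square)

lemma nL_zero_iff:
 assumes "u \<in> L2 N"
 shows "nL u = 0 \<longleftrightarrow> ae_eq N u (%e x. 0)"
proof
 assume "nL u = 0"
 then have "(\<Sum>e\<in>E. ig 0 (len N e) (%x. (u e x)^2)) = 0" using nL_sq[OF assms] by simp
 moreover have i: "intable 0 (len N e) (%x. (u e x)^2)" if "e \<in> E" for e
  using assms that by (simp add: L2_iff sq_int_def)
 ultimately have "\<forall>e\<in>E. ig 0 (len N e) (%x. (u e x)^2) = 0"
  using finE by (subst (asm) sum_nonneg_eq_0_iff) (auto intro!: ivl_nonneg)
 then have "\<forall>e\<in>E. lint 0 (len N e) (%x. (u e x)^2) = 0"
  using i by (simp add: ivl_eq)
 then have "\<forall>e\<in>E. AE x in ivl 0 (len N e). (u e x)^2 = 0"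
  using i by (auto simp: integral_nonneg_eq_0_iff_AE)
 then show "ae_eq N u (%e x. 0)" by (simp add: ae_eq_def)
next
 assume "ae_eq N u (%e x. 0)"
 then have "ip N u u = ip N (%e x. 0) u"
  using assms L.carr_zero by (intro ip_cong) (auto simp: zero_fun_def[symmetric])
 then show "nL u = 0" by (simp add: nrm_def ip_def)
qed

lemma ae_eq_iff_nL: "u \<in> L2 N ==> w \<in> L2 N ==> ae_eq N u w \<longleftrightarrow> nL (u - w) = 0"
 using nL_zero_iff[of "u - w"] L.carr_diff[of u w] by (simp add: ae_eq_def)

lemma ae_eq_L2:
 assumes "ae_eq N u w" "u \<in> L2 N"
 shows "w \<in> L2 N"
 unfolding L2_iff sq_int_def
proof (intro ballI conjI)
 fix e assume e: "e \<in> E"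
 have ae: "AE x in ivl 0 (len N e). u e x = w e x" using assms e by (simp add: ae_eq_def)
 have u: "u e \<in> meas 0 (len N e)" "intable 0 (len N e) (%x. (u e x)^2)"
  using assms(2) e by (auto simp: L2_iff sq_int_def)
 show "w e \<in> meas 0 (len N e)" by (rule ivl_meas_cong_AE[OF u(1) ae])
 have "AE x in ivl 0 (len N e). (u e x)^2 = (w e x)^2" using ae by eventually_elim simp
 then show "intable 0 (len N e) (%x. (w e x)^2)" by (rule integrable_ivl_cong_AE[OF u(2)])
qed

subsection \<open>Completeness of \<open>L^2\<close>\<close>

text \<open>The sums \<open>h n\<close> of absolute increments are bounded in \<open>L^2\<close>, so
  the increasing limit of their squares is integrable and hence finite almost everywhere. This gives
  pointwise convergence, and four times that limit dominates the squared errors.\<close>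

lemma Riesz_Fischer_ivl:
 fixes f :: "nat => real => real"
 assumes f: "\<And>n. sq_int a b (f n)"
  and cau: "\<And>n. ig a b (%x. (f (Suc n) x - f n x)^2) \<le> (1 / 4) ^ n"
 obtains g where "sq_int a b g" "(%n. ig a b (%x. (f n x - g x)^2)) ----> 0"
proof -
 define M where "M = ivl a b"
 have df: "sq_int a b (%x. f m x - f n x)" for m n
  using sq_int_add[OF f[of m] sq_int_cmult[OF f[of n], of "-1"]] by simp
 have d2: "intable a b (%x. (f m x - f n x)^2)" for m n using df by (simp add: sq_int_def)
 define h where "h n x = (\<Sum>i<n. \<bar>f (Suc i) x - f i x\<bar>)" for n x
 have hs: "sq_int a b (h n)" for n
  unfolding h_def by (intro sq_int_sum sq_int_abs df) auto
 \<comment> \<open>The increment with index \<open>i\<close> has norm at most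
   \<open>(1 / 2) ^ i\<close>, and \<open>2 - 2 * (1 / 2) ^ n\<close> is the sum of these numbers
   over \<open>i < n\<close>.\<close>
 have hb: "ig a b (%x. (h n x)^2) \<le> (2 - 2 * (1 / 2) ^ n)^2" for n
 proof (induction n)
  case 0
  then show ?case by (simp add: h_def)
 next
  case (Suc n)
  have "ig a b (%x. (h n x + \<bar>f (Suc n) x - f n x\<bar>)^2) \<le> ((2 - 2 * (1 / 2) ^ n) + (1 / 2) ^ n)^2"
  proof (rule L2_triangle[OF hs sq_int_abs[OF df] _ _ Suc])
   show "ig a b (%x. \<bar>f (Suc n) x - f n x\<bar>^2) \<le> ((1 / 2) ^ n)^2"
    using cau[of n] by (simp add: power_mult[symmetric] mult.commute power_mult power2_eq_square power_mult_distrib[symmetric])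
   have "(1 / 2 :: real) ^ n \<le> 1" by (simp add: power_le_one)
   then show "(0::real) \<le> 2 - 2 * (1 / 2) ^ n" by simp
  qed auto
  then show ?case by (simp add: h_def)
 qed
 have hb4: "ig a b (%x. (h n x)^2) \<le> 4" for n
 proof -
  have "(1 / 2 :: real) ^ n \<le> 1" "0 \<le> (1 / 2 :: real) ^ n" by (simp_all add: power_le_one)
  then have "(2 - 2 * (1 / 2 :: real) ^ n)^2 \<le> 2^2" by (intro power_mono) auto
  from order_trans[OF hb[of n] this] show ?thesis by simp
 qed
 have h2: "integrable M (%x. (h n x)^2)" for n using hs by (simp add: sq_int_def M_def)
 have hmono: "h m x \<le> h n x" if "m \<le> n" for m n x
  unfolding h_def using that by (intro sum_mono2) auto
 have h0: "0 \<le> h n x" for n x unfolding h_def by (intro sum_nonneg) auto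
 define H where "H x = (SUP n. ennreal ((h n x)^2))" for x
 have "(\<integral>\<^sup>+x. H x \<partial>M) = (SUP n. \<integral>\<^sup>+x. ennreal ((h n x)^2) \<partial>M)"
  unfolding H_def using h2 h0 hmono
  by (intro nn_integral_monotone_convergence_SUP) (auto simp: incseq_def le_fun_def intro!: ennreal_leI power_mono)
 also have "\<dots> \<le> 4"
 proof (rule SUP_least)
  fix n
  have "(\<integral>\<^sup>+x. ennreal ((h n x)^2) \<partial>M) = ennreal (integral\<^sup>L M (%x. (h n x)^2))"
   using h2 by (intro nn_integral_eq_integral) auto
  also have "\<dots> \<le> ennreal 4"
   using hb4[of n] h2[of n] by (intro ennreal_leI) (simp add: M_def ivl_eq)
  finally show "(\<integral>\<^sup>+x. ennreal ((h n x)^2) \<partial>M) \<le> 4" by simp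
 qed
 finally have "(\<integral>\<^sup>+x. H x \<partial>M) \<noteq> \<infinity>" using ennreal_less_top[of 4] by (auto simp: top_unique)
 moreover have Hm: "H \<in> borel_measurable M"
  unfolding H_def using h2 by (intro borel_measurable_SUP) auto
 ultimately have Hfin: "AE x in M. H x \<noteq> \<infinity>" by (intro nn_integral_PInf_AE)
 define g where "g x = lim (%n. f n x)" for x
 define W where "W x = enn2real (H x)" for x
 have W: "integrable M W"
 proof (rule integrableI_bounded)
  show "W \<in> borel_measurable M" unfolding W_def using Hm by measurable
  have "(\<integral>\<^sup>+x. ennreal (norm (W x)) \<partial>M) \<le> (\<integral>\<^sup>+x. H x \<partial>M)"
   by (intro nn_integral_mono) (simp add: W_def ennreal_enn2real_if)
  then show "(\<integral>\<^sup>+x. ennreal (norm (W x)) \<partial>M) < \<infinity>" using \<open>(\<integral>\<^sup>+x. H x \<partial>M) \<noteq> \<infinity>\<close>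
   by (simp add: less_top[symmetric]) (metis top.extremum_uniqueI)
 qed
 have pt: "AE x in M. (%n. f n x) ----> g x \<and> (\<forall>n. \<bar>f n x - g x\<bar> \<le> 2 * sqrt (W x)) \<and> (\<forall>n. (h n x)^2 \<le> W x)"
  using Hfin
 proof eventually_elim
  case (elim x)
  have hW: "(h n x)^2 \<le> W x" for n
  proof -
   have "ennreal ((h n x)^2) \<le> H x" unfolding H_def by (intro SUP_upper) auto
   also have "H x = ennreal (W x)" using elim by (simp add: W_def less_top[symmetric])
   finally show ?thesis by (simp add: W_def ennreal_le_iff)
  qed
  have hs: "h n x \<le> sqrt (W x)" for n using hW[of n] by (intro real_le_rsqrt)
  have "summable (%i. \<bar>f (Suc i) x - f i x\<bar>)"
  proof (rule bounded_imp_summable)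
   show "(\<Sum>k\<le>n. \<bar>f (Suc k) x - f k x\<bar>) \<le> sqrt (W x)" for n
    using hs[of "Suc n"] by (simp add: h_def lessThan_Suc_atMost)
  qed simp
  then have "summable (%i. f (Suc i) x - f i x)" by (rule summable_rabs_cancel)
  then have "convergent (%n. \<Sum>i<n. f (Suc i) x - f i x)" by (simp add: summable_iff_convergent)
  then have "convergent (%n. f n x - f 0 x)" unfolding sum_lessThan_telescope[of "%i. f i x"] .
  then have "convergent (%n. f n x)" by (simp add: convergent_diff_const_right_iff)
  then have lim: "(%n. f n x) ----> g x" by (simp add: g_def convergent_LIMSEQ_iff)
  have fd: "\<bar>f n x - f 0 x\<bar> \<le> sqrt (W x)" for n
  proof -
   have "\<bar>f n x - f 0 x\<bar> = \<bar>\<Sum>i<n. f (Suc i) x - f i x\<bar>" unfolding sum_lessThan_telescope[of "%i. f i x"] ..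
   also have "\<dots> \<le> h n x" unfolding h_def by (rule sum_abs)
   finally show ?thesis using hs[of n] by linarith
  qed
  have "\<bar>g x - f 0 x\<bar> \<le> sqrt (W x)"
   using lim fd by (intro tendsto_upperbound[of "%n. \<bar>f n x - f 0 x\<bar>" _ sequentially]) (auto intro!: tendsto_intros)
  then have "\<bar>f n x - g x\<bar> \<le> 2 * sqrt (W x)" for n using fd[of n] by linarith
  then show ?case using lim hW by blast
 qed
 have gm: "g \<in> meas a b"
 proof (rule ivl_meas_lim_AE)
  show "f n \<in> meas a b" for n using f by (simp add: sq_int_def)
  show "AE x in ivl a b. (%n. f n x) ----> g x"
   using pt unfolding M_def by eventually_elim blast
 qed
 have g0: "sq_int a b (%x. f n x - g x)" for n
  unfolding sq_int_def
 proof (intro conjI Bochner_Integration.integrable_bound[of _ "%x. 4 * W x" "%x. (f n x - g x)^2"])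
  show "AE x in ivl a b. norm ((f n x - g x)^2) \<le> norm (4 * W x)"
   using pt unfolding M_def
  proof eventually_elim
   case (elim x)
   then have "0 \<le> W x" using zero_le_power2 order_trans by blast
   moreover have "(f n x - g x)^2 \<le> (2 * sqrt (W x))^2" using elim by (intro abs_le_imp_square_le) auto
   ultimately show ?case by (simp add: power_mult_distrib)
  qed
 qed (use W f[of n] gm in \<open>auto simp: M_def sq_int_def\<close>)
 have "(%n. ig a b (%x. (f n x - g x)^2)) ----> ig a b (%x. 0)"
 proof (rule tendsto_ivl_dominated(2)[where w = "%x. 4 * W x"])
  show "AE x in ivl a b. (%n. (f n x - g x)^2) ----> 0"
   using pt unfolding M_def
  proof eventually_elim
   case (elim x)
   then have "(%n. (f n x - g x)^2) ----> (g x - g x)^2" by (intro tendsto_intros) auto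
   then show ?case by simp
  qed
  show "AE x in ivl a b. \<bar>(f n x - g x)^2\<bar> \<le> 4 * W x" for n
   using pt unfolding M_def
  proof eventually_elim
   case (elim x)
   then have "0 \<le> W x" using zero_le_power2 order_trans by blast
   moreover have "(f n x - g x)^2 \<le> (2 * sqrt (W x))^2" using elim by (intro abs_le_imp_square_le) auto
   ultimately show ?case by (simp add: power_mult_distrib)
  qed
 qed (use W g0 in \<open>auto simp: M_def sq_int_def\<close>)
 moreover have "sq_int a b g"
  using sq_int_add[OF f[of 0] sq_int_cmult[OF g0[of 0], of "-1"]] by simp
 ultimately show ?thesis using that by simp
qed

sublocale L: hilbert "L2_sp N"
proof
 fix x :: "nat => 'e nfun"
 assume x: "\<And>n. x n \<in> carr (L2_sp N)" and cau: "\<And>e. e > 0 ==> \<exists>M::nat. \<forall>m\<ge>M. \<forall>n\<ge>M. nL (x m - x n) < e"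
 have "\<forall>k. \<exists>M::nat. \<forall>m\<ge>M. \<forall>n\<ge>M. nL (x m - x n) < (1 / 2) ^ k" using cau by simp
 from choice[OF this] obtain M where M: "\<And>k m n. m \<ge> M k ==> n \<ge> M k ==> nL (x m - x n) < (1 / 2) ^ k" by blast
 \<comment> \<open>Partial sums are monotone and dominate each \<open>M k\<close>, so consecutive
   members of the subsequence are both beyond \<open>M k\<close>.\<close>
 define r where "r k = (\<Sum>i\<le>k. M i)" for k
 have r: "M k \<le> r k" "r k \<le> r (Suc k)" for k
  unfolding r_def using member_le_sum[of k "{..k}" M] by auto
 have ge: "M k \<le> r (Suc k)" for k using r[of k] by linarith
 have xd: "x m - x n \<in> L2 N" for m n using x L.carr_diff by simp
 have edge: "ig 0 (len N e) (%y. (x m e y - x n e y)^2) \<le> (nL (x m - x n))^2" if "e \<in> E" for e m n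
 proof -
  have "ig 0 (len N e) (%y. ((x m - x n) e y)^2) \<le> (\<Sum>e\<in>E. ig 0 (len N e) (%y. ((x m - x n) e y)^2))"
   using that xd finE by (intro member_le_sum ivl_nonneg) (auto simp: L2_iff sq_int_def)
  then show ?thesis using nL_sq[OF xd, of m n] by simp
 qed
 have "\<forall>e\<in>E. \<exists>g. sq_int 0 (len N e) g \<and> (%n. ig 0 (len N e) (%y. (x (r n) e y - g y)^2)) ----> 0"
 proof
  fix e assume e: "e \<in> E"
  show "\<exists>g. sq_int 0 (len N e) g \<and> (%n. ig 0 (len N e) (%y. (x (r n) e y - g y)^2)) ----> 0"
  proof (rule Riesz_Fischer_ivl[of 0 "len N e" "%n. x (r n) e"])
   show "sq_int 0 (len N e) (x (r n) e)" for n using x e by (simp add: L2_iff)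
   show "ig 0 (len N e) (%y. (x (r (Suc n)) e y - x (r n) e y)^2) \<le> (1 / 4) ^ n" for n
   proof -
    have "(nL (x (r (Suc n)) - x (r n)))^2 \<le> ((1 / 2) ^ n)^2"
     using M[OF ge r(1), of n] xd by (intro power_mono) (auto intro: less_imp_le)
    then show ?thesis using edge[OF e, of "r (Suc n)" "r n"]
     by (simp add: power_mult[symmetric] mult.commute[of n 2]) (simp add: power_mult power2_eq_square)
   qed
  qed blast
 qed
 from bchoice[OF this] obtain g where g: "\<And>e. e \<in> E ==> sq_int 0 (len N e) (g e)"
  "\<And>e. e \<in> E ==> (%n. ig 0 (len N e) (%y. (x (r n) e y - g e y)^2)) ----> 0" by blast
 have gL: "g \<in> L2 N" using g by (simp add: L2_iff)
 have xg: "x n - g \<in> L2 N" for n using x gL L.carr_diff by simp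
 have "(%n. \<Sum>e\<in>E. ig 0 (len N e) (%y. (x (r n) e y - g e y)^2)) ----> (\<Sum>e\<in>E. 0)"
  by (intro tendsto_sum g)
 then have "(%n. sqrt ((nL (x (r n) - g))^2)) ----> sqrt 0"
  using nL_sq[OF xg] by (intro tendsto_real_sqrt) simp
 then have sub: "(%n. nL (x (r n) - g)) ----> 0" using xg by simp
 have "(%n. nL (x n - g)) ----> 0"
 proof (rule LIMSEQ_I)
  fix e :: real assume e: "e > 0"
  have "\<forall>\<^sub>F k in sequentially. nL (x (r k) - g) < e / 2" using sub e by (intro order_tendstoD) auto
  moreover have "\<forall>\<^sub>F k in sequentially. (1 / 2 :: real) ^ k < e / 2"
   using LIMSEQ_realpow_zero[of "1 / 2"] e by (intro order_tendstoD) auto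
  ultimately have "\<forall>\<^sub>F k in sequentially. nL (x (r k) - g) < e / 2 \<and> (1 / 2) ^ k < e / 2" by eventually_elim simp
  then obtain k where k: "nL (x (r k) - g) < e / 2" "(1 / 2) ^ k < e / 2" by (auto simp: eventually_sequentially)
  show "\<exists>no. \<forall>n\<ge>no. norm (nL (x n - g) - 0) < e"
  proof (intro exI allI impI)
   fix n assume "M k \<le> n"
   then have "nL (x n - x (r k)) < (1 / 2) ^ k" using r(1)[of k] by (intro M)
   moreover have "nL (x n - g) \<le> nL (x n - x (r k)) + nL (x (r k) - g)"
    using x gL by (intro L.nrm_diff_triangle) auto
   ultimately show "norm (nL (x n - g) - 0) < e" using k xg by simp
  qed
 qed
 then show "\<exists>y\<in>carr (L2_sp N). (%n. nL (x n - y)) ----> 0" using gL by auto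
qed

end

section \<open>Calculus of weak derivatives\<close>

lemma test_fun_affine_mult:
 assumes "test_fun L phi"
 shows "test_fun L (%x. (c + d * x) * phi x)"
proof -
 have "smooth (%x. (c + d * x) * phi x)" by (intro smooth_affine_mult smooth_test_fun[OF assms])
 then show ?thesis using assms unfolding test_fun_def smooth_def by fastforce
qed

lemma weak_derivI:
 assumes "\<And>phi. test_fun L phi ==> ig 0 L (%x. u x * deriv phi x) = - ig 0 L (%x. v x * phi x)"
  and u: "intable 0 L u" and v: "intable 0 L v"
 shows "weak_deriv L u v"
 unfolding weak_deriv_def
proof (intro allI impI)
 fix phi assume phi: "test_fun L phi"
 note s = smooth_test_fun[OF phi]
 have "intable 0 L (%x. u x * deriv phi x)" "intable 0 L (%x. v x * phi x)"
  using u v s by (auto intro!: integrable_ivl_mult_cont smooth_continuous_on smooth_deriv)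
 then show "lint 0 L (%x. u x * deriv phi x) = - lint 0 L (%x. v x * phi x)"
  using assms(1)[OF phi] by (simp only: ivl_eq)
qed

lemma weak_deriv_lin:
 assumes uv: "weak_deriv L u v" "weak_deriv L w z"
  and i: "intable 0 L u" "intable 0 L v" "intable 0 L w" "intable 0 L z"
 shows "weak_deriv L (%x. u x + c * w x) (%x. v x + c * z x)"
proof (rule weak_derivI)
 fix phi assume phi: "test_fun L phi"
 note s = smooth_test_fun[OF phi]
 have j: "intable 0 L (%x. f x * deriv phi x)" "intable 0 L (%x. f x * phi x)" if "intable 0 L f" for f
  using that s by (auto intro!: integrable_ivl_mult_cont smooth_continuous_on smooth_deriv)
 have e: "ig 0 L (%x. (f x + c * g x) * k x) = ig 0 L (%x. f x * k x) + c * ig 0 L (%x. g x * k x)"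
  if "intable 0 L (%x. f x * k x)" "intable 0 L (%x. g x * k x)" for f g k
  using ivl_add[OF that(1) integrable_mult_right[OF that(2), of c]] by (simp add: ring_distribs mult.assoc)
 show "ig 0 L (%x. (u x + c * w x) * deriv phi x) = - ig 0 L (%x. (v x + c * z x) * phi x)"
  using weak_derivD[OF uv(1) phi i(1,2)] weak_derivD[OF uv(2) phi i(3,4)] by (simp add: e j i)
qed (use i in auto)

lemma weak_deriv_cong_AE:
 assumes uv: "weak_deriv L u v" and ae: "AE x in ivl 0 L. u x = w x"
  and i: "intable 0 L u" "intable 0 L v"
 shows "weak_deriv L w v"
proof (rule weak_derivI)
 fix phi assume phi: "test_fun L phi"
 have "intable 0 L (%x. u x * deriv phi x)"
  using i smooth_test_fun[OF phi] by (intro integrable_ivl_mult_cont smooth_continuous_on smooth_deriv)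
 moreover have "AE x in ivl 0 L. u x * deriv phi x = w x * deriv phi x"
  using ae by eventually_elim simp
 ultimately have "ig 0 L (%x. w x * deriv phi x) = ig 0 L (%x. u x * deriv phi x)"
  by (rule ivl_cong_AE)
 then show "ig 0 L (%x. w x * deriv phi x) = - ig 0 L (%x. v x * phi x)"
  using weak_derivD[OF uv phi i] by simp
qed (use i integrable_ivl_cong_AE[OF i(1) ae] in auto)

text \<open>The product rule follows by moving the factor onto the test function, which remains a
  test function. Affine factors suffice to isolate one end of an edge.\<close>

lemma weak_deriv_affine_mult:
 assumes uv: "weak_deriv L u v" and i: "intable 0 L u" "intable 0 L v"
 shows "weak_deriv L (%x. (c + d * x) * u x) (%x. (c + d * x) * v x + d * u x)"
proof (rule weak_derivI)
 have aff: "intable 0 L (%x. (c + d * x) * f x)" if "intable 0 L f" for f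
  using integrable_ivl_mult_cont[OF that, of "%x. c + d * x"] by (simp add: mult.commute continuous_intros)
 show "intable 0 L (%x. (c + d * x) * u x)" "intable 0 L (%x. (c + d * x) * v x + d * u x)"
  using aff i by auto
 fix phi assume phi: "test_fun L phi"
 note s = smooth_test_fun[OF phi]
 have j: "intable 0 L (%x. f x * deriv phi x)" "intable 0 L (%x. f x * phi x)" if "intable 0 L f" for f
  using that s by (auto intro!: integrable_ivl_mult_cont smooth_continuous_on smooth_deriv)
 have "deriv (%x. (c + d * x) * phi x) = (%x. (c + d * x) * deriv phi x + d * phi x)"
  by (intro ext DERIV_imp_deriv) (auto intro!: derivative_eq_intros smooth_deriv[OF s])
 then have "ig 0 L (%x. (c + d * x) * u x * deriv phi x + d * u x * phi x) = - ig 0 L (%x. (c + d * x) * v x * phi x)"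
  using weak_derivD[OF uv test_fun_affine_mult[OF phi, of c d] i] by (simp add: algebra_simps)
 then have "ig 0 L (%x. (c + d * x) * u x * deriv phi x) + ig 0 L (%x. d * u x * phi x) =
   - ig 0 L (%x. (c + d * x) * v x * phi x)"
  using j[OF aff[OF i(1)]] j[OF integrable_mult_right[OF i(1), of d]] by (simp add: ivl_add)
 moreover have "ig 0 L (%x. ((c + d * x) * v x + d * u x) * phi x) =
   ig 0 L (%x. (c + d * x) * v x * phi x) + ig 0 L (%x. d * u x * phi x)"
  using ivl_add[OF j(2)[OF aff[OF i(2)]] j(2)[OF integrable_mult_right[OF i(1), of d]]] by (simp add: distrib_right)
 ultimately show "ig 0 L (%x. (c + d * x) * u x * deriv phi x) = - ig 0 L (%x. ((c + d * x) * v x + d * u x) * phi x)"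
  by linarith
qed

lemma test_fun_weak_deriv:
 assumes phi: "test_fun L phi"
 shows "weak_deriv L phi (deriv phi)"
proof (rule weak_derivI)
 note s = smooth_test_fun[OF phi]
 fix psi assume psi: "test_fun L psi"
 note r = smooth_test_fun[OF psi]
 obtain \<alpha> \<beta> where ab: "0 < \<alpha>" "\<beta> < L" "\<And>x. x \<notin> {\<alpha>..\<beta>} ==> phi x = 0"
  using phi unfolding test_fun_def by blast
 show "ig 0 L (%x. phi x * deriv psi x) = - ig 0 L (%x. deriv phi x * psi x)"
 proof (cases "0 \<le> L")
  case True
  have "((%x. deriv phi x * psi x + deriv psi x * phi x) has_integral phi L * psi L - phi 0 * psi 0) {0..L}"
  proof (rule fundamental_theorem_of_calculus[OF True])
   fix x
   have "((%x. phi x * psi x) has_real_derivative deriv phi x * psi x + deriv psi x * phi x) (at x within {0..L})"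
    by (rule has_field_derivative_at_within[OF DERIV_mult[OF smooth_deriv(2)[OF s] smooth_deriv(2)[OF r]]])
   then show "((%x. phi x * psi x) has_vector_derivative deriv phi x * psi x + deriv psi x * phi x) (at x within {0..L})"
    by (simp add: has_real_derivative_iff_has_vector_derivative)
  qed
  then have "ig 0 L (%x. deriv phi x * psi x + deriv psi x * phi x) = 0"
   using ab by (simp add: integral_unique)
  moreover have "intable 0 L (%x. deriv phi x * psi x)" "intable 0 L (%x. deriv psi x * phi x)"
   by (intro ivl_cont continuous_intros smooth_continuous_on smooth_deriv s r)+
  ultimately show ?thesis by (simp add: ivl_add mult.commute)
 qed simp
qed (use smooth_test_fun[OF phi] in \<open>auto intro!: ivl_cont smooth_continuous_on smooth_deriv\<close>)

lemma sum_insert_right: "finite I ==> i \<notin> I ==> sum f (insert i I) = sum f I + f i"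
 by (simp add: add.commute)

section \<open>The derivative and the vertex values of functions on the network\<close>

context net
begin

abbreviation K :: "'e nfun => 'e nfun" where "K \<equiv> dx N"

lemma L2_integrable: "u \<in> L2 N ==> e \<in> E ==> intable 0 (len N e) (u e)"
 by (intro sq_int_integrable L2D)

lemma has_dx_unique: "has_dx N u w ==> has_dx N u z ==> ae_eq N w z"
 unfolding has_dx_def ae_eq_def by (auto intro!: weak_deriv_AE_unique L2_integrable)

lemma has_dx_dx: "has_dx N u w ==> has_dx N u (K u)"
 unfolding dx_def using someI[of "has_dx N u" w] .

lemma dx_ae: "has_dx N u w ==> ae_eq N (K u) w"
 using has_dx_unique has_dx_dx by blast

lemma has_dx_lin:
 assumes "has_dx N u w" "has_dx N v z" "u \<in> L2 N" "v \<in> L2 N"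
 shows "has_dx N (u + c *R v) (w + c *R z)"
proof -
 have "w + c *R z \<in> L2 N" using assms L.carr_add[of w "c *R z"] L.carr_scale[of z c] by (auto simp: has_dx_def)
 moreover have "weak_deriv (len N e) ((u + c *R v) e) ((w + c *R z) e)" if "e \<in> E" for e
 proof -
  have "weak_deriv (len N e) (%x. u e x + c * v e x) (%x. w e x + c * z e x)"
   using assms that by (intro weak_deriv_lin) (auto simp: has_dx_def intro: L2_integrable)
  moreover have "(u + c *R v) e = (%x. u e x + c * v e x)" "(w + c *R z) e = (%x. w e x + c * z e x)"
   by (auto simp: fun_eq_iff)
  ultimately show ?thesis by simp
 qed
 ultimately show ?thesis by (simp add: has_dx_def)
qed

lemma has_dx_cong:
 assumes "has_dx N u w" "ae_eq N u v" "u \<in> L2 N"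
 shows "has_dx N v w"
 unfolding has_dx_def
proof (intro conjI ballI)
 show w: "w \<in> L2 N" using assms(1) by (simp add: has_dx_def)
 fix e assume e: "e \<in> E"
 have "weak_deriv (len N e) (u e) (w e)" "AE x in ivl 0 (len N e). u e x = v e x"
  using assms e by (auto simp: has_dx_def ae_eq_def)
 then show "weak_deriv (len N e) (v e) (w e)"
  by (rule weak_deriv_cong_AE) (use L2_integrable assms(3) w e in auto)
qed

lemma H1_D:
 assumes "q \<in> H1 N"
 shows "q \<in> L2 N" "has_dx N q (K q)" "K q \<in> L2 N" "e \<in> E ==> continuous_on {0..len N e} (q e)"
proof -
 show "q \<in> L2 N" and h: "has_dx N q (K q)" using assms has_dx_dx by (auto simp: H1_def)
 show "K q \<in> L2 N" using h by (simp add: has_dx_def)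
 show "e \<in> E ==> continuous_on {0..len N e} (q e)" using assms by (simp add: H1_def)
qed

lemma vval_eqs:
 assumes "q \<in> H1 N" "e \<in> E"
 shows "vval N q (tail (graph N) e) = q e 0" "vval N q (head (graph N) e) = q e (len N e)"
proof -
 obtain V where V: "\<And>e. e \<in> E ==> q e 0 = V (tail (graph N) e) \<and> q e (len N e) = V (head (graph N) e)"
  using assms by (auto simp: H1_def)
 have "vval N q v = V v" if "\<exists>e\<in>E. tail (graph N) e = v \<or> head (graph N) e = v" for v
  unfolding vval_def using that V by (intro the_equality) auto
 then show "vval N q (tail (graph N) e) = q e 0" "vval N q (head (graph N) e) = q e (len N e)"
  using assms V by auto
qed

lemma H1_lin:
 assumes q: "q \<in> H1 N" and r: "r \<in> H1 N"
 shows "q + c *R r \<in> H1 N"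
 unfolding H1_def
proof (intro CollectI conjI ballI)
 show "q + c *R r \<in> L2 N" using H1_D(1)[OF q] H1_D(1)[OF r] L.carr_add[of q "c *R r"] L.carr_scale[of r c] by simp
 show "\<exists>w. has_dx N (q + c *R r) w" using has_dx_lin[OF H1_D(2)[OF q] H1_D(2)[OF r] H1_D(1)[OF q] H1_D(1)[OF r]] by blast
 fix e assume e: "e \<in> E"
 have "(q + c *R r) e = (%x. q e x + c * r e x)" by (auto simp: fun_eq_iff)
 then show "continuous_on {0..len N e} ((q + c *R r) e)"
  using H1_D(4)[OF q e] H1_D(4)[OF r e] by (auto intro!: continuous_intros)
next
 show "\<exists>V. \<forall>e\<in>E. (q + c *R r) e 0 = V (tail (graph N) e) \<and> (q + c *R r) e (len N e) = V (head (graph N) e)"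
  using vval_eqs[OF q] vval_eqs[OF r] by (intro exI[of _ "%v. vval N q v + c * vval N r v"]) simp
qed

lemma H1_zero: "0 \<in> H1 N"
proof -
 have "weak_deriv L (%x. 0) (%x. 0)" for L by (simp add: weak_deriv_def)
 then have "has_dx N 0 0" using L.carr_zero by (simp add: has_dx_def zero_fun_def)
 then show ?thesis using L.carr_zero by (auto simp: H1_def zero_fun_def intro!: exI[of _ "%_. 0"])
qed

lemma H1_sum: "finite I ==> (\<And>i. i \<in> I ==> q i \<in> H1 N) ==> (\<Sum>i\<in>I. c i *R q i) \<in> H1 N"
proof (induction I rule: finite_induct)
 case (insert i I)
 show ?case unfolding sum_insert_right[OF insert.hyps(1,2)]
  by (rule H1_lin[OF insert.IH insert.prems]) (use insert.prems in auto)
qed (simp add: H1_zero)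

lemma dx_lin_ae: "q \<in> H1 N ==> r \<in> H1 N ==> ae_eq N (K (q + c *R r)) (K q + c *R K r)"
 by (intro dx_ae has_dx_lin H1_D)

lemma dx_zero_ae: "ae_eq N (K 0) 0"
 using dx_lin_ae[OF H1_zero H1_zero, of "-1"] by simp

lemma dx_sum_ae:
 "finite I ==> (\<And>i. i \<in> I ==> q i \<in> H1 N) ==> ae_eq N (K (\<Sum>i\<in>I. c i *R q i)) (\<Sum>i\<in>I. c i *R K (q i))"
proof (induction I rule: finite_induct)
 case (insert i I)
 have "ae_eq N (K ((\<Sum>i\<in>I. c i *R q i) + c i *R q i)) (K (\<Sum>i\<in>I. c i *R q i) + c i *R K (q i))"
  using insert by (intro dx_lin_ae H1_sum) auto
 moreover have "ae_eq N (u + w) (z + w)" if "ae_eq N u z" for u w z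
  using that unfolding ae_eq_def by (auto elim!: eventually_mono)
 ultimately show ?case
  unfolding sum_insert_right[OF insert.hyps(1,2)] using insert by (blast intro: ae_eq_trans)
qed (simp add: dx_zero_ae)

text \<open>The value at a vertex is a definite description over the incident edges, so it has a
  meaning only where there is such an edge.\<close>

definition touched :: "'v => bool" where
 "touched v \<longleftrightarrow> (\<exists>e\<in>E. tail (graph N) e = v \<or> head (graph N) e = v)"

lemma vval_lin: "touched v ==> q \<in> H1 N ==> r \<in> H1 N ==> vval N (q + c *R r) v = vval N q v + c * vval N r v"
 unfolding touched_def using vval_eqs[of q] vval_eqs[of r] vval_eqs[of "q + c *R r"] H1_lin[of q r c] by auto

lemma vval_zero: "touched v ==> vval N 0 v = 0"
 using vval_lin[OF _ H1_zero H1_zero, of v 1] by simp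

lemma vval_sum:
 "finite I ==> touched v ==> (\<And>i. i \<in> I ==> q i \<in> H1 N) ==> vval N (\<Sum>i\<in>I. c i *R q i) v = (\<Sum>i\<in>I. c i * vval N (q i) v)"
proof (induction I rule: finite_induct)
 case (insert i I)
 have "vval N ((\<Sum>i\<in>I. c i *R q i) + c i *R q i) v = vval N (\<Sum>i\<in>I. c i *R q i) v + c i * vval N (q i) v"
  by (rule vval_lin[OF insert.prems(1) H1_sum]) (use insert in auto)
 moreover have "vval N (\<Sum>i\<in>I. c i *R q i) v = (\<Sum>i\<in>I. c i * vval N (q i) v)"
  using insert.IH insert.prems by blast
 ultimately show ?case unfolding sum_insert_right[OF insert.hyps(1,2)] by linarith
qed (simp add: vval_zero)

text \<open>A right inverse of the evaluation at \<open>VD\<close> attains different values at each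
  Dirichlet vertex, so these vertices have edges. Every other vertex is joined to one of them by a
  path, since the graph is connected.\<close>

lemma touched_all:
 assumes Bm: "B_right_inverse N Bm" and v: "v \<in> verts (graph N)"
 shows "touched v"
proof -
 have VD: "touched v" if "v \<in> VD N" for v
 proof (rule ccontr)
  assume "\<not> touched v"
  \<comment> \<open>Without an incident edge the description is that of an empty predicate. Its
    value is unspecified but the same for all \<open>q\<close>, so it cannot be both 0 and
    1.\<close>
  then have "vval N q v = (THE c::real. False)" for q by (simp add: vval_def touched_def cong: conj_cong)
  then have "vval N (Bm (%_. 0)) v = vval N (Bm (%_. 1)) v" by simp
  then show False using Bm that by (simp add: B_right_inverse_def)
 qed
 show ?thesis
 proof (cases "v \<in> VD N")
  case False
  obtain w where w: "w \<in> VD N" "w \<in> verts (graph N)" using net by (auto simp: is_network_def)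
  have "strongly_connected (with_proj (mk_symmetric (graph N)))"
   using net by (simp add: is_network_def Digraph_Component.connected_def)
  then have "w \<rightarrow>\<^sup>*\<^bsub>with_proj (mk_symmetric (graph N))\<^esub> v"
   using v w by (auto simp: strongly_connected_def)
  then have "\<exists>z. (z, v) \<in> arcs_ends (with_proj (mk_symmetric (graph N)))"
   using False w unfolding reachable_def by cases auto
  then show ?thesis
   by (auto simp: touched_def mk_symmetric_def arcs_ends_def arc_to_ends_def)
 qed (rule VD)
qed

lemma H1_affine_identity:
 assumes q: "q \<in> H1 N" and e: "e \<in> E"
 shows "(c + d * len N e) * q e (len N e) - c * q e 0 = ig 0 (len N e) (%x. (c + d * x) * K q e x + d * q e x)"
proof -
 have i: "intable 0 (len N e) (q e)" "intable 0 (len N e) (K q e)"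
  using H1_D[OF q] e by (auto intro: L2_integrable)
 have "weak_deriv (len N e) (%x. (c + d * x) * q e x) (%x. (c + d * x) * K q e x + d * q e x)"
  using H1_D(2)[OF q] e i by (intro weak_deriv_affine_mult) (auto simp: has_dx_def)
 moreover have "continuous_on {0..len N e} (%x. (c + d * x) * q e x)" by (intro continuous_intros H1_D(4)[OF q e])
 moreover have "intable 0 (len N e) (%x. (c + d * x) * K q e x)"
  using integrable_ivl_mult_cont[OF i(2), of "%x. c + d * x"] by (simp add: mult.commute continuous_intros)
 then have "intable 0 (len N e) (%x. (c + d * x) * K q e x + d * q e x)" using i by auto
 ultimately have "(c + d * len N e) * q e (len N e) - (c + d * 0) * q e 0 = ig 0 (len N e) (%x. (c + d * x) * K q e x + d * q e x)"
  using len_pos[OF e] by (intro weak_deriv_primitive) auto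
 then show ?thesis by simp
qed

text \<open>A vertex value as a combination of \<open>L^2\<close> products with \<open>\<partial>\<^sub>x q\<close> and \<open>q\<close>: integrate
 \<open>(l q)'\<close> over one edge, where \<open>l\<close> is affine and vanishes at the other end.\<close>

lemma vertex_lift:
 assumes "touched v"
 obtains \<rho> \<gamma> where "\<rho> \<in> L2 N" "\<gamma> \<in> L2 N" "\<And>q. q \<in> H1 N ==> vval N q v = ip N \<rho> (K q) - ip N \<gamma> q"
proof -
 obtain e where e: "e \<in> E" "tail (graph N) e = v \<or> head (graph N) e = v" using assms by (auto simp: touched_def)
 define L where "L = len N e"
 have L: "L > 0" using len_pos[OF e(1)] by (simp add: L_def)
 \<comment> \<open>The weight -1 + x / L, entering with a sign at its lower end, yields the value at
   the tail; the weight x / L yields that at the head.\<close>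
 obtain c d where cd: "\<And>q. q \<in> H1 N ==> vval N q v = (c + d * L) * q e L - c * q e 0"
 proof (cases "tail (graph N) e = v")
  case True
  then show ?thesis using that[of "-1" "1 / L"] vval_eqs(1)[OF _ e(1)] L by (auto simp: L_def)
 next
  case False
  then show ?thesis using e that[of 0 "1 / L"] vval_eqs(2)[OF _ e(1)] L by (auto simp: L_def)
 qed
 define \<rho> where "\<rho> = (%e' x. if e' = e then c + d * x else 0)"
 define \<gamma> where "\<gamma> = (%e' (x::real). if e' = e then - d else 0)"
 have "sq_int 0 (len N e') (\<rho> e')" "sq_int 0 (len N e') (\<gamma> e')" for e'
  by (cases "e' = e"; auto simp: \<rho>_def \<gamma>_def intro!: sq_int_cont continuous_intros)+
 then have mem: "\<rho> \<in> L2 N" "\<gamma> \<in> L2 N" by (auto simp: L2_iff)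
 have "vval N q v = ip N \<rho> (K q) - ip N \<gamma> q" if q: "q \<in> H1 N" for q
 proof -
  have i: "intable 0 L (q e)" "intable 0 L (%x. (c + d * x) * K q e x)"
   using H1_D[OF q] e integrable_ivl_mult_cont[OF L2_integrable[OF H1_D(3)[OF q] e(1)], of "%x. c + d * x"]
   by (auto intro: L2_integrable simp: L_def mult.commute continuous_intros)
  have "ip N \<rho> (K q) = (\<Sum>e'\<in>E. if e' = e then ig 0 L (%x. (c + d * x) * K q e x) else 0)"
   unfolding ip_eq[OF mem(1) H1_D(3)[OF q]] by (intro sum.cong) (auto simp: \<rho>_def L_def)
  then have 1: "ip N \<rho> (K q) = ig 0 L (%x. (c + d * x) * K q e x)" using e finE by simp
  have "ip N \<gamma> q = (\<Sum>e'\<in>E. if e' = e then - ig 0 L (%x. d * q e x) else 0)"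
   unfolding ip_eq[OF mem(2) H1_D(1)[OF q]] by (intro sum.cong) (auto simp: \<gamma>_def L_def)
  then have 2: "ip N \<gamma> q = - ig 0 L (%x. d * q e x)" using e finE by simp
  show ?thesis
   using cd[OF q] H1_affine_identity[OF q e(1), of c d] ivl_add[OF i(2) integrable_mult_right[OF i(1), of d]]
   unfolding 1 2 by (simp add: L_def)
 qed
 then show ?thesis using that mem by blast
qed

lemma test_H10:
 assumes phi: "test_fun (len N e) phi" and e: "e \<in> E" and VD: "\<And>v. v \<in> VD N ==> touched v"
 shows "(%e' x. if e' = e then phi x else 0) \<in> H10 N"
proof -
 define q where "q = (%e' x. if e' = e then phi x else 0)"
 define w where "w = (%e' x. if e' = e then deriv phi x else 0)"
 note s = smooth_test_fun[OF phi]
 obtain \<alpha> \<beta> where ab: "0 < \<alpha>" "\<beta> < len N e" "\<And>x. x \<notin> {\<alpha>..\<beta>} ==> phi x = 0"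
  using phi unfolding test_fun_def by blast
 have ends: "q e' 0 = 0" "q e' (len N e') = 0" for e' using ab by (auto simp: q_def)
 have "continuous_on {0..len N e'} (q e')" "continuous_on {0..len N e'} (w e')" for e'
  using smooth_continuous_on[OF s] smooth_continuous_on[OF smooth_deriv(1)[OF s]]
  by (cases "e' = e"; simp add: q_def w_def)+
 then have "sq_int 0 (len N e') (q e')" "sq_int 0 (len N e') (w e')" for e' by (blast intro: sq_int_cont)+
 then have "q \<in> L2 N" "w \<in> L2 N" by (auto simp: L2_iff)
 moreover have "weak_deriv (len N e') (q e') (w e')" for e'
  using test_fun_weak_deriv[OF phi] by (cases "e' = e") (auto simp: q_def w_def weak_deriv_def)
 moreover have "continuous_on {0..len N e'} (q e')" for e'
  by (cases "e' = e") (simp_all add: q_def smooth_continuous_on s)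
 ultimately have H: "q \<in> H1 N"
  using ends unfolding H1_def has_dx_def by (intro CollectI conjI exI[of _ w] exI[of _ "%_. 0"] ballI) simp_all
 then have "vval N q v = 0" if "v \<in> VD N" for v
  using VD[OF that] vval_eqs[OF H] ends by (auto simp: touched_def)
 then show ?thesis using H by (simp add: H10_def q_def)
qed

text \<open>Test functions supported inside a single edge vanish at all vertices, so they are
  admissible, and they already determine \<open>z\<close> almost everywhere.\<close>

lemma H10_dense:
 assumes z: "z \<in> L2 N" and VD: "\<And>v. v \<in> VD N ==> touched v" and orth: "\<And>q. q \<in> H10 N ==> ip N z q = 0"
 shows "nL z = 0"
proof -
 have "AE x in ivl 0 (len N e). z e x = 0" if e: "e \<in> E" for e
 proof (rule AE_zero_of_test_integrals[OF L2_integrable[OF z e]])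
  fix phi assume phi: "test_fun (len N e) phi"
  have "0 = ip N z (%e' x. if e' = e then phi x else 0)" using orth[OF test_H10[OF phi e VD]] by simp
  also have "\<dots> = (\<Sum>e'\<in>E. if e' = e then lint 0 (len N e) (%x. z e x * phi x) else 0)"
   unfolding ip_def by (intro sum.cong) auto
  finally show "lint 0 (len N e) (%x. z e x * phi x) = 0" using e finE by simp
 qed
 then show ?thesis using nL_zero_iff[OF z] by (simp add: ae_eq_def)
qed

section \<open>Multiplication by the coefficients\<close>

definition mul :: "'e nfun => 'e nfun => 'e nfun" where
 "mul c u = (%e x. c e x * u e x)"

lemma mul_bounds:
 assumes c: "\<And>e. e \<in> E ==> c e \<in> meas 0 (len N e)"
  and lo: "\<And>e. e \<in> E ==> AE x in ivl 0 (len N e). lo \<le> c e x \<and> c e x \<le> hi" and "0 \<le> lo" and u: "u \<in> L2 N"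
 shows "mul c u \<in> L2 N" "nL (mul c u) \<le> \<bar>hi\<bar> * nL u" "lo * ip N u u \<le> ip N (mul c u) u"
proof -
 have b: "AE x in ivl 0 (len N e). \<bar>c e x * u e x\<bar> \<le> \<bar>hi\<bar> * \<bar>u e x\<bar>" if "e \<in> E" for e
  using lo[OF that]
 proof eventually_elim
  case (elim x)
  then show ?case using \<open>0 \<le> lo\<close> unfolding abs_mult by (intro mult_right_mono) auto
 qed
 have us: "sq_int 0 (len N e) (u e)" if "e \<in> E" for e using u that by (simp add: L2_iff)
 have s: "sq_int 0 (len N e) (mul c u e)" if e: "e \<in> E" for e
  unfolding mul_def using c[OF e] us[OF e] b[OF e]
  by (intro sq_int_bound[OF sq_int_cmult[OF sq_int_abs[OF us[OF e]], of "\<bar>hi\<bar>"]]) (auto simp: sq_int_def)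
 then show m: "mul c u \<in> L2 N" by (simp add: L2_iff)
 have "(nL (mul c u))^2 \<le> (\<Sum>e\<in>E. \<bar>hi\<bar>^2 * ig 0 (len N e) (%x. (u e x)^2))"
  unfolding nL_sq[OF m]
 proof (rule sum_mono)
  fix e assume e: "e \<in> E"
  have "ig 0 (len N e) (%x. (mul c u e x)^2) \<le> ig 0 (len N e) (%x. \<bar>hi\<bar>^2 * (u e x)^2)"
  proof (rule ivl_mono_AE)
   show "AE x in ivl 0 (len N e). (mul c u e x)^2 \<le> \<bar>hi\<bar>^2 * (u e x)^2"
    using b[OF e]
   proof eventually_elim
    case (elim x)
    show ?case using abs_le_imp_square_le[OF elim] by (simp add: mul_def power_mult_distrib)
   qed
  qed (use s[OF e] us[OF e] in \<open>auto simp: sq_int_def\<close>)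
  then show "ig 0 (len N e) (%x. (mul c u e x)^2) \<le> \<bar>hi\<bar>^2 * ig 0 (len N e) (%x. (u e x)^2)" by simp
 qed
 also have "\<dots> = (\<bar>hi\<bar> * nL u)^2" using nL_sq[OF u] by (simp add: power_mult_distrib sum_distrib_left)
 finally show "nL (mul c u) \<le> \<bar>hi\<bar> * nL u" by (rule power2_le_imp_le) (use u in simp)
 have "lo * ip N u u = (\<Sum>e\<in>E. ig 0 (len N e) (%x. lo * (u e x)^2))"
  unfolding ip_eq[OF u u] by (simp add: sum_distrib_left power2_eq_square)
 also have "\<dots> \<le> ip N (mul c u) u"
  unfolding ip_eq[OF m u]
 proof (rule sum_mono)
  fix e assume e: "e \<in> E"
  show "ig 0 (len N e) (%x. lo * (u e x)^2) \<le> ig 0 (len N e) (%x. mul c u e x * u e x)"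
  proof (rule ivl_mono_AE)
   show "intable 0 (len N e) (%x. mul c u e x * u e x)" by (rule sq_int_mult[OF s[OF e] us[OF e]])
   show "AE x in ivl 0 (len N e). lo * (u e x)^2 \<le> mul c u e x * u e x"
    using lo[OF e]
   proof eventually_elim
    case (elim x)
    then have "lo * (u e x)^2 \<le> c e x * (u e x)^2" by (intro mult_right_mono) auto
    then show ?case by (simp add: mul_def power2_eq_square mult.assoc)
   qed
  qed (use us[OF e] in \<open>auto simp: sq_int_def\<close>)
 qed
 finally show "lo * ip N u u \<le> ip N (mul c u) u" .
qed

lemma H10_subspace:
 assumes VD: "\<And>v. v \<in> VD N ==> touched v"
 shows "subspace (H10 N)"
proof (rule subspaceI)
 show "0 \<in> H10 N" using VD by (simp add: H10_def H1_zero vval_zero)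
 show "q + r \<in> H10 N" if "q \<in> H10 N" "r \<in> H10 N" for q r
  using that VD H1_lin[of q r 1] vval_lin[of _ q r 1] by (simp add: H10_def)
 show "c *R q \<in> H10 N" if "q \<in> H10 N" for c q
  using that VD H1_lin[OF H1_zero, of q c] vval_lin[OF _ H1_zero, of _ q c] by (simp add: H10_def vval_zero)
qed

lemma energy_ops_net:
 assumes co: "coefficients N a d a_hi d_lo d_hi" and VD: "\<And>v. v \<in> VD N ==> touched v"
 shows "energy_ops (L2_sp N) (H10 N) K (mul a) (mul d) \<bar>a_hi\<bar> \<bar>d_hi\<bar> d_lo"
proof unfold_locales
 have a: "e \<in> E ==> a e \<in> meas 0 (len N e)"
  "e \<in> E ==> AE x in ivl 0 (len N e). 0 \<le> a e x \<and> a e x \<le> a_hi"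
  and d: "e \<in> E ==> d e \<in> meas 0 (len N e)"
  "e \<in> E ==> AE x in ivl 0 (len N e). d_lo \<le> d e x \<and> d e x \<le> d_hi" and d0: "0 < d_lo" for e
  using co by (auto simp: coefficients_def elim!: eventually_mono)
 note ma = mul_bounds[OF a(1) a(2) order_refl] and md = mul_bounds[OF d(1) d(2) less_imp_le[OF d0]]
 have H: "q \<in> H10 N ==> q \<in> H1 N" for q by (simp add: H10_def)
 show "subspace (H10 N)" by (rule H10_subspace[OF VD])
 show "H10 N \<subseteq> carr (L2_sp N)" using H H1_D(1) by auto
 show "q \<in> H10 N ==> K q \<in> carr (L2_sp N)" for q using H H1_D(3) by auto
 show "nL (K (q + c *R r) - (K q + c *R K r)) = 0" if "q \<in> H10 N" "r \<in> H10 N" for q r c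
  using dx_lin_ae[OF H[OF that(1)] H[OF that(2)], of c] H1_D(3)[OF H1_lin[OF H[OF that(1)] H[OF that(2)], of c]]
   ae_eq_L2 ae_eq_iff_nL by blast
 show "x \<in> carr (L2_sp N) ==> mul a x \<in> carr (L2_sp N)" for x using ma(1) by simp
 show "x \<in> carr (L2_sp N) ==> mul d x \<in> carr (L2_sp N)" for x using md(1) by simp
 show "mul c (x + k *R y) = mul c x + k *R mul c y" for c k x y
  by (simp add: mul_def fun_eq_iff algebra_simps)
 then show "mul d (x + k *R y) = mul d x + k *R mul d y" for k x y .
 show "x \<in> carr (L2_sp N) ==> nL (mul a x) \<le> \<bar>a_hi\<bar> * nL x" for x using ma(2) by simp
 show "x \<in> carr (L2_sp N) ==> 0 \<le> inn (L2_sp N) (mul a x) x" for x using ma(3)[of x] by simp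
 show "x \<in> carr (L2_sp N) ==> nL (mul d x) \<le> \<bar>d_hi\<bar> * nL x" for x using md(2) by simp
 show "x \<in> carr (L2_sp N) ==> d_lo * inn (L2_sp N) x x \<le> inn (L2_sp N) (mul d x) x" for x using md(3)[of x] by simp
qed (use co in \<open>auto simp: coefficients_def\<close>)

end

section \<open>Limits of difference quotients\<close>

context semi_inner
begin

abbreviation dq_error :: "real => real => (real => 'x) => (real => 'x) => real => bool" where
 "dq_error T k u v e \<equiv> \<exists>R. sq_int 0 (T - k) R \<and> ig 0 (T - k) (%t. (R t)^2) \<le> e \<and>
   (AE t in ivl 0 (T - k). nrm X (dq k u t - v t) \<le> R t)"

text \<open>A notion of derivative that both weak and strong derivatives satisfy. It is applied to
  the difference of the two fluxes, of which the hyperbolic one has a strong and the parabolic one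
  only a weak time derivative.\<close>

definition dq_limit :: "real => (real => 'x) => (real => 'x) => bool" where
 "dq_limit T u v \<longleftrightarrow> L2c T u \<and> L2c T v \<and>
   (\<forall>dl>0. \<exists>tau0>0. \<forall>tau. 0 < tau --> tau < tau0 --> tau \<le> T -->
    (dq_error T tau u v dl))"

lemma dq_limitD:
 assumes "dq_limit T u v" "dl > 0"
 obtains tau0 where "tau0 > 0" "\<And>tau. 0 < tau ==> tau < tau0 ==> tau \<le> T ==>
   dq_error T tau u v dl"
proof -
 have "\<exists>tau0>0. \<forall>tau. 0 < tau --> tau < tau0 --> tau \<le> T -->
   (dq_error T tau u v dl)"
  using assms unfolding dq_limit_def by simp
 then show ?thesis using that by blast
qed

lemma weak_tderiv_dq_limit:
 assumes u: "L2T X T u" and v: "L2T X T v" and wd: "weak_tderiv X T u v" and T: "T > 0"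
 shows "dq_limit T u v"
 unfolding dq_limit_def
proof (intro conjI allI impI)
 show "L2c T u" "L2c T v" using u v by (auto intro: L2T_L2c)
 fix dl :: real assume dl: "dl > 0"
 obtain tau0 where tau0: "tau0 > 0" "\<And>tau. 0 < tau ==> tau < tau0 ==> tau \<le> T ==> \<exists>R. sq_int 0 (T - tau) R \<and> ig 0 (T - tau) (%t. (R t)^2) \<le> dl \<and>
    (AE t in ivl 0 (T - tau). nrm X ((u (t + tau) - u t) /R tau - v t) \<le> R t)"
  by (rule weak_tderiv_quotient_error[OF u v wd dl T]) blast
 then show "\<exists>tau0>0. \<forall>tau. 0 < tau --> tau < tau0 --> tau \<le> T --> (dq_error T tau u v dl)"
  unfolding dq_def by blast
qed

lemma sderiv_dq_limit:
 assumes u: "sderiv T u u'" and c: "contT X T u" and c': "contT X T u'" and T: "T > 0"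
 shows "dq_limit T u u'"
 unfolding dq_limit_def
proof (intro conjI allI impI)
 show "L2c T u" "L2c T u'" using c c' by (auto intro: contT_L2c)
 fix dl :: real assume dl: "dl > 0"
 \<comment> \<open>A constant error function will do; its square integral over \<open>{0..T}\<close>
   is \<open>dl\<close>.\<close>
 define e where "e = sqrt (dl / T)"
 have e: "e > 0" using dl T by (simp add: e_def)
 obtain k where k: "k > 0" "\<And>s t. s \<in> {0..T} ==> t \<in> {0..T} ==> \<bar>s - t\<bar> < k ==> nrm X (u' s - u' t) < e"
  by (rule contT_uniform[OF c' e]) blast
 have "dq_error T tau u u' dl" if tau: "0 < tau" "tau < k" "tau \<le> T" for tau
 proof (intro exI[of _ "%_. e"] conjI AE_ivl_all)
  show "sq_int 0 (T - tau) (%_. e)" by (rule sq_int_const)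
  have "ig 0 (T - tau) (%t. e^2) = (T - tau) * (dl / T)" using tau dl T by (simp add: e_def)
  also have "\<dots> \<le> T * (dl / T)" using tau dl T by (intro mult_right_mono) auto
  finally show "ig 0 (T - tau) (%t. e^2) \<le> dl" using T by simp
  fix t assume t: "t \<in> {0..T - tau}"
  have tt: "t \<in> {0..T}" "t + tau \<in> {0..T}" using t tau by auto
  define w where "w = dq tau u t - u' t"
  have uc: "u t \<in> carr X" "u (t + tau) \<in> carr X" "u' t \<in> carr X" using tt contT_carr c c' by auto
  then have w: "w \<in> carr X" by (simp add: w_def dq_def)
  have sub: "{t..t + tau} \<subseteq> {0..T}" using tt by auto
  have iw: "intable t (t + tau) (%r. inn X (u' r) w)"
   by (rule ivl_cont[OF continuous_on_subset[OF contT_inn[OF c' contT_const[OF w]] sub]])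
  have in_eq: "inn X (u' r - u' t) w = inn X (u' r) w - inn X (u' t) w" if "r \<in> {t..t + tau}" for r
   using contT_carr[OF c'] that sub uc w by (subst inn_diff_left) auto
  have "inn X w w = inn X (u (t + tau) - u t) w / tau - inn X (u' t) w"
   using uc w by (subst (1) w_def) (simp add: dq_def inn_simps divide_inverse_commute)
  also have "inn X (u (t + tau) - u t) w = ig t (t + tau) (%r. inn X (u' r) w)"
   using t tau by (intro sderiv_primitive[OF u contT_carr[OF c] w]) auto
  also have "\<dots> = ig t (t + tau) (%r. inn X (u' r - u' t) w + inn X (u' t) w)"
   by (rule integral_cong) (simp add: in_eq)
  also have "\<dots> = ig t (t + tau) (%r. inn X (u' r - u' t) w) + tau * inn X (u' t) w"
  proof (subst ivl_add)
   show "intable t (t + tau) (%r. inn X (u' r - u' t) w)"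
    by (rule ivl_cont[OF continuous_on_subset[OF contT_inn[OF contT_diff[OF c' contT_const[OF uc(3)]] contT_const[OF w]] sub]])
  qed (use tau in auto)
  finally have ww: "inn X w w \<le> (1 / tau) * ig t (t + tau) (%r. inn X (u' r - u' t) w)"
   using tau by (simp add: add_divide_distrib)
  have "nrm X w \<le> (1 / tau) * ig t (t + tau) (%r. e)"
  proof (rule nrm_le_integral[OF w _ _ _ ww])
   show "AE r in ivl t (t + tau). u' r - u' t \<in> carr X \<and> nrm X (u' r - u' t) \<le> e"
   proof (rule AE_ivl_all)
    fix r assume r: "r \<in> {t..t + tau}"
    then have "r \<in> {0..T}" "\<bar>r - t\<bar> < k" using sub tau by auto
    then show "u' r - u' t \<in> carr X \<and> nrm X (u' r - u' t) \<le> e" using k(2)[of r t] tt uc contT_carr[OF c'] by auto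
   qed
   show "intable t (t + tau) (%r. inn X (u' r - u' t) w)"
    by (rule ivl_cont[OF continuous_on_subset[OF contT_inn[OF contT_diff[OF c' contT_const[OF uc(3)]] contT_const[OF w]] sub]])
   show "intable t (t + tau) (%r. e)" by (intro ivl_cont continuous_intros)
  qed (use tau in auto)
  then show "nrm X (dq tau u t - u' t) \<le> e" using tau by (simp add: w_def)
 qed
 then show "\<exists>tau0>0. \<forall>tau. 0 < tau --> tau < tau0 --> tau \<le> T --> (dq_error T tau u u' dl)"
  using k(1) by blast
qed

lemma dq_limit_diff:
 assumes u: "dq_limit T u u'" and v: "dq_limit T v v'"
 shows "dq_limit T (%t. u t - v t) (%t. u' t - v' t)"
 unfolding dq_limit_def
proof (intro conjI allI impI)
 have L: "L2c T u" "L2c T u'" "L2c T v" "L2c T v'" using u v by (auto simp: dq_limit_def)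
 then show "L2c T (%t. u t - v t)" "L2c T (%t. u' t - v' t)" by (auto intro: L2c_diff)
 fix dl :: real assume dl: "dl > 0"
 have dl4: "dl / 4 > 0" using dl by simp
 obtain a where a: "a > 0" "\<And>tau. 0 < tau ==> tau < a ==> tau \<le> T ==>
   dq_error T tau u u' (dl / 4)" by (rule dq_limitD[OF u dl4]) blast
 obtain b where b: "b > 0" "\<And>tau. 0 < tau ==> tau < b ==> tau \<le> T ==>
   dq_error T tau v v' (dl / 4)" by (rule dq_limitD[OF v dl4]) blast
 have "dq_error T tau (%t. u t - v t) (%t. u' t - v' t) dl"
  if tau: "0 < tau" "tau < min a b" "tau \<le> T" for tau
 proof -
  obtain R where R: "sq_int 0 (T - tau) R" "ig 0 (T - tau) (%t. (R t)^2) \<le> dl / 4"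
   "AE t in ivl 0 (T - tau). nrm X (dq tau u t - u' t) \<le> R t" using a(2)[of tau] tau by auto
  obtain S where S: "sq_int 0 (T - tau) S" "ig 0 (T - tau) (%t. (S t)^2) \<le> dl / 4"
   "AE t in ivl 0 (T - tau). nrm X (dq tau v t - v' t) \<le> S t" using b(2)[of tau] tau by auto
  have "ig 0 (T - tau) (%t. (R t + S t)^2) \<le> (sqrt (dl / 4) + sqrt (dl / 4))^2"
   using R S dl by (intro L2_triangle) auto
  also have "\<dots> = dl" using dl by (simp add: real_sqrt_divide power2_eq_square)
  finally have 1: "ig 0 (T - tau) (%t. (R t + S t)^2) \<le> dl" .
  have "AE t in ivl 0 (T - tau). dq tau u t \<in> carr X" "AE t in ivl 0 (T - tau). dq tau v t \<in> carr X"
   "AE t in ivl 0 (T - tau). u' t \<in> carr X" "AE t in ivl 0 (T - tau). v' t \<in> carr X"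
   using tau L2c_dq[OF L(1), of tau] L2c_dq[OF L(3), of tau] L2c_sub[OF L(2), of "T - tau"] L2c_sub[OF L(4), of "T - tau"]
   by (auto intro: L2c_carr)
  with R(3) S(3) have "AE t in ivl 0 (T - tau). nrm X (dq tau (%t. u t - v t) t - (u' t - v' t)) \<le> R t + S t"
  proof eventually_elim
   case (elim t)
   have *: "dq tau (%t. u t - v t) t - (u' t - v' t) = (dq tau u t - u' t) - (dq tau v t - v' t)"
    by (simp add: dq_def algebra_simps)
   have "nrm X ((dq tau u t - u' t) - (dq tau v t - v' t)) \<le> nrm X (dq tau u t - u' t) + nrm X (dq tau v t - v' t)"
    using elim by (intro nrm_diff_le) auto
   then show ?case using elim(1,2) unfolding * by linarith
  qed
  then show ?thesis using 1 sq_int_add[OF R(1) S(1)] by blast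
 qed
 moreover have "min a b > 0" using a b by simp
 ultimately show "\<exists>tau0>0. \<forall>tau. 0 < tau --> tau < tau0 --> tau \<le> T --> (dq_error T tau (%t. u t - v t) (%t. u' t - v' t) dl)" by blast
qed

text \<open>The bound \<open>b tau\<close> for the quotients is carried to the derivative by the
  triangle inequality, with \<open>tau\<close> tending to zero before \<open>dl\<close> does. Since
  \<open>b\<close> is only required to have a limit, terms that vanish with \<open>tau\<close> may
  have arbitrary constants.\<close>

lemma dq_limit_bound:
 assumes lim: "dq_limit T u v" and T: "T > 0"
  and b: "\<And>tau. 0 < tau ==> tau < T ==> nI 0 (T - tau) (dq tau u) \<le> b tau"
  and B: "(b ---> B) (at_right 0)"
 shows "nI 0 T v \<le> B"
proof -
 have L: "L2c T u" "L2c T v" using lim by (auto simp: dq_limit_def)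
 define I where "I t = nI 0 t v" for t
 have vi: "intable 0 T (%t. (nrm X (v t))^2)" using L2c_nrm[OF L(2)] by (simp add: sq_int_def)
 have ev: "\<forall>\<^sub>F tau in at_right 0. 0 < tau \<and> tau < (c::real)" if "c > 0" for c
  using that eventually_at_right_real[of 0 c] by simp
 have Ic: "((%tau. I (T - tau)) ---> I T) (at_right 0)"
 proof -
  have "continuous_on {0..T} I"
   unfolding I_def by (rule indefinite_integral_continuous_1[OF ivl_integrable_on[OF vi]])
  then have "continuous_on {0..T} (%tau. I (T - tau))"
   by (rule continuous_on_compose2) (auto intro!: continuous_intros)
  then have "((%tau. I (T - tau)) ---> I (T - 0)) (at 0 within {0..T})"
   using T unfolding continuous_on_def by (elim bspec) simp
  then show ?thesis using T by (simp add: at_within_Icc_at_right)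
 qed
 have le: "I T \<le> (sqrt B + sqrt dl)^2" if dl: "dl > 0" for dl
 proof -
  obtain a where a: "a > 0" "\<And>tau. 0 < tau ==> tau < a ==> tau \<le> T ==>
   dq_error T tau u v dl" by (rule dq_limitD[OF lim dl]) blast
  have "I (T - tau) \<le> (sqrt (b tau) + sqrt dl)^2" if tau: "0 < tau" "tau < min a T" for tau
  proof -
   obtain R where R: "sq_int 0 (T - tau) R" "ig 0 (T - tau) (%t. (R t)^2) \<le> dl"
    "AE t in ivl 0 (T - tau). nrm X (dq tau u t - v t) \<le> R t" using a(2)[of tau] tau by auto
   have q: "L2c (T - tau) (dq tau u)" "L2c (T - tau) v" using tau L2c_dq[OF L(1), of tau] L2c_sub[OF L(2), of "T - tau"] by auto
   have s: "sq_int 0 (T - tau) (%t. nrm X (dq tau u t))" "sq_int 0 (T - tau) (%t. nrm X (v t))" using q L2c_nrm by auto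
   have b': "nI 0 (T - tau) (dq tau u) \<le> b tau" using b[of tau] tau by simp
   moreover have "0 \<le> nI 0 (T - tau) (dq tau u)" using s(1) by (intro ivl_nonneg) (auto simp: sq_int_def)
   ultimately have b0: "0 \<le> b tau" by linarith
   have "I (T - tau) \<le> ig 0 (T - tau) (%t. (nrm X (dq tau u t) + R t)^2)"
    unfolding I_def
   proof (rule ivl_mono_AE)
    show "intable 0 (T - tau) (%t. (nrm X (v t))^2)" using s(2) by (simp add: sq_int_def)
    show "intable 0 (T - tau) (%t. (nrm X (dq tau u t) + R t)^2)" using sq_int_add[OF s(1) R(1)] by (simp add: sq_int_def)
    show "AE t in ivl 0 (T - tau). (nrm X (v t))^2 \<le> (nrm X (dq tau u t) + R t)^2"
     using R(3) L2c_carr[OF q(1)] L2c_carr[OF q(2)]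
    proof eventually_elim
     case (elim t)
     have "nrm X (v t) \<le> nrm X (dq tau u t) + nrm X (dq tau u t - v t)"
      using nrm_diff_le[of "dq tau u t" "dq tau u t - v t"] elim by simp
     then show ?case using elim nrm_nonneg[of "v t"] by (intro power_mono) auto
    qed
   qed
   also have "\<dots> \<le> (sqrt (b tau) + sqrt dl)^2" using s R b' b0 dl by (intro L2_triangle) auto
   finally show ?thesis .
  qed
  then have "\<forall>\<^sub>F tau in at_right 0. I (T - tau) \<le> (sqrt (b tau) + sqrt dl)^2"
   using ev[of "min a T"] a T by (auto elim: eventually_mono)
  then show ?thesis
   by (intro tendsto_le[OF _ _ Ic]) (auto intro!: tendsto_intros B)
 qed
 have "((%dl. (sqrt B + sqrt dl)^2) ---> (sqrt B + sqrt 0)^2) (at_right 0)" by (intro tendsto_intros)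
 then have 1: "I T \<le> (sqrt B)^2"
  using le ev[of 1] by (intro tendsto_lowerbound[of _ _ "at_right (0::real)"]) (auto elim: eventually_mono)
 have "0 \<le> B"
 proof (rule tendsto_lowerbound[OF B])
  show "\<forall>\<^sub>F tau in at_right 0. 0 \<le> b tau"
   using ev[OF T]
  proof eventually_elim
   case (elim tau)
   have "0 \<le> nI 0 (T - tau) (dq tau u)"
    using L2c_nrm[OF L2c_dq[OF L(1), of tau]] elim by (intro ivl_nonneg) (auto simp: sq_int_def)
   then show ?case using b[of tau] elim by linarith
  qed
 qed simp
 then show ?thesis using 1 by (simp add: I_def)
qed

end

section \<open>Abstract parabolic solutions and the error estimate\<close>

context energy_ops
begin

definition constr :: "'x => 'x => 'x => bool" where
 "constr u n s \<longleftrightarrow> u \<in> V \<and> n \<in> carr X \<and> s \<in> carr X \<and> nrm X (K u - (s - D n)) = 0"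

lemma constr_lin:
 assumes a: "constr u n s" and b: "constr v m r"
 shows "constr (u + c *R v) (n + c *R m) (s + c *R r)"
proof -
 have V: "u + c *R v \<in> V" using a b V_sub by (simp add: constr_def subspace_add subspace_scale)
 have c: "K u \<in> carr X" "K v \<in> carr X" "K (u + c *R v) \<in> carr X" "n \<in> carr X" "m \<in> carr X" "s \<in> carr X" "r \<in> carr X"
  "D n \<in> carr X" "D m \<in> carr X"
  using a b V by (auto simp: constr_def intro: K_carr D_carr)
 define x where "x = K (u + c *R v) - (K u + c *R K v)"
 define y where "y = K u - (s - D n)"
 define z where "z = c *R (K v - (r - D m))"
 have 0: "nrm X x = 0" "nrm X y = 0" "nrm X z = 0"
  using a b K_lin[of u v c] nrm_scale[of "K v - (r - D m)" c] c by (auto simp: constr_def x_def y_def z_def)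
 have "x \<in> carr X" "y \<in> carr X" "z \<in> carr X" using c by (auto simp: x_def y_def z_def)
 then have "nrm X (x + (y + z)) = 0" using 0 by (simp add: nrm_zero_add)
 moreover have "x + (y + z) = K (u + c *R v) - (s + c *R r - D (n + c *R m))"
  by (simp add: x_def y_def z_def D_lin algebra_simps)
 ultimately show ?thesis using V c by (simp add: constr_def)
qed

lemma constr_zero: "constr 0 0 0"
proof -
 have V: "0 \<in> V" using V_sub by (rule subspace_0)
 then have "nrm X (K 0) = 0" using K_lin[OF V V, of "-1"] by simp
 then show ?thesis using V by (simp add: constr_def)
qed

text \<open>Weak solutions of \<open>u' + A u - K\<^sup>* n = 0\<close> on \<open>V\<close> and \<open>K u + D n = S\<close>.\<close>

definition parab :: "real => (real => 'x) => (real => 'x) => (real => 'x) => bool" where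
 "parab T u n S \<longleftrightarrow> contT X T u \<and> L2c T n \<and> L2c T S \<and> (AE t in ivl 0 T. constr (u t) (n t) (S t)) \<and>
   (\<forall>q\<in>V. \<forall>s t. 0 \<le> s --> s \<le> t --> t \<le> T -->
    inn X (u t - u s) q = ig s t (%r. inn X (n r) (K q) - inn X (A (u r)) q))"

lemma parab_integrable:
 assumes "contT X T u" "L2c T n" "q \<in> V" "0 \<le> s" "t \<le> T"
 shows "intable s t (%r. inn X (n r) (K q) - inn X (A (u r)) q)"
proof -
 have "q \<in> carr X" "K q \<in> carr X" using assms V_carr K_carr by auto
 then have "intable 0 T (%r. inn X (n r) (K q))" "intable 0 T (%r. inn X (A (u r)) q)"
  using L2c_inn[OF assms(2) L2c_const] L2c_inn[OF L2c_map[OF contT_L2c[OF assms(1)] A_carr A_Lipschitz] L2c_const] by blast+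
 then have "intable 0 T (%r. inn X (n r) (K q) - inn X (A (u r)) q)" by (rule Bochner_Integration.integrable_diff)
 then show ?thesis by (rule ivl_sub[OF _ assms(4,5)])
qed

lemma parab_lin:
 assumes u: "parab T u n S" and v: "parab T v m R"
 shows "parab T (%t. u t + c *R v t) (%t. n t + c *R m t) (%t. S t + c *R R t)"
 unfolding parab_def
proof (intro conjI ballI allI impI)
 have cu: "contT X T u" "L2c T n" "L2c T S" and cv: "contT X T v" "L2c T m" "L2c T R" using u v by (auto simp: parab_def)
 show "contT X T (%t. u t + c *R v t)" using cu cv by (intro contT_add contT_scale)
 show "L2c T (%t. n t + c *R m t)" "L2c T (%t. S t + c *R R t)" using cu cv by (auto intro!: L2c_add L2c_scale)
 have "AE t in ivl 0 T. constr (u t) (n t) (S t)" "AE t in ivl 0 T. constr (v t) (m t) (R t)"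
  using u v by (auto simp: parab_def)
 then show "AE t in ivl 0 T. constr (u t + c *R v t) (n t + c *R m t) (S t + c *R R t)"
  by eventually_elim (rule constr_lin)
 fix q s t assume q: "q \<in> V" and st: "0 \<le> s" "s \<le> t" "t \<le> T"
 have qc: "q \<in> carr X" "K q \<in> carr X" using q V_carr K_carr by auto
 have iu: "intable s t (%r. inn X (n r) (K q) - inn X (A (u r)) q)" by (rule parab_integrable[OF cu(1,2) q st(1,3)])
 have iv: "intable s t (%r. inn X (m r) (K q) - inn X (A (v r)) q)" by (rule parab_integrable[OF cv(1,2) q st(1,3)])
 have uc: "u r \<in> carr X" "v r \<in> carr X" if "r \<in> {0..T}" for r using that contT_carr cu cv by auto
 have "AE r in ivl s t. n r \<in> carr X \<and> m r \<in> carr X"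
  using AE_ivl_sub[of "%r. n r \<in> carr X \<and> m r \<in> carr X" 0 T s t] L2c_carr[OF cu(2)] L2c_carr[OF cv(2)] st by auto
 moreover have "AE r in ivl s t. r \<in> {0..T}" using st by (intro AE_ivl_all) auto
 ultimately have ae: "AE r in ivl s t.
   (inn X (n r) (K q) - inn X (A (u r)) q) + c * (inn X (m r) (K q) - inn X (A (v r)) q) =
   inn X (n r + c *R m r) (K q) - inn X (A (u r + c *R v r)) q"
 proof eventually_elim
  case (elim r)
  then show ?case using qc uc[OF elim(2)] by (simp add: A_lin inn_simps A_carr right_diff_distrib)
 qed
 have "inn X (u t + c *R v t - (u s + c *R v s)) q = inn X (u t - u s) q + c * inn X (v t - v s) q"
  using uc[of s] uc[of t] st qc by (simp add: inn_simps algebra_simps)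
 also have "\<dots> = ig s t (%r. (inn X (n r) (K q) - inn X (A (u r)) q) + c * (inn X (m r) (K q) - inn X (A (v r)) q))"
  using u v q st by (subst ivl_add[OF iu integrable_mult_right[OF iv]]) (simp add: parab_def)
 also have "\<dots> = ig s t (%r. inn X (n r + c *R m r) (K q) - inn X (A (u r + c *R v r)) q)"
  by (rule ivl_cong_AE[symmetric, OF Bochner_Integration.integrable_add[OF iu integrable_mult_right[OF iv]] ae])
 finally show "inn X (u t + c *R v t - (u s + c *R v s)) q =
  ig s t (%r. inn X (n r + c *R m r) (K q) - inn X (A (u r + c *R v r)) q)" .
qed

lemma parab_zero: "parab T (%t. 0) (%t. 0) (%t. 0)"
proof -
 have "q \<in> carr X \<and> K q \<in> carr X" if "q \<in> V" for q using that V_carr K_carr by auto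
 then show ?thesis using constr_zero by (simp add: parab_def contT_const L2c_const)
qed

lemma parab_shift:
 assumes u: "parab T u n S" and c: "0 \<le> c" "T' + c \<le> T"
 shows "parab T' (%t. u (t + c)) (%t. n (t + c)) (%t. S (t + c))"
 unfolding parab_def
proof (intro conjI ballI allI impI)
 have cu: "contT X T u" "L2c T n" "L2c T S" using u by (auto simp: parab_def)
 show "contT X T' (%t. u (t + c))" "L2c T' (%t. n (t + c))" "L2c T' (%t. S (t + c))"
  using contT_shift[OF cu(1) c] L2c_shift[OF cu(2) c] L2c_shift[OF cu(3) c] by auto
 have "AE t in ivl c (T' + c). constr (u t) (n t) (S t)"
  by (rule AE_ivl_sub[of _ 0 T]) (use u c in \<open>simp_all add: parab_def\<close>)
 from AE_ivl_shift[OF this, where c = c] show "AE t in ivl 0 T'. constr (u (t + c)) (n (t + c)) (S (t + c))"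
  unfolding diff_self add_diff_cancel_right' .
 fix q s t assume q: "q \<in> V" and st: "0 \<le> s" "s \<le> t" "t \<le> T'"
 have i: "intable (s + c) (t + c) (%r. inn X (n r) (K q) - inn X (A (u r)) q)"
  using st c by (intro parab_integrable[OF cu(1,2) q]) auto
 have "inn X (u (t + c) - u (s + c)) q = ig (s + c) (t + c) (%r. inn X (n r) (K q) - inn X (A (u r)) q)"
  using u q st c by (auto simp: parab_def)
 then show "inn X (u (t + c) - u (s + c)) q = ig s t (%r. inn X (n (r + c)) (K q) - inn X (A (u (r + c))) q)"
  using ivl_shift(2)[OF i, of c] by simp
qed

lemma parab_dq:
 assumes u: "parab T u n S" and k: "0 \<le> k"
 shows "parab (T - k) (dq k u) (dq k n) (dq k S)"
proof -
 have "parab (T - k) u n S" using parab_shift[OF u, of 0 "T - k"] k by simp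
 then have "parab (T - k) (%t. u (t + k) + (-1) *R u t) (%t. n (t + k) + (-1) *R n t) (%t. S (t + k) + (-1) *R S t)"
  using parab_shift[OF u k, of "T - k"] by (intro parab_lin) auto
 from parab_lin[OF parab_zero this, of "inverse k"] show ?thesis by (simp add: dq_def[abs_def])
qed

lemma parab_energy:
 assumes u: "parab T u n S" and t: "0 \<le> t" "t \<le> T"
 shows "(nrm X (u t))^2 + ig 0 t (%t. inn X (D (n t)) (n t)) \<le> (nrm X (u 0))^2 + nI 0 t S / d"
proof (rule weak_energy[where K = K and A = A and D = D and V = V, OF t])
 show "contT X T u" "L2c T n" "L2c T S" using u by (auto simp: parab_def)
 show "q \<in> V ==> q \<in> carr X \<and> K q \<in> carr X" for q using V_carr K_carr by auto
 have "AE t in ivl 0 T. constr (u t) (n t) (S t)" using u by (simp add: parab_def)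
 then show "AE t in ivl 0 T. u t \<in> V \<and> nrm X (K (u t) - (S t - D (n t))) = 0"
  by eventually_elim (simp add: constr_def)
 show "inn X (u t - u s) q = ig s t (%r. inn X (n r) (K q) - inn X (A (u r)) q)"
  if "q \<in> V" "0 \<le> s" "s \<le> t" "t \<le> T" for q s t using u that by (simp add: parab_def)
qed (use A_carr A_Lipschitz A_nonneg BA_nonneg D_carr D_Lipschitz D_ge d_pos in auto)

lemma D_integral:
 assumes n: "L2c T n" and t: "0 \<le> t" "t \<le> T"
 shows "intable 0 t (%t. inn X (D (n t)) (n t))"
  and "d * nI 0 t n \<le> ig 0 t (%t. inn X (D (n t)) (n t))"
  and "0 \<le> ig 0 t (%t. inn X (D (n t)) (n t))"
proof -
 have n': "L2c t n" by (rule L2c_sub[OF n t(2)])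
 show i: "intable 0 t (%t. inn X (D (n t)) (n t))"
  by (rule L2c_inn[OF L2c_map[OF n' D_carr D_Lipschitz] n'])
 have s: "intable 0 t (%t. (nrm X (n t))^2)" using L2c_nrm[OF n'] by (simp add: sq_int_def)
 have "ig 0 t (%t. d * (nrm X (n t))^2) \<le> ig 0 t (%t. inn X (D (n t)) (n t))"
 proof (rule ivl_mono_AE[OF integrable_mult_right[OF s] i])
  show "AE t in ivl 0 t. d * (nrm X (n t))^2 \<le> inn X (D (n t)) (n t)"
   using L2c_carr[OF n'] by eventually_elim (simp add: nrm_sq D_ge)
 qed
 then show 1: "d * nI 0 t n \<le> ig 0 t (%t. inn X (D (n t)) (n t))" by simp
 have "0 \<le> nI 0 t n" by (intro ivl_nonneg[OF s]) auto
 then show "0 \<le> ig 0 t (%t. inn X (D (n t)) (n t))" using 1 d_pos by (intro order_trans[OF mult_nonneg_nonneg 1]) auto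
qed

text \<open>The energy inequality is used three times. For \<open>E\<close> on
  \<open>{0..tau}\<close> it shows that the initial value of \<open>dq tau E\<close> is negligible;
  for \<open>dq tau E\<close> it bounds the derivative of \<open>Em\<close> by
  \<open>eps^2 * B / d^2\<close>; for \<open>e\<close>, whose source \<open>S\<close> is
  \<open>eps\<close> times that derivative, it gives \<open>eps^4\<close>. Each use costs a factor
  \<open>1 / d\<close> by Young's inequality; the second costs another one when the dissipation is
  turned into a norm, hence \<open>d^3\<close>.\<close>

lemma error_estimate:
 assumes T: "T > 0" and E: "parab T E Em (%t. - eps *R m' t)" "nrm X (E 0) = 0"
  and p1: "parab T p1 m1 (%t. - m0' t)" "nrm X (p1 0) = 0"
  and m': "contT X T m'" and C: "\<And>s. 0 \<le> s ==> s < T ==> nrm X (m' s) \<le> C * s"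
  and b: "\<And>tau. 0 < tau ==> tau < T ==> nI 0 (T - tau) (dq tau m') \<le> b tau"
  and B: "(b ---> B) (at_right 0)"
  and lim: "dq_limit T Em (%t. m' t - m0' t)"
 defines "S \<equiv> %t. - eps *R (m' t - m0' t)" and "e \<equiv> %t. E t - eps *R p1 t" and "em \<equiv> %t. Em t - eps *R m1 t"
 shows "parab T e em S" "nI 0 T S \<le> eps^4 * B / d^2"
  and "t \<in> {0..T} ==> (nrm X (e t))^2 + ig 0 t (%t. inn X (D (em t)) (em t)) \<le> eps^4 * B / d^3"
proof -
 have cE: "contT X T E" "L2c T Em" and cp1: "contT X T p1" using E p1 by (auto simp: parab_def)
 show pe: "parab T e em S"
  using parab_lin[OF E(1) p1(1), of "- eps"] by (simp add: e_def em_def S_def algebra_simps)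
 have E0: "E 0 \<in> carr X" "E tau \<in> carr X" if "tau \<in> {0..T}" for tau using contT_carr[OF cE(1)] T that by auto
 have nS: "(nrm X (- eps *R x))^2 = eps^2 * (nrm X x)^2" if "x \<in> carr X" for x
  using nrm_scale[OF that, of "- eps"] by (simp add: power_mult_distrib)
 \<comment> \<open>Two powers of \<open>tau\<close> come from the squared bound of
   \<open>m'\<close>, one from the length of the interval. After division by \<open>tau^2\<close>
   one power is left.\<close>
 have Etau: "(nrm X (E tau))^2 \<le> eps^2 * C^2 * tau^3 / d" if tau: "0 < tau" "tau < T" for tau
 proof -
  have "nI 0 tau (%t. - eps *R m' t) \<le> ig 0 tau (%t. eps^2 * (C * tau)^2)"
  proof (rule ivl_mono_AE)
   have "contT X tau (%t. - eps *R m' t)" using tau contT_sub[OF m'] by (intro contT_scale) auto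
   then show "intable 0 tau (%t. (nrm X (- eps *R m' t))^2)" by (intro ivl_cont continuous_intros contT_nrm)
   show "intable 0 tau (%t. eps^2 * (C * tau)^2)" by (intro ivl_cont continuous_intros)
   show "AE t in ivl 0 tau. (nrm X (- eps *R m' t))^2 \<le> eps^2 * (C * tau)^2"
   proof (rule AE_ivl_all)
    fix t assume t: "t \<in> {0..tau}"
    have mc: "m' t \<in> carr X" "m' tau \<in> carr X" using contT_carr[OF m'] t tau by auto
    have "0 \<le> C * tau" using C[of tau] nrm_nonneg[OF mc(2)] tau by linarith
    then have "0 \<le> C" using tau by (simp add: zero_le_mult_iff)
    then have "C * t \<le> C * tau" using t by (intro mult_left_mono) auto
    moreover have "nrm X (m' t) \<le> C * t" using C[of t] t tau by auto
    ultimately have "(nrm X (m' t))^2 \<le> (C * tau)^2" using nrm_nonneg[OF mc(1)] by (intro power_mono) auto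
    then show "(nrm X (- eps *R m' t))^2 \<le> eps^2 * (C * tau)^2" unfolding nS[OF mc(1)] by (intro mult_left_mono) auto
   qed
  qed
  then have "nI 0 tau (%t. - eps *R m' t) \<le> eps^2 * C^2 * tau^3"
   using tau by (simp add: power2_eq_square power3_eq_cube mult_ac)
  then have "nI 0 tau (%t. - eps *R m' t) / d \<le> eps^2 * C^2 * tau^3 / d"
   using d_pos by (intro divide_right_mono) auto
  then show ?thesis using parab_energy[OF E(1), of tau] D_integral(3)[OF cE(2), of tau] tau E(2) by simp
 qed
 define b' where "b' tau = (eps^2 * C^2 * tau + eps^2 * b tau) / d^2" for tau
 have "nI 0 T (%t. m' t - m0' t) \<le> (eps^2 * C^2 * 0 + eps^2 * B) / d^2"
 proof (rule dq_limit_bound[OF lim T, where b = b'])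
  show "(b' ---> (eps^2 * C^2 * 0 + eps^2 * B) / d^2) (at_right 0)"
   unfolding b'_def using d_pos by (intro tendsto_intros B) auto
  fix tau assume tau: "0 < tau" "tau < T"
  have pd: "parab (T - tau) (dq tau E) (dq tau Em) (dq tau (%t. - eps *R m' t))" using tau by (intro parab_dq E) auto
  have L: "L2c (T - tau) (dq tau Em)" using pd by (simp add: parab_def)
  have "nrm X (dq tau E 0) = nrm X (E tau - E 0) / tau" using E0[of tau] tau by (simp add: dq_def nrm_scale divide_inverse_commute)
  also have "nrm X (E tau - E 0) = nrm X (E tau)" using E0[of tau] E(2) tau by (intro nrm_eqI) (auto simp: nrm_minus)
  finally have "(nrm X (dq tau E 0))^2 = (nrm X (E tau))^2 / tau^2" by (simp add: power_divide)
  also have "\<dots> \<le> eps^2 * C^2 * tau^3 / d / tau^2" using Etau[OF tau] by (intro divide_right_mono) auto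
  finally have 1: "(nrm X (dq tau E 0))^2 \<le> eps^2 * C^2 * tau / d" using tau by (simp add: power2_eq_square power3_eq_cube)
  have cm: "contT X (T - tau) (dq tau m')" using tau by (intro contT_dq m') auto
  have "nI 0 (T - tau) (%t. dq tau (%t. - eps *R m' t) t) =
   ig 0 (T - tau) (%t. eps^2 * (nrm X (dq tau m' t))^2)"
  proof (rule integral_cong)
   fix t assume t: "t \<in> {0..T - tau}"
   have "dq tau (%t. - eps *R m' t) t = - eps *R dq tau m' t" by (simp add: dq_def algebra_simps)
   then show "(nrm X (dq tau (%t. - eps *R m' t) t))^2 = eps^2 * (nrm X (dq tau m' t))^2"
    using nS[OF contT_carr[OF cm t]] by simp
  qed
  also have "\<dots> \<le> eps^2 * b tau" using b[OF tau] by (simp add: mult_left_mono)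
  finally have "nI 0 (T - tau) (%t. dq tau (%t. - eps *R m' t) t) / d \<le> eps^2 * b tau / d"
   using d_pos by (intro divide_right_mono) auto
  moreover have "0 \<le> T - tau" using tau by simp
  ultimately have "d * nI 0 (T - tau) (dq tau Em) \<le> eps^2 * C^2 * tau / d + eps^2 * b tau / d"
   using parab_energy[OF pd _ order_refl] D_integral(2)[OF L _ order_refl] 1
    zero_le_power2[of "nrm X (dq tau E (T - tau))"] by linarith
  also have "\<dots> = d * b' tau" using d_pos by (simp add: b'_def power2_eq_square add_divide_distrib distrib_left)
  finally show "nI 0 (T - tau) (dq tau Em) \<le> b' tau" using d_pos by simp
 qed
 then have W: "nI 0 T (%t. m' t - m0' t) \<le> eps^2 * B / d^2" by simp
 have LW: "L2c T (%t. m' t - m0' t)" using lim by (simp add: dq_limit_def)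
 have LS: "L2c T S" using pe by (simp add: parab_def)
 have SS: "intable 0 T (%t. (nrm X (S t))^2)" using L2c_nrm[OF LS] by (simp add: sq_int_def)
 have WW: "intable 0 T (%t. eps^2 * (nrm X (m' t - m0' t))^2)"
  using L2c_nrm[OF LW] by (auto simp: sq_int_def)
 have "AE t in ivl 0 T. eps^2 * (nrm X (m' t - m0' t))^2 = (nrm X (S t))^2"
  using L2c_carr[OF LW] by eventually_elim (simp add: S_def nS[symmetric])
 then have "nI 0 T S = ig 0 T (%t. eps^2 * (nrm X (m' t - m0' t))^2)"
  by (rule ivl_cong_AE[OF WW])
 also have "\<dots> \<le> eps^2 * (eps^2 * B / d^2)" using mult_left_mono[OF W, of "eps^2"] by simp
 finally show IS: "nI 0 T S \<le> eps^4 * B / d^2" by (simp add: power4_eq_xxxx power2_eq_square mult_ac)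
 fix t assume t: "t \<in> {0..T}"
 have "nI 0 t S \<le> nI 0 T S"
  using t by (intro ivl_mono_sub[OF SS]) auto
 then have "nI 0 t S / d \<le> eps^4 * B / d^2 / d"
  using IS d_pos by (intro divide_right_mono) auto
 moreover have "nrm X (e 0) = 0"
 proof -
  have c: "E 0 \<in> carr X" "p1 0 \<in> carr X" using E0[of 0] contT_carr[OF cp1, of 0] T by auto
  have "nrm X (e 0) \<le> nrm X (E 0) + nrm X (eps *R p1 0)" unfolding e_def using c by (intro nrm_diff_le) auto
  then show ?thesis using c E(2) p1(2) by (intro nrm_le_zeroI) (auto simp: e_def nrm_scale)
 qed
 ultimately show "(nrm X (e t))^2 + ig 0 t (%t. inn X (D (em t)) (em t)) \<le> eps^4 * B / d^3"
  using parab_energy[OF pe, of t] t by (simp add: power2_eq_square power3_eq_cube)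
qed

end

section \<open>Scalar boundary data of class \<open>H^3\<close>\<close>

lemma sum_sq_le: "(a + b)^2 \<le> 2 * a^2 + 2 * (b::real)^2"
 using zero_le_power2[of "a - b"] by (simp add: power2_sum power2_diff)

text \<open>The derivatives of order one and two are honest functions, the third is a density
  \<open>y\<close>. The third one matters because lifting puts the first derivatives of the boundary
  data on the right-hand sides, which must have the regularity of \<open>H2_data\<close>. The single
  number \<open>Q\<close> bounds the initial values and the norms.\<close>

definition H3_path :: "real => (real => real) => (real => real) => (real => real) => (real => real) => real => bool" where
 "H3_path T phi phi1 phi2 y Q \<longleftrightarrow>
   (\<forall>t\<in>{0..T}. (phi has_real_derivative phi1 t) (at t within {0..T}) \<and> (phi1 has_real_derivative phi2 t) (at t within {0..T})) \<and>
   continuous_on {0..T} phi2 \<and> sq_int 0 T y \<and> (\<forall>s t. 0 \<le> s --> s \<le> t --> t \<le> T --> phi2 t - phi2 s = ig s t y) \<and>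
   (phi1 0)^2 \<le> Q \<and> (phi2 0)^2 \<le> Q \<and> ig 0 T (%t. (phi2 t)^2) \<le> Q \<and> ig 0 T (%t. (y t)^2) \<le> Q"

lemma H3_path_primitive:
 assumes "H3_path T phi phi1 phi2 y Q" "0 \<le> s" "s \<le> t" "t \<le> T"
 shows "phi1 t - phi1 s = ig s t phi2"
proof -
 have "(phi2 has_integral phi1 t - phi1 s) {s..t}"
 proof (rule fundamental_theorem_of_calculus[OF assms(3)])
  fix x assume x: "x \<in> {s..t}"
  then have "(phi1 has_real_derivative phi2 x) (at x within {0..T})" using assms by (auto simp: H3_path_def)
  then have "(phi1 has_real_derivative phi2 x) (at x within {s..t})" by (rule DERIV_subset) (use assms in auto)
  then show "(phi1 has_vector_derivative phi2 x) (at x within {s..t})" by (simp add: has_real_derivative_iff_has_vector_derivative)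
 qed
 then show ?thesis by (simp add: integral_unique)
qed

lemma H3_path_cont:
 assumes "H3_path T phi phi1 phi2 y Q"
 shows "continuous_on {0..T} phi" "continuous_on {0..T} phi1" "continuous_on {0..T} phi2"
 using assms by (auto simp: H3_path_def intro!: DERIV_continuous_on)

text \<open>For the data at \<open>VN\<close>, whose derivative vanishes initially: the lift of
  \<open>r\<close> then does not disturb the linear growth of \<open>m'\<close> from zero.\<close>

lemma H3_path_linear_bound:
 assumes p: "H3_path T phi phi1 phi2 y Q" and 0: "phi1 0 = 0"
 obtains C where "0 \<le> C" "\<And>s. s \<in> {0..T} ==> \<bar>phi1 s\<bar> \<le> C * s"
proof -
 have "bounded (phi2 ` {0..T})" by (intro compact_imp_bounded compact_continuous_image H3_path_cont[OF p]) simp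
 then obtain C where C: "C > 0" "\<And>s. s \<in> {0..T} ==> \<bar>phi2 s\<bar> \<le> C" by (auto simp: bounded_pos)
 have "\<bar>phi1 s\<bar> \<le> C * s" if s: "s \<in> {0..T}" for s
 proof -
  have i: "intable 0 s phi2" using s by (intro ivl_cont continuous_on_subset[OF H3_path_cont(3)[OF p]]) auto
  have "phi1 s = ig 0 s phi2" using H3_path_primitive[OF p, of 0 s] 0 s by simp
  also have "\<bar>\<dots>\<bar> \<le> ig 0 s (%_. C)"
   using s C by (intro ivl_abs_le[OF i] ivl_cont continuous_intros AE_ivl_all) auto
  finally show ?thesis using s by (simp add: mult.commute)
 qed
 then show ?thesis using that[of C] C by simp
qed

lemma H3_path_dq:
 assumes p: "H3_path T phi phi1 phi2 y Q" and tau: "0 < tau" "tau \<le> T"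
 shows "continuous_on {0..T - tau} (dq tau phi1)" "ig 0 (T - tau) (%t. (dq tau phi1 t)^2) \<le> Q"
proof -
 have eq: "ig s (s + tau) phi2 / tau = dq tau phi1 s" if "s \<in> {0..T - tau}" for s
  using H3_path_primitive[OF p, of s "s + tau"] that tau by (simp add: dq_def divide_inverse_commute)
 have q: "sq_int 0 T phi2" by (rule sq_int_cont[OF H3_path_cont(3)[OF p]])
 show "continuous_on {0..T - tau} (dq tau phi1)"
  using window_average_sq_le(1)[OF q tau] eq by (simp cong: continuous_on_cong_simp)
 have "ig 0 (T - tau) (%t. (dq tau phi1 t)^2) = ig 0 (T - tau) (%s. (ig s (s + tau) phi2 / tau)^2)"
  by (rule integral_cong) (simp add: eq)
 also have "\<dots> \<le> Q" using window_average_sq_le(2)[OF q tau] p by (auto simp: H3_path_def)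
 finally show "ig 0 (T - tau) (%t. (dq tau phi1 t)^2) \<le> Q" .
qed

context semi_inner
begin

text \<open>Records \<open>H2_data\<close> by one bound for squares, so that constants add up
  linearly in the squared norms of the data.\<close>

definition data :: "real => (real => 'x) => 'x => real => bool" where
 "data T u u1 Q \<longleftrightarrow> (\<exists>M. H2_data T u u1 M \<and> M^2 \<le> Q \<and> (nrm X u1)^2 \<le> Q)"

lemma data_mono: "data T u u1 Q ==> Q \<le> R ==> data T u u1 R"
 unfolding data_def by (meson order_trans)

lemma data_contT: "data T u u1 Q ==> contT X T u" and data_carr: "data T u u1 Q ==> u1 \<in> carr X"
 by (auto simp: data_def H2_data_def)

lemma data_sum:
 assumes I: "finite I" and u: "\<And>i. i \<in> I ==> data T (u i) (u1 i) (Q i)"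
 shows "data T (%t. \<Sum>i\<in>I. u i t) (\<Sum>i\<in>I. u1 i) (real (card I) * (\<Sum>i\<in>I. Q i))"
proof -
 have "\<forall>i\<in>I. \<exists>M. H2_data T (u i) (u1 i) M \<and> M^2 \<le> Q i \<and> (nrm X (u1 i))^2 \<le> Q i" using u by (simp add: data_def)
 then obtain M where M: "\<And>i. i \<in> I ==> H2_data T (u i) (u1 i) (M i)" "\<And>i. i \<in> I ==> (M i)^2 \<le> Q i"
  "\<And>i. i \<in> I ==> (nrm X (u1 i))^2 \<le> Q i" by metis
 have "(\<Sum>i\<in>I. M i)^2 \<le> (\<Sum>i\<in>I. (M i)^2) * real (card I)" by (rule sum_squared_le_sum_of_squares)
 also have "\<dots> \<le> (\<Sum>i\<in>I. Q i) * real (card I)" using M by (intro mult_right_mono sum_mono) auto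
 finally have 1: "(\<Sum>i\<in>I. M i)^2 \<le> real (card I) * (\<Sum>i\<in>I. Q i)" by (simp add: mult.commute)
 have c: "i \<in> I ==> u1 i \<in> carr X" for i using u data_carr by blast
 have "(nrm X (\<Sum>i\<in>I. u1 i))^2 \<le> (\<Sum>i\<in>I. nrm X (u1 i))^2" using c by (intro power_mono nrm_sum_le) auto
 also have "\<dots> \<le> (\<Sum>i\<in>I. (nrm X (u1 i))^2) * real (card I)" by (rule sum_squared_le_sum_of_squares)
 also have "\<dots> \<le> (\<Sum>i\<in>I. Q i) * real (card I)" using M by (intro mult_right_mono sum_mono) auto
 finally have "(nrm X (\<Sum>i\<in>I. u1 i))^2 \<le> real (card I) * (\<Sum>i\<in>I. Q i)" by (simp add: mult.commute)
 moreover have "H2_data T (%t. \<Sum>i\<in>I. u i t) (\<Sum>i\<in>I. u1 i) (\<Sum>i\<in>I. M i)" by (rule H2_data_sum[OF I M(1)])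
 ultimately show ?thesis using 1 unfolding data_def by blast
qed

lemma data_add:
 assumes u: "data T u u1 Q" and v: "data T v v1 R"
 shows "data T (%t. u t + v t) (u1 + v1) (2 * Q + 2 * R)"
proof -
 obtain M N where MN: "H2_data T u u1 M" "M^2 \<le> Q" "(nrm X u1)^2 \<le> Q" "H2_data T v v1 N" "N^2 \<le> R" "(nrm X v1)^2 \<le> R"
  using u v by (auto simp: data_def)
 have c: "u1 \<in> carr X" "v1 \<in> carr X" using u v data_carr by auto
 have "(nrm X (u1 + v1))^2 \<le> (nrm X u1 + nrm X v1)^2" using c nrm_triangle by (intro power_mono) auto
 then have "(nrm X (u1 + v1))^2 \<le> 2 * Q + 2 * R" using sum_sq_le[of "nrm X u1" "nrm X v1"] MN by linarith
 moreover have "(M + N)^2 \<le> 2 * Q + 2 * R" using sum_sq_le[of M N] MN by linarith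
 ultimately show ?thesis using H2_data_add[OF MN(1,4)] unfolding data_def by blast
qed

lemma data_of_path:
 assumes p: "H3_path T phi phi1 phi2 y Q" and w: "w \<in> carr X" and T: "0 \<le> T"
 shows "data T (%t. phi t *R w) (phi1 0 *R w) (Q * (nrm X w)^2)" "data T (%t. phi1 t *R w) (phi2 0 *R w) (Q * (nrm X w)^2)"
proof -
 have q: "sq_int 0 T phi2" by (rule sq_int_cont[OF H3_path_cont(3)[OF p]])
 have sq: "(sqrt (ig 0 T (%t. (z t)^2)) * nrm X w)^2 \<le> Q * (nrm X w)^2"
  if "sq_int 0 T z" "ig 0 T (%t. (z t)^2) \<le> Q" for z
 proof -
  have "0 \<le> ig 0 T (%t. (z t)^2)" using that by (intro ivl_nonneg) (auto simp: sq_int_def)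
  then show ?thesis using that by (simp add: power_mult_distrib mult_right_mono)
 qed
 have sn: "(nrm X (c *R w))^2 \<le> Q * (nrm X w)^2" if "c^2 \<le> Q" for c
  using that w by (simp add: nrm_scale power_mult_distrib mult_right_mono)
 have y: "sq_int 0 T y" using p by (simp add: H3_path_def)
 have "H2_data T (%t. phi t *R w) (phi1 0 *R w) (sqrt (ig 0 T (%t. (phi2 t)^2)) * nrm X w)"
  by (rule H2_data_scale_const[OF _ H3_path_cont(2)[OF p] q H3_path_primitive[OF p] w T]) (use p in \<open>auto simp: H3_path_def\<close>)
 then show "data T (%t. phi t *R w) (phi1 0 *R w) (Q * (nrm X w)^2)"
  using sq[OF q] sn[of "phi1 0"] p unfolding data_def H3_path_def by blast
 have "H2_data T (%t. phi1 t *R w) (phi2 0 *R w) (sqrt (ig 0 T (%t. (y t)^2)) * nrm X w)"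
  by (rule H2_data_scale_const[OF _ H3_path_cont(3)[OF p] y _ w T]) (use p in \<open>auto simp: H3_path_def\<close>)
 then show "data T (%t. phi1 t *R w) (phi2 0 *R w) (Q * (nrm X w)^2)"
  using sq[OF y] sn[of "phi2 0"] p unfolding data_def H3_path_def by blast
qed

end

lemma linear_over_sqrt_tendsto:
 "((%tau::real. k * ((a + sqrt tau * c)^2 + e) + r) ---> k * (a^2 + e) + r) (at_right 0)"
proof -
 have "((%tau::real. k * ((a + sqrt tau * c)^2 + e) + r) ---> k * ((a + sqrt 0 * c)^2 + e) + r) (at_right 0)"
  by (intro tendsto_intros)
 then show ?thesis by simp
qed

section \<open>Lifting the boundary data\<close>

context semi_inner
begin

abbreviation lc :: "'i set => ('i => real => real) => ('i => 'x) => real => 'x" where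
 "lc S c w t \<equiv> (\<Sum>i\<in>S. c i t *R w i)"

lemma inn_lc:
 assumes "\<And>i. i \<in> S ==> w i \<in> carr X" "z \<in> carr X"
 shows "inn X (lc S c w t) z = (\<Sum>i\<in>S. c i t * inn X (w i) z)"
 using assms by (simp add: inn_sum_left inn_scale_left)

lemma contT_lc: "(\<And>i. i \<in> S ==> continuous_on {0..T} (c i)) ==> (\<And>i. i \<in> S ==> w i \<in> carr X) ==> contT X T (lc S c w)"
 by (intro contT_sum contT_scale_const)

lemma sderiv_lc:
 assumes "\<And>i t. i \<in> S ==> t \<in> {0..T} ==> (c i has_real_derivative c' i t) (at t within {0..T})" "\<And>i. i \<in> S ==> w i \<in> carr X"
 shows "sderiv T (lc S c w) (lc S c' w)"
 by (rule sderiv_sum) (use assms in \<open>auto intro: sderiv_scale_const\<close>)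

lemma data_lc:
 assumes S: "finite S" and w: "\<And>i. i \<in> S ==> w i \<in> carr X" and W: "card S * (\<Sum>i\<in>S. (nrm X (w i))^2) \<le> P" and Q: "0 \<le> Q"
  and d: "\<And>i. i \<in> S ==> data T (%t. c i t *R w i) (c1 i 0 *R w i) (Q * (nrm X (w i))^2)"
 shows "data T (lc S c w) (lc S c1 w 0) (P * Q)"
proof -
 have "real (card S) * (\<Sum>i\<in>S. Q * (nrm X (w i))^2) = card S * (\<Sum>i\<in>S. (nrm X (w i))^2) * Q"
  by (simp add: sum_distrib_left[symmetric])
 also have "\<dots> \<le> P * Q" by (rule mult_right_mono[OF W Q])
 finally have "real (card S) * (\<Sum>i\<in>S. Q * (nrm X (w i))^2) \<le> P * Q" .
 moreover have "data T (lc S c w) (lc S c1 w 0) (real (card S) * (\<Sum>i\<in>S. Q * (nrm X (w i))^2))" by (rule data_sum[OF S d])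
 ultimately show ?thesis by (rule data_mono[rotated])
qed

end

context energy_ops
begin

lemma A_lc: "A (lc S c w t) = lc S c (%i. A (w i)) t" and D_lc: "D (lc S c w t) = lc S c (%i. D (w i)) t"
 by (induction S rule: infinite_finite_induct) (use A_lin[of _ 1] D_lin[of _ 1] in \<open>auto simp: A_scale D_scale\<close>)

text \<open>Subtracting the lift of \<open>h\<close> from \<open>p\<close> restores homogeneous
  boundary values and leaves terms in \<open>h\<close> and its derivative. In the vertex values
  tested by \<open>r\<close>, the part with \<open>K q\<close> is absorbed by shifting
  \<open>m\<close> by the functions \<open>\<rho>\<close>, and the part with \<open>q\<close> joins
  \<open>g\<close>. The shift of \<open>m\<close> creates the term \<open>- eps *R \<rho> j\<close>
  with the derivative of \<open>r\<close>.\<close>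

lemma wave_lift:
 assumes h: "\<And>i. i \<in> I ==> H3_path T (h i) (h1 i) (h2 i) (h3 i) Q" and r: "\<And>j. j \<in> J ==> H3_path T (r j) (r1 j) (r2 j) (r3 j) Q"
  and l: "\<And>i. i \<in> I ==> \<eta> i \<in> carr X" "\<And>i. i \<in> I ==> \<kappa> i \<in> carr X" "\<And>j. j \<in> J ==> \<rho> j \<in> carr X" "\<And>j. j \<in> J ==> \<gamma> j \<in> carr X"
  and p: "contT X T p" "sderiv T p p'" and m: "contT X T m" "sderiv T m m'"
  and g: "contT X T g" and f: "contT X T f"
  and pV: "\<And>t. t \<in> {0..T} ==> p t - lc I h \<eta> t \<in> V"
  and k: "\<And>t. t \<in> {0..T} ==> k t \<in> carr X" "\<And>t. t \<in> {0..T} ==> nrm X (K (p t - lc I h \<eta> t) - (k t - lc I h \<kappa> t)) = 0"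
  and eq1: "\<And>t q. t \<in> {0..T} ==> q \<in> V ==> inn X (p' t) q + inn X (A (p t)) q - inn X (m t) (K q) =
    inn X (g t) q - (\<Sum>j\<in>J. r j t * (inn X (\<rho> j) (K q) - inn X (\<gamma> j) q))"
  and eq2: "\<And>t. t \<in> {0..T} ==> nrm X (eps *R m' t + k t + D (m t) - f t) = 0"
 shows "wave T eps (%t. p t - lc I h \<eta> t) (%t. m t - lc J r \<rho> t) (%t. p' t - lc I h1 \<eta> t) (%t. m' t - lc J r1 \<rho> t)
  (%t. (g t + lc I h1 (%i. - \<eta> i) t) + (lc I h (%i. - A (\<eta> i)) t + lc J r \<gamma> t))
  (%t. (f t + lc J r1 (%j. - eps *R \<rho> j) t) + (lc I h (%i. - \<kappa> i) t + lc J r (%j. - D (\<rho> j)) t))"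
 unfolding wave_def
proof (intro conjI ballI)
 have hd: "i \<in> I ==> t \<in> {0..T} ==> (h i has_real_derivative h1 i t) (at t within {0..T})"
  and rd: "j \<in> J ==> t \<in> {0..T} ==> (r j has_real_derivative r1 j t) (at t within {0..T})" for i j t
  using h r by (auto simp: H3_path_def)
 note hc = H3_path_cont[OF h] and rc = H3_path_cont[OF r]
 note lcc = contT_lc[OF hc(1)] contT_lc[OF hc(2)] contT_lc[OF rc(1)] contT_lc[OF rc(2)]
 have pc: "t \<in> {0..T} ==> p t \<in> carr X" "t \<in> {0..T} ==> m t \<in> carr X" for t using contT_carr p m by blast+
 show "contT X T (%t. p t - lc I h \<eta> t)" "contT X T (%t. m t - lc J r \<rho> t)"
  using l by (auto intro!: contT_diff p m lcc)
 show "contT X T (%t. (g t + lc I h1 (%i. - \<eta> i) t) + (lc I h (%i. - A (\<eta> i)) t + lc J r \<gamma> t))"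
  by (rule contT_add[OF contT_add[OF g] contT_add]; rule lcc) (use l A_carr in auto)
 show "contT X T (%t. (f t + lc J r1 (%j. - eps *R \<rho> j) t) + (lc I h (%i. - \<kappa> i) t + lc J r (%j. - D (\<rho> j)) t))"
  by (rule contT_add[OF contT_add[OF f] contT_add]; rule lcc) (use l D_carr in auto)
 show "sderiv T (%t. p t - lc I h \<eta> t) (%t. p' t - lc I h1 \<eta> t)" "sderiv T (%t. m t - lc J r \<rho> t) (%t. m' t - lc J r1 \<rho> t)"
  using l pc by (auto intro!: sderiv_diff sderiv_lc p m hd rd)
 fix t assume t: "t \<in> {0..T}"
 show "p t - lc I h \<eta> t \<in> V" by (rule pV[OF t])
 have c: "p t \<in> carr X" "m t \<in> carr X" "p' t \<in> carr X" "m' t \<in> carr X" "g t \<in> carr X" "f t \<in> carr X" "k t \<in> carr X"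
  using t contT_carr p m g f sderiv_carr k by blast+
 define x where "x = eps *R m' t + k t + D (m t) - f t"
 define y where "y = K (p t - lc I h \<eta> t) - (k t - lc I h \<kappa> t)"
 have "x \<in> carr X" "y \<in> carr X" using c K_carr[OF pV[OF t]] D_carr l by (auto simp: x_def y_def)
 then have "nrm X (x + y) = 0" by (rule nrm_zero_add) (simp_all only: x_def y_def eq2[OF t] k(2)[OF t])
 also have "x + y = eps *R (m' t - lc J r1 \<rho> t) + K (p t - lc I h \<eta> t) + D (m t - lc J r \<rho> t) -
   ((f t + lc J r1 (%j. - eps *R \<rho> j) t) + (lc I h (%i. - \<kappa> i) t + lc J r (%j. - D (\<rho> j)) t))"
  by (simp add: x_def y_def D_diff D_lc scaleR_right_diff_distrib scaleR_sum_right sum_negf mult.commute algebra_simps)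
 finally show "nrm X (eps *R (m' t - lc J r1 \<rho> t) + K (p t - lc I h \<eta> t) + D (m t - lc J r \<rho> t) -
   ((f t + lc J r1 (%j. - eps *R \<rho> j) t) + (lc I h (%i. - \<kappa> i) t + lc J r (%j. - D (\<rho> j)) t))) = 0" .
 fix q assume q: "q \<in> V"
 have qc: "q \<in> carr X" "K q \<in> carr X" using q V_carr K_carr by auto
 have "inn X (p' t - lc I h1 \<eta> t) q = inn X (p' t) q - (\<Sum>i\<in>I. h1 i t * inn X (\<eta> i) q)"
  "inn X (A (p t - lc I h \<eta> t)) q = inn X (A (p t)) q - (\<Sum>i\<in>I. h i t * inn X (A (\<eta> i)) q)"
  "inn X (m t - lc J r \<rho> t) (K q) = inn X (m t) (K q) - (\<Sum>j\<in>J. r j t * inn X (\<rho> j) (K q))"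
  using c qc l A_carr inn_lc[of I "%i. A (\<eta> i)" q h t] by (simp_all add: A_diff A_lc inn_diff_left inn_lc)
 moreover have "inn X ((g t + lc I h1 (%i. - \<eta> i) t) + (lc I h (%i. - A (\<eta> i)) t + lc J r \<gamma> t)) q =
  (inn X (g t) q + (\<Sum>i\<in>I. h1 i t * inn X (- \<eta> i) q)) + ((\<Sum>i\<in>I. h i t * inn X (- A (\<eta> i)) q) + (\<Sum>j\<in>J. r j t * inn X (\<gamma> j) q))"
  using c qc l A_carr inn_lc[of I "%i. - A (\<eta> i)" q h t] inn_lc[of I "%i. - \<eta> i" q h1 t]
  by (simp add: inn_add_left inn_lc del: scaleR_minus_right)
 moreover have "(\<Sum>i\<in>I. h1 i t * inn X (- \<eta> i) q) = - (\<Sum>i\<in>I. h1 i t * inn X (\<eta> i) q)"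
  "(\<Sum>i\<in>I. h i t * inn X (- A (\<eta> i)) q) = - (\<Sum>i\<in>I. h i t * inn X (A (\<eta> i)) q)"
  using l A_carr qc by (simp_all add: inn_minus_left sum_negf)
 ultimately show "inn X (p' t - lc I h1 \<eta> t) q + inn X (A (p t - lc I h \<eta> t)) q - inn X (m t - lc J r \<rho> t) (K q) =
   inn X ((g t + lc I h1 (%i. - \<eta> i) t) + (lc I h (%i. - A (\<eta> i)) t + lc J r \<gamma> t)) q"
  using eq1[OF t q] by (simp add: right_diff_distrib sum_subtractf)
qed

text \<open>\<open>P\<close> bounds the fixed lifting functions and \<open>Q\<close> the data. The
  point is the shape of \<open>B\<close>: only the squared initial defect of the second equation,
  differentiated in time, is divided by \<open>eps\<close>, while everything else is a multiple of
  \<open>Q\<close>.\<close>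

lemma lifted_wave_estimate:
 assumes T: "0 < T" and eps: "0 < eps" "eps \<le> 1" and IJ: "finite I" "finite J"
  and h: "\<And>i. i \<in> I ==> H3_path T (h i) (h1 i) (h2 i) (h3 i) Q"
  and r: "\<And>j. j \<in> J ==> H3_path T (r j) (r1 j) (r2 j) (r3 j) Q" and r0: "\<And>j. j \<in> J ==> r1 j 0 = 0"
  and l: "\<And>i. i \<in> I ==> \<eta> i \<in> carr X" "\<And>i. i \<in> I ==> \<kappa> i \<in> carr X" "\<And>j. j \<in> J ==> \<rho> j \<in> carr X" "\<And>j. j \<in> J ==> \<gamma> j \<in> carr X"
  and p: "contT X T p" "sderiv T p p'" and m: "contT X T m" "sderiv T m m'" "contT X T m'"
  and g: "data T g g1 Q" and f: "data T f f1 Q"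
  and pV: "\<And>t. t \<in> {0..T} ==> p t - lc I h \<eta> t \<in> V"
  and k: "\<And>t. t \<in> {0..T} ==> k t \<in> carr X" "\<And>t. t \<in> {0..T} ==> nrm X (K (p t - lc I h \<eta> t) - (k t - lc I h \<kappa> t)) = 0"
  and eq1: "\<And>t q. t \<in> {0..T} ==> q \<in> V ==> inn X (p' t) q + inn X (A (p t)) q - inn X (m t) (K q) =
    inn X (g t) q - (\<Sum>j\<in>J. r j t * (inn X (\<rho> j) (K q) - inn X (\<gamma> j) q))"
  and eq2: "\<And>t. t \<in> {0..T} ==> nrm X (eps *R m' t + k t + D (m t) - f t) = 0"
  and ps: "ps \<in> V" "nrm X (p' 0 - (ps + lc I h1 \<eta> 0)) = 0" "(nrm X ps)^2 \<le> Q" and m0: "nrm X (m' 0) = 0"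
  and P: "card I * (\<Sum>i\<in>I. (nrm X (\<eta> i))^2) \<le> P" "card I * (\<Sum>i\<in>I. (nrm X (A (\<eta> i)))^2) \<le> P" "card I * (\<Sum>i\<in>I. (nrm X (\<kappa> i))^2) \<le> P"
   "card J * (\<Sum>j\<in>J. (nrm X (\<rho> j))^2) \<le> P" "card J * (\<Sum>j\<in>J. (nrm X (\<gamma> j))^2) \<le> P" "card J * (\<Sum>j\<in>J. (nrm X (D (\<rho> j)))^2) \<le> P" "1 \<le> P"
 obtains C b B where "\<And>s. 0 \<le> s ==> s < T ==> nrm X (m' s) \<le> C * s"
  "\<And>tau. 0 < tau ==> tau < T ==> nI 0 (T - tau) (dq tau m') \<le> b tau" "(b ---> B) (at_right 0)"
  "B \<le> 8 * exp 1 / d * (nrm X (f1 - (K ps + lc I h1 \<kappa> 0)))^2 / eps +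
   (2 * exp 1 / d * (68 * P + 4 * BA^2 + 16 * T * P + 16 * P / d) + 2 * P) * Q"
proof -
 have Q: "0 \<le> Q" using ps(3) by (rule order_trans[OF zero_le_power2])
 have QP: "Q \<le> P * Q" using mult_right_mono[OF P(7) Q] by simp
 have PQ: "0 \<le> P * Q" using QP Q by linarith
 define G where "G t = (g t + lc I h1 (%i. - \<eta> i) t) + (lc I h (%i. - A (\<eta> i)) t + lc J r \<gamma> t)" for t
 define F where "F t = (f t + lc J r1 (%j. - eps *R \<rho> j) t) + (lc I h (%i. - \<kappa> i) t + lc J r (%j. - D (\<rho> j)) t)" for t
 define G1 where "G1 = (g1 + lc I h2 (%i. - \<eta> i) 0) + (lc I h1 (%i. - A (\<eta> i)) 0 + lc J r1 \<gamma> 0)"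
 define F1 where "F1 = (f1 + lc J r2 (%j. - eps *R \<rho> j) 0) + (lc I h1 (%i. - \<kappa> i) 0 + lc J r1 (%j. - D (\<rho> j)) 0)"
 define n' where "n' t = m' t - lc J r1 \<rho> t" for t
 have w: "wave T eps (%t. p t - lc I h \<eta> t) (%t. m t - lc J r \<rho> t) (%t. p' t - lc I h1 \<eta> t) n' G F"
  unfolding G_def F_def n'_def using contT_carr
  by (intro wave_lift[OF h r l p m(1,2) data_contT[OF g] data_contT[OF f] pV k eq1 eq2])
 have nm: "(nrm X (- eps *R \<rho> j))^2 \<le> (nrm X (\<rho> j))^2" if "j \<in> J" for j
  using eps l(3)[OF that] nrm_scale[OF l(3)[OF that], of "- eps"] by (auto intro!: power_mono mult_left_le_one_le)
 have "card J * (\<Sum>j\<in>J. (nrm X (- eps *R \<rho> j))^2) \<le> card J * (\<Sum>j\<in>J. (nrm X (\<rho> j))^2)"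
  by (intro mult_left_mono sum_mono nm) auto
 then have P4: "card J * (\<Sum>j\<in>J. (nrm X (- eps *R \<rho> j))^2) \<le> P" using P(4) by linarith
 have T0: "0 \<le> T" using T by simp
 \<comment> \<open>Each of the four summands has the bound \<open>P * Q\<close>. Two nested uses of
   (x + y)^2 \<le> 2 x^2 + 2 y^2 multiply the sum of the bounds by 4.\<close>
 have dG: "data T G G1 (16 * P * Q)"
  unfolding G_def G1_def
 proof (rule data_mono[OF data_add[OF data_add[OF data_mono[OF g QP] data_lc] data_add[OF data_lc data_lc]]])
  show "real (card I) * (\<Sum>i\<in>I. (nrm X (- \<eta> i))^2) \<le> P" using P(1) l by (simp add: nrm_minus)
  show "real (card I) * (\<Sum>i\<in>I. (nrm X (- A (\<eta> i)))^2) \<le> P" using P(2) l A_carr by (simp add: nrm_minus)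
 qed (use IJ l A_carr P(5) Q data_of_path[OF h _ T0] data_of_path[OF r _ T0] in \<open>auto simp del: scaleR_minus_right\<close>)
 have dF: "data T F F1 (16 * P * Q)"
  unfolding F_def F1_def
 proof (rule data_mono[OF data_add[OF data_add[OF data_mono[OF f QP] data_lc] data_add[OF data_lc data_lc]]])
  show "real (card I) * (\<Sum>i\<in>I. (nrm X (- \<kappa> i))^2) \<le> P" using P(3) l by (simp add: nrm_minus)
  show "real (card J) * (\<Sum>j\<in>J. (nrm X (- D (\<rho> j)))^2) \<le> P" using P(6) l D_carr by (simp add: nrm_minus)
  show "real (card J) * (\<Sum>j\<in>J. (nrm X (- eps *R \<rho> j))^2) \<le> P" by (rule P4)
  show "- eps *R \<rho> j \<in> carr X" if "j \<in> J" for j by (intro carr_scale l that)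
  show "data T (%t. r1 j t *R - eps *R \<rho> j) (r2 j 0 *R - eps *R \<rho> j) (Q * (nrm X (- eps *R \<rho> j))^2)" if "j \<in> J" for j
   by (intro data_of_path(2)[OF r _ T0] carr_scale l that)
 qed (use IJ l D_carr Q data_of_path[OF h _ T0] data_of_path[OF r _ T0] in \<open>auto simp del: scaleR_minus_right\<close>)
 obtain MG where MG: "H2_data T G G1 MG" "MG^2 \<le> 16 * P * Q" and G1: "(nrm X G1)^2 \<le> 16 * P * Q" using dG by (auto simp: data_def)
 obtain MF where MF: "H2_data T F F1 MF" "MF^2 \<le> 16 * P * Q" using dF by (auto simp: data_def)
 have z: "(0::real) \<in> {0..T}" using T by simp
 have c: "p' 0 \<in> carr X" "m' 0 \<in> carr X" "ps \<in> carr X" "K ps \<in> carr X" "A ps \<in> carr X" "G1 \<in> carr X" "F1 \<in> carr X" "f1 \<in> carr X"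
  using sderiv_carr[OF p(2) z] contT_carr[OF m(3) z] ps(1) V_carr K_carr A_carr data_carr dG dF f by blast+
 have p0: "nrm X (p' 0 - lc I h1 \<eta> 0 - ps) = 0" using ps(2) by (simp add: algebra_simps)
 have n0: "nrm X (n' 0) = 0" using m0 r0 by (simp add: n'_def)
 note W = w eps(1) MG(1) MF(1) ps(1) p0 n0
 define a where "a = nrm X (G1 - A ps) + nrm X (F1 - K ps) / sqrt eps"
 define c0 where "c0 = MG + MF / sqrt eps"
 have a0: "0 \<le> a" "0 \<le> c0" using c eps MG(1) MF(1) by (auto simp: a_def c0_def H2_data_def intro!: add_nonneg_nonneg divide_nonneg_nonneg)
 have cn': "contT X T n'" unfolding n'_def by (rule contT_diff[OF m(3) contT_lc[OF H3_path_cont(2)[OF r] l(3)]])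
 have m'c: "t \<in> {0..T} ==> m' t \<in> carr X" "t \<in> {0..T} ==> n' t \<in> carr X" for t using contT_carr m(3) cn' by blast+
 have "\<forall>j\<in>J. \<exists>C. \<forall>s\<in>{0..T}. \<bar>r1 j s\<bar> \<le> C * s" using H3_path_linear_bound[OF r r0] by metis
 then obtain R where R: "\<And>j s. j \<in> J ==> s \<in> {0..T} ==> \<bar>r1 j s\<bar> \<le> R j * s" by metis
 \<comment> \<open>This constant contains \<open>1 / sqrt eps\<close> and worse; it is used only
   where a factor \<open>tau\<close> tends to zero.\<close>
 define C where "C = (a + sqrt T * c0) / sqrt eps + (\<Sum>j\<in>J. R j * nrm X (\<rho> j))"
 have m'_le: "nrm X (m' s) \<le> C * s" if s: "0 \<le> s" "s < T" for s
 proof (cases "s = 0")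
  case False
  then have s0: "0 < s" "s \<in> {0..T}" using s by auto
  have "sqrt eps * nrm X (n' s) = sqrt (eps * (nrm X (n' s))^2)" using m'c(2)[OF s0(2)] by (simp add: real_sqrt_mult)
  also have "\<dots> \<le> sqrt ((nrm X (p' s - lc I h1 \<eta> s - ps))^2 + eps * (nrm X (n' s))^2)" by simp
  also have "\<dots> \<le> s * (a + sqrt s * c0)" using wave_first_order[OF W s0(1) s(2)] by (simp add: a_def c0_def)
  also have "\<dots> \<le> s * (a + sqrt T * c0)" using s a0 by (intro mult_left_mono add_left_mono mult_right_mono) auto
  finally have 1: "nrm X (n' s) \<le> (a + sqrt T * c0) / sqrt eps * s" using eps by (simp add: field_simps)
  have "nrm X (lc J r1 \<rho> s) \<le> (\<Sum>j\<in>J. \<bar>r1 j s\<bar> * nrm X (\<rho> j))"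
   using nrm_sum_le[of J "%j. r1 j s *R \<rho> j"] l by (simp add: nrm_scale)
  also have "\<dots> \<le> (\<Sum>j\<in>J. R j * s * nrm X (\<rho> j))" using R[OF _ s0(2)] l by (intro sum_mono mult_right_mono) auto
  finally have "nrm X (lc J r1 \<rho> s) \<le> (\<Sum>j\<in>J. R j * nrm X (\<rho> j)) * s" by (simp add: sum_distrib_left mult_ac)
  moreover have "nrm X (n' s + lc J r1 \<rho> s) \<le> nrm X (n' s) + nrm X (lc J r1 \<rho> s)" using m'c(2)[OF s0(2)] l by (intro nrm_triangle) auto
  moreover have "n' s + lc J r1 \<rho> s = m' s" by (simp add: n'_def)
  ultimately show ?thesis using 1 by (simp add: C_def distrib_right)
 qed (use m0 in simp)
 define E where "E = T * MG^2 + MF^2 / d"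
 define b where "b tau = 2 * exp 1 / d * ((a + sqrt tau * c0)^2 + E) + 2 * (P * Q)" for tau
 \<comment> \<open>Undoing the shift: the quotient of \<open>m'\<close> is that of \<open>n'\<close>
   plus a combination of quotients of the derivatives of \<open>r\<close>. The factor 2 and the
   summand \<open>2 * (P * Q)\<close> in \<open>b\<close> stem from this.\<close>
 have m'_dq: "nI 0 (T - tau) (dq tau m') \<le> b tau" if tau: "0 < tau" "tau < T" for tau
 proof -
  let ?R = "%t. card J * (\<Sum>j\<in>J. (dq tau (r1 j) t)^2 * (nrm X (\<rho> j))^2)"
  have cd: "contT X (T - tau) (dq tau m')" "contT X (T - tau) (dq tau n')" using tau by (auto intro: contT_dq m cn')
  have dr: "continuous_on {0..T - tau} (dq tau (r1 j))" "ig 0 (T - tau) (%t. (dq tau (r1 j) t)^2) \<le> Q" if "j \<in> J" for j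
   using H3_path_dq[OF r[OF that], of tau] tau by auto
  have i: "intable 0 (T - tau) (%t. (nrm X (dq tau n' t))^2)" "intable 0 (T - tau) ?R"
   by (intro ivl_cont continuous_intros contT_nrm cd dr; assumption)+
  have "nI 0 (T - tau) (dq tau m') \<le> ig 0 (T - tau) (%t. 2 * (nrm X (dq tau n' t))^2 + 2 * ?R t)"
  proof (rule ivl_mono_AE[OF _ _ AE_ivl_all])
   show "intable 0 (T - tau) (%t. (nrm X (dq tau m' t))^2)" by (intro ivl_cont continuous_intros contT_nrm cd)
   show "intable 0 (T - tau) (%t. 2 * (nrm X (dq tau n' t))^2 + 2 * ?R t)" using i by auto
   fix t assume t: "t \<in> {0..T - tau}"
   have nc: "dq tau n' t \<in> carr X" "dq tau m' t \<in> carr X" using contT_carr[OF cd(2) t] contT_carr[OF cd(1) t] by auto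
   have eq: "dq tau m' t = dq tau n' t + lc J (%j. dq tau (r1 j)) \<rho> t"
    by (simp add: dq_def n'_def scaleR_right_diff_distrib scaleR_sum_right sum_subtractf algebra_simps)
   have "(nrm X (dq tau m' t))^2 \<le> (nrm X (dq tau n' t) + nrm X (lc J (%j. dq tau (r1 j)) \<rho> t))^2"
    using nc l unfolding eq by (intro power_mono nrm_triangle nrm_nonneg) auto
   moreover have "(nrm X (lc J (%j. dq tau (r1 j)) \<rho> t))^2 \<le> ?R t"
   proof -
    have "(nrm X (lc J (%j. dq tau (r1 j)) \<rho> t))^2 \<le> (\<Sum>j\<in>J. \<bar>dq tau (r1 j) t\<bar> * nrm X (\<rho> j))^2"
     using nrm_sum_le[of J "%j. dq tau (r1 j) t *R \<rho> j"] l by (intro power_mono) (simp_all add: nrm_scale)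
    also have "\<dots> \<le> (\<Sum>j\<in>J. (\<bar>dq tau (r1 j) t\<bar> * nrm X (\<rho> j))^2) * card J" by (rule sum_squared_le_sum_of_squares)
    finally show ?thesis by (simp add: power_mult_distrib mult.commute)
   qed
   ultimately show "(nrm X (dq tau m' t))^2 \<le> 2 * (nrm X (dq tau n' t))^2 + 2 * ?R t"
    using sum_sq_le[of "nrm X (dq tau n' t)" "nrm X (lc J (%j. dq tau (r1 j)) \<rho> t)"] by linarith
  qed
  also have "\<dots> = 2 * nI 0 (T - tau) (dq tau n') + 2 * ig 0 (T - tau) ?R"
   using i by (subst ivl_add) auto
  also have "ig 0 (T - tau) ?R = card J * (\<Sum>j\<in>J. ig 0 (T - tau) (%t. (dq tau (r1 j) t)^2) * (nrm X (\<rho> j))^2)"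
   using dr IJ by (simp add: integral_sum integrable_continuous_interval continuous_intros)
  also have "\<dots> \<le> card J * (\<Sum>j\<in>J. Q * (nrm X (\<rho> j))^2)" using dr by (intro mult_left_mono sum_mono mult_right_mono) auto
  also have "\<dots> = card J * (\<Sum>j\<in>J. (nrm X (\<rho> j))^2) * Q" by (simp add: sum_distrib_left[symmetric])
  also have "\<dots> \<le> P * Q" by (rule mult_right_mono[OF P(4) Q])
  also have "nI 0 (T - tau) (dq tau n') \<le> exp 1 * ((a + sqrt tau * c0)^2 + E) / d"
   using wave_second_order[OF W tau cn'] d_pos by (simp add: a_def c0_def E_def field_simps)
  finally show ?thesis by (simp add: b_def)
 qed
 have lim: "(b ---> 2 * exp 1 / d * (a^2 + E) + 2 * (P * Q)) (at_right 0)" unfolding b_def by (rule linear_over_sqrt_tendsto)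
 let ?f = "f1 - (K ps + lc I h1 \<kappa> 0)"
 have "(nrm X (G1 - A ps))^2 \<le> (nrm X G1 + BA * nrm X ps)^2"
  using c nrm_diff_le[of G1 "A ps"] A_bnd[of ps] by (intro power_mono) auto
 also have "\<dots> \<le> 2 * (16 * P * Q) + 2 * (BA^2 * Q)"
  using sum_sq_le[of "nrm X G1" "BA * nrm X ps"] G1 mult_left_mono[OF ps(3), of "BA^2"] by (simp add: power_mult_distrib)
 finally have gA: "(nrm X (G1 - A ps))^2 \<le> 2 * (16 * P * Q) + 2 * (BA^2 * Q)" .
 have "data T (lc J r1 \<rho>) (lc J r2 \<rho> 0) (P * Q)"
  by (rule data_lc[OF IJ(2) l(3) P(4) Q]) (auto intro!: data_of_path(2)[OF r l(3) T0])
 then have R2: "lc J r2 \<rho> 0 \<in> carr X" "(nrm X (lc J r2 \<rho> 0))^2 \<le> P * Q" using l by (auto simp: data_def)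
 \<comment> \<open>The terms with the first derivative of \<open>r\<close> vanish at time 0. The
   terms with that of \<open>h\<close> combine with \<open>K ps\<close> to the derivative of
   \<open>K p\<close>, so that the defect appears; what remains carries a factor
   \<open>eps\<close>.\<close>
 have FK: "F1 - K ps = ?f - eps *R lc J r2 \<rho> 0" using r0
  by (simp add: F1_def sum_negf scaleR_sum_right mult.commute algebra_simps)
 have fc: "?f \<in> carr X" using c l by auto
 have "nrm X (eps *R lc J r2 \<rho> 0) = eps * nrm X (lc J r2 \<rho> 0)" using nrm_scale[OF R2(1), of eps] eps by simp
 then have "nrm X (F1 - K ps) \<le> nrm X ?f + eps * nrm X (lc J r2 \<rho> 0)"
  using nrm_diff_le[OF fc carr_scale[OF R2(1), of eps]] unfolding FK by linarith
 then have "(nrm X (F1 - K ps))^2 \<le> (nrm X ?f + eps * nrm X (lc J r2 \<rho> 0))^2" using c by (intro power_mono) auto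
 also have "\<dots> \<le> 2 * (nrm X ?f)^2 + 2 * (eps^2 * (P * Q))"
  using sum_sq_le[of "nrm X ?f" "eps * nrm X (lc J r2 \<rho> 0)"] mult_left_mono[OF R2(2), of "eps^2"] by (simp add: power_mult_distrib)
 \<comment> \<open>One factor \<open>eps\<close> is given away by \<open>eps \<le> 1\<close>; the
   other one cancels the division by \<open>eps\<close> that follows.\<close>
 also have "eps^2 * (P * Q) \<le> eps * (P * Q)" using eps PQ by (intro mult_right_mono) (auto simp: power2_eq_square mult_left_le)
 finally have "(nrm X (F1 - K ps))^2 / eps \<le> (2 * (nrm X ?f)^2 + 2 * (eps * (P * Q))) / eps" using eps by (intro divide_right_mono) auto
 then have fK: "(nrm X (F1 - K ps))^2 / eps \<le> 2 * (nrm X ?f)^2 / eps + 2 * (P * Q)" using eps by (simp add: add_divide_distrib)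
 have "a^2 \<le> 2 * (nrm X (G1 - A ps))^2 + 2 * ((nrm X (F1 - K ps))^2 / eps)"
  using sum_sq_le[of "nrm X (G1 - A ps)" "nrm X (F1 - K ps) / sqrt eps"] eps by (simp add: a_def power_divide)
 \<comment> \<open>The number 68 is 64 from the bound of \<open>G1 - A ps\<close>, namely 2 * 2 *
   16, plus 4 from the remainder in \<open>F1 - K ps\<close>.\<close>
 then have a2: "a^2 \<le> 4 * (nrm X ?f)^2 / eps + (68 * P + 4 * BA^2) * Q" using gA fK by (simp add: algebra_simps)
 have "E \<le> T * (16 * P * Q) + 16 * P * Q / d"
  unfolding E_def using MG(2) MF(2) T d_pos by (intro add_mono mult_left_mono divide_right_mono) auto
 then have "a^2 + E \<le> 4 * (nrm X ?f)^2 / eps + (68 * P + 4 * BA^2 + 16 * T * P + 16 * P / d) * Q" using a2 by (simp add: algebra_simps)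
 then have "2 * exp 1 / d * (a^2 + E) \<le> 2 * exp 1 / d * (4 * (nrm X ?f)^2 / eps + (68 * P + 4 * BA^2 + 16 * T * P + 16 * P / d) * Q)"
  using d_pos by (intro mult_left_mono) auto
 then have "2 * exp 1 / d * (a^2 + E) + 2 * (P * Q) \<le> 8 * exp 1 / d * (nrm X ?f)^2 / eps +
   (2 * exp 1 / d * (68 * P + 4 * BA^2 + 16 * T * P + 16 * P / d) + 2 * P) * Q"
  by (simp add: distrib_left distrib_right mult.assoc)
 then show ?thesis using that[OF m'_le m'_dq lim] by simp
qed

end

section \<open>From Sobolev regularity in time to usable data\<close>

lemma integral_primitive_init_sq_le:
 assumes T: "T > 0" and phi: "continuous_on {0..T} phi" and y: "sq_int 0 T y"
  and p: "\<And>t. 0 \<le> t ==> t \<le> T ==> phi t - phi 0 = ig 0 t y"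
 shows "(phi 0)^2 \<le> 2 / T * ig 0 T (%t. (phi t)^2) + 2 * T * ig 0 T (%t. (y t)^2)"
proof -
 define Y where "Y = ig 0 T (%t. (y t)^2)"
 have i: "intable 0 T (%t. (y t)^2)" using y by (simp add: sq_int_def)
 have Y: "0 \<le> Y" unfolding Y_def by (rule ivl_nonneg[OF i]) simp
 \<comment> \<open>The scalar trace inequality: the initial value is compared with the value at
   every \<open>t\<close>, the difference being an integral of \<open>y\<close>, and the result is
   averaged.\<close>
 have "ig 0 T (%t. (phi 0)^2) \<le> ig 0 T (%t. 2 * (phi t)^2 + 2 * (T * Y))"
 proof (rule ivl_mono_AE[OF _ _ AE_ivl_all])
  fix t assume t: "t \<in> {0..T}"
  have s: "sq_int 0 t y" "sq_int 0 t (%_. 1)" using t by (auto intro: sq_int_sub[OF y] sq_int_const)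
  have "intable 0 t y" by (rule sq_int_integrable[OF s(1)])
  have "(ig 0 t y)^2 \<le> (sqrt t * sqrt (ig 0 t (%t. (y t)^2)))^2"
  proof (rule abs_le_imp_square_le)
   have "ig 0 t y \<le> sqrt t * sqrt (ig 0 t (%t. (y t)^2))" using sq_int_integral_le[OF s(1)] t by simp
   moreover have "- ig 0 t y \<le> sqrt t * sqrt (ig 0 t (%t. (y t)^2))"
    using sq_int_integral_le[OF sq_int_cmult[OF s(1), of "-1"]] t by simp
   ultimately show "\<bar>ig 0 t y\<bar> \<le> sqrt t * sqrt (ig 0 t (%t. (y t)^2))" by linarith
  qed
  also have "\<dots> = t * ig 0 t (%t. (y t)^2)"
   using t ivl_nonneg[of 0 t "%t. (y t)^2"] s by (simp add: power_mult_distrib sq_int_def)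
  also have "\<dots> \<le> T * Y" unfolding Y_def
   using t ivl_nonneg[of 0 t "%t. (y t)^2"] s i by (intro mult_mono ivl_mono_sub) (auto simp: sq_int_def)
  finally have "(ig 0 t y)^2 \<le> T * Y" .
  then show "(phi 0)^2 \<le> 2 * (phi t)^2 + 2 * (T * Y)"
   using sum_sq_le[of "phi t" "- ig 0 t y"] p[of t] t by (simp add: algebra_simps)
 qed (auto intro!: ivl_cont continuous_intros phi)
 also have "\<dots> = 2 * ig 0 T (%t. (phi t)^2) + T * (2 * (T * Y))"
  using T phi by (subst ivl_add) (auto intro!: ivl_cont continuous_intros)
 finally show ?thesis using T by (simp add: Y_def field_simps power2_eq_square)
qed

lemma weak_deriv_continuous_rep:
 assumes T: "T > 0" and wd: "weak_deriv T u v" and u: "intable 0 T u" and v: "intable 0 T v"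
 obtains c where "AE t in ivl 0 T. u t = c + ig 0 t v"
proof -
 obtain Z where Z: "negligible Z" "\<And>s t. s \<in> {0..T} - Z ==> t \<in> {0..T} - Z ==> s \<le> t ==> u t - u s = ig s t v"
  by (rule weak_deriv_AE_primitive[OF wd u v]) blast
 have "closure ({0..T} - Z) \<noteq> {}" using closure_ivl_minus_negligible[OF Z(1) T] T by simp
 then obtain s where s: "s \<in> {0..T} - Z" by fastforce
 have "u t = (u s - ig 0 s v) + ig 0 t v" if t: "t \<in> {0..T}" "t \<notin> Z" for t
 proof (cases "s \<le> t")
  case True
  then show ?thesis using Z(2)[OF s, of t] t s ivl_combine[OF ivl_sub[OF v, of 0 t], of s] by auto
 next
  case False
  then show ?thesis using Z(2)[of t s] t s ivl_combine[OF ivl_sub[OF v, of 0 s], of t] by auto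
 qed
 then have "AE t in ivl 0 T. u t = (u s - ig 0 s v) + ig 0 t v" by (rule AE_ivlI[OF Z(1)])
 then show ?thesis by (rule that)
qed

text \<open>The members \<open>f 1\<close> and \<open>f 2\<close> are only classes of functions.
  Starting from the top, each is replaced by the primitive of the representative above it, so that
  the derivatives below become classical.\<close>

lemma H3_path_of_weak:
 assumes T: "T > 0" and f: "continuous_on {0..T} (f 0)" "\<And>k. k \<le> 3 ==> sq_int 0 T (f k)"
  "\<And>k. k \<le> 3 ==> ig 0 T (%t. (f k t)^2) \<le> M" "\<And>k. k < 3 ==> weak_deriv T (f k) (f (Suc k))"
 obtains phi1 phi2 where "H3_path T (f 0) phi1 phi2 (f 3) ((1 + 2 / T + 2 * T) * M)"
proof -
 have i: "intable 0 T (f k)" if "k \<le> 3" for k using f(2)[OF that] by (rule sq_int_integrable)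
 have "0 \<le> ig 0 T (%t. (f 0 t)^2)" using f(2)[of 0] by (intro ivl_nonneg) (auto simp: sq_int_def)
 then have M: "0 \<le> M" using f(3)[of 0] by simp
 have wd0: "weak_deriv T (f 0) (f 1)" using f(4)[of 0] by simp
 have wd: "weak_deriv T (f 1) (f 2)" "weak_deriv T (f 2) (f 3)" using f(4)[of 1] f(4)[of 2] by (simp_all add: numeral_2_eq_2 numeral_3_eq_3)
 have i3: "intable 0 T (f 1)" "intable 0 T (f 2)" "intable 0 T (f 3)" by (auto intro: i)
 obtain c2 where c2: "AE t in ivl 0 T. f 2 t = c2 + ig 0 t (f 3)"
  by (rule weak_deriv_continuous_rep[OF T wd(2) i3(2,3)])
 define phi2 where "phi2 t = c2 + ig 0 t (f 3)" for t
 obtain c1 where c1: "AE t in ivl 0 T. f 1 t = c1 + ig 0 t (f 2)"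
  by (rule weak_deriv_continuous_rep[OF T wd(1) i3(1,2)])
 define phi1 where "phi1 t = c1 + ig 0 t phi2" for t
 have cphi2: "continuous_on {0..T} phi2" unfolding phi2_def
  by (intro continuous_intros indefinite_integral_continuous_1 ivl_integrable_on i) simp
 have e2: "AE t in ivl 0 T. f 2 t = phi2 t" using c2 by (simp add: phi2_def)
 have ieq: "ig s t f' = ig s t g'" if "AE t in ivl 0 T. f' t = g' t" "intable 0 T f'" "0 \<le> s" "t \<le> T" for s t f' g'
  using ivl_cong_AE[OF ivl_sub[OF that(2-4)] AE_ivl_sub[OF that(1,3,4)]] by simp
 have "AE t in ivl 0 T. t \<in> {0..T}" by (rule AE_ivl_all)
 with c1 have e1: "AE t in ivl 0 T. f 1 t = phi1 t"
 proof eventually_elim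
  case (elim t)
  then show ?case using ieq[OF e2 i, of 0 t] by (simp add: phi1_def)
 qed
 have d1: "(phi1 has_real_derivative phi2 t) (at t within {0..T})" if "t \<in> {0..T}" for t
  unfolding phi1_def using integral_has_real_derivative[OF cphi2 that] by (auto intro!: derivative_eq_intros)
 then have cphi1: "continuous_on {0..T} phi1" by (rule DERIV_continuous_on)
 have f0: "f 0 t = f 0 0 + ig 0 t phi1" if "t \<in> {0..T}" for t
  using weak_deriv_primitive[OF wd0 f(1) i3(1), of 0 t] ieq[OF e1 i, of 0 t] that by simp
 have d0: "(f 0 has_real_derivative phi1 t) (at t within {0..T})" if t: "t \<in> {0..T}" for t
 proof (rule has_field_derivative_transform_within[OF _ zero_less_one t])
  show "((%t. f 0 0 + ig 0 t phi1) has_real_derivative phi1 t) (at t within {0..T})"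
   using integral_has_real_derivative[OF cphi1 t] by (auto intro!: derivative_eq_intros)
 qed (rule f0[symmetric])
 have p2: "phi2 t - phi2 s = ig s t (f 3)" if "0 \<le> s" "s \<le> t" "t \<le> T" for s t
  using ivl_combine[OF ivl_sub[OF i[of 3], of 0 t], of s] that by (simp add: phi2_def)
 have sq: "ig 0 T (%t. (psi t)^2) \<le> M" if "AE t in ivl 0 T. f k t = psi t" "k \<le> 3" for psi k
 proof -
  have "AE t in ivl 0 T. (f k t)^2 = (psi t)^2" using that(1) by eventually_elim simp
  then have "ig 0 T (%t. (psi t)^2) = ig 0 T (%t. (f k t)^2)" using f(2)[OF that(2)] by (intro ivl_cong_AE) (auto simp: sq_int_def)
  then show ?thesis using f(3)[OF that(2)] by simp
 qed
 \<comment> \<open>The trace inequality bounds the initial values by \<open>c\<close>, the norms are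
   bounded by \<open>M\<close>; the sum of the two is the factor \<open>1 + 2 / T + 2 * T\<close>
   times \<open>M\<close>.\<close>
 define c where "c = 2 / T * M + 2 * T * M"
 have s1: "ig 0 T (%t. (phi1 t)^2) \<le> M" and s2: "ig 0 T (%t. (phi2 t)^2) \<le> M" using sq[OF e1] sq[OF e2] by auto
 have b: "2 / T * x + 2 * T * y \<le> c" if "x \<le> M" "y \<le> M" for x y
  unfolding c_def using that T by (intro add_mono mult_left_mono) auto
 have "(phi2 0)^2 \<le> c" using integral_primitive_init_sq_le[OF T cphi2 f(2)[of 3]] p2[of 0] b[OF s2 f(3)[of 3]] by fastforce
 moreover have "(phi1 0)^2 \<le> c"
  using integral_primitive_init_sq_le[OF T cphi1 sq_int_cont[OF cphi2]] b[OF s1 s2] by (fastforce simp: phi1_def)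
 moreover have "0 \<le> c" using M T by (simp add: c_def)
 moreover have "(1 + 2 / T + 2 * T) * M = M + c" by (simp add: c_def algebra_simps)
 ultimately have "H3_path T (f 0) phi1 phi2 (f 3) ((1 + 2 / T + 2 * T) * M)"
  unfolding H3_path_def using cphi2 d0 d1 p2 s2 f(2)[of 3] f(3)[of 3] M by auto
 then show ?thesis by (rule that)
qed

lemma vec_semi_inner: "finite S ==> semi_inner (vec_sp S)"
 by unfold_locales (auto simp: vec_sp_def sum.distrib sum_distrib_left algebra_simps intro!: sum_nonneg)

lemma tderiv_works: "weakly_diffT X T u ==> L2T X T (tderiv X T u) \<and> weak_tderiv X T u (tderiv X T u)"
 unfolding weakly_diffT_def tderiv_def by (erule someI_ex)

lemma HkT_chain:
 assumes "HkT X T n u"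
 shows "k \<le> n ==> L2T X T ((tderiv X T ^^ k) u)" "k < n ==> weak_tderiv X T ((tderiv X T ^^ k) u) ((tderiv X T ^^ Suc k) u)"
proof -
 have w: "weakly_diffT X T ((tderiv X T ^^ j) u)" if "j < n" for j using assms that by (simp add: HkT_def)
 show "weak_tderiv X T ((tderiv X T ^^ k) u) ((tderiv X T ^^ Suc k) u)" if "k < n" using tderiv_works[OF w[OF that]] by simp
 show "L2T X T ((tderiv X T ^^ k) u)" if "k \<le> n"
 proof (cases k)
  case (Suc j)
  then show ?thesis using tderiv_works[OF w[of j]] that by simp
 qed (use assms in \<open>simp add: HkT_def\<close>)
qed

lemma HkT_norm_ge:
 assumes "HkT X T n u" "k \<le> n"
 shows "ig 0 T (%t. (nrm X ((tderiv X T ^^ k) u t))^2) \<le> HkT_norm2 X T n u"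
proof -
 have i: "intable 0 T (%t. (nrm X ((tderiv X T ^^ j) u t))^2)" if "j \<le> n" for j
  using HkT_chain(1)[OF assms(1) that] by (simp add: L2T_def)
 then have "HkT_norm2 X T n u = (\<Sum>j\<le>n. ig 0 T (%t. (nrm X ((tderiv X T ^^ j) u t))^2))"
  unfolding HkT_norm2_def by (intro sum.cong ivl_eq) auto
 then show ?thesis using assms(2) i ivl_nonneg[OF i] by (auto intro!: member_le_sum)
qed

lemma H3_path_component:
 assumes S: "finite S" "v \<in> S" and T: "T > 0" and h: "HkT (vec_sp S) T 3 h"
 obtains phi1 phi2 y where "H3_path T (%t. h t v) phi1 phi2 y ((1 + 2 / T + 2 * T) * HkT_norm2 (vec_sp S) T 3 h)"
proof -
 interpret V: semi_inner "vec_sp S" by (rule vec_semi_inner[OF S(1)])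
 let ?X = "vec_sp S"
 \<comment> \<open>Testing with this unit vector extracts the component at \<open>v\<close>, so that
   weak derivatives of vectors become scalar ones.\<close>
 define dl :: "'a => real" where "dl w = (if w = v then 1 else 0)" for w
 define u where "u k = (tderiv ?X T ^^ k) h" for k
 have carr: "x \<in> carr ?X" for x by (simp add: vec_sp_def)
 have ev: "inn ?X x dl = x v" for x
  using S by (simp add: vec_sp_def dl_def of_bool_def[symmetric] if_distrib cong: if_cong)
 have nv: "\<bar>x v\<bar> \<le> nrm ?X x" for x
 proof -
  have "(x v)^2 \<le> (\<Sum>w\<in>S. x w * x w)" using S member_le_sum[of v S "%w. x w * x w"] by (simp add: power2_eq_square)
  then show ?thesis by (simp add: nrm_def vec_sp_def real_le_rsqrt)
 qed
 have L: "L2T ?X T (u k)" if "k \<le> 3" for k unfolding u_def by (rule HkT_chain(1)[OF h that])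
 have wt: "weak_tderiv ?X T (u k) (u (Suc k))" if "k < 3" for k unfolding u_def by (rule HkT_chain(2)[OF h that])
 have sq: "sq_int 0 T (%t. u k t v)" if "k \<le> 3" for k
 proof (rule sq_int_bound[OF V.L2c_nrm[OF V.L2T_L2c[OF L[OF that]]]])
  show "(%t. u k t v) \<in> meas 0 T"
   using V.L2c_inn[OF V.L2T_L2c[OF L[OF that]] V.L2c_const[OF carr[of dl]]] by (simp add: ev)
 qed (simp add: nv)
 have "continuous_on {0..T} (%t. inn ?X (h t) dl)"
  using h by (intro V.contT_inn V.contT_const carr) (simp add: HkT_def)
 then have "continuous_on {0..T} (%t. u 0 t v)" by (simp add: ev u_def)
 moreover have "ig 0 T (%t. (u k t v)^2) \<le> HkT_norm2 ?X T 3 h" if "k \<le> 3" for k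
 proof -
  have "ig 0 T (%t. (u k t v)^2) \<le> ig 0 T (%t. (nrm ?X (u k t))^2)"
   using sq[OF that] L[OF that] nv by (intro ivl_mono_AE AE_ivl_all abs_le_imp_square_le) (auto simp: sq_int_def L2T_def)
  then show ?thesis using HkT_norm_ge[OF h that] by (simp add: u_def)
 qed
 moreover have "weak_deriv T (%t. u k t v) (%t. u (Suc k) t v)" if "k < 3" for k
  unfolding weak_deriv_def
 proof (intro allI impI)
  fix phi assume "test_fun T phi"
  then show "lint 0 T (%x. u k x v * deriv phi x) = - lint 0 T (%x. u (Suc k) x v * phi x)"
   using wt[OF that] carr[of dl] unfolding weak_tderiv_def ev[symmetric] by blast
 qed
 ultimately obtain phi1 phi2 where "H3_path T (%t. u 0 t v) phi1 phi2 (%t. u 3 t v) ((1 + 2 / T + 2 * T) * HkT_norm2 ?X T 3 h)"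
  using H3_path_of_weak[OF T, of "%k t. u k t v" "HkT_norm2 ?X T 3 h"] sq by blast
 then show ?thesis using that by (simp add: u_def)
qed

context hilbert
begin

lemma data_of_HkT:
 assumes T: "T > 0" and u: "HkT X T 2 u"
 obtains u1 where "data T u u1 ((1 + 2 / T + 2 * T) * HkT_norm2 X T 2 u)"
proof -
 let ?M = "HkT_norm2 X T 2 u"
 define v z where "v = (tderiv X T ^^ 1) u" and "z = (tderiv X T ^^ 2) u"
 have L: "L2T X T u" "L2T X T v" "L2T X T z" and wt: "weak_tderiv X T u v" "weak_tderiv X T v z"
  using HkT_chain(1)[OF u, of 0] HkT_chain(1)[OF u, of 1] HkT_chain(1)[OF u, of 2] HkT_chain(2)[OF u, of 0] HkT_chain(2)[OF u, of 1]
  by (simp_all add: v_def z_def numeral_2_eq_2)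
 have iv: "nI 0 T v \<le> ?M" and iz: "nI 0 T z \<le> ?M"
  using HkT_norm_ge[OF u, of 1] HkT_norm_ge[OF u, of 2] by (auto simp: v_def z_def)
 have z0: "0 \<le> nI 0 T z" using L(3) by (intro ivl_nonneg) (auto simp: L2T_def)
 have M: "0 \<le> ?M" using z0 iz by linarith
 have c: "contT X T u" using u by (simp add: HkT_def)
 obtain u1 where u1: "H2_data T u u1 (sqrt (nI 0 T z))"
  "(nrm X u1)^2 \<le> 2 / T * nI 0 T v + 2 * T * nI 0 T z"
  by (rule H2_data_of_weak[OF T c L wt])
 have "2 / T * nI 0 T v + 2 * T * nI 0 T z \<le> 2 / T * ?M + 2 * T * ?M"
  using iv iz T by (intro add_mono mult_left_mono) auto
 moreover have "0 \<le> 2 / T * ?M + 2 * T * ?M" using M T by simp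
 moreover have "(1 + 2 / T + 2 * T) * ?M = ?M + (2 / T * ?M + 2 * T * ?M)" by (simp add: algebra_simps)
 ultimately have "(nrm X u1)^2 \<le> (1 + 2 / T + 2 * T) * ?M" "(sqrt (nI 0 T z))^2 \<le> (1 + 2 / T + 2 * T) * ?M"
  using u1(2) iz z0 M by auto
 then show ?thesis using that u1(1) unfolding data_def by blast
qed

end

section \<open>Strong derivatives, lifts and the elliptic operator on the network\<close>

context net
begin

lemma has_L2_deriv_iff: "has_L2_deriv N T u w t \<longleftrightarrow>
  w \<in> L2 N \<and> ((%s. nL ((u s - u t) /R (s - t) - w)) ---> 0) (at t within {0..T})"
proof -
 have "(%e x. (u s e x - u t e x) / (s - t) - w e x) = (u s - u t) /R (s - t) - w" for s
  by (simp add: fun_eq_iff divide_inverse mult.commute)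
 then show ?thesis by (simp add: has_L2_deriv_def)
qed

lemma has_L2_deriv_works: "has_L2_deriv N T u w t ==> has_L2_deriv N T u (L2_deriv N T u t) t"
 unfolding L2_deriv_def using someI[of "%w. has_L2_deriv N T u w t" w] .

lemma C1T_D:
 assumes "C1T N T u"
 shows "contT (L2_sp N) T u" "L.sderiv T u (L2_deriv N T u)" "contT (L2_sp N) T (L2_deriv N T u)"
 using assms has_L2_deriv_works unfolding C1T_def L.sderiv_def by (auto simp: has_L2_deriv_iff)

text \<open>\<open>L2_deriv\<close> is a choice, and \<open>f\<close> is merely of class
  \<open>H^2\<close> in time. The square root rate in \<open>H2_data\<close> shows that
  \<open>u1\<close> is a strong derivative at time 0, and two such derivatives are at distance
  zero.\<close>

lemma data_L2_deriv:
 assumes T: "T > 0" and u: "L.data T u u1 Q"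
 shows "L2_deriv N T u 0 \<in> L2 N" "nL (L2_deriv N T u 0 - u1) = 0"
proof -
 obtain M where M: "L.H2_data T u u1 M" using u by (auto simp: L.data_def)
 then have c: "contT (L2_sp N) T u" and u1: "u1 \<in> L2 N"
  and le: "\<And>k. 0 < k ==> k \<le> T ==> nL (dq k u 0 - u1) \<le> sqrt k * M" unfolding L.H2_data_def by fastforce+
 have uc: "t \<in> {0..T} ==> u t \<in> L2 N" for t using L.contT_carr[OF c] by simp
 have u0: "u 0 \<in> L2 N" using uc[of 0] T by simp
 have "((%s. nL ((u s - u 0) /R (s - 0) - u1)) ---> 0) (at 0 within {0..T})"
 proof (rule L.tendsto_zero_le)
  have "((%s. sqrt s * M) ---> sqrt 0 * M) (at 0 within {0..T})" by (intro tendsto_intros)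
  then show "((%s. sqrt s * M) ---> 0) (at 0 within {0..T})" by simp
  have ev: "\<forall>\<^sub>F s in at 0 within {0..T}. 0 < s \<and> s \<le> T" by (auto simp: eventually_at_filter)
  then show "\<forall>\<^sub>F s in at 0 within {0..T}. 0 \<le> nL ((u s - u 0) /R (s - 0) - u1)"
   by eventually_elim (use uc u0 u1 L.carr_diff L.carr_scale in \<open>auto intro!: L.nrm_nonneg\<close>)
  show "\<forall>\<^sub>F s in at 0 within {0..T}. nL ((u s - u 0) /R (s - 0) - u1) \<le> sqrt s * M"
   using ev by eventually_elim (use le in \<open>simp add: dq_def\<close>)
 qed
 then have h1: "has_L2_deriv N T u u1 0" using u1 by (simp add: has_L2_deriv_iff)
 then have h: "has_L2_deriv N T u (L2_deriv N T u 0) 0" by (rule has_L2_deriv_works)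
 then show w: "L2_deriv N T u 0 \<in> L2 N" by (simp add: has_L2_deriv_def)
 have wu: "L2_deriv N T u 0 - u1 \<in> L2 N" using L.carr_diff[of "L2_deriv N T u 0" u1] w u1 by simp
 have "((%s. nL ((u s - u 0) /R (s - 0) - u1) + nL ((u s - u 0) /R (s - 0) - L2_deriv N T u 0)) ---> 0 + 0) (at 0 within {0..T})"
  using h h1 by (intro tendsto_add) (auto simp: has_L2_deriv_iff)
 moreover have "\<forall>\<^sub>F s in at 0 within {0..T}. nL (L2_deriv N T u 0 - u1) \<le>
   nL ((u s - u 0) /R (s - 0) - u1) + nL ((u s - u 0) /R (s - 0) - L2_deriv N T u 0)"
  unfolding eventually_at_filter
 proof (rule always_eventually, intro allI impI)
  fix s assume "s \<noteq> 0" "s \<in> {0..T}"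
  define q where "q = (u s - u 0) /R (s - 0)"
  have "u s - u 0 \<in> carr (L2_sp N)" using uc[OF \<open>s \<in> {0..T}\<close>] u0 by (intro L.carr_diff) auto
  then have q: "q \<in> carr (L2_sp N)" unfolding q_def by (rule L.carr_scale)
  have "nL ((q - u1) - (q - L2_deriv N T u 0)) \<le> nL (q - u1) + nL (q - L2_deriv N T u 0)"
   using q u1 w by (intro L.nrm_diff_le L.carr_diff) auto
  then show "nL (L2_deriv N T u 0 - u1) \<le> nL ((u s - u 0) /R (s - 0) - u1) + nL ((u s - u 0) /R (s - 0) - L2_deriv N T u 0)"
   unfolding q_def[symmetric] by simp
 qed
 moreover have "at 0 within {0..T} \<noteq> bot" using T by (simp add: trivial_limit_within islimpt_Icc)
 ultimately have "nL (L2_deriv N T u 0 - u1) \<le> 0" using tendsto_lowerbound by fastforce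
 then show "nL (L2_deriv N T u 0 - u1) = 0" by (intro antisym L.nrm_nonneg) (simp_all add: wu)
qed

text \<open>The right inverse is linear up to null sets and sees only the entries at
  \<open>VD\<close>, so it is determined by finitely many unit vectors.\<close>

lemma B_right_inverse_sum:
 assumes Bm: "B_right_inverse N Bm"
 shows "ae_eq N (Bm \<mu>) (\<Sum>v\<in>VD N. \<mu> v *R Bm (%w. if w = v then 1 else 0))"
proof -
 define dl :: "'v => 'v => real" where "dl v = (%w. if w = v then 1 else 0)" for v
 have lin: "ae_eq N (Bm (%v. \<mu> v + c * \<nu> v)) (Bm \<mu> + c *R Bm \<nu>)" for \<mu> \<nu> c
 proof -
  have "(%e x. Bm \<mu> e x + c * Bm \<nu> e x) = Bm \<mu> + c *R Bm \<nu>" by (simp add: fun_eq_iff)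
  moreover have "ae_eq N (Bm (%v. \<mu> v + c * \<nu> v)) (%e x. Bm \<mu> e x + c * Bm \<nu> e x)"
   using Bm unfolding B_right_inverse_def by blast
  ultimately show ?thesis by simp
 qed
 have fin: "finite (VD N)" using net finV finite_subset by (auto simp: is_network_def)
 have "ae_eq N (Bm (%v. if v \<in> F then \<mu> v else 0)) (\<Sum>v\<in>F. \<mu> v *R Bm (dl v))" if "finite F" for F
  using that
 proof (induction F rule: finite_induct)
  case empty
  show ?case using lin[of "%_. 0" "-1" "%_. 0"] by (simp add: zero_fun_def)
 next
  case (insert i F)
  have "(%v. if v \<in> insert i F then \<mu> v else 0) = (%v. (if v \<in> F then \<mu> v else 0) + \<mu> i * dl i v)"
   using insert.hyps by (auto simp: fun_eq_iff dl_def)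
  then have "ae_eq N (Bm (%v. if v \<in> insert i F then \<mu> v else 0)) (Bm (%v. if v \<in> F then \<mu> v else 0) + \<mu> i *R Bm (dl i))"
   using lin by simp
  moreover have "ae_eq N (Bm (%v. if v \<in> F then \<mu> v else 0) + \<mu> i *R Bm (dl i)) ((\<Sum>v\<in>F. \<mu> v *R Bm (dl v)) + \<mu> i *R Bm (dl i))"
   using insert.IH unfolding ae_eq_def by (auto elim: eventually_mono)
  ultimately show ?case unfolding sum_insert_right[OF insert.hyps] by (rule ae_eq_trans)
 qed
 from this[OF fin] have "ae_eq N (Bm (%v. if v \<in> VD N then \<mu> v else 0)) (\<Sum>v\<in>VD N. \<mu> v *R Bm (dl v))" .
 moreover have "ae_eq N (Bm \<mu>) (Bm (%v. if v \<in> VD N then \<mu> v else 0))"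
  using Bm unfolding B_right_inverse_def by (simp add: Ball_def)
 ultimately show ?thesis unfolding dl_def by (rule ae_eq_trans[rotated])
qed

text \<open>Integrate \<open>(s - d n)^2 / d \<le> 2 s^2 / d + 2 d n^2\<close>.\<close>

lemma L_op_le:
 assumes co: "coefficients N a d a_hi d_lo d_hi" and q: "q \<in> H1 N" and s: "s \<in> L2 N" and n: "n \<in> L2 N"
  and eq: "nL (K q - (s - mul d n)) = 0"
 shows "L_op N d q q \<le> 2 / d_lo * (nL s)^2 + 2 * ip N (mul d n) n"
proof -
 define R where "R = mul (%e x. 1 / d e x)"
 have d0: "0 < d_lo" using co by (simp add: coefficients_def)
 have dm: "e \<in> E ==> d e \<in> meas 0 (len N e)"
  and db: "e \<in> E ==> AE x in ivl 0 (len N e). d_lo \<le> d e x \<and> d e x \<le> d_hi" for e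
  using co by (auto simp: coefficients_def elim!: eventually_mono)
 have rm: "e \<in> E ==> (%x. 1 / d e x) \<in> meas 0 (len N e)" for e using dm by (intro borel_measurable_divide) auto
 have rb: "AE x in ivl 0 (len N e). 0 \<le> 1 / d e x \<and> 1 / d e x \<le> 1 / d_lo" if "e \<in> E" for e
  using db[OF that] by eventually_elim (use d0 in \<open>auto simp: divide_left_mono frac_le\<close>)
 have Rb: "x \<in> L2 N ==> R x \<in> L2 N" "x \<in> L2 N ==> nL (R x) \<le> 1 / d_lo * nL x" "x \<in> L2 N ==> 0 \<le> ip N (R x) x" for x
  using mul_bounds[OF rm rb order_refl, of x] d0 by (simp_all add: R_def)
 have Kq: "K q \<in> L2 N" by (rule H1_D(3)[OF q])
 have dn: "mul d n \<in> L2 N" using mul_bounds(1)[OF dm db less_imp_le[OF d0] n] by simp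
 define w where "w = s - mul d n"
 have w: "w \<in> L2 N" using L.carr_diff[of s "mul d n"] s dn by (simp add: w_def)
 have Rlin: "R (x + c *R y) = R x + c *R R y" for x y c by (simp add: R_def mul_def fun_eq_iff algebra_simps)
 have sym: "ip N (R x) y = ip N (R y) x" for x y by (simp add: ip_def R_def mul_def mult_ac)
 have "L_op N d q q = ip N (R (K q)) (K q)" by (simp add: L_op_def K_adj_def R_def mul_def)
 also have "\<dots> = ip N (R (K q)) w" using L.inn_eqI[of "K q" w "R (K q)"] eq Kq w Rb(1) L.inn_commute[of _ "R (K q)"] by (simp add: w_def)
 also have "\<dots> = ip N (R w) w" using L.inn_eqI[of "K q" w "R w"] eq Kq w Rb(1) L.inn_commute[of _ "R w"] sym[of "K q" w] by (simp add: w_def)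
 \<comment> \<open>A nonnegative term with the sum in place of the difference is added, so that the
   parallelogram identity removes the mixed products.\<close>
 also have "\<dots> \<le> ip N (R w) w + ip N (R (s + mul d n)) (s + mul d n)"
  using Rb(3)[of "s + mul d n"] L.carr_add[of s "mul d n"] s dn by simp
 also have "\<dots> = 2 * ip N (R s) s + 2 * ip N (R (mul d n)) (mul d n)"
 proof -
  have c: "s \<in> carr (L2_sp N)" "mul d n \<in> carr (L2_sp N)" "R s \<in> carr (L2_sp N)" "R (mul d n) \<in> carr (L2_sp N)" using s dn Rb(1) by auto
  have "R w = R s - R (mul d n)" "R (s + mul d n) = R s + R (mul d n)" using Rlin[of s "-1" "mul d n"] Rlin[of s 1 "mul d n"] by (simp_all add: w_def)
  then show ?thesis using L.inn_diff_left[OF c(3,4), of w] L.inn_diff_right[OF c(1,2,3)] L.inn_diff_right[OF c(1,2,4)]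
   L.inn_add_left[OF c(3,4), of "s + mul d n"] L.inn_add_right[OF c(1,2,3)] L.inn_add_right[OF c(1,2,4)] L.carr_add[OF c(1,2)] w by (simp add: w_def)
 qed
 also have "ip N (R (mul d n)) (mul d n) = ip N (mul d n) n"
  unfolding ip_def
 proof (intro sum.cong refl integral_cong_AE)
  fix e assume e: "e \<in> E"
  show "AE x in ivl 0 (len N e). R (mul d n) e x * mul d n e x = mul d n e x * n e x"
   using db[OF e] by eventually_elim (use d0 in \<open>simp add: R_def mul_def\<close>)
 qed (use L2D[OF Rb(1)[OF dn]] L2D[OF dn] L2D[OF n] in \<open>auto intro!: borel_measurable_times simp: sq_int_def\<close>)
 also have "ip N (R s) s \<le> nL (R s) * nL s" using L.inn_le_nrm[of "R s" s] s Rb(1) by simp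
 also have "\<dots> \<le> 1 / d_lo * nL s * nL s" using Rb(2)[OF s] s d0 by (intro mult_right_mono) auto
 finally show ?thesis by (simp add: power2_eq_square)
qed

end

lemma H3_path_mono: "H3_path T phi phi1 phi2 y Q ==> Q \<le> R ==> H3_path T phi phi1 phi2 y R"
 unfolding H3_path_def by (elim conjE, intro conjI) (assumption | erule order_trans; assumption)+

lemma HkT_norm2_nonneg: "0 \<le> HkT_norm2 X T k u"
 unfolding HkT_norm2_def by (intro sum_nonneg integral_nonneg) auto

context net
begin

lemma ae_comb: "ae_eq N u u' ==> ae_eq N v v' ==> ae_eq N (u + c *R v) (u' + c *R v')"
 unfolding ae_eq_def
proof
 fix e assume h: "\<forall>e\<in>E. AE x in ivl 0 (len N e). u e x = u' e x" "\<forall>e\<in>E. AE x in ivl 0 (len N e). v e x = v' e x" "e \<in> E"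
 then have "AE x in ivl 0 (len N e). u e x = u' e x" "AE x in ivl 0 (len N e). v e x = v' e x" by auto
 then show "AE x in ivl 0 (len N e). (u + c *R v) e x = (u' + c *R v') e x" by eventually_elim simp
qed

lemma ae_mul: "ae_eq N u u' ==> ae_eq N (mul c u) (mul c u')"
 unfolding ae_eq_def mul_def by (auto elim: eventually_mono)

lemma dx_cong:
 assumes "q \<in> H1 N" "ae_eq N u q"
 shows "ae_eq N (K u) (K q)"
 by (rule dx_ae[OF has_dx_cong[OF H1_D(2)[OF assms(1)] ae_eq_sym[OF assms(2)] H1_D(1)[OF assms(1)]]])

end

section \<open>The parabolic limit on the network\<close>

locale net_coeff = net N for N :: "('v, 'e) network" +
 fixes a d :: "'e nfun" and a_hi d_lo d_hi :: real and Bm :: "('v => real) => 'e nfun"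
 assumes co: "coefficients N a d a_hi d_lo d_hi" and Bm: "B_right_inverse N Bm"
begin

lemma VD_touched: "v \<in> VD N ==> touched v" and VN_touched: "v \<in> VN N ==> touched v"
 using touched_all[OF Bm] net by (auto simp: is_network_def VN_def)

lemma fin_V: "finite (VD N)" "finite (VN N)"
 using net finV finite_subset by (auto simp: is_network_def VN_def)

sublocale O: energy_ops "L2_sp N" "H10 N" K "mul a" "mul d" "\<bar>a_hi\<bar>" "\<bar>d_hi\<bar>" d_lo
 by (rule energy_ops_net[OF co VD_touched])

lemma d_pos: "0 < d_lo" by (rule O.d_pos)

lemma H10_D: "q \<in> H10 N ==> q \<in> H1 N" "q \<in> H10 N ==> q \<in> L2 N" "q \<in> H10 N ==> K q \<in> L2 N"
 using H1_D by (auto simp: H10_def)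

lemma mul_L2: "x \<in> L2 N ==> mul a x \<in> L2 N" "x \<in> L2 N ==> mul d x \<in> L2 N"
 using O.A_carr O.D_carr by simp_all

lemma B_adj_H10: "q \<in> H10 N ==> B_adj N \<mu> q = 0"
 by (simp add: B_adj_def H10_def)

text \<open>With lifts of unit vectors, the lifted boundary data are finite sums of fixed functions
  with scalar coefficients depending on time; no continuity of the right inverse enters.\<close>

definition lift :: "'v => 'e nfun" where
 "lift v = Bm (%w. if w = v then 1 else 0)"

lemma lift_H1: "lift v \<in> H1 N" and lift_val: "w \<in> VD N ==> vval N (lift v) w = (if w = v then 1 else 0)"
 using Bm by (auto simp: lift_def B_right_inverse_def)

lemma lift_H10:
 assumes p: "p \<in> H1 N" and v: "\<And>v. v \<in> VD N ==> vval N p v = h v"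
 shows "p - (\<Sum>v\<in>VD N. h v *R lift v) \<in> H10 N"
  and "nL (K (p - (\<Sum>v\<in>VD N. h v *R lift v)) - (K p - (\<Sum>v\<in>VD N. h v *R K (lift v)))) = 0"
proof -
 define S where "S = (\<Sum>v\<in>VD N. h v *R lift v)"
 have S: "S \<in> H1 N" unfolding S_def by (rule H1_sum[OF fin_V(1) lift_H1])
 have eq: "p + (-1) *R S = p - S" by simp
 have H: "p - S \<in> H1 N" using H1_lin[OF p S, of "-1"] unfolding eq .
 have "vval N (p - S) v = 0" if vD: "v \<in> VD N" for v
 proof -
  have "vval N S v = (\<Sum>w\<in>VD N. h w * vval N (lift w) v)" unfolding S_def by (rule vval_sum[OF fin_V(1) VD_touched[OF vD] lift_H1])
  also have "\<dots> = h v" using fin_V(1) vD by (simp add: lift_val if_distrib cong: if_cong)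
  finally show ?thesis using vval_lin[OF VD_touched[OF vD] p S, of "-1"] v[OF vD] unfolding eq by simp
 qed
 then show "p - (\<Sum>v\<in>VD N. h v *R lift v) \<in> H10 N" using H by (simp add: H10_def S_def)
 have s: "ae_eq N (K S) (\<Sum>v\<in>VD N. h v *R K (lift v))" unfolding S_def by (rule dx_sum_ae[OF fin_V(1) lift_H1])
 have "ae_eq N (K (p - S)) (K p + (-1) *R K S)" using dx_lin_ae[OF p S, of "-1"] unfolding eq .
 then have "ae_eq N (K (p - S)) (K p + (-1) *R (\<Sum>v\<in>VD N. h v *R K (lift v)))"
  by (rule ae_eq_trans[OF _ ae_comb[OF ae_eq_refl s]])
 then have "ae_eq N (K (p - S)) (K p - (\<Sum>v\<in>VD N. h v *R K (lift v)))" by simp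
 then show "nL (K (p - (\<Sum>v\<in>VD N. h v *R lift v)) - (K p - (\<Sum>v\<in>VD N. h v *R K (lift v)))) = 0"
  using ae_eq_iff_nL[OF H1_D(3)[OF H] ae_eq_L2[OF _ H1_D(3)[OF H]]] unfolding S_def by blast
qed

lemma C_adj_continuous:
 assumes "\<And>v. v \<in> VN N ==> continuous_on {0..T} (%t. r t v)"
 shows "continuous_on {0..T} (%t. C_adj N (r t) q)"
 unfolding C_adj_def by (intro continuous_intros assms)

text \<open>A test function vanishing at \<open>VD\<close> eliminates the distributional multiplier.
  What is left is a scalar weak derivative, and since \<open>p\<close> is continuous in
  \<open>L^2\<close>, the equation can be integrated between any two times. All parabolic estimates
  start from this integrated form.\<close>

lemma solves_P_facts:
 assumes P: "solves_P N T a d f g h r p m lam" and g: "contT (L2_sp N) T g"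
  and r: "\<forall>v\<in>VN N. continuous_on {0..T} (%t. r t v)"
 shows "contT (L2_sp N) T p" "L.L2c T m"
  "AE t in ivl 0 T. p t \<in> H1 N \<and> m t \<in> L2 N \<and> ae_eq N (K (p t) + mul d (m t)) (f t) \<and> (\<forall>v\<in>VD N. vval N (p t) v = h t v)"
  "q \<in> H10 N ==> 0 \<le> s ==> s \<le> t ==> t \<le> T ==>
    intable s t (%r'. ip N (m r') (K q) - ip N (mul a (p r')) q + (ip N (g r') q - C_adj N (r r') q)) \<and>
    ip N (p t - p s) q = ig s t (%r'. ip N (m r') (K q) - ip N (mul a (p r')) q + (ip N (g r') q - C_adj N (r r') q))"
proof -
 show p: "contT (L2_sp N) T p" using P by (simp add: solves_P_def)
 show m: "L.L2c T m" using P by (intro L.L2T_L2c) (simp add: solves_P_def)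
 have "AE t in ivl 0 T. p t \<in> H1 N"
 proof -
  have "L2T (H1_sp N) T p" using P by (simp add: solves_P_def)
  then obtain s :: "nat => real => 'e nfun" where
   "AE t in ivl 0 T. p t \<in> carr (H1_sp N) \<and> (%n. nrm (H1_sp N) (s n t - p t)) ----> 0"
   by (auto simp: L2T_def strongly_meas_def)
  then show ?thesis by eventually_elim (simp add: H1_sp_def)
 qed
 moreover have "AE t in ivl 0 T. m t \<in> carr (L2_sp N)" by (rule L.L2c_carr[OF m])
 moreover have "AE t in ivl 0 T. ae_eq N (%e x. dx N (p t) e x + d e x * m t e x) (f t) \<and> (\<forall>v\<in>VD N. vval N (p t) v = h t v)"
  using P by (simp add: solves_P_def)
 ultimately show "AE t in ivl 0 T. p t \<in> H1 N \<and> m t \<in> L2 N \<and> ae_eq N (K (p t) + mul d (m t)) (f t) \<and> (\<forall>v\<in>VD N. vval N (p t) v = h t v)"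
  by eventually_elim (simp add: plus_fun_def mul_def)
 assume q: "q \<in> H10 N" and st: "0 \<le> s" "s \<le> t" "t \<le> T"
 define l where "l t = ip N (g t) q - C_adj N (r t) q" for t
 define w where "w t = ip N (mul a (p t)) q - ip N (m t) (K q)" for t
 have qc: "contT (L2_sp N) T (%_. q)" "L.L2c T (%_. K q)" using H10_D[OF q] by (auto intro: L.contT_const L.L2c_const)
 have lc: "continuous_on {0..T} l"
  unfolding l_def using L.contT_inn[OF g qc(1)] by (intro continuous_intros C_adj_continuous r[rule_format]) auto
 have "intable 0 T (%t. ip N (mul a (p t)) q)" "intable 0 T (%t. ip N (m t) (K q))"
  using L.L2c_inn[OF L.L2c_map[OF L.contT_L2c[OF p] O.A_carr O.A_Lipschitz] L.contT_L2c[OF qc(1)]] L.L2c_inn[OF m qc(2)] by simp_all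
 then have wi: "intable 0 T w" unfolding w_def by simp
 have li: "intable 0 T l" by (rule ivl_cont[OF lc])
 have "weak_deriv T (%t. ip N (p t) q) (%t. l t - w t)"
  unfolding weak_deriv_def
 proof (intro allI impI)
  fix phi assume phi: "test_fun T phi"
  have c: "continuous_on {0..T} phi" by (rule smooth_continuous_on[OF smooth_test_fun[OF phi]])
  have "- lint 0 T (%t. ip N (p t) q * deriv phi t) + lint 0 T (%t. w t * phi t) +
   B_adj N (lam phi) q = lint 0 T (%t. l t * phi t)"
   using P phi H10_D(1)[OF q] unfolding solves_P_def w_def l_def mul_def K_adj_def by blast
  then have "- lint 0 T (%t. ip N (p t) q * deriv phi t) + lint 0 T (%t. w t * phi t) =
   lint 0 T (%t. l t * phi t)" using B_adj_H10[OF q] by simp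
  moreover have "lint 0 T (%t. (l t - w t) * phi t) =
   lint 0 T (%t. l t * phi t) - lint 0 T (%t. w t * phi t)"
   unfolding left_diff_distrib by (rule Bochner_Integration.integral_diff; rule integrable_ivl_mult_cont[OF _ c]; rule li wi)
  ultimately show "lint 0 T (%t. ip N (p t) q * deriv phi t) = - lint 0 T (%t. (l t - w t) * phi t)"
   by linarith
 qed
 moreover have "continuous_on {0..T} (%t. ip N (p t) q)" using L.contT_inn[OF p qc(1)] by simp
 moreover have i: "intable 0 T (%t. l t - w t)" using li wi by simp
 ultimately have "ip N (p t) q - ip N (p s) q = ig s t (%t. l t - w t)" by (rule weak_deriv_primitive[OF _ _ _ st])
 moreover have "ip N (p t - p s) q = ip N (p t) q - ip N (p s) q"
  using L.inn_diff_left[of "p t" "p s" q] L.contT_carr[OF p, of t] L.contT_carr[OF p, of s] st H10_D[OF q] by simp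
 moreover have "(%t. l t - w t) = (%r'. ip N (m r') (K q) - ip N (mul a (p r')) q + (ip N (g r') q - C_adj N (r r') q))"
  by (simp add: l_def w_def fun_eq_iff)
 ultimately show "intable s t (%r'. ip N (m r') (K q) - ip N (mul a (p r')) q + (ip N (g r') q - C_adj N (r r') q)) \<and>
    ip N (p t - p s) q = ig s t (%r'. ip N (m r') (K q) - ip N (mul a (p r')) q + (ip N (g r') q - C_adj N (r r') q))"
  using ivl_sub[OF i st(1,3)] by simp
qed

lemma solves_H_facts:
 assumes H: "solves_H N T a d eps f g h r p m lam" and t: "t \<in> {0..T}"
 shows "p t \<in> H1 N" "v \<in> VD N ==> vval N (p t) v = h t v"
  "ae_eq N (eps *R L2_deriv N T m t + K (p t) + mul d (m t)) (f t)"
  "q \<in> H10 N ==> ip N (L2_deriv N T p t) q + ip N (mul a (p t)) q - ip N (m t) (K q) = ip N (g t) q - C_adj N (r t) q"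
proof -
 have "contT (H1_sp N) T p" using H by (simp add: solves_H_def)
 then show "p t \<in> H1 N" using t by (auto simp: contT_def H1_sp_def)
 show "v \<in> VD N ==> vval N (p t) v = h t v" using H t by (simp add: solves_H_def)
 have "(%e x. eps * L2_deriv N T m t e x + dx N (p t) e x + d e x * m t e x) = eps *R L2_deriv N T m t + K (p t) + mul d (m t)"
  by (simp add: fun_eq_iff mul_def)
 moreover have "ae_eq N (%e x. eps * L2_deriv N T m t e x + dx N (p t) e x + d e x * m t e x) (f t)"
  using H t unfolding solves_H_def by blast
 ultimately show "ae_eq N (eps *R L2_deriv N T m t + K (p t) + mul d (m t)) (f t)" by simp
 show "ip N (L2_deriv N T p t) q + ip N (mul a (p t)) q - ip N (m t) (K q) = ip N (g t) q - C_adj N (r t) q" if q: "q \<in> H10 N"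
 proof -
  have "ip N (L2_deriv N T p t) q + ip N (%e x. a e x * p t e x) q - K_adj N (m t) q + B_adj N (lam t) q = ip N (g t) q - C_adj N (r t) q"
   using H t H10_D(1)[OF q] unfolding solves_H_def by blast
  then show ?thesis using B_adj_H10[OF q] by (simp add: mul_def K_adj_def)
 qed
qed

lemma constr_I:
 assumes "u \<in> H10 N" "n \<in> L2 N" "s \<in> L2 N" "ae_eq N (K u) (s - mul d n)"
 shows "O.constr u n s"
 using assms ae_eq_iff_nL[of "K u" "s - mul d n"] H10_D(3)[of u] mul_L2(2)[of n] L.carr_diff[of s "mul d n"]
 by (simp add: O.constr_def)

lemma parab_corrector:
 assumes P: "solves_P N T a d (%t e x. - z t e x) (%t e x. 0) (%t v. 0) (%t v. 0) p m lam" and z: "L.L2c T z"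
 shows "O.parab T p m (%t. - z t)"
proof -
 have g0: "contT (L2_sp N) T (%t. %(e::'e) (x::real). 0)" using L.contT_const[of 0 T] L.carr_zero by (simp add: zero_fun_def)
 have r0: "\<forall>v\<in>VN N. continuous_on {0..T} (%t. 0 :: real)" by simp
 note F = solves_P_facts[OF P g0 r0]
 have z': "L.L2c T (%t. - z t)" using L.L2c_scale[OF z, of "-1"] by simp
 have "AE t in ivl 0 T. - z t \<in> carr (L2_sp N)" by (rule L.L2c_carr[OF z'])
 then have "AE t in ivl 0 T. O.constr (p t) (m t) (- z t)"
  using F(3)
 proof eventually_elim
  case (elim t)
  then have ae: "ae_eq N (K (p t) + mul d (m t)) (- z t)" by (simp add: fun_Compl_def)
  from ae_comb[OF this ae_eq_refl, of "-1" "mul d (m t)"] have "ae_eq N (K (p t)) (- z t - mul d (m t))" by simp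
  then show ?case using elim by (intro constr_I) (auto simp: H10_def)
 qed
 moreover have "ip N (p t - p s) q = ig s t (%r'. ip N (m r') (K q) - ip N (mul a (p r')) q)"
  if "q \<in> H10 N" "0 \<le> s" "s \<le> t" "t \<le> T" for q s t
 proof -
  have "ip N (%e x. 0) q - C_adj N (%v. 0) q = 0" by (simp add: ip_def C_adj_def)
  then show ?thesis using F(4)[OF that] by simp
 qed
 ultimately show ?thesis using F(1,2) z' by (simp add: O.parab_def)
qed

text \<open>The hyperbolic solution is integrated in time to match the parabolic formulation. The
  data \<open>f\<close>, \<open>g\<close>, \<open>h\<close>, \<open>r\<close> then cancel, and
  \<open>- eps *R L2_deriv N T m t\<close> is the only source left.\<close>

lemma parab_difference:
 assumes H: "solves_H N T a d eps f g h r p m lam" and P: "solves_P N T a d f g h r p0 m0 lam0" and g: "contT (L2_sp N) T g"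
  and r: "\<forall>v\<in>VN N. continuous_on {0..T} (%t. r t v)"
 shows "O.parab T (%t. p t - p0 t) (%t. m t - m0 t) (%t. - eps *R L2_deriv N T m t)"
proof -
 note F = solves_P_facts[OF P g r]
 have "C1T N T p" "C1T N T m" using H by (auto simp: solves_H_def)
 note Cp = C1T_D[OF \<open>C1T N T p\<close>] and Cm = C1T_D[OF \<open>C1T N T m\<close>]
 have in1: "AE t in ivl 0 T. t \<in> {0..T}" by (rule AE_ivl_all)
 have "AE t in ivl 0 T. O.constr (p t - p0 t) (m t - m0 t) (- eps *R L2_deriv N T m t)"
  using F(3) in1
 proof eventually_elim
  case (elim t)
  note t = elim(2)
  have Hp: "p t \<in> H1 N" "p0 t \<in> H1 N" using solves_H_facts(1)[OF H t] elim by auto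
  have eq: "p t + (-1) *R p0 t = p t - p0 t" by simp
  have "p t - p0 t \<in> H1 N" using H1_lin[OF Hp, of "-1"] unfolding eq .
  moreover have "vval N (p t - p0 t) v = 0" if v: "v \<in> VD N" for v
   using vval_lin[OF VD_touched[OF v] Hp, of "-1"] solves_H_facts(2)[OF H t v] elim(1) v unfolding eq by simp
  ultimately have V: "p t - p0 t \<in> H10 N" by (simp add: H10_def)
  have 1: "ae_eq N (K (p t - p0 t)) (K (p t) + (-1) *R K (p0 t))" using dx_lin_ae[OF Hp, of "-1"] unfolding eq .
  have 2: "ae_eq N (K (p0 t) + mul d (m0 t)) (f t)" using elim by simp
  have 3: "ae_eq N (eps *R L2_deriv N T m t + K (p t) + mul d (m t)) (f t)" by (rule solves_H_facts(3)[OF H t])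
  have "ae_eq N (K (p t - p0 t)) (- eps *R L2_deriv N T m t - mul d (m t - m0 t))"
   unfolding ae_eq_def
  proof
   fix e assume e: "e \<in> E"
   have "AE x in ivl 0 (len N e). K (p t - p0 t) e x = (K (p t) + (-1) *R K (p0 t)) e x"
    "AE x in ivl 0 (len N e). (K (p0 t) + mul d (m0 t)) e x = f t e x"
    "AE x in ivl 0 (len N e). (eps *R L2_deriv N T m t + K (p t) + mul d (m t)) e x = f t e x"
    using 1 2 3 e unfolding ae_eq_def by auto
   then show "AE x in ivl 0 (len N e). K (p t - p0 t) e x = (- eps *R L2_deriv N T m t - mul d (m t - m0 t)) e x"
    by eventually_elim (simp add: mul_def algebra_simps)
  qed
  moreover have "m t - m0 t \<in> L2 N" "- eps *R L2_deriv N T m t \<in> L2 N"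
   using L.carr_diff[of "m t" "m0 t"] L.carr_scale[of "L2_deriv N T m t" "- eps"] L.contT_carr[OF Cm(1) t] L.contT_carr[OF Cm(3) t] elim by auto
  ultimately show ?case using V by (intro constr_I)
 qed
 moreover have "ip N ((p t - p0 t) - (p s - p0 s)) q = ig s t (%r'. ip N (m r' - m0 r') (K q) - ip N (mul a (p r' - p0 r')) q)"
  if q: "q \<in> H10 N" and st: "0 \<le> s" "s \<le> t" "t \<le> T" for q s t
 proof -
  define l where "l t = ip N (g t) q - C_adj N (r t) q" for t
  have qL: "q \<in> L2 N" "K q \<in> L2 N" using H10_D q by auto
  have pc: "t \<in> {0..T} ==> p t \<in> L2 N" "t \<in> {0..T} ==> p0 t \<in> L2 N" "t \<in> {0..T} ==> m t \<in> L2 N" for t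
   using L.contT_carr[OF Cp(1)] L.contT_carr[OF F(1)] L.contT_carr[OF Cm(1)] by auto
  have i0: "intable s t (%r'. ip N (m0 r') (K q) - ip N (mul a (p0 r')) q + l r')"
   and e0: "ip N (p0 t - p0 s) q = ig s t (%r'. ip N (m0 r') (K q) - ip N (mul a (p0 r')) q + l r')"
   using F(4)[OF q st] unfolding l_def by blast+
  have ip': "ip N (L2_deriv N T p r') q = ip N (m r') (K q) - ip N (mul a (p r')) q + l r'" if "r' \<in> {s..t}" for r'
   using solves_H_facts(4)[OF H _ q, of r'] that st by (auto simp: l_def)
  have "continuous_on {0..T} (%r'. ip N (L2_deriv N T p r') q)"
   using L.contT_inn[OF Cp(3) L.contT_const[of q]] qL by simp
  then have "intable s t (%r'. ip N (L2_deriv N T p r') q)" by (rule ivl_cont[OF continuous_on_subset]) (use st in auto)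
  then have i1: "intable s t (%r'. ip N (m r') (K q) - ip N (mul a (p r')) q + l r')"
   by (rule integrable_ivl_cong_AE) (rule AE_ivl_all, simp add: ip')
  have "ip N (p t - p s) q = ig s t (%r'. ip N (L2_deriv N T p r') q)"
   using L.sderiv_primitive[OF Cp(2) _ _ st, of q] L.contT_carr[OF Cp(1)] qL by simp
  then have e1: "ip N (p t - p s) q = ig s t (%r'. ip N (m r') (K q) - ip N (mul a (p r')) q + l r')"
   using integral_cong[of "{s..t}", OF ip'] by simp
  have ae: "AE r' in ivl s t. m0 r' \<in> carr (L2_sp N)" by (rule AE_ivl_sub[OF L.L2c_carr[OF F(2)] st(1,3)])
  have ae2: "AE r' in ivl s t. r' \<in> {0..T}" using st by (intro AE_ivl_all) auto
  have "ip N ((p t - p0 t) - (p s - p0 s)) q = ip N (p t - p s) q - ip N (p0 t - p0 s) q"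
  proof -
   have *: "(p t - p0 t) - (p s - p0 s) = (p t - p s) - (p0 t - p0 s)" by simp
   show ?thesis unfolding * using L.inn_diff_left[of "p t - p s" "p0 t - p0 s" q] pc[of t] pc[of s] st qL L.carr_diff by simp
  qed
  also have "\<dots> = ig s t (%r'. (ip N (m r') (K q) - ip N (mul a (p r')) q + l r') - (ip N (m0 r') (K q) - ip N (mul a (p0 r')) q + l r'))"
   unfolding e0 e1 by (rule ivl_diff[OF i1 i0, symmetric])
  also have "\<dots> = ig s t (%r'. ip N (m r' - m0 r') (K q) - ip N (mul a (p r' - p0 r')) q)"
  proof (rule ivl_cong_AE[symmetric, OF Bochner_Integration.integrable_diff[OF i1 i0]])
   show "AE r' in ivl s t. (ip N (m r') (K q) - ip N (mul a (p r')) q + l r') - (ip N (m0 r') (K q) - ip N (mul a (p0 r')) q + l r') =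
     ip N (m r' - m0 r') (K q) - ip N (mul a (p r' - p0 r')) q"
    using ae ae2
   proof eventually_elim
    case (elim r')
    then show ?case using L.inn_diff_left[of "m r'" "m0 r'" "K q"] L.inn_diff_left[of "mul a (p r')" "mul a (p0 r')" q] pc[of r'] qL mul_L2(1) O.A_diff[of "p r'" "p0 r'"]
     by simp
   qed
  qed
  finally show ?thesis .
 qed
 moreover have "L.L2c T (%t. - eps *R L2_deriv N T m t)" by (intro L.L2c_scale L.contT_L2c Cm)
 ultimately show ?thesis
  using L.contT_diff[OF Cp(1) F(1)] L.L2c_diff[OF L.contT_L2c[OF Cm(1)] F(2)] by (simp add: O.parab_def)
qed

text \<open>The first equation at time 0, with \<open>m 0\<close> expressed by the compatibility
  condition, differs from the characterization of \<open>p_star\<close> only by the lift of the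
  derivative of \<open>h\<close>. As the test functions are dense, this determines the derivative of
  \<open>p\<close>. The same condition inserted in the second equation leaves \<open>eps\<close>
  times the derivative of \<open>m\<close> equal to zero.\<close>

lemma initial_derivatives:
 assumes eps: "0 < eps" and T: "0 < T" and H: "solves_H N T a d eps f g h r p m lam"
  and f: "contT (L2_sp N) T f" and g: "contT (L2_sp N) T g" and pi: "p_init \<in> H1 N" and ps: "p_star \<in> H10 N"
  and c1: "\<forall>q\<in>H10 N. ip N p_star q = ip N (g 0) q - C_adj N (r 0) q
      - (L_op N d p_init q + ip N (%e x. a e x * p_init e x) q) - ip N (Bm \<mu>) q + K_adj N (%e x. f 0 e x / d e x) q"
  and c2: "ae_eq N (%e x. dx N p_init e x - f 0 e x + d e x * m_init e x) (%e x. 0)"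
  and p0: "ae_eq N (p 0) p_init" and m0: "ae_eq N (m 0) m_init"
 shows "nL (L2_deriv N T p 0 - (p_star + (\<Sum>v\<in>VD N. \<mu> v *R lift v))) = 0" "nL (L2_deriv N T m 0) = 0"
  "ae_eq N (K (L2_deriv N T p 0)) (K p_star + (\<Sum>v\<in>VD N. \<mu> v *R K (lift v)))" "K (L2_deriv N T p 0) \<in> L2 N"
proof -
 have z: "0 \<in> {0..T}" using T by simp
 have C1: "C1T N T p" "C1T N T m" using H by (auto simp: solves_H_def)
 define p' m' where "p' = L2_deriv N T p 0" and "m' = L2_deriv N T m 0"
 define S where "S = (\<Sum>v\<in>VD N. \<mu> v *R lift v)"
 have S1: "S \<in> H1 N" unfolding S_def by (rule H1_sum[OF fin_V(1) lift_H1])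
 have BS: "ae_eq N (Bm \<mu>) S" using B_right_inverse_sum[OF Bm, of \<mu>] by (simp add: S_def lift_def)
 have c: "p 0 \<in> L2 N" "m 0 \<in> L2 N" "p' \<in> L2 N" "m' \<in> L2 N" "f 0 \<in> L2 N" "g 0 \<in> L2 N" "p_init \<in> L2 N" "K p_init \<in> L2 N" "p_star \<in> L2 N" "S \<in> L2 N"
  using L.contT_carr[OF C1T_D(1)[OF C1(1)] z] L.contT_carr[OF C1T_D(1)[OF C1(2)] z] L.contT_carr[OF C1T_D(3)[OF C1(1)] z]
   L.contT_carr[OF C1T_D(3)[OF C1(2)] z] L.contT_carr[OF f z] L.contT_carr[OF g z] H1_D(1,3)[OF pi] H10_D(2)[OF ps] H1_D(1)[OF S1]
  by (auto simp: p'_def m'_def)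
 define R where "R = mul (%e x. 1 / d e x)"
 have db: "AE x in ivl 0 (len N e). 0 < d e x" and rb: "AE x in ivl 0 (len N e). 0 \<le> 1 / d e x \<and> 1 / d e x \<le> 1 / d_lo"
  and rm: "(%x. 1 / d e x) \<in> meas 0 (len N e)" if e: "e \<in> E" for e
 proof -
  have "AE x in ivl 0 (len N e). d_lo \<le> d e x" using co e by (auto simp: coefficients_def)
  then show "AE x in ivl 0 (len N e). 0 < d e x" "AE x in ivl 0 (len N e). 0 \<le> 1 / d e x \<and> 1 / d e x \<le> 1 / d_lo"
   by (eventually_elim, use d_pos in \<open>auto simp: frac_le\<close>)+
  show "(%x. 1 / d e x) \<in> meas 0 (len N e)"
   using co e by (intro borel_measurable_divide) (auto simp: coefficients_def)
 qed
 have R: "x \<in> L2 N ==> R x \<in> L2 N" for x using mul_bounds(1)[OF rm rb order_refl, of x] by (simp add: R_def)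
 \<comment> \<open>The compatibility condition solved for the flux; after division by
   \<open>d\<close> it turns the terms with \<open>L_op\<close> and \<open>f 0\<close> into a
   product with \<open>m 0\<close>.\<close>
 have m0R: "ae_eq N (R (f 0) - R (K p_init)) (m 0)"
  unfolding ae_eq_def
 proof
  fix e assume e: "e \<in> E"
  have "AE x in ivl 0 (len N e). dx N p_init e x - f 0 e x + d e x * m_init e x = 0" "AE x in ivl 0 (len N e). m 0 e x = m_init e x"
   using c2 m0 e by (auto simp: ae_eq_def)
  then show "AE x in ivl 0 (len N e). (R (f 0) - R (K p_init)) e x = m 0 e x"
   using db[OF e] by eventually_elim (simp add: R_def mul_def field_simps)
 qed
 have zc: "p' - (p_star + S) \<in> L2 N" using L.carr_diff[of p' "p_star + S"] L.carr_add[of p_star S] c by simp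
 have "nL (p' - (p_star + S)) = 0"
 proof (rule H10_dense[OF zc VD_touched])
  fix q assume q: "q \<in> H10 N"
  have qL: "q \<in> L2 N" "K q \<in> L2 N" using H10_D q by auto
  have "ip N p' q + ip N (mul a (p 0)) q - ip N (m 0) (K q) = ip N (g 0) q - C_adj N (r 0) q"
   using solves_H_facts(4)[OF H z q] by (simp add: p'_def)
  moreover have "ip N p_star q = ip N (g 0) q - C_adj N (r 0) q - (ip N (R (K p_init)) (K q) + ip N (mul a p_init) q) - ip N (Bm \<mu>) q + ip N (R (f 0)) (K q)"
   using c1 q by (simp add: L_op_def K_adj_def mul_def R_def)
  moreover have "ip N (mul a (p 0)) q = ip N (mul a p_init) q" by (rule ip_cong[OF ae_mul[OF p0]]) (use c mul_L2 qL in auto)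
  moreover have "ip N (Bm \<mu>) q = ip N S q" by (rule ip_cong[OF BS ae_eq_L2[OF ae_eq_sym[OF BS]]]) (use c qL in auto)
  moreover have "ip N (R (f 0) - R (K p_init)) (K q) = ip N (m 0) (K q)"
   by (rule ip_cong[OF m0R ae_eq_L2[OF ae_eq_sym[OF m0R]]]) (use c qL in auto)
  moreover have "ip N (R (f 0) - R (K p_init)) (K q) = ip N (R (f 0)) (K q) - ip N (R (K p_init)) (K q)"
   using L.inn_diff_left[of "R (f 0)" "R (K p_init)" "K q"] R c qL by simp
  moreover have "ip N (p' - (p_star + S)) q = ip N p' q - (ip N p_star q + ip N S q)"
   using L.inn_diff_left[of p' "p_star + S" q] L.inn_add_left[of p_star S q] L.carr_add[of p_star S] c qL by simp
  ultimately show "ip N (p' - (p_star + S)) q = 0" by linarith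
 qed
 then show 1: "nL (L2_deriv N T p 0 - (p_star + (\<Sum>v\<in>VD N. \<mu> v *R lift v))) = 0" by (simp add: p'_def S_def)
 have psS: "p_star + 1 *R S \<in> H1 N" by (rule H1_lin[OF H10_D(1)[OF ps] S1])
 have "ae_eq N p' (p_star + S)" using ae_eq_iff_nL[of p' "p_star + S"] 1 c psS H1_D(1)[OF psS] by (simp add: p'_def S_def)
 then have ae1: "ae_eq N (K p') (K (p_star + 1 *R S))" using dx_cong[OF psS, of p'] by simp
 have s: "ae_eq N (K S) (\<Sum>v\<in>VD N. \<mu> v *R K (lift v))" unfolding S_def by (rule dx_sum_ae[OF fin_V(1) lift_H1])
 have "ae_eq N (K (p_star + 1 *R S)) (K p_star + 1 *R (\<Sum>v\<in>VD N. \<mu> v *R K (lift v)))"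
  by (rule ae_eq_trans[OF dx_lin_ae[OF H10_D(1)[OF ps] S1] ae_comb[OF ae_eq_refl s]])
 then show "ae_eq N (K (L2_deriv N T p 0)) (K p_star + (\<Sum>v\<in>VD N. \<mu> v *R K (lift v)))"
  using ae_eq_trans[OF ae1] by (simp add: p'_def)
 show "K (L2_deriv N T p 0) \<in> L2 N" using ae_eq_L2[OF ae_eq_sym[OF ae1] H1_D(3)[OF psS]] by (simp add: p'_def)
 have 3: "ae_eq N (eps *R m' + K (p 0) + mul d (m 0)) (f 0)" unfolding m'_def by (rule solves_H_facts(3)[OF H z])
 \<comment> \<open>The second equation at time 0 minus the compatibility condition.\<close>
 have "ae_eq N m' (%e x. 0)"
  unfolding ae_eq_def
 proof
  fix e assume e: "e \<in> E"
  have "AE x in ivl 0 (len N e). (eps *R m' + K (p 0) + mul d (m 0)) e x = f 0 e x"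
   "AE x in ivl 0 (len N e). K (p 0) e x = K p_init e x" "AE x in ivl 0 (len N e). m 0 e x = m_init e x"
   "AE x in ivl 0 (len N e). dx N p_init e x - f 0 e x + d e x * m_init e x = 0"
   using 3 dx_cong[OF pi p0] m0 c2 e unfolding ae_eq_def by auto
  then show "AE x in ivl 0 (len N e). m' e x = 0"
  proof eventually_elim
   case (elim x)
   from elim(1) have "eps * m' e x + K (p 0) e x + d e x * m 0 e x = f 0 e x" by (simp add: mul_def)
   then have "eps * m' e x = 0" using elim(4) unfolding elim(2,3) by linarith
   then show ?case using eps by simp
  qed
 qed
 then show "nL (L2_deriv N T m 0) = 0" using nL_zero_iff[OF c(4)] by (simp add: m'_def)
qed

text \<open>Coercivity is used pointwise in time, together with the bound of \<open>L_op\<close> by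
  the source and the dissipation. The dissipation is already controlled by the energy inequality,
  and no division by \<open>cL\<close> occurs.\<close>

lemma coercive_integral_le:
 assumes cL: "\<forall>q\<in>H10 N. L_op N d q q \<ge> cL * (nrm (H1_sp N) q)^2" and e: "O.parab T e em S" and t: "0 \<le> t" "t \<le> T"
 shows "cL * lint 0 t (%s. (nrm (H1_sp N) (e s))^2) \<le>
  2 / d_lo * ig 0 t (%s. (nL (S s))^2) + 2 * ig 0 t (%s. ip N (mul d (em s)) (em s))"
proof -
 have L: "L.L2c T em" "L.L2c T S" using e by (auto simp: O.parab_def)
 have iD: "intable 0 t (%s. ip N (mul d (em s)) (em s))" "0 \<le> ig 0 t (%s. ip N (mul d (em s)) (em s))"
  using O.D_integral(1,3)[OF L(1) t] by simp_all
 have iS: "intable 0 t (%s. (nL (S s))^2)" using L.L2c_nrm[OF L.L2c_sub[OF L(2) t(2)]] by (simp add: sq_int_def)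
 have S0: "0 \<le> ig 0 t (%s. (nL (S s))^2)" by (rule ivl_nonneg[OF iS]) simp
 show ?thesis
 proof (cases "intable 0 t (%s. (nrm (H1_sp N) (e s))^2)")
  case True
  have "AE s in ivl 0 t. O.constr (e s) (em s) (S s)"
   by (rule AE_ivl_sub[of _ 0 T]) (use e t in \<open>simp_all add: O.parab_def\<close>)
  then have ae: "AE s in ivl 0 t. cL * (nrm (H1_sp N) (e s))^2 \<le> 2 / d_lo * (nL (S s))^2 + 2 * ip N (mul d (em s)) (em s)"
  proof eventually_elim
   case (elim s)
   then have V: "e s \<in> H10 N" by (simp add: O.constr_def)
   have "L_op N d (e s) (e s) \<le> 2 / d_lo * (nL (S s))^2 + 2 * ip N (mul d (em s)) (em s)"
    using elim by (intro L_op_le[OF co H10_D(1)[OF V]]) (simp_all add: O.constr_def)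
   then show ?case using cL V by (meson order_trans)
  qed
  have "cL * lint 0 t (%s. (nrm (H1_sp N) (e s))^2) = ig 0 t (%s. cL * (nrm (H1_sp N) (e s))^2)"
   by (simp add: ivl_eq[OF True])
  also have "\<dots> \<le> ig 0 t (%s. 2 / d_lo * (nL (S s))^2 + 2 * ip N (mul d (em s)) (em s))"
   by (rule ivl_mono_AE[OF integrable_mult_right[OF True]
    Bochner_Integration.integrable_add[OF integrable_mult_right[OF iS] integrable_mult_right[OF iD(1)]] ae])
  also have "\<dots> = 2 / d_lo * ig 0 t (%s. (nL (S s))^2) + 2 * ig 0 t (%s. ip N (mul d (em s)) (em s))"
   using ivl_add[OF integrable_mult_right[OF iS, of "2 / d_lo"] integrable_mult_right[OF iD(1), of 2]] by simp
  finally show ?thesis .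
 next
  \<comment> \<open>If the \<open>H^1\<close> norm were not square integrable, the integral on the
    left would be zero by convention, while the right-hand side is nonnegative.\<close>
  case False
  then show ?thesis using iD S0 d_pos by (simp add: not_integrable_integral_eq)
 qed
qed

end

section \<open>The estimate on the network\<close>

context net_coeff
begin

text \<open>The liftings \<open>\<rho>\<close>, \<open>\<gamma>\<close> and the number
  \<open>P\<close> are parameters so that they can be chosen before \<open>eps\<close> and the data;
  \<open>c0\<close> is then a constant of the network and of \<open>T\<close>. The factor 40 is 5
  from the assembly of the three norms times 8 from the wave estimate.\<close>

lemma asymptotic_estimate:
 fixes \<rho> \<gamma> :: "'v => 'e nfun" and P T :: real
 defines "c0 \<equiv> 2 * exp 1 / d_lo * (68 * P + 4 * \<bar>a_hi\<bar>^2 + 16 * T * P + 16 * P / d_lo) + 2 * P"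
 assumes \<rho>\<gamma>: "\<forall>v\<in>VN N. \<rho> v \<in> L2 N \<and> \<gamma> v \<in> L2 N \<and> (\<forall>q\<in>H1 N. vval N q v = ip N (\<rho> v) (K q) - ip N (\<gamma> v) q)"
  and P: "real (card (VD N)) * (\<Sum>v\<in>VD N. (nL (lift v))^2) \<le> P" "real (card (VD N)) * (\<Sum>v\<in>VD N. (nL (mul a (lift v)))^2) \<le> P"
   "real (card (VD N)) * (\<Sum>v\<in>VD N. (nL (K (lift v)))^2) \<le> P" "real (card (VN N)) * (\<Sum>v\<in>VN N. (nL (\<rho> v))^2) \<le> P"
   "real (card (VN N)) * (\<Sum>v\<in>VN N. (nL (\<gamma> v))^2) \<le> P" "real (card (VN N)) * (\<Sum>v\<in>VN N. (nL (mul d (\<rho> v)))^2) \<le> P" "1 \<le> P"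
  and cL: "\<forall>q\<in>H10 N. L_op N d q q \<ge> cL * (nrm (H1_sp N) q)^2" and T: "0 < T" and eps: "0 < eps" "eps \<le> 1"
  and f: "HkT (L2_sp N) T 2 f" and g: "HkT (L2_sp N) T 2 g" and h: "HkT (vec_sp (VD N)) T 3 h" and r: "HkT (vec_sp (VN N)) T 3 r"
  and r0: "\<forall>v\<in>VN N. vec_deriv T r 0 v = 0" and pi: "p_init \<in> H1 N" and ps: "p_star \<in> H10 N"
  and c1: "\<forall>q\<in>H10 N. ip N p_star q = ip N (g 0) q - C_adj N (r 0) q
      - (L_op N d p_init q + ip N (%e x. a e x * p_init e x) q) - ip N (Bm (vec_deriv T h 0)) q + K_adj N (%e x. f 0 e x / d e x) q"
  and c2: "ae_eq N (%e x. dx N p_init e x - f 0 e x + d e x * m_init e x) (%e x. 0)"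
  and H: "solves_H N T a d eps f g h r p m lam" "ae_eq N (p 0) p_init" "ae_eq N (m 0) m_init"
  and P0: "solves_P N T a d f g h r p0 m0 lam0" "ae_eq N (p0 0) p_init"
  and P1: "solves_P1 N T a d m0 p1 m1 lam1" "ae_eq N (p1 0) (%e x. 0)" and t: "t \<in> {0..T}"
 shows "(nL (p t - p0 t - eps *R p1 t))^2 + cL * lint 0 t (%s. (nrm (H1_sp N) (p s - p0 s - eps *R p1 s))^2)
   + d_lo * lint 0 t (%s. (nL (m s - m0 s - eps *R m1 s))^2)
  \<le> eps ^ 3 * (40 * exp 1 / d_lo ^ 4) * (nL (L2_deriv N T f 0 - K (L2_deriv N T p 0)))^2 +
   eps ^ 4 * (5 / d_lo ^ 3 * c0 * ((1 + 2 / T + 2 * T) * ((nrm (H1_sp N) p_star)^2 + HkT_norm2 (L2_sp N) T 2 f +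
    HkT_norm2 (L2_sp N) T 2 g + HkT_norm2 (vec_sp (VD N)) T 3 h + HkT_norm2 (vec_sp (VN N)) T 3 r)))"
proof -
 define k where "k = 1 + 2 / T + 2 * T"
 have k: "1 \<le> k" using T by (simp add: k_def)
 define Q where "Q = k * ((nrm (H1_sp N) p_star)^2 + HkT_norm2 (L2_sp N) T 2 f + HkT_norm2 (L2_sp N) T 2 g +
  HkT_norm2 (vec_sp (VD N)) T 3 h + HkT_norm2 (vec_sp (VN N)) T 3 r)"
 have Q_ge: "k * HkT_norm2 (L2_sp N) T 2 f \<le> Q" "k * HkT_norm2 (L2_sp N) T 2 g \<le> Q"
  "k * HkT_norm2 (vec_sp (VD N)) T 3 h \<le> Q" "k * HkT_norm2 (vec_sp (VN N)) T 3 r \<le> Q" "k * (nrm (H1_sp N) p_star)^2 \<le> Q"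
  unfolding Q_def using k HkT_norm2_nonneg[of "L2_sp N" T 2 f] HkT_norm2_nonneg[of "L2_sp N" T 2 g]
   HkT_norm2_nonneg[of "vec_sp (VD N)" T 3 h] HkT_norm2_nonneg[of "vec_sp (VN N)" T 3 r] zero_le_power2[of "nrm (H1_sp N) p_star"]
  by (intro mult_left_mono; linarith)+
 have "(nL p_star)^2 = ip N p_star p_star" using L.nrm_sq[of p_star] H10_D[OF ps] by simp
 also have "\<dots> \<le> ip N p_star p_star + ip N (K p_star) (K p_star)" using L.inn_nonneg[of "K p_star"] H10_D[OF ps] by simp
 also have "\<dots> = (nrm (H1_sp N) p_star)^2"
  using L.inn_nonneg[of "K p_star"] L.inn_nonneg[of p_star] H10_D[OF ps] by (simp add: nrm_def H1_sp_def)
 also have "\<dots> \<le> k * (nrm (H1_sp N) p_star)^2" using mult_right_mono[OF k, of "(nrm (H1_sp N) p_star)^2"] by simp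
 finally have psQ: "(nL p_star)^2 \<le> Q" using Q_ge by linarith
 obtain f1 where "L.data T f f1 (k * HkT_norm2 (L2_sp N) T 2 f)" unfolding k_def by (rule L.data_of_HkT[OF T f])
 then have f1: "L.data T f f1 Q" by (rule L.data_mono[OF _ Q_ge(1)])
 obtain g1 where "L.data T g g1 (k * HkT_norm2 (L2_sp N) T 2 g)" unfolding k_def by (rule L.data_of_HkT[OF T g])
 then have g1: "L.data T g g1 Q" by (rule L.data_mono[OF _ Q_ge(2)])
 have "\<forall>v\<in>VD N. \<exists>x y z. H3_path T (%t. h t v) x y z Q"
  using H3_path_component[OF fin_V(1) _ T h] H3_path_mono[OF _ Q_ge(3)] unfolding k_def by metis
 then obtain h1 h2 h3 where hp: "\<And>v. v \<in> VD N ==> H3_path T (%t. h t v) (h1 v) (h2 v) (h3 v) Q" by metis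
 have "\<forall>v\<in>VN N. \<exists>x y z. H3_path T (%t. r t v) x y z Q"
  using H3_path_component[OF fin_V(2) _ T r] H3_path_mono[OF _ Q_ge(4)] unfolding k_def by metis
 then obtain r1 r2 r3 where rp: "\<And>v. v \<in> VN N ==> H3_path T (%t. r t v) (r1 v) (r2 v) (r3 v) Q" by metis
 have vd: "vec_deriv T u 0 v = y1 0" if "H3_path T (%t. u t v) y1 y2 y3 Q" for u :: "real => 'v => real" and v y1 y2 y3
 proof -
  have "((%t. u t v) has_real_derivative y1 0) (at 0 within {0..T})" using that T by (simp add: H3_path_def)
  then have "((%t. u t v) has_vector_derivative y1 0) (at 0 within {0..T})" by (simp add: has_real_derivative_iff_has_vector_derivative)
  then show ?thesis unfolding vec_deriv_def by (intro vector_derivative_within_closed_interval) (use T in auto)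
 qed
 have r10: "r1 v 0 = 0" if "v \<in> VN N" for v using vd[of r v "r1 v" "r2 v" "r3 v", OF rp[OF that]] r0 that by simp
 have hv: "(\<Sum>v\<in>VD N. vec_deriv T h 0 v *R x v) = L.lc (VD N) h1 x 0" for x :: "'v => 'e nfun"
 proof (rule sum.cong[OF refl])
  fix v assume v: "v \<in> VD N"
  show "vec_deriv T h 0 v *R x v = h1 v 0 *R x v" using vd[of h v "h1 v" "h2 v" "h3 v", OF hp[OF v]] by simp
 qed
 note fc = L.data_contT[OF f1] and gc = L.data_contT[OF g1]
 have rc: "\<forall>v\<in>VN N. continuous_on {0..T} (%t. r t v)" using H3_path_cont(1)[OF rp] by simp
 note ini = initial_derivatives[OF eps(1) T H(1) fc gc pi ps c1 c2 H(2,3), unfolded hv]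
 have C1: "C1T N T p" "C1T N T m" using H(1) by (auto simp: solves_H_def)
 note Cp = C1T_D[OF C1(1)] and Cm = C1T_D[OF C1(2)]
 note HF = solves_H_facts[OF H(1)]
 have liftL: "lift v \<in> L2 N" "K (lift v) \<in> L2 N" for v using H1_D(1,3)[OF lift_H1] by auto
 have eq1: "inn (L2_sp N) (L2_deriv N T p t) q + inn (L2_sp N) (mul a (p t)) q - inn (L2_sp N) (m t) (K q) =
   inn (L2_sp N) (g t) q - (\<Sum>v\<in>VN N. r t v * (inn (L2_sp N) (\<rho> v) (K q) - inn (L2_sp N) (\<gamma> v) q))"
  if "t \<in> {0..T}" "q \<in> H10 N" for t q
  using HF(4)[OF that] \<rho>\<gamma> H10_D(1)[OF that(2)] by (simp add: C_adj_def)
 have eq2: "nL (eps *R L2_deriv N T m t + K (p t) + mul d (m t) - f t) = 0" if t: "t \<in> {0..T}" for t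
 proof -
  have "L2_deriv N T m t \<in> carr (L2_sp N)" "K (p t) \<in> carr (L2_sp N)" "mul d (m t) \<in> carr (L2_sp N)" "f t \<in> carr (L2_sp N)"
   using L.contT_carr[OF Cm(3) t] H1_D(3)[OF HF(1)[OF t]] mul_L2(2) L.contT_carr[OF Cm(1) t] L.contT_carr[OF fc t] by auto
  then have "eps *R L2_deriv N T m t + K (p t) + mul d (m t) \<in> carr (L2_sp N)" "f t \<in> carr (L2_sp N)"
   by (auto intro!: L.carr_add L.carr_scale simp del: carr_L)
  then show ?thesis using ae_eq_iff_nL HF(3)[OF t] by simp
 qed
 obtain C b B where CbB: "\<And>s. 0 \<le> s ==> s < T ==> nL (L2_deriv N T m s) \<le> C * s"
  "\<And>tau. 0 < tau ==> tau < T ==> ig 0 (T - tau) (%t. (nL (dq tau (L2_deriv N T m) t))^2) \<le> b tau" "(b ---> B) (at_right 0)"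
  "B \<le> 8 * exp 1 / d_lo * (nL (f1 - (K p_star + L.lc (VD N) h1 (%v. K (lift v)) 0)))^2 / eps + c0 * Q"
  unfolding c0_def
 proof (rule O.lifted_wave_estimate[where I = "VD N" and J = "VN N" and h = "%v t. h t v" and r = "%v t. r t v" and \<eta> = lift
   and \<kappa> = "%v. K (lift v)" and \<rho> = \<rho> and \<gamma> = \<gamma> and p = p and m = m and k = "%t. K (p t)" and Q = Q and P = P,
   OF T eps fin_V hp rp r10 _ _ _ _ Cp(1,2) Cm g1 f1 _ _ _ eq1 eq2 ps ini(1) psQ ini(2) P])
  show "p t - L.lc (VD N) (%v t. h t v) lift t \<in> H10 N" "K (p t) \<in> carr (L2_sp N)"
   "nL (K (p t - L.lc (VD N) (%v t. h t v) lift t) - (K (p t) - L.lc (VD N) (%v t. h t v) (%v. K (lift v)) t)) = 0" if t: "t \<in> {0..T}" for t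
   using lift_H10[OF HF(1,2)[OF t]] H1_D(3)[OF HF(1)[OF t]] by simp_all
 qed ((rule that[unfolded c0_def]; assumption) | (use liftL \<rho>\<gamma> in simp))+
 define F0 where "F0 = nL (L2_deriv N T f 0 - K (L2_deriv N T p 0))"
 \<comment> \<open>The wave estimate yields the defect in terms of \<open>f1\<close> and lifts. The
   quantity of the theorem is written with \<open>L2_deriv\<close> and \<open>dx\<close>, which
   agree with these up to distance zero.\<close>
 have "nL (f1 - (K p_star + L.lc (VD N) h1 (%v. K (lift v)) 0)) = F0"
  unfolding F0_def
 proof (rule L.nrm_eqI)
  let ?Y = "K p_star + L.lc (VD N) h1 (%v. K (lift v)) 0" and ?Z = "K (L2_deriv N T p 0)" and ?f = "L2_deriv N T f 0"
  have lcc: "L.lc (VD N) h1 (%v. K (lift v)) 0 \<in> carr (L2_sp N)" by (rule L.carr_sum, rule L.carr_scale) (simp add: liftL)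
  have c: "f1 \<in> carr (L2_sp N)" "?Y \<in> carr (L2_sp N)" "?Z \<in> carr (L2_sp N)" "?f \<in> carr (L2_sp N)"
   using L.data_carr[OF f1] L.carr_add[OF _ lcc, of "K p_star"] H10_D(3)[OF ps] ini(4) data_L2_deriv(1)[OF T f1] by simp_all
  show "f1 - ?Y \<in> carr (L2_sp N)" "?f - ?Z \<in> carr (L2_sp N)" using c by (blast intro: L.carr_diff)+
  have "nL (?Z - ?Y) = 0" using ae_eq_iff_nL[of ?Z ?Y] ini(3) c by simp
  moreover have "nL (?f - f1) = 0" by (rule data_L2_deriv(2)[OF T f1])
  then have "nL (f1 - ?f) = 0" using L.nrm_diff_commute[OF c(1,4)] by simp
  ultimately have "nL ((f1 - ?f) + (?Z - ?Y)) = 0" using c by (intro O.nrm_zero_add L.carr_diff)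
  then show "nL (f1 - ?Y - (?f - ?Z)) = 0" by (simp add: algebra_simps)
 qed
 then have B: "B \<le> 8 * exp 1 / d_lo * F0^2 / eps + c0 * Q" using CbB(4) by simp
 define z where "z = tderiv (L2_sp N) T m0"
 have m0L: "L2T (L2_sp N) T m0" using P0 by (simp add: solves_P_def)
 have zz: "L2T (L2_sp N) T z" "weak_tderiv (L2_sp N) T m0 z"
  using P1(1) tderiv_works[of "L2_sp N" T m0] by (auto simp: solves_P1_def z_def)
 have S1: "solves_P N T a d (%t e x. - z t e x) (%t e x. 0) (%t v. 0) (%t v. 0) p1 m1 lam1"
  using P1(1) by (simp add: solves_P1_def z_def)
 have lim: "L.dq_limit T (%t. m t - m0 t) (%t. L2_deriv N T m t - z t)"
  by (rule L.dq_limit_diff[OF L.sderiv_dq_limit[OF Cm(2,1,3) T] L.weak_tderiv_dq_limit[OF m0L zz T]])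
 have pE: "O.parab T (%t. p t - p0 t) (%t. m t - m0 t) (%t. - eps *R L2_deriv N T m t)"
  by (rule parab_difference[OF H(1) P0(1) gc rc])
 have p1: "O.parab T p1 m1 (%t. - z t)" by (rule parab_corrector[OF S1 L.L2T_L2c[OF zz(1)]])
 have z0: "0 \<in> {0..T}" using T by simp
 have c0c: "p 0 \<in> L2 N" "p0 0 \<in> L2 N" "p1 0 \<in> L2 N"
  using L.contT_carr[OF Cp(1) z0] L.contT_carr[OF solves_P_facts(1)[OF P0(1) gc rc] z0] L.contT_carr[of T p1 0] p1 z0 by (auto simp: O.parab_def)
 have E0: "nL (p 0 - p0 0) = 0" using ae_eq_iff_nL[OF c0c(1,2)] ae_eq_trans[OF H(2) ae_eq_sym[OF P0(2)]] by simp
 have p10: "nL (p1 0) = 0" using nL_zero_iff[OF c0c(3)] P1(2) by simp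
 let ?e = "%s. p s - p0 s - eps *R p1 s" and ?em = "%s. m s - m0 s - eps *R m1 s" and ?S = "%s. - eps *R (L2_deriv N T m s - z s)"
 have tt: "0 \<le> t" "t \<le> T" using t by auto
 have EE: "O.parab T ?e ?em ?S" "ig 0 T (%s. (nL (?S s))^2) \<le> eps^4 * B / d_lo^2"
  "(nL (?e t))^2 + ig 0 t (%s. inn (L2_sp N) (mul d (?em s)) (?em s)) \<le> eps^4 * B / d_lo^3"
  using O.error_estimate[OF T pE E0 p1 p10 Cm(3) CbB(1,2,3) lim] t by blast+
 have Lem: "L.L2c T ?em" "L.L2c T ?S" using EE(1) by (auto simp: O.parab_def)
 let ?D = "ig 0 t (%s. ip N (mul d (?em s)) (?em s))"
 have e1: "(nL (?e t))^2 + ?D \<le> eps^4 * B / d_lo^3" using EE(3) by simp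
 have e2: "d_lo * lint 0 t (%s. (nL (?em s))^2) \<le> ?D"
 proof -
  have "intable 0 t (%s. (nL (?em s))^2)" using L.L2c_nrm[OF L.L2c_sub[OF Lem(1) tt(2)]] by (simp add: sq_int_def)
  from ivl_eq[OF this] show ?thesis using O.D_integral(2)[OF Lem(1) tt] by simp
 qed
 have iS: "intable 0 T (%s. (nL (?S s))^2)" using L.L2c_nrm[OF Lem(2)] by (simp add: sq_int_def)
 have "ig 0 t (%s. (nL (?S s))^2) \<le> ig 0 T (%s. (nL (?S s))^2)" by (rule ivl_mono_sub[OF iS]) (use tt in auto)
 then have "ig 0 t (%s. (nL (?S s))^2) \<le> eps^4 * B / d_lo^2" using EE(2) by linarith
 then have "2 / d_lo * ig 0 t (%s. (nL (?S s))^2) \<le> 2 / d_lo * (eps^4 * B / d_lo^2)" using d_pos by (intro mult_left_mono) auto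
 then have e3: "2 / d_lo * ig 0 t (%s. (nL (?S s))^2) \<le> 2 * (eps^4 * B / d_lo^3)" using d_pos by (simp add: power3_eq_cube power2_eq_square)
 \<comment> \<open>With \<open>X\<close> the energy bound and \<open>y\<close> the dissipation: the
   squared norm and the flux term together take at most one \<open>X\<close>, the \<open>H^1\<close>
   term at most \<open>2 * X\<close> from the source and \<open>2 * y\<close> from the
   dissipation.\<close>
 have lin: "x + I + J \<le> 5 * X" if "0 \<le> x" "x + y \<le> X" "J \<le> y" "W \<le> 2 * X" "I \<le> W + 2 * y" for x y I J W X :: real
  using that by linarith
 have "(nL (?e t))^2 + cL * lint 0 t (%s. (nrm (H1_sp N) (?e s))^2)
   + d_lo * lint 0 t (%s. (nL (?em s))^2) \<le> 5 * (eps^4 * B / d_lo^3)"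
  by (rule lin[OF zero_le_power2 e1 e2 e3 coercive_integral_le[OF cL EE(1) tt]])
 also have "\<dots> = 5 * eps^4 / d_lo^3 * B" by simp
 also have "\<dots> \<le> 5 * eps^4 / d_lo^3 * (8 * exp 1 / d_lo * F0^2 / eps + c0 * Q)" using B d_pos by (intro mult_left_mono) auto
 also have "\<dots> = eps ^ 3 * (40 * exp 1 / d_lo ^ 4) * F0^2 + eps ^ 4 * (5 / d_lo ^ 3 * c0 * Q)"
  using eps d_pos by (simp add: field_simps power3_eq_cube power4_eq_xxxx)
 finally show ?thesis by (simp add: F0_def Q_def k_def)
qed

end

text \<open>The order of the quantifiers expresses what the constants depend on: \<open>Chat\<close>
  is fixed before the network and sees only \<open>cL\<close> and \<open>d_lo\<close>;
  \<open>Cdata\<close> is fixed once the network, the coefficients, \<open>Bm\<close>,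
  \<open>cL\<close> and \<open>T\<close> are given, before \<open>\<epsilon>\<close> and the
  data.\<close>

theorem theorem4p7:
  "\<exists>Chat :: real \<Rightarrow> real \<Rightarrow> real.
   \<forall>(N :: ('v, 'e) network) a d a_hi d_lo d_hi Bm cL T.
     is_network N \<longrightarrow> coefficients N a d a_hi d_lo d_hi \<longrightarrow> B_right_inverse N Bm \<longrightarrow>
     0 < cL \<longrightarrow> (\<forall>q\<in>H10 N. L_op N d q q \<ge> cL * (nrm (H1_sp N) q)\<^sup>2) \<longrightarrow> 0 < T \<longrightarrow>
     (\<exists>Cdata :: real \<Rightarrow> real \<Rightarrow> real \<Rightarrow> real \<Rightarrow> real \<Rightarrow> real.
      \<forall>\<epsilon> f g h r p_init m_init m_star p_star p m lam p0 m0 lam0 p1 m1 lam1.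
        0 < \<epsilon> \<longrightarrow> \<epsilon> \<le> 1 \<longrightarrow>
        HkT (L2_sp N) T 2 f \<longrightarrow> HkT (L2_sp N) T 2 g \<longrightarrow>
        HkT (vec_sp (VD N)) T 3 h \<longrightarrow> HkT (vec_sp (VN N)) T 3 r \<longrightarrow>
        (\<forall>v\<in>VN N. vec_deriv T r 0 v = 0) \<longrightarrow>
        p_init \<in> H1 N \<longrightarrow> (\<forall>v\<in>VD N. vval N p_init v = h 0 v) \<longrightarrow> m_init \<in> L2 N \<longrightarrow>
        m_star \<in> L2 N \<longrightarrow>
        (\<forall>q\<in>H10 N. ip N m_star q = K_adj N m_init q - C_adj N (r 0) q) \<longrightarrow>
        p_star \<in> H10 N \<longrightarrow>
        (\<forall>q\<in>H10 N. ip N p_star q =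
           ip N (g 0) q - C_adj N (r 0) q
           - (L_op N d p_init q + ip N (\<lambda>e x. a e x * p_init e x) q)
           - ip N (Bm (vec_deriv T h 0)) q
           + K_adj N (\<lambda>e x. f 0 e x / d e x) q) \<longrightarrow>
        ae_eq N (\<lambda>e x. dx N p_init e x - f 0 e x + d e x * m_init e x) (\<lambda>e x. 0) \<longrightarrow>
        solves_H N T a d \<epsilon> f g h r p m lam \<longrightarrow> ae_eq N (p 0) p_init \<longrightarrow> ae_eq N (m 0) m_init \<longrightarrow>
        solves_P N T a d f g h r p0 m0 lam0 \<longrightarrow> ae_eq N (p0 0) p_init \<longrightarrow>
        solves_P1 N T a d m0 p1 m1 lam1 \<longrightarrow> ae_eq N (p1 0) (\<lambda>e x. 0) \<longrightarrow>
        (let ep = (\<lambda>s e x. p s e x - (p0 s e x + \<epsilon> * p1 s e x));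
             em = (\<lambda>s e x. m s e x - (m0 s e x + \<epsilon> * m1 s e x))
         in \<forall>t\<in>{0..T}.
              (nrm (L2_sp N) (ep t))\<^sup>2
              + cL * integral\<^sup>L (lebesgue_on {0..t}) (\<lambda>s. (nrm (H1_sp N) (ep s))\<^sup>2)
              + d_lo * integral\<^sup>L (lebesgue_on {0..t}) (\<lambda>s. (nrm (L2_sp N) (em s))\<^sup>2)
              \<le> \<epsilon> ^ 3 * Chat cL d_lo
                  * (nrm (L2_sp N) (\<lambda>e x. L2_deriv N T f 0 e x - dx N (L2_deriv N T p 0) e x))\<^sup>2
                + \<epsilon> ^ 4 * Cdata ((nrm (H1_sp N) p_star)\<^sup>2)
                    (HkT_norm2 (L2_sp N) T 2 f) (HkT_norm2 (L2_sp N) T 2 g)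
                    (HkT_norm2 (vec_sp (VD N)) T 3 h) (HkT_norm2 (vec_sp (VN N)) T 3 r)))"
proof (intro exI[of _ "%cL d :: real. 40 * exp 1 / d ^ 4"] allI impI, goal_cases)
 \<comment> \<open>The first constant is the same for all \<open>cL\<close>, since the weight
   \<open>cL\<close> on the left is exactly what coercivity supplies.\<close>
 case (1 N a d a_hi d_lo d_hi Bm cL T)
 interpret net_coeff N a d a_hi d_lo d_hi Bm by unfold_locales (fact 1)+
 have "\<forall>v\<in>VN N. \<exists>\<rho> \<gamma>. \<rho> \<in> L2 N \<and> \<gamma> \<in> L2 N \<and> (\<forall>q\<in>H1 N. vval N q v = ip N \<rho> (K q) - ip N \<gamma> q)"
  using vertex_lift[OF VN_touched] by metis
 then obtain \<rho> \<gamma> where \<rho>\<gamma>: "\<forall>v\<in>VN N. \<rho> v \<in> L2 N \<and> \<gamma> v \<in> L2 N \<and> (\<forall>q\<in>H1 N. vval N q v = ip N (\<rho> v) (K q) - ip N (\<gamma> v) q)"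
  by metis
 define s :: "'v set => ('v => 'e nfun) => real" where "s V x = card V * (\<Sum>v\<in>V. (nL (x v))^2)" for V x
 have s: "0 \<le> s V x" for V x by (simp add: s_def sum_nonneg)
 \<comment> \<open>The sum of all the quantities that \<open>P\<close> has to dominate. It is built
   from the network, the coefficients and the chosen lifts only.\<close>
 define P where "P = 1 + s (VD N) lift + s (VD N) (%v. mul a (lift v)) + s (VD N) (%v. K (lift v)) +
  s (VN N) \<rho> + s (VN N) \<gamma> + s (VN N) (%v. mul d (\<rho> v))"
 have "s (VD N) lift \<le> P" "s (VD N) (%v. mul a (lift v)) \<le> P" "s (VD N) (%v. K (lift v)) \<le> P"
  "s (VN N) \<rho> \<le> P" "s (VN N) \<gamma> \<le> P" "s (VN N) (%v. mul d (\<rho> v)) \<le> P" "1 \<le> P"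
  using s[of "VD N" lift] s[of "VD N" "%v. mul a (lift v)"] s[of "VD N" "%v. K (lift v)"] s[of "VN N" \<rho>] s[of "VN N" \<gamma>]
   s[of "VN N" "%v. mul d (\<rho> v)"] unfolding P_def by linarith+
 note est = asymptotic_estimate[OF \<rho>\<gamma> this[unfolded s_def] 1(5,6)]
 let ?c = "2 * exp 1 / d_lo * (68 * P + 4 * \<bar>a_hi\<bar>^2 + 16 * T * P + 16 * P / d_lo) + 2 * P"
 have ep: "(%e x. u e x - (v e x + c * w e x)) = u - v - c *R w" for u v w :: "'e nfun" and c
  by (simp add: fun_eq_iff)
 have F0: "(%e x. u e x - w e x) = u - w" for u w :: "'e nfun"
  by (simp add: fun_eq_iff)
 show ?case
 proof (intro exI[of _ "%x1 x2 x3 x4 x5. 5 / d_lo ^ 3 * ?c * ((1 + 2 / T + 2 * T) * (x1 + x2 + x3 + x4 + x5))"] allI impI, goal_cases)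
  case h: (1 eps f g h r p_init m_init m_star p_star p m lam p0 m0 lam0 p1 m1 lam1)
  show ?case
   unfolding Let_def ep unfolding F0
   by (rule ballI) (rule est[OF h(1-8) h(13-22)])
 qed
qed

end
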